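(* Let $A$ be a finite dimensional cocommutative Hopf algebra over a commutative field $\mathbb{K}$. Let $(w,\gamma,\theta,\varepsilon)\in\bigoplus_{p+q=3}C_N^{p,q}(A,\mathbb{K})$, with $w\in C_N^{0,3}$, $\gamma\in C_N^{1,2}$, $\theta\in C_N^{2,1}$ and $\varepsilon\in C_N^{3,0}$ the trivial element. Put $$\phi=\sum(w^{-1}_{(1)}\otimes1_A)\otimes(w^{-1}_{(2)}\otimes1_A)\otimes(w^{-1}_{(3)}\otimes1_A),\quad\alpha=\varepsilon\otimes1_A,\quad\beta=\sum(w_{(1)}\mathrm S(w_{(2)})w_{(3)})\otimes1_A .$$ Then the space $\mathcal D(A)=A^*\otimes A$ is a quasi-Hopf algebra with the product $$(f\otimes x)\cdot(g\otimes y)=\sum f\,(x_{(1)}g\mathrm S(x_{(2)}))\,\theta(x_{(3)}\otimes y_{(1)})\otimes x_{(4)}y_{(2)},$$ the coproduct $$\Delta_\gamma(f\otimes x)=\sum(f_{(1)}\gamma(x_{(1)})_{(1)}\otimes x_{(2)})\otimes(f_{(2)}\gamma(x_{(1)})_{(2)}\otimes x_{(3)}),$$ the unit $\varepsilon\otimes1_A$, the counit $f\otimes x\mapsto f(1_A)\varepsilon(x)$, the antipode $$\mathrm S(f\otimes x)=\sum\big(\varepsilon\otimes\mathrm S(x_{(1)})\big)\cdot\Big(\theta^{-1}(x_{(2)}\otimes\mathrm S(x_{(3)}))\,\mathrm S\big(f\gamma^{-1}(x_{(4)})_{(1)}\big)\,\gamma^{-1}(x_{(4)})_{(2)}\otimes1_A\Big),$$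 the associator $\phi$ and the elements $\alpha,\beta$, if and only if $(w,\gamma,\theta,\varepsilon)$ is a normalized $3$-cocycle of the total complex associated to $(C^{\cdot,\cdot}(A,\mathbb{K}),\widetilde\rho)$.
   Context: Sweedler notation is used, extended to tensor powers of $A$. $A^*$ is the dual Hopf algebra (convolution product, unit $\varepsilon$, coproduct dual to the product of $A$, antipode $f\mapsto f\circ\mathrm S$), and an $A$-bimodule via $(xf)(a)=f(ax)$, $(fx)(a)=f(xa)$. $\mathbb{K}$ is an $A$-bimodule via $\varepsilon$. $\mathrm{ad}_a(b)=\sum\mathrm S(a_{(1)})ba_{(2)}$. $C^{p,q}(A,\mathbb{K})=\mathrm{Reg}(A^{\otimes p},\mathrm{Hom}_{\mathbb{K}}(A^{\otimes q},\mathbb{K}))$ is the abelian group of linear maps $A^{\otimes p}\to\mathrm{Hom}_{\mathbb{K}}(A^{\otimes q},\mathbb{K})$ invertible for convolution $(f*g)(\underline a)(\underline x)=\sum f(\underline a_{(1)})(\underline x_{(1)})g(\underline a_{(2)})(\underline x_{(2)})$; the identity element is denoted $\varepsilon$ (value: product of the counits of all arguments), $f^{-1}$ is the convolution inverse. $C^{p,q}_N(A,\mathbb{K})$ is the subgroup of normalized $f$: $f(a^1\otimes\cdots\otimes a^p)(x^1\otimes\cdots\otimes x^q)=\varepsilon(a^1)\cdots\varepsilon(a^p)\varepsilon(x^1)\cdots\varepsilon(x^q)$ whenever one of the $a^i$ or $x^j$ is $1_A$. Via $(A^{\otimes k})^*\simeq(A^* )^{\otimes k}$ write $\gamma(x)=\sum\gamma(x)_{(1)}\otimes\gamma(x)_{(2)}\in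 A^*\otimes A^*$, $w=\sum w_{(1)}\otimes w_{(2)}\otimes w_{(3)}\in(A^* )^{\otimes3}$, $w^{-1}=\sum w^{-1}_{(1)}\otimes w^{-1}_{(2)}\otimes w^{-1}_{(3)}$, and similarly for $\gamma^{-1}$; $\theta(x\otimes y)\in A^*$. Differentials: for $f\in C^{p,q}(A,\mathbb{K})$, $\widetilde\rho(f)=(\widetilde D^{(q)}_p(f),\widetilde d^{(p)}_q(f))\in C^{p+1,q}\oplus C^{p,q+1}$, where $$\begin{aligned}\widetilde D^{(q)}_p(f)(a^1\otimes\cdots\otimes a^{p+1})(\underline x)=\sum\;&f^{(-1)^q}(a^2_{(1)}\otimes\cdots\otimes a^{p+1}_{(1)})(\mathrm{ad}_{a^1_{(1)}}\underline x_{(1)})\prod_{i=1}^pf^{(-1)^{q+i}}(a^1_{(i+1)}\otimes\cdots\otimes a^i_{(i+1)}a^{i+1}_{(i+1)}\otimes\cdots\otimes a^{p+1}_{(i+1)})(\underline x_{(i+1)})\\&f^{(-1)^{q+p+1}}(a^1_{(p+2)}\otimes\cdots\otimes a^p_{(p+2)})(\underline x_{(p+2)})\,\varepsilon(a^{p+1}_{(p+2)}),\end{aligned}$$ $$\begin{aligned}\widetilde d^{(p)}_q(f)(\underline a)(x^1\otimes\cdots\otimes x^{q+1})=\sum\;&\varepsilon(x^1_{(1)})f(\underline a_{(1)})(x^2_{(1)}\otimes\cdots\otimes x^{q+1}_{(1)})\prod_{i=1}^qf^{(-1)^i}(\underline a_{(i+1)})(x^1_{(i+1)}\otimes\cdots\otimes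 x^i_{(i+1)}x^{i+1}_{(i+1)}\otimes\cdots\otimes x^{q+1}_{(i+1)})\\&f^{(-1)^{q+1}}(\underline a_{(q+2)})(x^1_{(q+2)}\otimes\cdots\otimes x^q_{(q+2)})\,\varepsilon(x^{q+1}_{(q+2)}),\end{aligned}$$ with $\mathrm{ad}_a\underline x=\sum\mathrm{ad}_{a_{(1)}}x^1\otimes\cdots\otimes\mathrm{ad}_{a_{(q)}}x^q$. A normalized $3$-cocycle is $(f_0,f_1,f_2,f_3)$ with $f_l\in C_N^{l,3-l}(A,\mathbb{K})$ such that $\widetilde d^{(0)}_3(f_0)$, $\widetilde D^{(3)}_0(f_0)*\widetilde d^{(1)}_2(f_1)$, $\widetilde D^{(2)}_1(f_1)*\widetilde d^{(2)}_1(f_2)$, $\widetilde D^{(1)}_2(f_2)*\widetilde d^{(3)}_0(f_3)$ and $\widetilde D^{(0)}_3(f_3)$ are all trivial ($=\varepsilon$). Quasi-Hopf algebra: an algebra $B$ with algebra morphisms $\Delta:B\to B\otimes B$, $\varepsilon:B\to\mathbb{K}$, an anti-automorphism of algebras $S$, an invertible $\phi\in B^{\otimes3}$ and $\alpha,\beta\in B$ with: (i) $(\mathrm{Id}\otimes\Delta)\Delta(a)=\phi(\Delta\otimes\mathrm{Id})\Delta(a)\phi^{-1}$; (ii) $(\mathrm{Id}\otimes\mathrm{Id}\otimes\Delta)(\phi)\cdot(\Delta\otimes\mathrm{Id}\otimes\mathrm{Id})(\phi)=(1\otimes\phi)\cdot(\mathrm{Id}\otimes\Delta\otimes\mathrm{Id})(\phi)\cdot(\phi\otimes1)$;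 (iii) $(\varepsilon\otimes\mathrm{Id})\Delta=\mathrm{Id}=(\mathrm{Id}\otimes\varepsilon)\Delta$ and $(\mathrm{Id}\otimes\varepsilon\otimes\mathrm{Id})(\phi)=1\otimes1$; (iv) $\sum S(a_{(1)})\alpha a_{(2)}=\varepsilon(a)\alpha$, $\sum a_{(1)}\beta S(a_{(2)})=\varepsilon(a)\beta$; (v) if $\phi=\sum_iX_i\otimes Y_i\otimes Z_i$, $\phi^{-1}=\sum_iP_i\otimes Q_i\otimes R_i$, then $\sum_iX_i\beta S(Y_i)\alpha Z_i=1$ and $\sum_iS(P_i)\alpha Q_i\beta S(R_i)=1$. *)

theory Defs
  imports Complex_Main "HOL-Library.Function_Algebras"
begin

section \<open>Vector spaces, tensor products, algebras\<close>

text \<open>A vector space is a subspace of an ambient type on which the scalars act; its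
  addition is the one of the ambient type. (Spaces of functions such as \<open>A\<^sup>*\<close> are not full
  types.)\<close>

record ('k, 'v) vspace =
  carr :: "'v set"
  smult :: "'k \<Rightarrow> 'v \<Rightarrow> 'v"

record ('k, 'v) kalg = "('k, 'v) vspace" +
  mult :: "'v \<Rightarrow> 'v \<Rightarrow> 'v"
  unit :: 'v

definition vec_space :: "('k::field, 'v::ab_group_add, 'm) vspace_scheme \<Rightarrow> bool" where
  "vec_space V \<longleftrightarrow> vector_space (smult V) \<and> module.subspace (smult V) (carr V)"

definition finite_dim :: "('k::field, 'v::ab_group_add, 'm) vspace_scheme \<Rightarrow> bool" where
  "finite_dim V \<longleftrightarrow> (\<exists>S. finite S \<and> module.span (smult V) S = carr V)"

definition lin_on ::
  "('k::field, 'v::ab_group_add, 'm) vspace_scheme \<Rightarrow> ('k, 'w::ab_group_add, 'n) vspace_scheme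
    \<Rightarrow> ('v \<Rightarrow> 'w) \<Rightarrow> bool" where
  "lin_on V W f \<longleftrightarrow>
     (\<forall>x\<in>carr V. f x \<in> carr W) \<and>
     (\<forall>x\<in>carr V. \<forall>y\<in>carr V. f (x + y) = f x + f y) \<and>
     (\<forall>c. \<forall>x\<in>carr V. f (smult V c x) = smult W c (f x))"

definition bilin_on ::
  "('k::field, 'v::ab_group_add, 'm) vspace_scheme \<Rightarrow> ('k, 'w::ab_group_add, 'n) vspace_scheme
    \<Rightarrow> ('k, 'u::ab_group_add, 'o) vspace_scheme \<Rightarrow> ('v \<Rightarrow> 'w \<Rightarrow> 'u) \<Rightarrow> bool" where
  "bilin_on V W U b \<longleftrightarrow>
     (\<forall>v\<in>carr V. lin_on W U (b v)) \<and> (\<forall>w\<in>carr W. lin_on V U (\<lambda>v. b v w))"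

definition base :: "('k::field, 'k) kalg" where
  "base = \<lparr>carr = UNIV, smult = (*), mult = (*), unit = 1\<rparr>"

definition fscale :: "'k::field \<Rightarrow> ('x \<Rightarrow> 'k) \<Rightarrow> 'x \<Rightarrow> 'k" where
  "fscale c f = (\<lambda>x. c * f x)"

text \<open>The elementary tensor \<open>v \<otimes> w\<close> is evaluation at \<open>(v, w)\<close> of the bilinear forms on
  \<open>V \<times> W\<close>. The tensor product is the space of finite sums of elementary tensors: over a field the
  canonical map from \<open>V \<otimes> W\<close> to the dual of the space of bilinear forms is injective.\<close>

definition tens ::
  "('k::field, 'v::ab_group_add, 'm) vspace_scheme \<Rightarrow> ('k, 'w::ab_group_add, 'n) vspace_scheme
    \<Rightarrow> 'v \<Rightarrow> 'w \<Rightarrow> ('v \<Rightarrow> 'w \<Rightarrow> 'k) \<Rightarrow> 'k" where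
  "tens V W v w = (\<lambda>b. if bilin_on V W base b then b v w else 0)"

definition tensor_space ::
  "('k::field, 'v::ab_group_add, 'm) vspace_scheme \<Rightarrow> ('k, 'w::ab_group_add, 'n) vspace_scheme
    \<Rightarrow> ('k, ('v \<Rightarrow> 'w \<Rightarrow> 'k) \<Rightarrow> 'k) vspace" where
  "tensor_space V W =
     \<lparr>carr = {\<Sum>(v, w)\<leftarrow>ps. tens V W v w | ps. set ps \<subseteq> carr V \<times> carr W}, smult = fscale\<rparr>"

text \<open>\<open>tsum V W t F\<close> is Sweedler's \<open>\<Sum> F(t\<^sub>1, t\<^sub>2)\<close> for \<open>t = \<Sum> t\<^sub>1 \<otimes> t\<^sub>2\<close> in \<open>V \<otimes> W\<close>. For bilinear
  \<open>F\<close>, the only case of interest, it does not depend on the decomposition of \<open>t\<close>, see the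
  lemma \<open>tsum_eq\<close> below.\<close>

definition tsum ::
  "('k::field, 'v::ab_group_add, 'm) vspace_scheme \<Rightarrow> ('k, 'w::ab_group_add, 'n) vspace_scheme
    \<Rightarrow> (('v \<Rightarrow> 'w \<Rightarrow> 'k) \<Rightarrow> 'k) \<Rightarrow> ('v \<Rightarrow> 'w \<Rightarrow> 'u::ab_group_add) \<Rightarrow> 'u" where
  "tsum V W t F =
     (let ps = (SOME ps. set ps \<subseteq> carr V \<times> carr W \<and> t = (\<Sum>(v, w)\<leftarrow>ps. tens V W v w))
      in \<Sum>(v, w)\<leftarrow>ps. F v w)"

lemma sum_list_fun_apply: "sum_list fs x = (\<Sum>f\<leftarrow>fs. f x)"
  for fs :: "('x \<Rightarrow> 'u::ab_group_add) list"
  by (induction fs) (auto simp: zero_fun_def)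

lemma tens_sum_apply:
  assumes "bilin_on V W base b"
  shows "(\<Sum>(v, w)\<leftarrow>ps. tens V W v w) b = (\<Sum>(v, w)\<leftarrow>ps. b v w)"
  using assms by (induction ps) (auto simp: tens_def zero_fun_def)

lemma tsum_eq:
  fixes V :: "('k::field, 'v::ab_group_add, 'm) vspace_scheme"
    and W :: "('k, 'w::ab_group_add, 'n) vspace_scheme"
    and U :: "('k, 'u::ab_group_add, 'o) vspace_scheme"
  assumes U: "vec_space U" and F: "bilin_on V W U F"
    and ps: "set ps \<subseteq> carr V \<times> carr W"
  shows "tsum V W (\<Sum>(v, w)\<leftarrow>ps. tens V W v w) F = (\<Sum>(v, w)\<leftarrow>ps. F v w)"
proof -
  interpret vs: vector_space "smult U" using U by (simp add: vec_space_def)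
  interpret K: vector_space "(*) :: 'k \<Rightarrow> 'k \<Rightarrow> 'k"
    by unfold_locales (auto simp: algebra_simps)
  interpret P: vector_space_pair "smult U" "(*) :: 'k \<Rightarrow> 'k \<Rightarrow> 'k" ..
  let ?t = "\<Sum>(v, w)\<leftarrow>ps. tens V W v w"
  define qs where
    "qs = (SOME qs. set qs \<subseteq> carr V \<times> carr W \<and> ?t = (\<Sum>(v, w)\<leftarrow>qs. tens V W v w))"
  have "set qs \<subseteq> carr V \<times> carr W \<and> ?t = (\<Sum>(v, w)\<leftarrow>qs. tens V W v w)"
    unfolding qs_def by (rule someI[where x = ps]) (use ps in auto)
  then have qs: "?t = (\<Sum>(v, w)\<leftarrow>qs. tens V W v w)" by blast
  define d where "d = (\<Sum>(v, w)\<leftarrow>qs. F v w) - (\<Sum>(v, w)\<leftarrow>ps. F v w)"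
  have zero: "l d = 0" if l: "Vector_Spaces.linear (smult U) (*) l" for l
  proof -
    interpret l: Vector_Spaces.linear "smult U" "(*)" l by (rule l)
    have b: "bilin_on V W base (\<lambda>v w. l (F v w))"
      using F unfolding bilin_on_def lin_on_def base_def by (auto simp: l.add l.scale)
    have s: "l (\<Sum>(v, w)\<leftarrow>rs. F v w) = (\<Sum>(v, w)\<leftarrow>rs. l (F v w))" for rs
      by (induction rs) (auto simp: l.add l.zero)
    have "(\<Sum>(v, w)\<leftarrow>ps. l (F v w)) = (\<Sum>(v, w)\<leftarrow>qs. l (F v w))"
      using tens_sum_apply[OF b, of ps] tens_sum_apply[OF b, of qs] qs by simp
    then show ?thesis unfolding d_def by (simp add: l.diff s)
  qed
  have "d = 0"
  proof (rule ccontr)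
    assume "d \<noteq> 0"
    then have "vs.independent {d}" by simp
    from P.linear_independent_extend[OF this, of "\<lambda>_. 1"]
    obtain l where l: "Vector_Spaces.linear (smult U) (*) l" and "l d = (1 :: 'k)"
      by auto
    with zero[OF l] show False by simp
  qed
  then show ?thesis
    unfolding tsum_def Let_def qs_def[symmetric] d_def by simp
qed

definition tmap where
  "tmap V W V' W' f g t = tsum V W t (\<lambda>v w. tens V' W' (f v) (g w))"

definition tassoc where
  "tassoc U V W t =
     tsum (tensor_space U V) W t (\<lambda>s w. tsum U V s (\<lambda>u v.
       tens U (tensor_space V W) u (tens V W v w)))"

definition tensor_alg ::
  "('k::field, 'v::ab_group_add, 'm) kalg_scheme \<Rightarrow> ('k, 'w::ab_group_add, 'n) kalg_scheme
    \<Rightarrow> ('k, ('v \<Rightarrow> 'w \<Rightarrow> 'k) \<Rightarrow> 'k) kalg"  (infixr "\<otimes>\<^sub>A" 70) where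
  "B \<otimes>\<^sub>A C =
     \<lparr>carr = carr (tensor_space B C), smult = smult (tensor_space B C),
      mult = (\<lambda>s t. tsum B C s (\<lambda>b c. tsum B C t (\<lambda>b' c'.
                tens B C (mult B b b') (mult C c c')))),
      unit = tens B C (unit B) (unit C)\<rparr>"

definition kalgebra :: "('k::field, 'v::ab_group_add, 'm) kalg_scheme \<Rightarrow> bool" where
  "kalgebra B \<longleftrightarrow>
     vec_space B \<and> bilin_on B B B (mult B) \<and> unit B \<in> carr B \<and>
     (\<forall>x\<in>carr B. \<forall>y\<in>carr B. \<forall>z\<in>carr B. mult B (mult B x y) z = mult B x (mult B y z)) \<and>
     (\<forall>x\<in>carr B. mult B (unit B) x = x \<and> mult B x (unit B) = x)"

definition alg_hom ::
  "('k::field, 'v::ab_group_add, 'm) kalg_scheme \<Rightarrow> ('k, 'w::ab_group_add, 'n) kalg_scheme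
    \<Rightarrow> ('v \<Rightarrow> 'w) \<Rightarrow> bool" where
  "alg_hom B C f \<longleftrightarrow>
     lin_on B C f \<and> f (unit B) = unit C \<and>
     (\<forall>x\<in>carr B. \<forall>y\<in>carr B. f (mult B x y) = mult C (f x) (f y))"

definition alg_antiaut ::
  "('k::field, 'v::ab_group_add, 'm) kalg_scheme \<Rightarrow> ('v \<Rightarrow> 'v) \<Rightarrow> bool" where
  "alg_antiaut B f \<longleftrightarrow>
     lin_on B B f \<and> bij_betw f (carr B) (carr B) \<and> f (unit B) = unit B \<and>
     (\<forall>x\<in>carr B. \<forall>y\<in>carr B. f (mult B x y) = mult B (f y) (f x))"

definition is_inverse :: "('k, 'v, 'm) kalg_scheme \<Rightarrow> 'v \<Rightarrow> 'v \<Rightarrow> bool" where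
  "is_inverse B x y \<longleftrightarrow>
     y \<in> carr B \<and> mult B x y = unit B \<and> mult B y x = unit B"


section \<open>Quasi-Hopf algebras\<close>

text \<open>Triple and quadruple tensor powers are bracketed to the right; \<open>tassoc\<close> rebrackets.\<close>

locale quasi_hopf_algebra =
  fixes B :: "('k::field, 'b::ab_group_add) kalg"
    and \<Delta> :: "'b \<Rightarrow> ('b \<Rightarrow> 'b \<Rightarrow> 'k) \<Rightarrow> 'k"
    and \<epsilon> :: "'b \<Rightarrow> 'k"
    and S :: "'b \<Rightarrow> 'b"
    and \<phi> :: "('b \<Rightarrow> (('b \<Rightarrow> 'b \<Rightarrow> 'k) \<Rightarrow> 'k) \<Rightarrow> 'k) \<Rightarrow> 'k"
    and \<alpha> :: 'b
    and \<beta> :: 'b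
  assumes algebra: "kalgebra B"
    and comult_hom: "alg_hom B (B \<otimes>\<^sub>A B) \<Delta>"
    and counit_hom: "alg_hom B base \<epsilon>"
    and antipode_antiaut: "alg_antiaut B S"
    and phi_carr: "\<phi> \<in> carr (B \<otimes>\<^sub>A B \<otimes>\<^sub>A B)"
    and phi_invertible: "\<exists>\<psi>. is_inverse (B \<otimes>\<^sub>A B \<otimes>\<^sub>A B) \<phi> \<psi>"
    and alpha_carr: "\<alpha> \<in> carr B"
    and beta_carr: "\<beta> \<in> carr B"
    and quasi_coassoc:
      "\<And>a \<psi>. a \<in> carr B \<Longrightarrow> is_inverse (B \<otimes>\<^sub>A B \<otimes>\<^sub>A B) \<phi> \<psi> \<Longrightarrow>
         tmap B B B (B \<otimes>\<^sub>A B) id \<Delta> (\<Delta> a) =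
         mult (B \<otimes>\<^sub>A B \<otimes>\<^sub>A B)
           (mult (B \<otimes>\<^sub>A B \<otimes>\<^sub>A B) \<phi>
             (tassoc B B B (tmap B B (B \<otimes>\<^sub>A B) B \<Delta> id (\<Delta> a))))
           \<psi>"
    and pentagon:
      "mult (B \<otimes>\<^sub>A B \<otimes>\<^sub>A B \<otimes>\<^sub>A B)
         (tmap B (B \<otimes>\<^sub>A B) B (B \<otimes>\<^sub>A B \<otimes>\<^sub>A B) id (tmap B B B (B \<otimes>\<^sub>A B) id \<Delta>) \<phi>)
         (tassoc B B (B \<otimes>\<^sub>A B)
           (tmap B (B \<otimes>\<^sub>A B) (B \<otimes>\<^sub>A B) (B \<otimes>\<^sub>A B) \<Delta> id \<phi>)) =
       mult (B \<otimes>\<^sub>A B \<otimes>\<^sub>A B \<otimes>\<^sub>A B)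
         (mult (B \<otimes>\<^sub>A B \<otimes>\<^sub>A B \<otimes>\<^sub>A B)
           (tens B (B \<otimes>\<^sub>A B \<otimes>\<^sub>A B) (unit B) \<phi>)
           (tmap B (B \<otimes>\<^sub>A B) B (B \<otimes>\<^sub>A B \<otimes>\<^sub>A B) id
             (\<lambda>t. tassoc B B B (tmap B B (B \<otimes>\<^sub>A B) B \<Delta> id t)) \<phi>))
         (tmap B ((B \<otimes>\<^sub>A B) \<otimes>\<^sub>A B) B (B \<otimes>\<^sub>A B \<otimes>\<^sub>A B) id (tassoc B B B)
           (tassoc B (B \<otimes>\<^sub>A B) B (tens (B \<otimes>\<^sub>A B \<otimes>\<^sub>A B) B \<phi> (unit B))))"
    and counit_left: "\<And>a. a \<in> carr B \<Longrightarrow> tsum B B (\<Delta> a) (\<lambda>x y. smult B (\<epsilon> x) y) = a"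
    and counit_right: "\<And>a. a \<in> carr B \<Longrightarrow> tsum B B (\<Delta> a) (\<lambda>x y. smult B (\<epsilon> y) x) = a"
    and phi_counit:
      "tsum B (B \<otimes>\<^sub>A B) \<phi> (\<lambda>x u. tsum B B u (\<lambda>y z. tens B B x (smult B (\<epsilon> y) z))) =
       tens B B (unit B) (unit B)"
    and antipode_alpha:
      "\<And>a. a \<in> carr B \<Longrightarrow>
         tsum B B (\<Delta> a) (\<lambda>x y. mult B (mult B (S x) \<alpha>) y) = smult B (\<epsilon> a) \<alpha>"
    and antipode_beta:
      "\<And>a. a \<in> carr B \<Longrightarrow>
         tsum B B (\<Delta> a) (\<lambda>x y. mult B (mult B x \<beta>) (S y)) = smult B (\<epsilon> a) \<beta>"
    and antipode_phi:
      "tsum B (B \<otimes>\<^sub>A B) \<phi> (\<lambda>x u. tsum B B u (\<lambda>y z.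
         mult B (mult B (mult B (mult B x \<beta>) (S y)) \<alpha>) z)) = unit B"
    and antipode_phi_inverse:
      "\<And>\<psi>. is_inverse (B \<otimes>\<^sub>A B \<otimes>\<^sub>A B) \<phi> \<psi> \<Longrightarrow>
         tsum B (B \<otimes>\<^sub>A B) \<psi> (\<lambda>p u. tsum B B u (\<lambda>q r.
           mult B (mult B (mult B (mult B (S p) \<alpha>) q) \<beta>) (S r))) = unit B"


section \<open>Hopf algebras\<close>

text \<open>The underlying ring of the Hopf algebra is the type \<open>'a\<close>; it is nonzero because the counit
  maps \<open>1\<close> to \<open>1\<close>.\<close>

record ('k, 'a) hopf =
  scal :: "'k \<Rightarrow> 'a \<Rightarrow> 'a"
  comult :: "'a \<Rightarrow> ('a \<Rightarrow> 'a \<Rightarrow> 'k) \<Rightarrow> 'k"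
  counit :: "'a \<Rightarrow> 'k"
  antipode :: "'a \<Rightarrow> 'a"

definition alg :: "('k::field, 'a::ring_1) hopf \<Rightarrow> ('k, 'a) kalg" where
  "alg H = \<lparr>carr = UNIV, smult = scal H, mult = (*), unit = 1\<rparr>"

definition sw :: "('k::field, 'a::ring_1) hopf \<Rightarrow> 'a \<Rightarrow> ('a \<Rightarrow> 'a \<Rightarrow> 'u::ab_group_add) \<Rightarrow> 'u" where
  "sw H a F = tsum (alg H) (alg H) (comult H a) F"

locale hopf_algebra =
  fixes H :: "('k::field, 'a::ring_1) hopf"
  assumes algebra: "kalgebra (alg H)"
    and comult_hom: "alg_hom (alg H) (alg H \<otimes>\<^sub>A alg H) (comult H)"
    and counit_hom: "alg_hom (alg H) base (counit H)"
    and antipode_linear: "lin_on (alg H) (alg H) (antipode H)"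
    and coassoc:
      "tassoc (alg H) (alg H) (alg H)
         (tmap (alg H) (alg H) (alg H \<otimes>\<^sub>A alg H) (alg H) (comult H) id (comult H a)) =
       tmap (alg H) (alg H) (alg H) (alg H \<otimes>\<^sub>A alg H) id (comult H) (comult H a)"
    and counit_left: "sw H a (\<lambda>x y. scal H (counit H x) y) = a"
    and counit_right: "sw H a (\<lambda>x y. scal H (counit H y) x) = a"
    and antipode_left: "sw H a (\<lambda>x y. antipode H x * y) = scal H (counit H a) 1"
    and antipode_right: "sw H a (\<lambda>x y. x * antipode H y) = scal H (counit H a) 1"

definition cocommutative :: "('k::field, 'a::ring_1) hopf \<Rightarrow> bool" where
  "cocommutative H \<longleftrightarrow>
     (\<forall>a. tsum (alg H) (alg H) (comult H a) (\<lambda>x y. tens (alg H) (alg H) y x) = comult H a)"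

definition sw3 where
  "sw3 H a F = sw H a (\<lambda>a1 b. sw H b (\<lambda>a2 a3. F a1 a2 a3))"

definition sw4 where
  "sw4 H a F = sw H a (\<lambda>a1 b. sw3 H b (\<lambda>a2 a3 a4. F a1 a2 a3 a4))"

text \<open>\<open>sw_list H n a F\<close> is \<open>\<Sum> F [a\<^sub>1, \<dots>, a\<^sub>n]\<close>. For \<open>n = 0\<close> this is the action of \<open>a\<close> on the
  ground field through the counit.\<close>

primrec sw_list ::
  "('k::field, 'a::ring_1) hopf \<Rightarrow> nat \<Rightarrow> 'a \<Rightarrow> ('a list \<Rightarrow> 'k) \<Rightarrow> 'k" where
  "sw_list H 0 = (\<lambda>a F. counit H a * F [])"
| "sw_list H (Suc n) = (\<lambda>a F. sw H a (\<lambda>a1 b. sw_list H n b (\<lambda>bs. F (a1 # bs))))"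

text \<open>Sweedler notation for the componentwise coproduct of a tensor power of the Hopf algebra.\<close>

primrec sw_pow ::
  "('k::field, 'a::ring_1) hopf \<Rightarrow> 'a list \<Rightarrow> ('a list \<Rightarrow> 'a list \<Rightarrow> 'k) \<Rightarrow> 'k" where
  "sw_pow H [] = (\<lambda>F. F [] [])"
| "sw_pow H (a # as) = (\<lambda>F. sw H a (\<lambda>x y. sw_pow H as (\<lambda>us vs. F (x # us) (y # vs))))"

definition ad :: "('k::field, 'a::ring_1) hopf \<Rightarrow> 'a \<Rightarrow> 'a \<Rightarrow> 'a" where
  "ad H a b = sw H a (\<lambda>a1 a2. antipode H a1 * b * a2)"


section \<open>The double complex\<close>

text \<open>A linear map from the \<open>p\<close>-th tensor power to the linear forms on the \<open>q\<close>-th tensor power is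
  given by its values on elementary tensors, that is, by a function of two lists of lengths \<open>p\<close>
  and \<open>q\<close> that is linear in every entry. The value at lists of other lengths is fixed to be \<open>0\<close>,
  so that such maps correspond bijectively to elements of \<open>multilin H p q\<close>.\<close>

type_synonym ('k, 'a) cochain = "'a list \<Rightarrow> 'a list \<Rightarrow> 'k"

definition multilin :: "('k::field, 'a::ring_1) hopf \<Rightarrow> nat \<Rightarrow> nat \<Rightarrow> ('k, 'a) cochain set" where
  "multilin H p q = {f.
     (\<forall>as xs. \<not> (length as = p \<and> length xs = q) \<longrightarrow> f as xs = 0) \<and>
     (\<forall>as xs. length as = p \<longrightarrow> length xs = q \<longrightarrow>
        (\<forall>i<p. lin_on (alg H) base (\<lambda>a. f (as[i := a]) xs)) \<and>
        (\<forall>j<q. lin_on (alg H) base (\<lambda>x. f as (xs[j := x]))))}"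

definition conv ::
  "('k::field, 'a::ring_1) hopf \<Rightarrow> ('k, 'a) cochain \<Rightarrow> ('k, 'a) cochain \<Rightarrow> ('k, 'a) cochain" where
  "conv H f g =
     (\<lambda>as xs. sw_pow H as (\<lambda>as1 as2. sw_pow H xs (\<lambda>xs1 xs2. f as1 xs1 * g as2 xs2)))"

definition triv :: "('k::field, 'a::ring_1) hopf \<Rightarrow> nat \<Rightarrow> nat \<Rightarrow> ('k, 'a) cochain" where
  "triv H p q = (\<lambda>as xs.
     if length as = p \<and> length xs = q
     then prod_list (map (counit H) as) * prod_list (map (counit H) xs) else 0)"

definition conv_list ::
  "('k::field, 'a::ring_1) hopf \<Rightarrow> nat \<Rightarrow> nat \<Rightarrow> ('k, 'a) cochain list \<Rightarrow> ('k, 'a) cochain" where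
  "conv_list H p q fs = foldr (conv H) fs (triv H p q)"

definition is_conv_inverse where
  "is_conv_inverse H p q f g \<longleftrightarrow>
     g \<in> multilin H p q \<and> conv H f g = triv H p q \<and> conv H g f = triv H p q"

definition cochains :: "('k::field, 'a::ring_1) hopf \<Rightarrow> nat \<Rightarrow> nat \<Rightarrow> ('k, 'a) cochain set" where
  "cochains H p q = {f \<in> multilin H p q. \<exists>g. is_conv_inverse H p q f g}"

definition cinv ::
  "('k::field, 'a::ring_1) hopf \<Rightarrow> nat \<Rightarrow> nat \<Rightarrow> ('k, 'a) cochain \<Rightarrow> ('k, 'a) cochain" where
  "cinv H p q f = (THE g. is_conv_inverse H p q f g)"

definition C_N :: "('k::field, 'a::ring_1) hopf \<Rightarrow> nat \<Rightarrow> nat \<Rightarrow> ('k, 'a) cochain set" where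
  "C_N H p q = {f \<in> cochains H p q. \<forall>as xs. length as = p \<longrightarrow> length xs = q \<longrightarrow>
     1 \<in> set as \<union> set xs \<longrightarrow>
     f as xs = prod_list (map (counit H) as) * prod_list (map (counit H) xs)}"

text \<open>\<open>sign_pow H p q f n\<close> is the convolution power of \<open>f\<close> with exponent \<open>(-1)^n\<close>.\<close>

definition sign_pow ::
  "('k::field, 'a::ring_1) hopf \<Rightarrow> nat \<Rightarrow> nat \<Rightarrow> ('k, 'a) cochain \<Rightarrow> nat \<Rightarrow> ('k, 'a) cochain" where
  "sign_pow H p q f n = (if even n then f else cinv H p q f)"

text \<open>\<open>merge i\<close> multiplies the \<open>i\<close>-th and the \<open>(i + 1)\<close>-st entry, counted from \<open>1\<close>.\<close>

definition merge :: "nat \<Rightarrow> 'a::ring_1 list \<Rightarrow> 'a list" where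
  "merge i as = take (i - 1) as @ [as ! (i - 1) * as ! i] @ drop (i + 1) as"

text \<open>The sums defining the differentials are convolution products of the faces below,
  the \<open>j\<close>-th face using the \<open>j\<close>-th Sweedler components of all arguments.\<close>

definition D_diff ::
  "('k::field, 'a::ring_1) hopf \<Rightarrow> nat \<Rightarrow> nat \<Rightarrow> ('k, 'a) cochain \<Rightarrow> ('k, 'a) cochain" where
  "D_diff H p q f = conv_list H (p + 1) q
     ([\<lambda>as xs. sw_list H q (hd as) (\<lambda>bs. sign_pow H p q f q (tl as) (map2 (ad H) bs xs))] @
      map (\<lambda>i as xs. sign_pow H p q f (q + i) (merge i as) xs) [1..<p + 1] @
      [\<lambda>as xs. sign_pow H p q f (q + p + 1) (butlast as) xs * counit H (last as)])"

definition d_diff ::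
  "('k::field, 'a::ring_1) hopf \<Rightarrow> nat \<Rightarrow> nat \<Rightarrow> ('k, 'a) cochain \<Rightarrow> ('k, 'a) cochain" where
  "d_diff H p q f = conv_list H p (q + 1)
     ([\<lambda>as xs. counit H (hd xs) * f as (tl xs)] @
      map (\<lambda>i as xs. sign_pow H p q f i as (merge i xs)) [1..<q + 1] @
      [\<lambda>as xs. sign_pow H p q f (q + 1) as (butlast xs) * counit H (last xs)])"

definition is_triv :: "('k::field, 'a::ring_1) hopf \<Rightarrow> nat \<Rightarrow> nat \<Rightarrow> ('k, 'a) cochain \<Rightarrow> bool" where
  "is_triv H p q f \<longleftrightarrow>
     (\<forall>as xs. length as = p \<longrightarrow> length xs = q \<longrightarrow> f as xs = triv H p q as xs)"

definition normalized_3_cocycle where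
  "normalized_3_cocycle H f0 f1 f2 f3 \<longleftrightarrow>
     f0 \<in> C_N H 0 3 \<and> f1 \<in> C_N H 1 2 \<and> f2 \<in> C_N H 2 1 \<and> f3 \<in> C_N H 3 0 \<and>
     is_triv H 0 4 (d_diff H 0 3 f0) \<and>
     is_triv H 1 3 (conv H (D_diff H 0 3 f0) (d_diff H 1 2 f1)) \<and>
     is_triv H 2 2 (conv H (D_diff H 1 2 f1) (d_diff H 2 1 f2)) \<and>
     is_triv H 3 1 (conv H (D_diff H 2 1 f2) (d_diff H 3 0 f3)) \<and>
     is_triv H 4 0 (D_diff H 3 0 f3)"


section \<open>The dual Hopf algebra\<close>

definition dual :: "('k::field, 'a::ring_1) hopf \<Rightarrow> ('k, 'a \<Rightarrow> 'k) kalg" where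
  "dual H =
     \<lparr>carr = {f. lin_on (alg H) base f}, smult = fscale,
      mult = (\<lambda>f g a. sw H a (\<lambda>a1 a2. f a1 * g a2)), unit = counit H\<rparr>"

text \<open>The canonical isomorphisms from the dual of a tensor power to the tensor power of the dual.\<close>

definition dual_tensor2 where
  "dual_tensor2 H h = (THE t. t \<in> carr (dual H \<otimes>\<^sub>A dual H) \<and>
     (\<forall>a b. tsum (dual H) (dual H) t (\<lambda>f g. f a * g b) = h a b))"

definition dual_tensor3 where
  "dual_tensor3 H h = (THE t. t \<in> carr (dual H \<otimes>\<^sub>A dual H \<otimes>\<^sub>A dual H) \<and>
     (\<forall>a b c. tsum (dual H) (dual H \<otimes>\<^sub>A dual H) t (\<lambda>f u.
        tsum (dual H) (dual H) u (\<lambda>g k. f a * g b * k c)) = h a b c))"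

definition dual_comult where
  "dual_comult H f = dual_tensor2 H (\<lambda>a b. f (a * b))"

definition dual_antipode :: "('k::field, 'a::ring_1) hopf \<Rightarrow> ('a \<Rightarrow> 'k) \<Rightarrow> 'a \<Rightarrow> 'k" where
  "dual_antipode H f = f \<circ> antipode H"

definition lact :: "'a::ring_1 \<Rightarrow> ('a \<Rightarrow> 'k) \<Rightarrow> 'a \<Rightarrow> 'k" where
  "lact x f = (\<lambda>a. f (a * x))"

definition ract :: "('a::ring_1 \<Rightarrow> 'k) \<Rightarrow> 'a \<Rightarrow> 'a \<Rightarrow> 'k" where
  "ract f x = (\<lambda>a. f (x * a))"


section \<open>The double \<open>D(A)\<close>\<close>

text \<open>\<open>dsum\<close> is the sum over \<open>f \<otimes> x\<close> in a decomposition of an element of \<open>A\<^sup>* \<otimes> A\<close>.\<close>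

definition dten where
  "dten H f x = tens (dual H) (alg H) f x"

definition dsum where
  "dsum H t F = tsum (dual H) (alg H) t F"

definition D_space where
  "D_space H = tensor_space (dual H) (alg H)"

definition D_unit where
  "D_unit H = dten H (counit H) 1"

definition D_mult where
  "D_mult H \<theta> s t = dsum H s (\<lambda>f x. dsum H t (\<lambda>g y.
     sw4 H x (\<lambda>x1 x2 x3 x4. sw H y (\<lambda>y1 y2.
       dten H
         (mult (dual H) (mult (dual H) f (lact x1 (ract g (antipode H x2))))
           (\<lambda>a. \<theta> [x3, y1] [a]))
         (x4 * y2)))))"

definition D_alg where
  "D_alg H \<theta> =
     \<lparr>carr = carr (D_space H), smult = smult (D_space H), mult = D_mult H \<theta>, unit = D_unit H\<rparr>"

definition D_comult where
  "D_comult H \<gamma> t = dsum H t (\<lambda>f x. sw3 H x (\<lambda>x1 x2 x3.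
     tsum (dual H) (dual H) (dual_comult H f) (\<lambda>f1 f2.
     tsum (dual H) (dual H) (dual_tensor2 H (\<lambda>a b. \<gamma> [x1] [a, b])) (\<lambda>g1 g2.
       tens (D_space H) (D_space H)
         (dten H (mult (dual H) f1 g1) x2) (dten H (mult (dual H) f2 g2) x3)))))"

definition D_counit where
  "D_counit H t = dsum H t (\<lambda>f x. f 1 * counit H x)"

definition D_antipode where
  "D_antipode H \<gamma> \<theta> t = dsum H t (\<lambda>f x. sw4 H x (\<lambda>x1 x2 x3 x4.
     tsum (dual H) (dual H) (dual_tensor2 H (\<lambda>a b. cinv H 1 2 \<gamma> [x4] [a, b])) (\<lambda>g1 g2.
       D_mult H \<theta>
         (dten H (counit H) (antipode H x1))
         (dten H
           (mult (dual H)
             (mult (dual H)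
               (\<lambda>a. cinv H 2 1 \<theta> [x2, antipode H x3] [a])
               (dual_antipode H (mult (dual H) f g1)))
             g2)
           1))))"

definition D_phi where
  "D_phi H w =
     tsum (dual H) (dual H \<otimes>\<^sub>A dual H)
       (dual_tensor3 H (\<lambda>a b c. cinv H 0 3 w [] [a, b, c])) (\<lambda>u1 u.
     tsum (dual H) (dual H) u (\<lambda>u2 u3.
       tens (D_space H) (tensor_space (D_space H) (D_space H)) (dten H u1 1)
         (tens (D_space H) (D_space H) (dten H u2 1) (dten H u3 1))))"

definition D_alpha where
  "D_alpha H = dten H (counit H) 1"

definition D_beta where
  "D_beta H w =
     tsum (dual H) (dual H \<otimes>\<^sub>A dual H) (dual_tensor3 H (\<lambda>a b c. w [] [a, b, c])) (\<lambda>w1 u.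
     tsum (dual H) (dual H) u (\<lambda>w2 w3.
       dten H (mult (dual H) (mult (dual H) w1 (dual_antipode H w2)) w3) 1))"

end

theory Submission
  imports Defs
begin

text \<open>Since \<open>A\<close> is cocommutative it behaves like the group algebra of a group: over the commutative convolution algebra \<open>R\<close> of linear forms on
  \<open>A\<^sup>\<otimes>\<^sup>4\<close> it has points (grouplike elements of \<open>R \<otimes> A\<close>), which form a group. A multilinear form
  in at most four variables is determined by its values at four universal points, and
  convolution of forms becomes multiplication of values in the commutative ring \<open>R\<close>. At points
  the cocycle conditions are identities between products of values of \<open>w\<close>, \<open>\<gamma>\<close> and \<open>\<theta>\<close>, as for
  ordinary group cochains. The elements of \<open>D(A)\<close> and of its tensor powers are separated by
  evaluating them at elements of \<open>A\<close> and linear forms on \<open>A\<close>. Written at points, associativity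
  is the condition for \<open>\<theta>\<close>, multiplicativity of \<open>\<Delta>\<^sub>\<gamma>\<close> the condition linking \<open>\<gamma>\<close> and \<open>\<theta>\<close>,
  quasi-coassociativity the one linking \<open>w\<close> and \<open>\<gamma>\<close>, and the pentagon the condition for \<open>w\<close>.
  The remaining axioms follow: the antipode acts at points by
  \<open>S(f \<otimes> x)(a) = \<theta>\<^sup>-\<^sup>1(x, x\<^sup>-\<^sup>1)(c) \<gamma>\<^sup>-\<^sup>1(x)(c\<^sup>-\<^sup>1, c) f(c\<^sup>-\<^sup>1) \<otimes> x\<^sup>-\<^sup>1\<close> with \<open>c = x a x\<^sup>-\<^sup>1\<close>, and the
  identities needed are the cocycle conditions at group elements such as
  \<open>(a, a\<^sup>-\<^sup>1, a)\<close> and \<open>(x, x\<^sup>-\<^sup>1, x)\<close>.\<close>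

section \<open>Tensor products\<close>

text \<open>A may have no grouplike element except 1, as for a restricted enveloping algebra, so
  group arguments cannot be run inside A. After extending scalars to R they can: the coordinate
  functions of a tensor factor are the coordinates of a point. Four variables suffice because each
  identity compared involves at most four arguments from A; the cocycle conditions live in total
  degree 4, and associativity is tested at one functional argument and three group variables. The
  conditions are kept at all points, not just the universal ones, because the antipode axioms
  substitute inverses and products. From the axioms a condition is extracted by inserting the counit
  for every free linear form, so that only values of the cochains survive. Conversely the free forms
  contribute equal factors to both sides, and the condition at the universal points gives the
  identity. Where an axiom quantifies over an inverse of the associator, an explicit one is inserted
  to extract the condition, while in the converse direction the associativity already obtained makes
  the inverse unique.\<close>

lemma vec_space_vs: "vec_space V \<Longrightarrow> vector_space (smult V)"
  by (simp add: vec_space_def)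

lemma vec_space_zero: "vec_space V \<Longrightarrow> 0 \<in> carr V"
  unfolding vec_space_def by (metis module.subspace_0 module_iff_vector_space)

lemma vec_space_add: "vec_space V \<Longrightarrow> x \<in> carr V \<Longrightarrow> y \<in> carr V \<Longrightarrow> x + y \<in> carr V"
  unfolding vec_space_def by (metis module.subspace_add module_iff_vector_space)

lemma vec_space_scale: "vec_space V \<Longrightarrow> x \<in> carr V \<Longrightarrow> smult V c x \<in> carr V"
  unfolding vec_space_def by (metis module.subspace_scale module_iff_vector_space)

lemma vec_space_diff: "vec_space V \<Longrightarrow> x \<in> carr V \<Longrightarrow> y \<in> carr V \<Longrightarrow> x - y \<in> carr V"
  unfolding vec_space_def by (metis module.subspace_diff module_iff_vector_space)

lemma vec_space_sum: "vec_space V \<Longrightarrow> (\<And>i. i \<in> I \<Longrightarrow> f i \<in> carr V) \<Longrightarrow> sum f I \<in> carr V"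
  by (induction I rule: infinite_finite_induct) (auto simp: vec_space_zero vec_space_add)

lemma vec_space_sum_list:
  "vec_space V \<Longrightarrow> (\<And>p. p \<in> set ps \<Longrightarrow> f p \<in> carr V) \<Longrightarrow> (\<Sum>p\<leftarrow>ps. f p) \<in> carr V"
  by (induction ps) (auto simp: vec_space_zero vec_space_add)

lemma vec_space_base: "vec_space (base :: ('k::field, 'k) kalg)"
proof -
  interpret vector_space "(*) :: 'k \<Rightarrow> 'k \<Rightarrow> 'k" by unfold_locales (auto simp: algebra_simps)
  show ?thesis unfolding vec_space_def base_def by (simp add: vector_space_axioms subspace_UNIV)
qed

lemma vector_space_fscale: "vector_space (fscale :: 'k::field \<Rightarrow> ('x \<Rightarrow> 'k) \<Rightarrow> 'x \<Rightarrow> 'k)"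
  by unfold_locales (auto simp: fscale_def algebra_simps)

lemma lin_onD:
  assumes "lin_on V W f"
  shows "x \<in> carr V \<Longrightarrow> f x \<in> carr W"
    and "x \<in> carr V \<Longrightarrow> y \<in> carr V \<Longrightarrow> f (x + y) = f x + f y"
    and "x \<in> carr V \<Longrightarrow> f (smult V c x) = smult W c (f x)"
  using assms by (auto simp: lin_on_def)

lemma lin_on_zero: "vec_space V \<Longrightarrow> lin_on V W f \<Longrightarrow> f 0 = 0"
  using lin_onD(2)[of V W f 0 0] by (simp add: vec_space_zero)

lemma lin_on_diff:
  assumes "vec_space V" "lin_on V W f" "x \<in> carr V" "y \<in> carr V"
  shows "f (x - y) = f x - f y"
proof -
  have "f ((x - y) + y) = f (x - y) + f y"
    by (rule lin_onD(2)) (use assms in \<open>auto intro: vec_space_diff\<close>)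
  then show ?thesis by simp
qed

lemma lin_on_sum:
  assumes "vec_space V" "lin_on V W f" "\<And>i. i \<in> I \<Longrightarrow> g i \<in> carr V"
  shows "f (sum g I) = (\<Sum>i\<in>I. f (g i))"
  using assms(3)
  by (induction I rule: infinite_finite_induct)
    (auto simp: lin_on_zero[OF assms(1,2)] lin_onD(2)[OF assms(2)] vec_space_sum[OF assms(1)])

lemma lin_on_sum_list:
  assumes "vec_space V" "lin_on V W f" "\<And>p. p \<in> set ps \<Longrightarrow> g p \<in> carr V"
  shows "f (\<Sum>p\<leftarrow>ps. g p) = (\<Sum>p\<leftarrow>ps. f (g p))"
  using assms(3)
  by (induction ps)
    (auto simp: lin_on_zero[OF assms(1,2)] lin_onD(2)[OF assms(2)] vec_space_sum_list[OF assms(1)])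

lemma lin_on_comp: "lin_on V W f \<Longrightarrow> lin_on W U g \<Longrightarrow> lin_on V U (\<lambda>x. g (f x))"
  by (auto simp: lin_on_def)

lemma lin_on_id: "lin_on V V id" "lin_on V V (\<lambda>x. x)"
  by (auto simp: lin_on_def)

lemma lin_on_sum_list_fun:
  assumes "vec_space W" "\<And>p. p \<in> set ps \<Longrightarrow> lin_on V W (f p)"
  shows "lin_on V W (\<lambda>x. \<Sum>p\<leftarrow>ps. f p x)"
proof -
  interpret vector_space "smult W" using assms(1) by (rule vec_space_vs)
  show ?thesis using assms(2)
    by (induction ps)
      (auto simp: lin_on_def scale_right_distrib vec_space_zero[OF assms(1)]
        vec_space_add[OF assms(1)])
qed

lemma bilin_onD:
  assumes "bilin_on V W U b"
  shows "v \<in> carr V \<Longrightarrow> lin_on W U (b v)" "w \<in> carr W \<Longrightarrow> lin_on V U (\<lambda>v. b v w)"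
    "v \<in> carr V \<Longrightarrow> w \<in> carr W \<Longrightarrow> b v w \<in> carr U"
  using assms by (auto simp: bilin_on_def lin_on_def)

lemma bilin_on_comp:
  "bilin_on V' W' U b \<Longrightarrow> lin_on V V' f \<Longrightarrow> lin_on W W' g \<Longrightarrow> bilin_on V W U (\<lambda>v w. b (f v) (g w))"
  unfolding bilin_on_def lin_on_def by auto

lemma bilin_on_post: "bilin_on V W U b \<Longrightarrow> lin_on U U' f \<Longrightarrow> bilin_on V W U' (\<lambda>v w. f (b v w))"
  unfolding bilin_on_def lin_on_def by auto

lemma bilin_on_base_mult:
  fixes f :: "'v::ab_group_add \<Rightarrow> 'k::field"
  assumes "lin_on V base f" "lin_on W base g"
  shows "bilin_on V W base (\<lambda>v w. f v * g w)"
  using assms by (auto simp: bilin_on_def lin_on_def base_def algebra_simps)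

section \<open>Elementary tensors and linear extension\<close>

lemma carr_tensorE:
  assumes "t \<in> carr (tensor_space V W)"
  obtains ps where "set ps \<subseteq> carr V \<times> carr W" "t = (\<Sum>(v, w)\<leftarrow>ps. tens V W v w)"
  using assms by (auto simp: tensor_space_def)

lemma tens_carr: "v \<in> carr V \<Longrightarrow> w \<in> carr W \<Longrightarrow> tens V W v w \<in> carr (tensor_space V W)"
  unfolding tensor_space_def by (auto intro!: exI[of _ "[(v, w)]"])

lemma tens_add_left:
  "v \<in> carr V \<Longrightarrow> v' \<in> carr V \<Longrightarrow> w \<in> carr W \<Longrightarrow> tens V W (v + v') w = tens V W v w + tens V W v' w"
  unfolding tens_def bilin_on_def lin_on_def by (rule ext) auto

lemma tens_add_right:
  "v \<in> carr V \<Longrightarrow> w \<in> carr W \<Longrightarrow> w' \<in> carr W \<Longrightarrow> tens V W v (w + w') = tens V W v w + tens V W v w'"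
  unfolding tens_def bilin_on_def lin_on_def by (rule ext) auto

lemma tens_scale_left:
  "v \<in> carr V \<Longrightarrow> w \<in> carr W \<Longrightarrow> tens V W (smult V c v) w = fscale c (tens V W v w)"
  unfolding tens_def bilin_on_def lin_on_def base_def fscale_def by (rule ext) auto

lemma tens_scale_right:
  "v \<in> carr V \<Longrightarrow> w \<in> carr W \<Longrightarrow> tens V W v (smult W c w) = fscale c (tens V W v w)"
  unfolding tens_def bilin_on_def lin_on_def base_def fscale_def by (rule ext) auto

lemma smult_tensor_space: "smult (tensor_space V W) = fscale"
  by (simp add: tensor_space_def)

lemma tens_bilin: "bilin_on V W (tensor_space V W) (tens V W)"
  unfolding bilin_on_def lin_on_def smult_tensor_space
  by (auto simp: tens_carr tens_add_left tens_add_right tens_scale_left tens_scale_right)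

lemma carr_tensor_add:
  assumes "t \<in> carr (tensor_space V W)" "t' \<in> carr (tensor_space V W)"
  shows "t + t' \<in> carr (tensor_space V W)"
proof -
  obtain ps qs where "set ps \<subseteq> carr V \<times> carr W" "t = (\<Sum>(v, w)\<leftarrow>ps. tens V W v w)"
    "set qs \<subseteq> carr V \<times> carr W" "t' = (\<Sum>(v, w)\<leftarrow>qs. tens V W v w)"
    using assms by (metis carr_tensorE)
  then show ?thesis unfolding tensor_space_def by (auto intro!: exI[of _ "ps @ qs"])
qed

lemma tensor_rep_scale:
  fixes V :: "('k::field, 'v::ab_group_add, 'm) vspace_scheme"
    and W :: "('k, 'w::ab_group_add, 'n) vspace_scheme"
  assumes "set ps \<subseteq> carr V \<times> carr W"
  shows "fscale c (\<Sum>(v, w)\<leftarrow>ps. tens V W v w) =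
    (\<Sum>(v, w)\<leftarrow>map (\<lambda>(v, w). (smult V c v, w)) ps. tens V W v w)"
proof -
  interpret vector_space "fscale :: 'k \<Rightarrow> (('v \<Rightarrow> 'w \<Rightarrow> 'k) \<Rightarrow> 'k) \<Rightarrow> _" by (rule vector_space_fscale)
  show ?thesis using assms by (induction ps) (auto simp: scale_right_distrib tens_scale_left)
qed

text \<open>A scalar is absorbed into the left factors of a decomposition, so closure under scaling
  comes from that of \<open>V\<close>.\<close>

lemma vec_space_tensor:
  fixes V :: "('k::field, 'v::ab_group_add, 'm) vspace_scheme"
    and W :: "('k, 'w::ab_group_add, 'n) vspace_scheme"
  assumes "vec_space V"
  shows "vec_space (tensor_space V W)"
proof -
  interpret vector_space "fscale :: 'k \<Rightarrow> (('v \<Rightarrow> 'w \<Rightarrow> 'k) \<Rightarrow> 'k) \<Rightarrow> _" by (rule vector_space_fscale)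
  have "subspace (carr (tensor_space V W))"
  proof (rule subspaceI)
    show "0 \<in> carr (tensor_space V W)"
      unfolding tensor_space_def by (auto intro!: exI[of _ "[]"])
    show "x + y \<in> carr (tensor_space V W)"
      if "x \<in> carr (tensor_space V W)" "y \<in> carr (tensor_space V W)" for x y
      using that by (rule carr_tensor_add)
    show "fscale c x \<in> carr (tensor_space V W)" if x: "x \<in> carr (tensor_space V W)" for c x
    proof -
      obtain ps where ps: "set ps \<subseteq> carr V \<times> carr W" "x = (\<Sum>(v, w)\<leftarrow>ps. tens V W v w)"
        using x by (rule carr_tensorE)
      show ?thesis unfolding ps(2) tensor_rep_scale[OF ps(1)]
        using ps(1) vec_space_scale[OF assms] unfolding tensor_space_def
        by (fastforce intro!: exI[of _ "map (\<lambda>(v, w). (smult V c v, w)) ps"])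
    qed
  qed
  then show ?thesis unfolding vec_space_def smult_tensor_space
    by (simp add: vector_space_axioms)
qed

lemma tensor_induct [consumes 1, case_names zero tens]:
  assumes "t \<in> carr (tensor_space V W)" "P 0"
    "\<And>v w t. v \<in> carr V \<Longrightarrow> w \<in> carr W \<Longrightarrow> t \<in> carr (tensor_space V W) \<Longrightarrow> P t \<Longrightarrow> P (tens V W v w + t)"
  shows "P t"
proof -
  have "P (\<Sum>(v, w)\<leftarrow>ps. tens V W v w)" if "set ps \<subseteq> carr V \<times> carr W" for ps
    using that
  proof (induction ps)
    case Nil
    show ?case using assms(2) by (simp only: list.map sum_list.Nil)
  next
    case (Cons p ps)
    have "(\<Sum>(v, w)\<leftarrow>ps. tens V W v w) \<in> carr (tensor_space V W)"
      using Cons.prems unfolding tensor_space_def by auto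
    with Cons have "P (tens V W (fst p) (snd p) + (\<Sum>(v, w)\<leftarrow>ps. tens V W v w))"
      by (intro assms(3)) auto
    then show ?case by (simp only: list.map sum_list.Cons split_def)
  qed
  with assms(1) show ?thesis by (metis carr_tensorE)
qed

text \<open>Elementary tensors span. Most identities between linear maps on tensor products below
  are reduced to elementary tensors in this way, one argument at a time.\<close>

lemma tensor_lin_ext:
  assumes "vec_space V" "lin_on (tensor_space V W) U f" "lin_on (tensor_space V W) U g"
    and "\<And>v w. v \<in> carr V \<Longrightarrow> w \<in> carr W \<Longrightarrow> f (tens V W v w) = g (tens V W v w)"
    and "t \<in> carr (tensor_space V W)"
  shows "f t = g t"
  using assms(5)
proof (induction t rule: tensor_induct)
  case zero
  show ?case
    using lin_on_zero[OF vec_space_tensor[OF assms(1)] assms(2)]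
      lin_on_zero[OF vec_space_tensor[OF assms(1)] assms(3)] by (simp only:)
next
  case (tens v w t)
  then show ?case
    using lin_onD(2)[OF assms(2) tens_carr tens(3)] lin_onD(2)[OF assms(3) tens_carr tens(3)] assms(4)
    by (simp only:)
qed

lemma tsum_tens:
  assumes "vec_space U" "bilin_on V W U F" "v \<in> carr V" "w \<in> carr W"
  shows "tsum V W (tens V W v w) F = F v w"
  using tsum_eq[OF assms(1,2), of "[(v, w)]"] assms(3,4) by simp

text \<open>Additivity is concatenation of decompositions; \<open>tsum_eq\<close> makes the value
  independent of which decomposition the choice operator picks.\<close>

lemma tsum_lin:
  assumes V: "vec_space V" and U: "vec_space U" and F: "bilin_on V W U F"
  shows "lin_on (tensor_space V W) U (\<lambda>t. tsum V W t F)"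
  unfolding lin_on_def
proof (intro conjI ballI allI)
  interpret vector_space "smult U" using U by (rule vec_space_vs)
  fix x assume x: "x \<in> carr (tensor_space V W)"
  then obtain ps where ps: "set ps \<subseteq> carr V \<times> carr W" "x = (\<Sum>(v, w)\<leftarrow>ps. tens V W v w)"
    by (rule carr_tensorE)
  have "(\<Sum>(v, w)\<leftarrow>ps. F v w) \<in> carr U"
    using ps(1) F by (intro vec_space_sum_list[OF U]) (auto dest: bilin_onD(3))
  then show "tsum V W x F \<in> carr U" unfolding ps(2) tsum_eq[OF U F ps(1)] .
  show "tsum V W (x + y) F = tsum V W x F + tsum V W y F" if y': "y \<in> carr (tensor_space V W)" for y
  proof -
    obtain qs where qs: "set qs \<subseteq> carr V \<times> carr W" and y: "y = (\<Sum>(v, w)\<leftarrow>qs. tens V W v w)"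
      by (rule carr_tensorE[OF y'])
    have "x + y = (\<Sum>(v, w)\<leftarrow>ps @ qs. tens V W v w)" by (simp add: ps(2) y)
    then have "tsum V W (x + y) F = (\<Sum>(v, w)\<leftarrow>ps @ qs. F v w)"
      using tsum_eq[OF U F, of "ps @ qs"] ps(1) qs by simp
    then show ?thesis using tsum_eq[OF U F ps(1)] tsum_eq[OF U F qs] by (simp add: ps(2) y)
  qed
  show "tsum V W (smult (tensor_space V W) c x) F = smult U c (tsum V W x F)" for c
  proof -
    let ?qs = "map (\<lambda>(v, w). (smult V c v, w)) ps"
    have qs: "set ?qs \<subseteq> carr V \<times> carr W" using ps(1) vec_space_scale[OF V] by auto
    have "smult (tensor_space V W) c x = (\<Sum>(v, w)\<leftarrow>?qs. tens V W v w)"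
      unfolding ps(2) smult_tensor_space by (rule tensor_rep_scale[OF ps(1)])
    then have "tsum V W (smult (tensor_space V W) c x) F = (\<Sum>(v, w)\<leftarrow>?qs. F v w)"
      using tsum_eq[OF U F qs] by simp
    also have "\<dots> = smult U c (\<Sum>(v, w)\<leftarrow>ps. F v w)"
      using ps(1) by (induction ps)
        (auto simp: scale_right_distrib lin_onD(3)[OF bilin_onD(2)[OF F]])
    also have "\<dots> = smult U c (tsum V W x F)" using tsum_eq[OF U F ps(1)] by (simp add: ps(2))
    finally show ?thesis .
  qed
qed

lemma tsum_carr:
  assumes "vec_space V" "vec_space U" "bilin_on V W U F" "t \<in> carr (tensor_space V W)"
  shows "tsum V W t F \<in> carr U"
  using lin_onD(1)[OF tsum_lin[OF assms(1-3)] assms(4)] .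

text \<open>The decomposition chosen inside \<open>tsum\<close>, under a name. It presents
  \<open>tsum\<close> as a plain list sum for arbitrary \<open>F\<close>, so sums can be
  interchanged, and congruence applied, before bilinearity is established.\<close>

definition trep where
  "trep V W t = (SOME ps. set ps \<subseteq> carr V \<times> carr W \<and> t = (\<Sum>(v, w)\<leftarrow>ps. tens V W v w))"

lemma tsum_trep: "tsum V W t F = (\<Sum>(v, w)\<leftarrow>trep V W t. F v w)"
  by (simp add: tsum_def trep_def)

lemma trep_carr: "t \<in> carr (tensor_space V W) \<Longrightarrow> set (trep V W t) \<subseteq> carr V \<times> carr W"
  unfolding trep_def by (rule someI2_ex) (auto elim: carr_tensorE)

lemma tsum_cong:
  assumes "t \<in> carr (tensor_space V W)" "\<And>v w. v \<in> carr V \<Longrightarrow> w \<in> carr W \<Longrightarrow> F v w = G v w"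
  shows "tsum V W t F = tsum V W t G"
  unfolding tsum_trep using trep_carr[OF assms(1)] assms(2)
  by (intro arg_cong[where f = sum_list] map_cong) auto

lemma lin_on_tsum:
  assumes "vec_space U" "lin_on U U' l" "t \<in> carr (tensor_space V W)" "bilin_on V W U F"
  shows "l (tsum V W t F) = tsum V W t (\<lambda>v w. l (F v w))"
  unfolding tsum_trep split_def
  by (rule lin_on_sum_list[OF assms(1,2)]) (use trep_carr[OF assms(3)] bilin_onD(3)[OF assms(4)] in auto)

lemma lin_on_tsum_fun:
  assumes "vec_space U" "t \<in> carr (tensor_space V W)"
    and "\<And>v w. v \<in> carr V \<Longrightarrow> w \<in> carr W \<Longrightarrow> lin_on X U (\<lambda>x. F x v w)"
  shows "lin_on X U (\<lambda>x. tsum V W t (F x))"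
  unfolding tsum_trep split_def
  by (rule lin_on_sum_list_fun[OF assms(1)]) (use trep_carr[OF assms(2)] assms(3) in auto)

lemma bilin_on_tsum_fun:
  assumes "vec_space U" "t \<in> carr (tensor_space V W)"
    and "\<And>v w. v \<in> carr V \<Longrightarrow> w \<in> carr W \<Longrightarrow> bilin_on X Y U (\<lambda>x y. F x y v w)"
  shows "bilin_on X Y U (\<lambda>x y. tsum V W t (F x y))"
  using assms(3) unfolding bilin_on_def
  by (auto intro!: lin_on_tsum_fun[OF assms(1,2)])

text \<open>\<open>tens\<close> and \<open>tsum\<close> look only at carriers and scalars. The
  records \<open>B \<otimes>\<^sub>A C\<close> and \<open>tensor_space B C\<close> therefore give
  the same iterated tensors, and these three lemmas allow passing from one to the other.\<close>

lemma tens_cong: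
  assumes "carr V = carr V'" "smult V = smult V'" "carr W = carr W'" "smult W = smult W'"
  shows "tens V W = tens V' W'"
  unfolding tens_def bilin_on_def lin_on_def by (intro ext) (simp add: assms)

lemma tensor_space_cong:
  assumes "carr V = carr V'" "smult V = smult V'" "carr W = carr W'" "smult W = smult W'"
  shows "tensor_space V W = tensor_space V' W'"
  unfolding tensor_space_def tens_cong[OF assms] by (simp add: assms)

lemma tsum_cong_space:
  assumes "carr V = carr V'" "smult V = smult V'" "carr W = carr W'" "smult W = smult W'"
  shows "tsum V W = tsum V' W'"
  unfolding tsum_def tens_cong[OF assms] by (intro ext) (simp add: assms)

text \<open>Families of linear forms that separate points of the factors separate points of the tensor
  product, because a tensor is determined by its contractions with linear forms on one factor.\<close>

lemma tensor_separate:
  fixes V :: "('k::field, 'v::ab_group_add, 'm) vspace_scheme"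
    and W :: "('k, 'w::ab_group_add, 'n) vspace_scheme"
  assumes V: "vec_space V" and W: "vec_space W" and t: "t \<in> carr (tensor_space V W)"
    and \<Phi>: "\<And>\<phi>. \<phi> \<in> \<Phi> \<Longrightarrow> lin_on V base \<phi>" and \<Psi>: "\<And>\<psi>. \<psi> \<in> \<Psi> \<Longrightarrow> lin_on W base \<psi>"
    and sep\<Phi>: "\<And>v. v \<in> carr V \<Longrightarrow> (\<And>\<phi>. \<phi> \<in> \<Phi> \<Longrightarrow> \<phi> v = 0) \<Longrightarrow> v = 0"
    and sep\<Psi>: "\<And>w. w \<in> carr W \<Longrightarrow> (\<And>\<psi>. \<psi> \<in> \<Psi> \<Longrightarrow> \<psi> w = 0) \<Longrightarrow> w = 0"
    and zero: "\<And>\<phi> \<psi>. \<phi> \<in> \<Phi> \<Longrightarrow> \<psi> \<in> \<Psi> \<Longrightarrow> tsum V W t (\<lambda>v w. \<phi> v * \<psi> w) = 0"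
  shows "t = 0"
proof -
  interpret v: vector_space "smult V" using V by (rule vec_space_vs)
  interpret w: vector_space "smult W" using W by (rule vec_space_vs)
  obtain ps where ps: "set ps \<subseteq> carr V \<times> carr W" and t': "t = (\<Sum>(v, w)\<leftarrow>ps. tens V W v w)"
    using t by (rule carr_tensorE)
  have sub: "w.subspace (carr W)" using W by (simp add: vec_space_def)
  \<comment> \<open>A basis of \<open>W\<close> inside its carrier: its coordinate forms are linear
    on \<open>W\<close> and supply the coefficients for expanding \<open>t\<close> in the second
    factor.\<close>
  obtain B where B: "B \<subseteq> carr W" "w.independent B" "carr W \<subseteq> w.span B"
    by (rule w.maximal_independent_subset)
  have span: "w.span B = carr W"
    using B(1,3) w.span_minimal[OF B(1) sub] by auto
  let ?r = "w.representation B"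
  have rlin: "lin_on W base (\<lambda>w. ?r w e)" for e
    unfolding lin_on_def base_def using B(2)
    by (auto simp: span w.representation_add w.representation_scale)
  \<comment> \<open>Contracting the first factor with \<open>\<phi>\<close> leaves a vector of
    \<open>W\<close> that every form in \<open>\<Psi>\<close> annihilates.\<close>
  have s1: "(\<Sum>(v, w)\<leftarrow>ps. smult W (\<phi> v) w) = 0" if "\<phi> \<in> \<Phi>" for \<phi>
  proof (rule sep\<Psi>)
    show "(\<Sum>(v, w)\<leftarrow>ps. smult W (\<phi> v) w) \<in> carr W"
      using ps by (intro vec_space_sum_list[OF W]) (auto intro: vec_space_scale[OF W])
    fix \<psi> assume "\<psi> \<in> \<Psi>"
    note \<psi> = \<Psi>[OF this]
    have "\<psi> (\<Sum>(v, w)\<leftarrow>ps. smult W (\<phi> v) w) = (\<Sum>(v, w)\<leftarrow>ps. \<phi> v * \<psi> w)"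
      unfolding split_def using ps lin_onD(3)[OF \<psi>]
      by (subst lin_on_sum_list[OF W \<psi>])
        (auto intro!: vec_space_scale[OF W] arg_cong[where f = sum_list] map_cong simp: base_def subset_iff)
    also have "\<dots> = tsum V W t (\<lambda>v w. \<phi> v * \<psi> w)"
      unfolding t' using tsum_eq[OF vec_space_base bilin_on_base_mult[OF \<Phi>[OF that] \<psi>] ps] by simp
    also have "\<dots> = 0" by (rule zero) fact+
    finally show "\<psi> (\<Sum>(v, w)\<leftarrow>ps. smult W (\<phi> v) w) = 0" .
  qed
  \<comment> \<open>The coefficient of \<open>t\<close> at the basis vector \<open>e\<close> is a
    vector of \<open>V\<close>; \<open>\<phi>\<close> sends it to a coordinate of the vector in
    \<open>s1\<close>, hence to 0.\<close>
  have s2: "(\<Sum>(v, w)\<leftarrow>ps. smult V (?r w e) v) = 0" for e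
  proof (rule sep\<Phi>)
    show "(\<Sum>(v, w)\<leftarrow>ps. smult V (?r w e) v) \<in> carr V"
      using ps by (intro vec_space_sum_list[OF V]) (auto intro: vec_space_scale[OF V])
    fix \<phi> assume "\<phi> \<in> \<Phi>"
    note \<phi> = \<Phi>[OF this]
    have "\<phi> (\<Sum>(v, w)\<leftarrow>ps. smult V (?r w e) v) = (\<Sum>(v, w)\<leftarrow>ps. ?r (smult W (\<phi> v) w) e)"
      unfolding split_def using ps lin_onD(3)[OF \<phi>] lin_onD(3)[OF rlin]
      by (subst lin_on_sum_list[OF V \<phi>])
        (auto intro!: vec_space_scale[OF V] arg_cong[where f = sum_list] map_cong simp: base_def subset_iff)
    also have "\<dots> = ?r (\<Sum>(v, w)\<leftarrow>ps. smult W (\<phi> v) w) e"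
      unfolding split_def using ps
      by (subst lin_on_sum_list[OF W rlin]) (auto intro!: vec_space_scale[OF W])
    also have "\<dots> = 0" using s1[OF \<open>\<phi> \<in> \<Phi>\<close>] lin_on_zero[OF W rlin] by simp
    finally show "\<phi> (\<Sum>(v, w)\<leftarrow>ps. smult V (?r w e) v) = 0" .
  qed
  \<comment> \<open>Finitely many basis vectors occur in the second components; off \<open>F\<close>
    all their coordinates vanish.\<close>
  define F where "F = (\<Union>(v, w)\<in>set ps. {e. ?r w e \<noteq> 0})"
  have F: "finite F" unfolding F_def by (auto simp: w.finite_representation)
  have F': "F \<subseteq> carr W" unfolding F_def using B(1) w.representation_ne_zero by fastforce
  have w_eq: "w = (\<Sum>e\<in>F. smult W (?r w e) e)" if "(v, w) \<in> set ps" for v w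
  proof -
    have "w \<in> w.span B" using that ps span by auto
    then have "w = (\<Sum>e | ?r w e \<noteq> 0. smult W (?r w e) e)"
      using B(2) by (simp add: w.sum_nonzero_representation_eq)
    also have "\<dots> = (\<Sum>e\<in>F. smult W (?r w e) e)"
      by (rule sum.mono_neutral_left) (use F that in \<open>auto simp: F_def\<close>)
    finally show ?thesis .
  qed
  have "t b = 0" for b
  proof (cases "bilin_on V W base b")
    case True
    have "t b = (\<Sum>(v, w)\<leftarrow>ps. b v w)" unfolding t' by (rule tens_sum_apply[OF True])
    also have "\<dots> = (\<Sum>(v, w)\<leftarrow>ps. \<Sum>e\<in>F. ?r w e * b v e)"
    proof (intro arg_cong[where f = sum_list] map_cong refl, clarify)
      fix v w assume vw: "(v, w) \<in> set ps"
      then have v: "v \<in> carr V" using ps by auto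
      have "b v w = b v (\<Sum>e\<in>F. smult W (?r w e) e)" using w_eq[OF vw] by simp
      also have "\<dots> = (\<Sum>e\<in>F. ?r w e * b v e)"
        using F' lin_onD(3)[OF bilin_onD(1)[OF True v]]
        by (subst lin_on_sum[OF W bilin_onD(1)[OF True v]])
          (auto intro!: vec_space_scale[OF W] sum.cong simp: base_def subset_iff)
      finally show "b v w = (\<Sum>e\<in>F. ?r w e * b v e)" .
    qed
    also have "\<dots> = (\<Sum>e\<in>F. \<Sum>(v, w)\<leftarrow>ps. ?r w e * b v e)"
      by (induction ps) (auto simp: sum.distrib)
    also have "\<dots> = (\<Sum>e\<in>F. b (\<Sum>(v, w)\<leftarrow>ps. smult V (?r w e) v) e)"
    proof (rule sum.cong[OF refl])
      fix e assume "e \<in> F"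
      then have e: "e \<in> carr W" using F' by auto
      show "(\<Sum>(v, w)\<leftarrow>ps. ?r w e * b v e) = b (\<Sum>(v, w)\<leftarrow>ps. smult V (?r w e) v) e"
        unfolding split_def using ps lin_onD(3)[OF bilin_onD(2)[OF True e]]
        by (subst lin_on_sum_list[OF V bilin_onD(2)[OF True e]])
          (auto intro!: vec_space_scale[OF V] arg_cong[where f = sum_list] map_cong simp: base_def subset_iff)
    qed
    also have "\<dots> = 0"
      using F' by (intro sum.neutral) (auto simp: s2 lin_on_zero[OF V bilin_onD(2)[OF True]])
    finally show ?thesis .
  next
    case False
    \<comment> \<open>Off the bilinear forms every elementary tensor has the default value
      0.\<close>
    then have "t b = 0" unfolding t' by (induction ps) (auto simp: tens_def zero_fun_def)
    then show ?thesis .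
  qed
  then show ?thesis by (intro ext) (simp add: zero_fun_def)
qed

section \<open>Tensor products of maps and rebracketing\<close>

lemma tmap_lin:
  assumes "vec_space V" "vec_space V'" "lin_on V V' f" "lin_on W W' g"
  shows "lin_on (tensor_space V W) (tensor_space V' W') (tmap V W V' W' f g)"
  unfolding tmap_def
  by (intro tsum_lin assms vec_space_tensor bilin_on_comp[OF tens_bilin assms(3,4)])

lemma tassoc_aux:
  assumes "vec_space U" "vec_space V"
  shows "w \<in> carr W \<Longrightarrow> bilin_on U V (tensor_space U (tensor_space V W))
      (\<lambda>u v. tens U (tensor_space V W) u (tens V W v w))"
    and "bilin_on (tensor_space U V) W (tensor_space U (tensor_space V W))
      (\<lambda>s w. tsum U V s (\<lambda>u v. tens U (tensor_space V W) u (tens V W v w)))"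
proof -
  show *: "bilin_on U V (tensor_space U (tensor_space V W))
      (\<lambda>u v. tens U (tensor_space V W) u (tens V W v w))" if "w \<in> carr W" for w
    using bilin_on_comp[OF tens_bilin[of U "tensor_space V W"] lin_on_id(2) bilin_onD(2)[OF tens_bilin that]] .
  show "bilin_on (tensor_space U V) W (tensor_space U (tensor_space V W))
      (\<lambda>s w. tsum U V s (\<lambda>u v. tens U (tensor_space V W) u (tens V W v w)))"
    unfolding bilin_on_def
  proof (intro conjI ballI)
    fix s assume "s \<in> carr (tensor_space U V)"
    then show "lin_on W (tensor_space U (tensor_space V W))
      (\<lambda>w. tsum U V s (\<lambda>u v. tens U (tensor_space V W) u (tens V W v w)))"
      by (rule lin_on_tsum_fun[OF vec_space_tensor[OF assms(1)]])
        (intro lin_on_comp[OF bilin_onD(1)[OF tens_bilin] bilin_onD(1)[OF tens_bilin]])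
  qed (intro tsum_lin assms vec_space_tensor *)
qed

lemma tassoc_lin:
  assumes "vec_space U" "vec_space V"
  shows "lin_on (tensor_space (tensor_space U V) W) (tensor_space U (tensor_space V W)) (tassoc U V W)"
  unfolding tassoc_def by (intro tsum_lin vec_space_tensor assms tassoc_aux)

lemma tassoc_tens:
  assumes "vec_space U" "vec_space V" "s \<in> carr (tensor_space U V)" "w \<in> carr W"
  shows "tassoc U V W (tens (tensor_space U V) W s w) =
    tsum U V s (\<lambda>u v. tens U (tensor_space V W) u (tens V W v w))"
  unfolding tassoc_def
  by (rule tsum_tens[OF _ tassoc_aux(2)]) (intro vec_space_tensor assms)+

section \<open>Tensor products of algebras\<close>

lemma tensor_alg_simps:
  "carr (B \<otimes>\<^sub>A C) = carr (tensor_space B C)" "smult (B \<otimes>\<^sub>A C) = fscale"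
  "unit (B \<otimes>\<^sub>A C) = tens B C (unit B) (unit C)"
  by (simp_all add: tensor_alg_def smult_tensor_space)

lemma kalgebraD:
  assumes "kalgebra B"
  shows "vec_space B" "bilin_on B B B (mult B)" "unit B \<in> carr B"
    "x \<in> carr B \<Longrightarrow> y \<in> carr B \<Longrightarrow> mult B x y \<in> carr B"
    "x \<in> carr B \<Longrightarrow> y \<in> carr B \<Longrightarrow> z \<in> carr B \<Longrightarrow> mult B (mult B x y) z = mult B x (mult B y z)"
    "x \<in> carr B \<Longrightarrow> mult B (unit B) x = x" "x \<in> carr B \<Longrightarrow> mult B x (unit B) = x"
  using assms by (auto simp: kalgebra_def bilin_on_def lin_on_def)

lemma lin_on_tensor_alg:
  "lin_on V (B \<otimes>\<^sub>A C) f = lin_on V (tensor_space B C) f"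
  "lin_on (B \<otimes>\<^sub>A C) V g = lin_on (tensor_space B C) V g"
  by (simp_all add: lin_on_def tensor_alg_simps smult_tensor_space)

lemma bilin_on_tensor_alg:
  "bilin_on V W (B \<otimes>\<^sub>A C) f = bilin_on V W (tensor_space B C) f"
  "bilin_on (B \<otimes>\<^sub>A C) V U g = bilin_on (tensor_space B C) V U g"
  "bilin_on V (B \<otimes>\<^sub>A C) U g' = bilin_on V (tensor_space B C) U g'"
  by (simp_all add: bilin_on_def lin_on_tensor_alg tensor_alg_simps)

lemma vec_space_tensor_alg: "vec_space B \<Longrightarrow> vec_space (B \<otimes>\<^sub>A C)"
  using vec_space_tensor[of B C] by (simp add: vec_space_def tensor_alg_simps smult_tensor_space)

lemma tensor_mult_aux:
  assumes "vec_space B" and mB: "bilin_on B B B mB" and mC: "bilin_on C C C mC"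
  shows "b \<in> carr B \<Longrightarrow> c \<in> carr C \<Longrightarrow>
      bilin_on B C (tensor_space B C) (\<lambda>b' c'. tens B C (mB b b') (mC c c'))"
    and "t \<in> carr (tensor_space B C) \<Longrightarrow>
      bilin_on B C (tensor_space B C) (\<lambda>b c. tsum B C t (\<lambda>b' c'. tens B C (mB b b') (mC c c')))"
  subgoal by (rule bilin_on_comp[OF tens_bilin bilin_onD(1)[OF mB] bilin_onD(1)[OF mC]])
  subgoal
    by (rule bilin_on_tsum_fun[OF vec_space_tensor[OF assms(1)]], assumption)
      (rule bilin_on_comp[OF tens_bilin bilin_onD(2)[OF mB] bilin_onD(2)[OF mC]])
  done

lemma tensor_alg_mult_bilin:
  assumes "vec_space B" "bilin_on B B B (mult B)" "bilin_on C C C (mult C)"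
  shows "bilin_on (B \<otimes>\<^sub>A C) (B \<otimes>\<^sub>A C) (B \<otimes>\<^sub>A C) (mult (B \<otimes>\<^sub>A C))"
proof -
  have m: "mult (B \<otimes>\<^sub>A C) = (\<lambda>s t. tsum B C s (\<lambda>b c. tsum B C t (\<lambda>b' c'.
                tens B C (mult B b b') (mult C c c'))))" by (simp add: tensor_alg_def)
  show ?thesis unfolding bilin_on_tensor_alg unfolding m bilin_on_def
  proof (intro conjI ballI)
    fix s assume "s \<in> carr (tensor_space B C)"
    then show "lin_on (tensor_space B C) (tensor_space B C)
          (\<lambda>t. tsum B C s (\<lambda>b c. tsum B C t (\<lambda>b' c'. tens B C (mult B b b') (mult C c c'))))"
      by (rule lin_on_tsum_fun[OF vec_space_tensor[OF assms(1)]])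
        (intro tsum_lin vec_space_tensor assms tensor_mult_aux)
  next
    fix t assume "t \<in> carr (tensor_space B C)"
    then show "lin_on (tensor_space B C) (tensor_space B C)
          (\<lambda>s. tsum B C s (\<lambda>b c. tsum B C t (\<lambda>b' c'. tens B C (mult B b b') (mult C c c'))))"
      by (intro tsum_lin vec_space_tensor assms tensor_mult_aux)
  qed
qed

lemma tensor_alg_mult_tens:
  assumes "vec_space B" "bilin_on B B B (mult B)" "bilin_on C C C (mult C)"
    "b \<in> carr B" "c \<in> carr C" "b' \<in> carr B" "c' \<in> carr C"
  shows "mult (B \<otimes>\<^sub>A C) (tens B C b c) (tens B C b' c') = tens B C (mult B b b') (mult C c c')"
proof -
  have "mult (B \<otimes>\<^sub>A C) (tens B C b c) (tens B C b' c') =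
    tsum B C (tens B C b c) (\<lambda>b c. tsum B C (tens B C b' c') (\<lambda>b' c'. tens B C (mult B b b') (mult C c c')))"
    by (simp add: tensor_alg_def)
  also have "\<dots> = tsum B C (tens B C b' c') (\<lambda>b' c'. tens B C (mult B b b') (mult C c c'))"
    by (rule tsum_tens[OF vec_space_tensor[OF assms(1)] tensor_mult_aux(2)[OF assms(1-3) tens_carr]])
      (use assms in auto)
  also have "\<dots> = tens B C (mult B b b') (mult C c c')"
    by (rule tsum_tens[OF vec_space_tensor[OF assms(1)] tensor_mult_aux(1)[OF assms(1-3)]])
      (use assms in auto)
  finally show ?thesis .
qed

text \<open>Associativity is checked on elementary tensors, by linear extension in the three
  arguments in turn. Applied to the third tensor power of D(A), the lemma makes the inverse of the
  associator unique.\<close>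

lemma kalgebra_tensor:
  assumes B: "kalgebra B" and C: "kalgebra C"
  shows "kalgebra (B \<otimes>\<^sub>A C)"
proof -
  note b = kalgebraD[OF B] and c = kalgebraD[OF C]
  note bil = tensor_alg_mult_bilin[OF b(1,2) c(2)]
  note mt = tensor_alg_mult_tens[OF b(1,2) c(2)]
  note bil' = bil[unfolded bilin_on_tensor_alg]
  let ?T = "tensor_space B C" and ?m = "mult (B \<otimes>\<^sub>A C)"
  have l1: "lin_on ?T ?T (\<lambda>x. ?m x y)" if "y \<in> carr ?T" for y using bilin_onD(2)[OF bil' that] .
  have l2: "lin_on ?T ?T (\<lambda>y. ?m x y)" if "x \<in> carr ?T" for x using bilin_onD(1)[OF bil' that] .
  have cl: "?m x y \<in> carr ?T" if "x \<in> carr ?T" "y \<in> carr ?T" for x y using bilin_onD(3)[OF bil' that] .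
  have assoc: "?m (?m x y) z = ?m x (?m y z)" if x: "x \<in> carr ?T" and y: "y \<in> carr ?T" and z: "z \<in> carr ?T" for x y z
  proof (rule tensor_lin_ext[OF b(1) _ _ _ x])
    show "lin_on ?T ?T (\<lambda>x. ?m (?m x y) z)" by (rule lin_on_comp[OF l1 l1]) fact+
    show "lin_on ?T ?T (\<lambda>x. ?m x (?m y z))" by (rule l1) (intro cl y z)
    fix p q assume pq: "p \<in> carr B" "q \<in> carr C"
    note x' = tens_carr[OF pq]
    show "?m (?m (tens B C p q) y) z = ?m (tens B C p q) (?m y z)"
    proof (rule tensor_lin_ext[OF b(1) _ _ _ y])
      show "lin_on ?T ?T (\<lambda>y. ?m (?m (tens B C p q) y) z)" by (rule lin_on_comp[OF l2 l1]) fact+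
      show "lin_on ?T ?T (\<lambda>y. ?m (tens B C p q) (?m y z))" by (rule lin_on_comp[OF l1 l2]) fact+
      fix p' q' assume pq': "p' \<in> carr B" "q' \<in> carr C"
      note y' = tens_carr[OF pq']
      show "?m (?m (tens B C p q) (tens B C p' q')) z = ?m (tens B C p q) (?m (tens B C p' q') z)"
      proof (rule tensor_lin_ext[OF b(1) _ _ _ z])
        show "lin_on ?T ?T (\<lambda>z. ?m (?m (tens B C p q) (tens B C p' q')) z)"
          by (rule l2) (intro cl x' y')
        show "lin_on ?T ?T (\<lambda>z. ?m (tens B C p q) (?m (tens B C p' q') z))"
          by (rule lin_on_comp[OF l2 l2]) fact+
      qed (use pq pq' in \<open>simp add: mt b c\<close>)
    qed
  qed
  have u: "tens B C (unit B) (unit C) \<in> carr ?T" by (intro tens_carr b c)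
  have un1: "?m (tens B C (unit B) (unit C)) x = x" if "x \<in> carr ?T" for x
    by (rule tensor_lin_ext[OF b(1) l2[OF u] lin_on_id(2) _ that]) (use mt b c in auto)
  have un2: "?m x (tens B C (unit B) (unit C)) = x" if "x \<in> carr ?T" for x
    by (rule tensor_lin_ext[OF b(1) l1[OF u] lin_on_id(2) _ that]) (use mt b c in auto)
  show ?thesis unfolding kalgebra_def
    using bil u un1 un2 assoc by (simp add: tensor_alg_simps vec_space_tensor_alg b)
qed

text \<open>Both inverses equal the product of \<open>y\<close>, \<open>x\<close> and
  \<open>z\<close>.\<close>

lemma is_inverse_unique:
  assumes "kalgebra B" "x \<in> carr B" "is_inverse B x y" "is_inverse B x z"
  shows "y = z"
  using assms kalgebraD(5)[OF assms(1), of y x z] kalgebraD(6,7)[OF assms(1)]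
  by (auto simp: is_inverse_def)

section \<open>Sweedler calculus in a cocommutative Hopf algebra\<close>

locale cocomm_hopf = hopf_algebra H for H :: "('k::field, 'a::ring_1) hopf" +
  assumes cocomm: "cocommutative H" and fin_dim: "finite_dim (alg H)"
begin

abbreviation A :: "('k, 'a) kalg" where "A \<equiv> alg H"
abbreviation \<epsilon> :: "'a \<Rightarrow> 'k" where "\<epsilon> \<equiv> counit H"
abbreviation S :: "'a \<Rightarrow> 'a" where "S \<equiv> antipode H"

text \<open>\<open>lk\<close> and \<open>la\<close> mark linear forms on A and linear maps from A to
  A. The versions in several variables are simp rules, so multilinearity is split into slots and
  each slot is closed by composition rules stated for an inner map \<open>g\<close> with
  \<open>la g\<close>.\<close>

definition lk :: "('a \<Rightarrow> 'k) \<Rightarrow> bool" where "lk f \<longleftrightarrow> lin_on A base f"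
definition la :: "('a \<Rightarrow> 'a) \<Rightarrow> bool" where "la f \<longleftrightarrow> lin_on A A f"
definition lk2 :: "('a \<Rightarrow> 'a \<Rightarrow> 'k) \<Rightarrow> bool" where
  [simp]: "lk2 F \<longleftrightarrow> (\<forall>x. lk (\<lambda>y. F x y)) \<and> (\<forall>y. lk (\<lambda>x. F x y))"
definition lk3 :: "('a \<Rightarrow> 'a \<Rightarrow> 'a \<Rightarrow> 'k) \<Rightarrow> bool" where
  [simp]: "lk3 F \<longleftrightarrow> (\<forall>x y. lk (\<lambda>z. F x y z)) \<and> (\<forall>x z. lk (\<lambda>y. F x y z)) \<and> (\<forall>y z. lk (\<lambda>x. F x y z))"
definition lk4 :: "('a \<Rightarrow> 'a \<Rightarrow> 'a \<Rightarrow> 'a \<Rightarrow> 'k) \<Rightarrow> bool" where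
  [simp]: "lk4 F \<longleftrightarrow> (\<forall>x. lk3 (\<lambda>y z u. F x y z u)) \<and> (\<forall>y z u. lk (\<lambda>x. F x y z u))"

lemma alg_simps [simp]: "carr A = UNIV" "smult A = scal H" "mult A = (*)" "unit A = 1"
  by (simp_all add: alg_def)

lemma base_simps [simp]: "carr (base :: ('k, 'k) kalg) = UNIV" "smult (base :: ('k, 'k) kalg) = (*)"
  "mult (base :: ('k, 'k) kalg) = (*)" "unit (base :: ('k, 'k) kalg) = 1"
  by (simp_all add: base_def)

lemma vec_space_A: "vec_space A"
  using algebra by (simp add: kalgebra_def)

lemma vector_space_A: "vector_space (scal H)"
  using vec_space_vs[OF vec_space_A] by simp

lemma lk_iff: "lk f \<longleftrightarrow> (\<forall>x y. f (x + y) = f x + f y) \<and> (\<forall>c x. f (scal H c x) = c * f x)"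
  by (simp add: lk_def lin_on_def)

lemma la_iff: "la f \<longleftrightarrow> (\<forall>x y. f (x + y) = f x + f y) \<and> (\<forall>c x. f (scal H c x) = scal H c (f x))"
  by (simp add: la_def lin_on_def)

lemma lk2_iff: "lk2 F \<longleftrightarrow> bilin_on A A base F"
  by (simp add: bilin_on_def lk_def)

lemma lkD: "lk f \<Longrightarrow> f (x + y) = f x + f y" "lk f \<Longrightarrow> f (scal H c x) = c * f x" "lk f \<Longrightarrow> f 0 = 0"
  subgoal by (simp add: lk_iff)
  subgoal by (simp add: lk_iff)
  subgoal using lin_on_zero[OF vec_space_A, of base f] by (simp add: lk_def)
  done

lemma lk_sum: "lk f \<Longrightarrow> f (\<Sum>i\<in>I. g i) = (\<Sum>i\<in>I. f (g i))"
  by (rule lin_on_sum[OF vec_space_A]) (auto simp: lk_def)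

lemma scal_mult: "scal H c x * y = scal H c (x * y)" "x * scal H c y = scal H c (x * y)"
  using kalgebraD(2)[OF algebra] by (auto simp: bilin_on_def lin_on_def)

lemma lk_mult_left [simp]: "lk f \<Longrightarrow> lk (\<lambda>x. c * f x)"
  and lk_mult_right [simp]: "lk f \<Longrightarrow> lk (\<lambda>x. f x * c)"
  and lk_zero [simp]: "lk (\<lambda>x. 0)"
  by (auto simp: lk_iff algebra_simps)

lemma lk_add [simp]: "lk f \<Longrightarrow> lk g \<Longrightarrow> lk (\<lambda>x. f x + g x)"
  by (auto simp: lk_iff algebra_simps)

lemma lk_sum_fun [simp]: "(\<And>i. i \<in> J \<Longrightarrow> lk (f i)) \<Longrightarrow> lk (\<lambda>x. \<Sum>i\<in>J. f i x)"
  by (induction J rule: infinite_finite_induct) auto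

lemma lk_comp: "lk f \<Longrightarrow> la g \<Longrightarrow> lk (\<lambda>x. f (g x))"
  by (auto simp: lk_iff la_iff)

lemma la_id [simp]: "la (\<lambda>x. x)" by (simp add: la_iff)

lemma la_mult_left [simp]: "la f \<Longrightarrow> la (\<lambda>x. c * f x)"
  and la_mult_right [simp]: "la f \<Longrightarrow> la (\<lambda>x. f x * c)"
  by (auto simp: la_iff algebra_simps scal_mult)

lemma la_S [simp]: "la f \<Longrightarrow> la (\<lambda>x. S (f x))"
  using antipode_linear by (auto simp: la_def lin_on_def)

lemma lk_eps [simp]: "la f \<Longrightarrow> lk (\<lambda>x. \<epsilon> (f x))"
  using counit_hom by (auto simp: la_iff lk_iff alg_hom_def lin_on_def)

lemma eps_mult [simp]: "\<epsilon> (x * y) = \<epsilon> x * \<epsilon> y" and eps_one [simp]: "\<epsilon> 1 = 1"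
  using counit_hom by (auto simp: alg_hom_def)

section \<open>Rules for Sweedler sums\<close>

lemma sw_trep: "sw H a F = (\<Sum>(x, y)\<leftarrow>trep A A (comult H a). F x y)"
  by (simp add: sw_def tsum_trep)

lemma comult_carr: "comult H a \<in> carr (tensor_space A A)"
  using comult_hom by (auto simp: alg_hom_def lin_on_def tensor_alg_simps)

lemma comult_lin: "lin_on A (tensor_space A A) (comult H)"
  using comult_hom by (auto simp: alg_hom_def lin_on_tensor_alg)

lemma sw_cmult: "c * sw H a F = sw H a (\<lambda>x y. c * F x y)" "sw H a F * c = sw H a (\<lambda>x y. F x y * c)"
  for F :: "'a \<Rightarrow> 'a \<Rightarrow> 'r::ring"
  by (simp_all add: sw_trep sum_list_const_mult sum_list_mult_const split_def)

lemma sw_add: "sw H a (\<lambda>x y. F x y + G x y) = sw H a F + sw H a G"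
  by (simp add: sw_trep sum_list_addf split_def)

lemma sum_list_swap: "(\<Sum>p\<leftarrow>ps. \<Sum>q\<leftarrow>qs. F p q) = (\<Sum>q\<leftarrow>qs. \<Sum>p\<leftarrow>ps. (F p q :: 'u::ab_group_add))"
  by (induction ps) (auto simp: sum_list_addf)

lemma sw_swap:
  "sw H a (\<lambda>x y. sw H b (\<lambda>u v. F x y u v)) = sw H b (\<lambda>u v. sw H a (\<lambda>x y. F x y u v))"
  unfolding sw_trep split_def by (rule sum_list_swap)

lemma sw_sum: "sw H a (\<lambda>x y. \<Sum>i\<in>J. F i x y) = (\<Sum>i\<in>J. sw H a (F i))"
proof (induction J rule: infinite_finite_induct)
  case (insert i J)
  then show ?case by (simp add: sw_add)
qed (simp_all add: sw_trep split_def sum_list_0)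

lemma sw_apply: "sw H a F c = sw H a (\<lambda>x y. F x y c)"
  by (simp add: sw_trep sum_list_fun_apply o_def split_def)

lemma tsum_sw_swap: "tsum V W t (\<lambda>v w. sw H a (\<lambda>x y. F v w x y)) = sw H a (\<lambda>x y. tsum V W t (\<lambda>v w. F v w x y))"
  unfolding sw_trep tsum_trep split_def by (rule sum_list_swap)

lemma lk_sw_fun [simp]: "(\<And>x y. lk (\<lambda>a. F a x y)) \<Longrightarrow> lk (\<lambda>a. sw H b (\<lambda>x y. F a x y))"
  unfolding sw_trep lk_def split_def
  by (rule lin_on_sum_list_fun[OF vec_space_base]) auto

lemma lk_sw' : "lk2 F \<Longrightarrow> lk (\<lambda>a. sw H a F)"
  unfolding lk2_iff sw_def lk_def
  by (rule lin_on_comp[OF comult_lin tsum_lin[OF vec_space_A vec_space_base]])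

lemma lk_sw [simp]: "la g \<Longrightarrow> lk2 (\<lambda>x y. F x y) \<Longrightarrow> lk (\<lambda>a. sw H (g a) (\<lambda>x y. F x y))"
  by (rule lk_comp[OF lk_sw'])

lemma lin_on_sw:
  assumes "vec_space U" "lin_on U U' l" "\<And>x y. F x y \<in> carr U"
  shows "l (sw H a F) = sw H a (\<lambda>x y. l (F x y))"
  unfolding sw_trep split_def by (rule lin_on_sum_list[OF assms(1,2)]) (auto intro: assms)

lemma sw_carr: "vec_space U \<Longrightarrow> (\<And>x y. F x y \<in> carr U) \<Longrightarrow> sw H a F \<in> carr U"
  unfolding sw_trep split_def by (intro vec_space_sum_list)

text \<open>A trilinear \<open>F\<close> induces a linear functional \<open>L\<close> on the triple
  tensor power; applied to both sides of the axiom \<open>coassoc\<close>, which compares tensors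
  and not sums, it gives the two iterated sums.\<close>

lemma sw_coassoc:
  assumes F: "lk3 F"
  shows "sw H a (\<lambda>x y. sw H x (\<lambda>x1 x2. F x1 x2 y)) = sw H a (\<lambda>x y. sw H y (\<lambda>y1 y2. F x y1 y2))"
proof -
  let ?T = "tensor_space A A"
  define L where "L = (\<lambda>t. tsum A ?T t (\<lambda>x u. tsum A A u (\<lambda>y z. F x y z)))"
  have F1: "bilin_on A A base (\<lambda>y z. F x y z)" for x using F unfolding lk2_iff[symmetric] by simp
  have F2: "bilin_on A A base (\<lambda>x y. F x y z)" for z using F unfolding lk2_iff[symmetric] by simp
  have Fb: "bilin_on A ?T base (\<lambda>x u. tsum A A u (\<lambda>y z. F x y z))"
    unfolding bilin_on_def
    using F by (auto intro!: tsum_lin[OF vec_space_A vec_space_base F1]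
        lin_on_tsum_fun[OF vec_space_base] simp: lk_def)
  have L: "lin_on (tensor_space A ?T) base L"
    unfolding L_def by (rule tsum_lin[OF vec_space_A vec_space_base Fb])
  have Lt: "L (tens A ?T x u) = tsum A A u (\<lambda>y z. F x y z)" if "u \<in> carr ?T" for x u
    unfolding L_def by (rule tsum_tens[OF vec_space_base Fb]) (use that in auto)
  note vT = vec_space_tensor[OF vec_space_A]
  note m = lin_on_id(1)[of A]
  have "L (tmap A A A ?T id (comult H) (comult H a)) = sw H a (\<lambda>v w. L (tens A ?T v (comult H w)))"
    unfolding tmap_def sw_def id_def
    by (rule lin_on_tsum[OF vT L comult_carr bilin_on_comp[OF tens_bilin lin_on_id(2) comult_lin]])
  also have "\<dots> = sw H a (\<lambda>x y. sw H y (\<lambda>y1 y2. F x y1 y2))"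
    by (simp add: Lt comult_carr) (simp add: sw_def)
  finally have 1: "L (tmap A A A ?T id (comult H) (comult H a)) = \<dots>" .
  have LA: "lin_on (tensor_space ?T A) base (\<lambda>t. L (tassoc A A A t))"
    by (rule lin_on_comp[OF tassoc_lin[OF vec_space_A vec_space_A] L])
  have "L (tassoc A A A (tmap A A ?T A (comult H) id (comult H a))) =
      sw H a (\<lambda>v w. L (tassoc A A A (tens ?T A (comult H v) w)))"
    unfolding tmap_def sw_def id_def
    by (rule lin_on_tsum[OF vec_space_tensor[OF vT] LA comult_carr bilin_on_comp[OF tens_bilin comult_lin lin_on_id(2)]])
  also have "\<dots> = sw H a (\<lambda>x y. sw H x (\<lambda>x1 x2. F x1 x2 y))"
  proof -
    have "L (tassoc A A A (tens ?T A (comult H v) w)) = sw H v (\<lambda>x1 x2. F x1 x2 w)" for v w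
    proof -
      have "L (tassoc A A A (tens ?T A (comult H v) w)) =
          L (tsum A A (comult H v) (\<lambda>x y. tens A ?T x (tens A A y w)))"
        by (subst tassoc_tens[OF vec_space_A vec_space_A comult_carr]) auto
      also have "\<dots> = sw H v (\<lambda>x y. L (tens A ?T x (tens A A y w)))"
        unfolding sw_def
        by (rule lin_on_tsum[OF vT L comult_carr tassoc_aux(1)[OF vec_space_A vec_space_A]]) auto
      also have "\<dots> = sw H v (\<lambda>x1 x2. F x1 x2 w)"
        by (simp add: Lt tens_carr tsum_tens[OF vec_space_base F1])
      finally show ?thesis .
    qed
    then show ?thesis by simp
  qed
  finally have 2: "L (tassoc A A A (tmap A A ?T A (comult H) id (comult H a))) = \<dots>" .
  \<comment> \<open>\<open>coassoc\<close> is phrased with the algebra record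
    \<open>A \<otimes>\<^sub>A A\<close>, the computation above with the plain tensor space;
    \<open>tens\<close> is the same for both.\<close>
  have "tens A (A \<otimes>\<^sub>A A) = tens A ?T" "tens (A \<otimes>\<^sub>A A) A = tens ?T A"
    by (rule tens_cong; simp add: tensor_alg_simps smult_tensor_space)+
  then have "tmap A A ?T A (comult H) id (comult H a) = tmap A A (A \<otimes>\<^sub>A A) A (comult H) id (comult H a)"
    "tmap A A A ?T id (comult H) (comult H a) = tmap A A A (A \<otimes>\<^sub>A A) id (comult H) (comult H a)"
    unfolding tmap_def by simp_all
  with 1 2 coassoc[of a] show ?thesis by simp
qed

text \<open>The bilinear form is applied to the flipped coproduct, which equals the
  coproduct.\<close>

lemma sw_cocomm:
  assumes F: "lk2 F"
  shows "sw H a (\<lambda>x y. F y x) = sw H a F"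
proof -
  let ?T = "tensor_space A A"
  have Fb: "bilin_on A A base F" using F by (simp only: lk2_iff)
  have L: "lin_on ?T base (\<lambda>t. tsum A A t F)"
    by (rule tsum_lin[OF vec_space_A vec_space_base Fb])
  have fl: "bilin_on A A ?T (\<lambda>x y. tens A A y x)"
    using tens_bilin[of A A] by (auto simp: bilin_on_def)
  have "sw H a F = tsum A A (tsum A A (comult H a) (\<lambda>x y. tens A A y x)) F"
    using cocomm by (simp add: cocommutative_def sw_def)
  also have "\<dots> = sw H a (\<lambda>x y. tsum A A (tens A A y x) F)"
    unfolding sw_def by (rule lin_on_tsum[OF vec_space_tensor[OF vec_space_A] L comult_carr fl])
  also have "\<dots> = sw H a (\<lambda>x y. F y x)"
    by (simp add: tsum_tens[OF vec_space_base Fb])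
  finally show ?thesis by simp
qed

lemma sw_counit:
  assumes "lk f"
  shows "sw H a (\<lambda>x y. \<epsilon> x * f y) = f a" "sw H a (\<lambda>x y. f x * \<epsilon> y) = f a"
proof -
  have l: "lin_on A base f" using assms by (simp add: lk_def)
  show "sw H a (\<lambda>x y. \<epsilon> x * f y) = f a"
    using lin_on_sw[OF vec_space_A l, of "\<lambda>x y. scal H (\<epsilon> x) y" a] counit_left[of a] lkD(2)[OF assms] by simp
  show "sw H a (\<lambda>x y. f x * \<epsilon> y) = f a"
    using lin_on_sw[OF vec_space_A l, of "\<lambda>x y. scal H (\<epsilon> y) x" a] counit_right[of a] lkD(2)[OF assms]
    by (simp add: mult.commute)
qed

lemma sw_antipode:
  assumes "lk f"
  shows "sw H a (\<lambda>x y. f (S x * y)) = \<epsilon> a * f 1" "sw H a (\<lambda>x y. f (x * S y)) = \<epsilon> a * f 1"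
  using lin_on_sw[OF vec_space_A, of base f "\<lambda>x y. S x * y" a]
    lin_on_sw[OF vec_space_A, of base f "\<lambda>x y. x * S y" a] antipode_left[of a] antipode_right[of a]
    assms lkD(2)[OF assms] by (simp_all add: lk_def)

lemma sw_mult:
  assumes F: "lk2 F"
  shows "sw H (a * b) F = sw H a (\<lambda>a1 a2. sw H b (\<lambda>b1 b2. F (a1 * b1) (a2 * b2)))"
proof -
  let ?T = "tensor_space A A"
  have Fb: "bilin_on A A base F" using F by (simp only: lk2_iff)
  have L: "lin_on ?T base (\<lambda>t. tsum A A t F)"
    by (rule tsum_lin[OF vec_space_A vec_space_base Fb])
  note k = kalgebraD[OF algebra]
  note aux = tensor_mult_aux[OF k(1) k(2) k(2)]
  have "sw H (a * b) F = tsum A A (mult (A \<otimes>\<^sub>A A) (comult H a) (comult H b)) F"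
    using comult_hom by (simp add: alg_hom_def sw_def)
  also have "mult (A \<otimes>\<^sub>A A) (comult H a) (comult H b) =
      tsum A A (comult H a) (\<lambda>x y. tsum A A (comult H b) (\<lambda>x' y'. tens A A (x * x') (y * y')))"
    by (simp add: tensor_alg_def)
  also have "tsum A A \<dots> F =
      sw H a (\<lambda>x y. tsum A A (tsum A A (comult H b) (\<lambda>x' y'. tens A A (x * x') (y * y'))) F)"
    unfolding sw_def using aux(2)[OF comult_carr]
    by (intro lin_on_tsum[OF vec_space_tensor[OF vec_space_A] L comult_carr]) simp
  also have "\<dots> = sw H a (\<lambda>x y. sw H b (\<lambda>x' y'. tsum A A (tens A A (x * x') (y * y')) F))"
    unfolding sw_def using aux(1)
    by (subst lin_on_tsum[OF vec_space_tensor[OF vec_space_A] L comult_carr]) simp_all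
  finally show ?thesis by (simp add: tsum_tens[OF vec_space_base Fb])
qed

lemma sw_one:
  assumes F: "lk2 F" shows "sw H 1 F = F 1 1"
  using comult_hom tsum_tens[OF vec_space_base, of A A F 1 1] F[unfolded lk2_iff]
  by (simp add: sw_def alg_hom_def tensor_alg_simps)

section \<open>A basis of A and its coordinates\<close>

definition Eb :: "'a set" where
  "Eb = (SOME B. finite B \<and> module.independent (scal H) B \<and> module.span (scal H) B = UNIV)"

definition cd :: "'a \<Rightarrow> 'a \<Rightarrow> 'k" where "cd i a = module.representation (scal H) Eb a i"

lemma Eb_props: "finite Eb \<and> module.independent (scal H) Eb \<and> module.span (scal H) Eb = UNIV"
proof -
  interpret vector_space "scal H" by (rule vector_space_A)
  obtain T where T: "finite T" "span T = UNIV" using fin_dim by (auto simp: finite_dim_def)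
  obtain B where B: "B \<subseteq> T" "independent B" "T \<subseteq> span B" by (rule maximal_independent_subset)
  have "span B = UNIV" using B(3) T(2) span_mono[OF B(3)] by (simp add: span_span top.extremum_unique)
  then have "\<exists>B. finite B \<and> independent B \<and> span B = UNIV"
    using B(2) finite_subset[OF B(1) T(1)] by (intro exI[of _ B] conjI)
  then show ?thesis unfolding Eb_def by (rule someI_ex)
qed

lemma finite_Eb [simp]: "finite Eb" using Eb_props by simp

lemma cd_sum: "(\<Sum>i\<in>Eb. scal H (cd i a) i) = a"
proof -
  interpret vector_space "scal H" by (rule vector_space_A)
  show ?thesis unfolding cd_def
    using Eb_props by (intro sum_representation_eq) auto
qed

lemma la_comp: "la f \<Longrightarrow> la g \<Longrightarrow> la (\<lambda>x. f (g x))" by (simp add: la_iff)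

lemma lk_cd' : "lk (cd i)"
proof -
  interpret vector_space "scal H" by (rule vector_space_A)
  show ?thesis unfolding lk_iff cd_def using Eb_props
    by (auto simp: representation_add representation_scale)
qed

lemma lk_cd [simp]: "la g \<Longrightarrow> lk (\<lambda>x. cd i (g x))"
  by (rule lk_comp[OF lk_cd'])

lemma lk_expand: "lk f \<Longrightarrow> f a = (\<Sum>i\<in>Eb. cd i a * f i)"
  using lk_sum[of f "\<lambda>i. scal H (cd i a) i" Eb] by (simp add: cd_sum lkD(2))

lemma cd_separate: "(\<And>i. i \<in> Eb \<Longrightarrow> cd i a = cd i b) \<Longrightarrow> a = b"
  using cd_sum[of a] cd_sum[of b] by (metis (no_types, lifting) sum.cong)

lemma lk_separate: "(\<And>p. lk p \<Longrightarrow> p a = p b) \<Longrightarrow> a = b"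
  using cd_separate lk_cd' by blast

text \<open>Reduces a Sweedler sum to the coefficients of the coproduct in the basis, the only data
  of the coproduct that the convolution algebras below refer to.\<close>

lemma sw_expand: "lk2 F \<Longrightarrow> sw H a F = (\<Sum>i\<in>Eb. \<Sum>j\<in>Eb. sw H a (\<lambda>x y. cd i x * cd j y) * F i j)"
proof -
  assume F: "lk2 F"
  have "F x y = (\<Sum>i\<in>Eb. \<Sum>j\<in>Eb. cd i x * cd j y * F i j)" for x y
    using lk_expand[of "\<lambda>x. F x y" x] lk_expand[of "\<lambda>y. F i y" y for i] F
    by (simp add: sum_distrib_left mult.assoc)
  then have "sw H a F = sw H a (\<lambda>x y. \<Sum>i\<in>Eb. \<Sum>j\<in>Eb. cd i x * cd j y * F i j)"
    by (intro arg_cong[where f = "sw H a"] ext)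
  then show ?thesis by (simp add: sw_sum sw_cmult)
qed

lemma ad_lk: "lk f \<Longrightarrow> f (ad H x a) = sw H x (\<lambda>x1 x2. f (S x1 * a * x2))"
  unfolding ad_def by (rule lin_on_sw[OF vec_space_A]) (auto simp: lk_def)

text \<open>Linear forms separate A, so linearity of a map into A is visible after composing with
  them. It is meant for \<open>ad\<close>, whose Sweedler formula is at hand under a linear
  form.\<close>

lemma la_separate: assumes "\<And>p. lk p \<Longrightarrow> lk (\<lambda>x. p (g x))" shows "la g"
  unfolding la_iff
proof safe
  show "g (x + y) = g x + g y" for x y
    by (rule lk_separate) (use assms in \<open>simp add: lk_iff\<close>)
  show "g (scal H c x) = scal H c (g x)" for c x
    by (rule lk_separate) (use assms in \<open>simp add: lk_iff\<close>)
qed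

lemma la_ad [simp]:
  assumes "la g"
  shows "la (\<lambda>x. ad H (g x) a)" "la (\<lambda>a. ad H x (g a))"
proof -
  have "lk (\<lambda>x. p (ad H x a))" "lk (\<lambda>a. p (ad H x a))" if "lk p" for p x a
    using lk_comp[OF that] by (simp_all add: ad_lk[OF that])
  then have "la (\<lambda>x. ad H x a)" "la (ad H x)" by (auto intro: la_separate)
  then show "la (\<lambda>x. ad H (g x) a)" "la (\<lambda>a. ad H x (g a))"
    using la_comp assms by blast+
qed

end

section \<open>Convolution algebras and their points\<close>

lemma sum_fun_apply: "(\<Sum>i\<in>J. f i) x = (\<Sum>i\<in>J. f i x)"
  for f :: "'i \<Rightarrow> 'x \<Rightarrow> 'u::ab_group_add"
  by (induction J rule: infinite_finite_induct) auto

lemma sum_four_swap: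
  "(\<Sum>m\<in>J. \<Sum>k\<in>K. \<Sum>i\<in>L. \<Sum>j\<in>M. G m k i j) = (\<Sum>i\<in>L. \<Sum>j\<in>M. \<Sum>k\<in>K. \<Sum>m\<in>J. G m k i j)"
proof -
  have "(\<Sum>m\<in>J. \<Sum>k\<in>K. \<Sum>i\<in>L. \<Sum>j\<in>M. G m k i j) = (\<Sum>m\<in>J. \<Sum>i\<in>L. \<Sum>k\<in>K. \<Sum>j\<in>M. G m k i j)"
    by (intro sum.cong refl sum.swap)
  also have "\<dots> = (\<Sum>i\<in>L. \<Sum>m\<in>J. \<Sum>k\<in>K. \<Sum>j\<in>M. G m k i j)" by (rule sum.swap)
  also have "\<dots> = (\<Sum>i\<in>L. \<Sum>m\<in>J. \<Sum>j\<in>M. \<Sum>k\<in>K. G m k i j)" by (intro sum.cong refl sum.swap)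
  also have "\<dots> = (\<Sum>i\<in>L. \<Sum>j\<in>M. \<Sum>m\<in>J. \<Sum>k\<in>K. G m k i j)"
    by (rule sum.cong[OF refl], rule sum.swap)
  also have "\<dots> = (\<Sum>i\<in>L. \<Sum>j\<in>M. \<Sum>k\<in>K. \<Sum>m\<in>J. G m k i j)" by (intro sum.cong refl sum.swap)
  finally show ?thesis .
qed

text \<open>\<open>D c i j\<close> is the coefficient of \<open>i \<otimes> j\<close> in the coproduct of \<open>c\<close>, and \<open>co i c\<close> the coordinate of
  \<open>c\<close> at the basis element \<open>i\<close>. Only the values at the basis enter \<open>cv\<close>, which is therefore
  associative and commutative on all functions.\<close>

locale fin_coalg =
  fixes I :: "'c set" and co :: "'c \<Rightarrow> 'c \<Rightarrow> 'k::field" and D :: "'c \<Rightarrow> 'c \<Rightarrow> 'c \<Rightarrow> 'k" and e :: "'c \<Rightarrow> 'k"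
  assumes fin: "finite I"
    and D_sym: "D c i j = D c j i"
    and D_assoc: "(\<Sum>m\<in>I. D c m k * D m i j) = (\<Sum>m\<in>I. D c i m * D m j k)"
    and D_counit: "(\<Sum>j\<in>I. D c i j * e j) = co i c"
    and D_lin: "D c i j = (\<Sum>m\<in>I. co m c * D m i j)"
    and e_lin: "e c = (\<Sum>m\<in>I. co m c * e m)"
begin

definition cv :: "('c \<Rightarrow> 'k) \<Rightarrow> ('c \<Rightarrow> 'k) \<Rightarrow> 'c \<Rightarrow> 'k" where
  "cv r s = (\<lambda>c. \<Sum>i\<in>I. \<Sum>j\<in>I. D c i j * (r i * s j))"

lemma cv_comm: "cv r s = cv s r"
  unfolding cv_def
  by (subst sum.swap) (intro ext sum.cong refl, simp add: D_sym mult_ac)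

lemma cv_assoc: "cv (cv r s) t = cv r (cv s t)"
proof
  fix c
  have "cv (cv r s) t c = (\<Sum>m\<in>I. \<Sum>k\<in>I. \<Sum>i\<in>I. \<Sum>j\<in>I. (D c m k * D m i j) * (r i * s j * t k))"
    by (simp add: cv_def sum_distrib_left sum_distrib_right mult_ac)
  also have "\<dots> = (\<Sum>i\<in>I. \<Sum>j\<in>I. \<Sum>k\<in>I. (\<Sum>m\<in>I. D c m k * D m i j) * (r i * s j * t k))"
    by (subst sum_four_swap) (simp add: sum_distrib_right)
  \<comment> \<open>Coassociativity of the coefficients; the intermediate index \<open>m\<close> was
    made innermost for this.\<close>
  also have "\<dots> = (\<Sum>i\<in>I. \<Sum>j\<in>I. \<Sum>k\<in>I. \<Sum>m\<in>I. (D c i m * D m j k) * (r i * s j * t k))"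
    by (simp only: D_assoc sum_distrib_right)
  also have "\<dots> = (\<Sum>i\<in>I. \<Sum>m\<in>I. \<Sum>j\<in>I. \<Sum>k\<in>I. (D c i m * D m j k) * (r i * s j * t k))"
  proof (rule sum.cong[OF refl])
    fix i
    let ?G = "\<lambda>j k m. (D c i m * D m j k) * (r i * s j * t k)"
    have "(\<Sum>j\<in>I. \<Sum>k\<in>I. \<Sum>m\<in>I. ?G j k m) = (\<Sum>j\<in>I. \<Sum>m\<in>I. \<Sum>k\<in>I. ?G j k m)"
      by (intro sum.cong refl sum.swap)
    also have "\<dots> = (\<Sum>m\<in>I. \<Sum>j\<in>I. \<Sum>k\<in>I. ?G j k m)" by (rule sum.swap)
    finally show "(\<Sum>j\<in>I. \<Sum>k\<in>I. \<Sum>m\<in>I. ?G j k m) = (\<Sum>m\<in>I. \<Sum>j\<in>I. \<Sum>k\<in>I. ?G j k m)" .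
  qed
  also have "\<dots> = cv r (cv s t) c"
    by (simp add: cv_def sum_distrib_left sum_distrib_right mult_ac)
  finally show "cv (cv r s) t c = cv r (cv s t) c" .
qed

lemma cv_left_comm: "cv r (cv s t) = cv s (cv r t)"
  by (metis cv_assoc cv_comm)

text \<open>The counit is not neutral for all functions: convolving with it replaces
  \<open>r\<close> by the linear extension of its values on the basis.\<close>

lemma cv_e: "cv r e c = (\<Sum>i\<in>I. co i c * r i)"
proof -
  have "cv r e c = (\<Sum>i\<in>I. (\<Sum>j\<in>I. D c i j * e j) * r i)"
    by (simp add: cv_def sum_distrib_left sum_distrib_right mult_ac)
  then show ?thesis by (simp add: D_counit)
qed

text \<open>A convolution product is already linear in its argument, by \<open>D_lin\<close>, so
  linear extension from the basis does not change it.\<close>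

lemma e_cv_cv: "cv e (cv r s) = cv r s"
proof
  fix c
  have "cv e (cv r s) c = (\<Sum>m\<in>I. \<Sum>i\<in>I. \<Sum>j\<in>I. co m c * (D m i j * (r i * s j)))"
    by (subst cv_comm) (simp add: cv_e, simp add: cv_def sum_distrib_left)
  also have "\<dots> = (\<Sum>i\<in>I. \<Sum>m\<in>I. \<Sum>j\<in>I. co m c * (D m i j * (r i * s j)))" by (rule sum.swap)
  also have "\<dots> = (\<Sum>i\<in>I. \<Sum>j\<in>I. \<Sum>m\<in>I. co m c * (D m i j * (r i * s j)))"
    by (intro sum.cong refl sum.swap)
  also have "\<dots> = (\<Sum>i\<in>I. \<Sum>j\<in>I. (\<Sum>m\<in>I. co m c * D m i j) * (r i * s j))"
    by (simp add: sum_distrib_left sum_distrib_right mult_ac)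
  also have "\<dots> = cv r s c" by (simp add: cv_def D_lin[symmetric])
  finally show "cv e (cv r s) c = cv r s c" .
qed

lemma e_cv_e: "cv e e = e"
  by (rule ext) (simp add: cv_e e_lin[symmetric])

lemma cv_add: "cv r (s + t) = cv r s + cv r t" "cv (s + t) r = cv s r + cv t r"
  by (auto simp: cv_def algebra_simps sum.distrib)

lemma cv_0: "cv r 0 = 0" "cv 0 r = 0"
  by (auto simp: cv_def)

lemma cv_sum: "cv r (\<Sum>j\<in>J. f j) = (\<Sum>j\<in>J. cv r (f j))" "cv (\<Sum>j\<in>J. f j) r = (\<Sum>j\<in>J. cv (f j) r)"
  by (induction J rule: infinite_finite_induct) (auto simp: cv_add cv_0)

lemma cv_sum_list: "cv r (\<Sum>p\<leftarrow>ps. f p) = (\<Sum>p\<leftarrow>ps. cv r (f p))" "cv (\<Sum>p\<leftarrow>ps. f p) r = (\<Sum>p\<leftarrow>ps. cv (f p) r)"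
  by (induction ps) (auto simp: cv_add cv_0)

lemma cv_scale: "cv r (fscale k s) = fscale k (cv r s)" "cv (fscale k r) s = fscale k (cv r s)"
  by (auto simp: cv_def fscale_def sum_distrib_left mult_ac)

end

lemma sum_times_fst_snd:
  "(\<Sum>m\<in>I \<times> I'. f (fst m) * g (snd m)) = (\<Sum>m\<in>I. f m) * (\<Sum>m\<in>I'. (g m :: 'k::field))"
  by (simp add: sum_product sum.cartesian_product split_def)

lemma sum_sum_times_fst_snd:
  "(\<Sum>i\<in>I \<times> I'. \<Sum>j\<in>J \<times> J'. F (fst i) (fst j) * G (snd i) (snd j)) =
    (\<Sum>i\<in>I. \<Sum>j\<in>J. F i j) * (\<Sum>i\<in>I'. \<Sum>j\<in>J'. (G i j :: 'k::field))"
  unfolding sum_times_fst_snd[where f = "F (fst i)" and g = "G (snd i)" for i]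
  by (rule sum_times_fst_snd)

text \<open>Coefficients, coordinates and counit of a tensor product are products of those of the
  factors, and each axiom splits into a product of two sums. Applied twice to A it gives the
  coalgebra underlying R.\<close>

lemma fin_coalg_prod:
  fixes e :: "'a \<Rightarrow> 'k::field" and e' :: "'c \<Rightarrow> 'k"
  assumes "fin_coalg I co D e" "fin_coalg I' co' D' e'"
  shows "fin_coalg (I \<times> I') (\<lambda>i c. co (fst i) (fst c) * co' (snd i) (snd c))
    (\<lambda>c i j. D (fst c) (fst i) (fst j) * D' (snd c) (snd i) (snd j)) (\<lambda>c. e (fst c) * e' (snd c))"
proof -
  interpret a: fin_coalg I co D e by fact
  interpret b: fin_coalg I' co' D' e' by fact
  have ac: "(p * q) * (r * s) = (p * r) * (q * s)" for p q r s :: 'k by (simp add: mult_ac)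
  show ?thesis
  proof
    show "finite (I \<times> I')" by (simp add: a.fin b.fin)
    fix c :: "'a \<times> 'c" and i j k :: "'a \<times> 'c"
    show "D (fst c) (fst i) (fst j) * D' (snd c) (snd i) (snd j) =
        D (fst c) (fst j) (fst i) * D' (snd c) (snd j) (snd i)"
      using a.D_sym b.D_sym by simp
    show "(\<Sum>m\<in>I \<times> I'. (D (fst c) (fst m) (fst k) * D' (snd c) (snd m) (snd k)) *
          (D (fst m) (fst i) (fst j) * D' (snd m) (snd i) (snd j))) =
        (\<Sum>m\<in>I \<times> I'. (D (fst c) (fst i) (fst m) * D' (snd c) (snd i) (snd m)) *
          (D (fst m) (fst j) (fst k) * D' (snd m) (snd j) (snd k)))"
      unfolding ac
        sum_times_fst_snd[where f = "\<lambda>m. D (fst c) m (fst k) * D m (fst i) (fst j)"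
          and g = "\<lambda>m. D' (snd c) m (snd k) * D' m (snd i) (snd j)"]
        sum_times_fst_snd[where f = "\<lambda>m. D (fst c) (fst i) m * D m (fst j) (fst k)"
          and g = "\<lambda>m. D' (snd c) (snd i) m * D' m (snd j) (snd k)"]
      by (simp only: a.D_assoc b.D_assoc)
    show "(\<Sum>j\<in>I \<times> I'. (D (fst c) (fst i) (fst j) * D' (snd c) (snd i) (snd j)) * (e (fst j) * e' (snd j))) =
        co (fst i) (fst c) * co' (snd i) (snd c)"
      unfolding ac
        sum_times_fst_snd[where f = "\<lambda>j. D (fst c) (fst i) j * e j"
          and g = "\<lambda>j. D' (snd c) (snd i) j * e' j"]
      by (simp only: a.D_counit b.D_counit)
    show "D (fst c) (fst i) (fst j) * D' (snd c) (snd i) (snd j) =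
        (\<Sum>m\<in>I \<times> I'. (co (fst m) (fst c) * co' (snd m) (snd c)) *
          (D (fst m) (fst i) (fst j) * D' (snd m) (snd i) (snd j)))"
      by (subst ac, subst sum_times_fst_snd[where f = "\<lambda>m. co m (fst c) * D m (fst i) (fst j)"
          and g = "\<lambda>m. co' m (snd c) * D' m (snd i) (snd j)"])
        (simp only: a.D_lin[symmetric] b.D_lin[symmetric])
    show "e (fst c) * e' (snd c) =
        (\<Sum>m\<in>I \<times> I'. (co (fst m) (fst c) * co' (snd m) (snd c)) * (e (fst m) * e' (snd m)))"
      by (subst ac, subst sum_times_fst_snd[where f = "\<lambda>m. co m (fst c) * e m"
          and g = "\<lambda>m. co' m (snd c) * e' m"])
        (simp only: a.e_lin[symmetric] b.e_lin[symmetric])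
  qed
qed

lemma cv_prod:
  assumes "fin_coalg I co D e" "fin_coalg I' co' D' e'"
  shows "fin_coalg.cv (I \<times> I') (\<lambda>c i j. D (fst c) (fst i) (fst j) * D' (snd c) (snd i) (snd j))
      (\<lambda>c. r (fst c) * r' (snd c)) (\<lambda>c. s (fst c) * s' (snd c)) =
    (\<lambda>c. fin_coalg.cv I D r s (fst c) * fin_coalg.cv I' D' r' s' (snd c))"
proof -
  interpret a: fin_coalg I co D e by fact
  interpret b: fin_coalg I' co' D' e' by fact
  interpret p: fin_coalg "I \<times> I'" "\<lambda>i c. co (fst i) (fst c) * co' (snd i) (snd c)"
    "\<lambda>c i j. D (fst c) (fst i) (fst j) * D' (snd c) (snd i) (snd j)" "\<lambda>c. e (fst c) * e' (snd c)"
    by (rule fin_coalg_prod) fact+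
  have "D (fst c) (fst i) (fst j) * D' (snd c) (snd i) (snd j) * ((r (fst i) * r' (snd i)) * (s (fst j) * s' (snd j)))
     = (D (fst c) (fst i) (fst j) * (r (fst i) * s (fst j))) * (D' (snd c) (snd i) (snd j) * (r' (snd i) * s' (snd j)))"
    for c i j by (simp add: mult_ac)
  then show ?thesis
    unfolding p.cv_def a.cv_def b.cv_def
    by (simp only: sum_sum_times_fst_snd[where F = "\<lambda>i j. D (fst c) i j * (r i * s j)"
          and G = "\<lambda>i j. D' (snd c) i j * (r' i * s' j)" for c])
qed

text \<open>Nested pairs instead of quadruples, because the coalgebra with four factors is built as
  a product of two products.\<close>

type_synonym 'b four = "('b \<times> 'b) \<times> ('b \<times> 'b)"

context cocomm_hopf
begin

section \<open>The convolution algebra of four-linear forms\<close>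

definition DA :: "'a \<Rightarrow> 'a \<Rightarrow> 'a \<Rightarrow> 'k" where "DA a i j = sw H a (\<lambda>x y. cd i x * cd j y)"

lemma lk_DA [simp]: "la g \<Longrightarrow> lk (\<lambda>a. DA (g a) i j)"
  unfolding DA_def by simp

sublocale FA: fin_coalg Eb cd DA \<epsilon>
proof
  show "DA c i j = DA c j i" for c i j
    unfolding DA_def using sw_cocomm[of "\<lambda>x y. cd i x * cd j y" c] by (simp add: mult.commute)
  show "(\<Sum>m\<in>Eb. DA c m k * DA m i j) = (\<Sum>m\<in>Eb. DA c i m * DA m j k)" for c k i j
  proof -
    have "(\<Sum>m\<in>Eb. DA c m k * DA m i j) = sw H c (\<lambda>x y. (\<Sum>m\<in>Eb. cd m x * DA m i j) * cd k y)"
      by (simp add: DA_def[of c] sw_cmult sw_sum[symmetric] sum_distrib_left sum_distrib_right mult_ac)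
    also have "\<dots> = sw H c (\<lambda>x y. sw H x (\<lambda>x1 x2. cd i x1 * (cd j x2 * cd k y)))"
      by (subst lk_expand[of "\<lambda>a. DA a i j", symmetric]) (simp_all add: DA_def sw_cmult mult_ac)
    also have "\<dots> = sw H c (\<lambda>x y. sw H y (\<lambda>y1 y2. cd i x * (cd j y1 * cd k y2)))"
      by (rule sw_coassoc) simp
    also have "\<dots> = sw H c (\<lambda>x y. cd i x * (\<Sum>m\<in>Eb. cd m y * DA m j k))"
      by (subst lk_expand[of "\<lambda>a. DA a j k", symmetric]) (simp_all add: DA_def sw_cmult mult_ac)
    also have "\<dots> = (\<Sum>m\<in>Eb. DA c i m * DA m j k)"
      by (simp add: DA_def[of c] sw_cmult sw_sum[symmetric] sum_distrib_left mult_ac)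
    finally show ?thesis .
  qed
  show "(\<Sum>j\<in>Eb. DA c i j * \<epsilon> j) = cd i c" for c i
  proof -
    have "(\<Sum>j\<in>Eb. DA c i j * \<epsilon> j) = sw H c (\<lambda>x y. cd i x * (\<Sum>j\<in>Eb. cd j y * \<epsilon> j))"
      by (simp add: DA_def sw_cmult sw_sum[symmetric] sum_distrib_left mult_ac)
    also have "\<dots> = sw H c (\<lambda>x y. cd i x * \<epsilon> y)"
      by (subst lk_expand[of \<epsilon>, symmetric]) simp_all
    also have "\<dots> = cd i c" by (simp add: sw_counit)
    finally show ?thesis .
  qed
  show "DA c i j = (\<Sum>m\<in>Eb. cd m c * DA m i j)" for c i j
    by (rule lk_expand) simp
  show "\<epsilon> c = (\<Sum>m\<in>Eb. cd m c * \<epsilon> m)" for c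
    by (rule lk_expand) simp
qed simp

lemma FA_cv: "lk r \<Longrightarrow> lk s \<Longrightarrow> FA.cv r s a = sw H a (\<lambda>x y. r x * s y)"
  unfolding FA.cv_def DA_def
  using sw_expand[of "\<lambda>x y. r x * s y" a] by simp

lemmas FA2 = fin_coalg_prod[OF FA.fin_coalg_axioms FA.fin_coalg_axioms]

definition J4 :: "'a four set" where "J4 = (Eb \<times> Eb) \<times> (Eb \<times> Eb)"
definition co4 :: "'a four \<Rightarrow> 'a four \<Rightarrow> 'k" where
  "co4 = (\<lambda>i c. (cd (fst (fst i)) (fst (fst c)) * cd (snd (fst i)) (snd (fst c))) *
    (cd (fst (snd i)) (fst (snd c)) * cd (snd (snd i)) (snd (snd c))))"
definition D4 :: "'a four \<Rightarrow> 'a four \<Rightarrow> 'a four \<Rightarrow> 'k" where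
  "D4 = (\<lambda>c i j. (DA (fst (fst c)) (fst (fst i)) (fst (fst j)) * DA (snd (fst c)) (snd (fst i)) (snd (fst j))) *
    (DA (fst (snd c)) (fst (snd i)) (fst (snd j)) * DA (snd (snd c)) (snd (snd i)) (snd (snd j))))"
definition e4 :: "'a four \<Rightarrow> 'k" where
  "e4 = (\<lambda>c. (\<epsilon> (fst (fst c)) * \<epsilon> (snd (fst c))) * (\<epsilon> (fst (snd c)) * \<epsilon> (snd (snd c))))"

sublocale R: fin_coalg J4 co4 D4 e4
  using fin_coalg_prod[OF FA2 FA2] unfolding J4_def co4_def D4_def e4_def .

abbreviation cvR (infixr "\<odot>" 70) where "r \<odot> s \<equiv> R.cv r s"

definition pure :: "('a \<Rightarrow> 'k) \<Rightarrow> ('a \<Rightarrow> 'k) \<Rightarrow> ('a \<Rightarrow> 'k) \<Rightarrow> ('a \<Rightarrow> 'k) \<Rightarrow> 'a four \<Rightarrow> 'k" where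
  "pure f g h k = (\<lambda>c. (f (fst (fst c)) * g (snd (fst c))) * (h (fst (snd c)) * k (snd (snd c))))"

lemma pure_cv: "pure f g h k \<odot> pure f' g' h' k' = pure (FA.cv f f') (FA.cv g g') (FA.cv h h') (FA.cv k k')"
  using cv_prod[OF FA2 FA2, of "\<lambda>c. f (fst c) * g (snd c)" "\<lambda>c. h (fst c) * k (snd c)"
      "\<lambda>c. f' (fst c) * g' (snd c)" "\<lambda>c. h' (fst c) * k' (snd c)"]
  unfolding pure_def J4_def D4_def cv_prod[OF FA.fin_coalg_axioms FA.fin_coalg_axioms] .

text \<open>Functions on \<open>'a four\<close> stand for linear forms on the fourth tensor power of \<open>A\<close>. Only the
  regular ones, for which \<open>e4\<close> is neutral, are multilinear. \<open>br\<close> embeds the scalars, and \<open>B u E\<close>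
  is the value at \<open>u \<in> R \<otimes> A\<close>, given by its coordinates, of the linear map \<open>E\<close> on \<open>A\<close>.\<close>

definition br :: "'k \<Rightarrow> 'a four \<Rightarrow> 'k" where "br k = fscale k e4"

definition reg where "reg r \<longleftrightarrow> e4 \<odot> r = r"

definition B :: "('a \<Rightarrow> 'a four \<Rightarrow> 'k) \<Rightarrow> ('a \<Rightarrow> 'a four \<Rightarrow> 'k) \<Rightarrow> 'a four \<Rightarrow> 'k" where
  "B u E = (\<Sum>i\<in>Eb. u i \<odot> E i)"

lemma reg_cv [simp]: "reg (r \<odot> s)" by (simp add: reg_def R.e_cv_cv)
lemma reg_br [simp]: "reg (br k)" by (simp add: reg_def br_def R.cv_scale R.e_cv_e)
lemma reg_B [simp]: "reg (B u E)" by (simp add: reg_def B_def R.cv_sum R.e_cv_cv)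

lemma br_1 [simp]: "br 1 = e4" by (simp add: br_def fscale_def)

lemma br_cv: "reg r \<Longrightarrow> br k \<odot> r = fscale k r"
  by (simp add: br_def R.cv_scale reg_def)

lemma br_mult: "br (k * l) = br k \<odot> br l"
  unfolding br_cv[OF reg_br] by (simp add: br_def fscale_def mult_ac)

lemma br_add: "br (k + l) = br k + br l" by (auto simp: br_def fscale_def algebra_simps)

lemma br_0: "br 0 = 0" by (auto simp: br_def fscale_def)

lemma br_sum_list: "br (\<Sum>p\<leftarrow>ps. f p) = (\<Sum>p\<leftarrow>ps. br (f p))"
  by (induction ps) (simp_all add: br_add br_0)

lemma br_sw: "br (sw H a F) = sw H a (\<lambda>x y. br (F x y))"
  unfolding sw_trep split_def by (rule br_sum_list)

lemma cv_sw: "r \<odot> sw H a F = sw H a (\<lambda>x y. r \<odot> F x y)" "sw H a F \<odot> r = sw H a (\<lambda>x y. F x y \<odot> r)"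
  unfolding sw_trep split_def by (rule R.cv_sum_list)+

lemma B_sw: "B u (\<lambda>b. sw H a (F b)) = sw H a (\<lambda>x y. B u (\<lambda>b. F b x y))"
  unfolding B_def cv_sw by (rule sw_sum[symmetric])

lemma B_cv_left: "B u (\<lambda>a. P \<odot> Q a) = P \<odot> B u Q"
  unfolding B_def R.cv_sum by (intro sum.cong refl R.cv_left_comm)

lemma B_cv_right: "B u (\<lambda>a. Q a \<odot> P) = B u Q \<odot> P"
  unfolding B_def R.cv_sum by (simp add: R.cv_assoc)

text \<open>Evaluation is R-linear and R is commutative, so evaluations at two points can be
  exchanged. Together with \<open>cv_ac\<close> this brings both sides of an identity at points to
  the same order.\<close>

lemma B_comm: "B u (\<lambda>a. B v (\<lambda>b. Q a b)) = B v (\<lambda>b. B u (\<lambda>a. Q a b))"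
  unfolding B_def R.cv_sum
  by (subst sum.swap) (intro sum.cong refl R.cv_left_comm)

lemma B_comm3: "B u (\<lambda>a. B v (\<lambda>b. B w (\<lambda>c. Q a b c))) = B v (\<lambda>b. B w (\<lambda>c. B u (\<lambda>a. Q a b c)))"
proof -
  have "B u (\<lambda>a. B v (\<lambda>b. B w (\<lambda>c. Q a b c))) = B v (\<lambda>b. B u (\<lambda>a. B w (\<lambda>c. Q a b c)))" by (rule B_comm)
  also have "\<dots> = B v (\<lambda>b. B w (\<lambda>c. B u (\<lambda>a. Q a b c)))"
    by (rule arg_cong[where f = "B v"], rule ext, rule B_comm)
  finally show ?thesis .
qed

section \<open>Linear maps from A to R\<close>

definition lr :: "('a \<Rightarrow> 'a four \<Rightarrow> 'k) \<Rightarrow> bool" where "lr E \<longleftrightarrow> (\<forall>c. lk (\<lambda>a. E a c))"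
definition lr2 :: "('a \<Rightarrow> 'a \<Rightarrow> 'a four \<Rightarrow> 'k) \<Rightarrow> bool" where
  [simp]: "lr2 F \<longleftrightarrow> (\<forall>x. lr (\<lambda>y. F x y)) \<and> (\<forall>y. lr (\<lambda>x. F x y))"

lemma lr_cv_left [simp]: "lr Q \<Longrightarrow> lr (\<lambda>a. P \<odot> Q a)"
  and lr_cv_right [simp]: "lr Q \<Longrightarrow> lr (\<lambda>a. Q a \<odot> P)"
  by (simp_all add: lr_def R.cv_def del: split_paired_All)

lemma lr_B [simp]: "(\<And>b. lr (\<lambda>a. Q a b)) \<Longrightarrow> lr (\<lambda>a. B u (\<lambda>b. Q a b))"
  by (simp add: lr_def B_def sum_fun_apply R.cv_def del: split_paired_All)

lemma lr_br [simp]: "lk f \<Longrightarrow> lr (\<lambda>a. br (f a))"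
  by (simp add: lr_def br_def fscale_def del: split_paired_All)

lemma lr_sw_fun [simp]: "(\<And>x y. lr (\<lambda>a. F a x y)) \<Longrightarrow> lr (\<lambda>a. sw H b (\<lambda>x y. F a x y))"
  by (simp add: lr_def sw_apply del: split_paired_All)

lemma lr_sw [simp]: "la g \<Longrightarrow> lr2 (\<lambda>x y. F x y) \<Longrightarrow> lr (\<lambda>a. sw H (g a) (\<lambda>x y. F x y))"
  by (simp add: lr_def sw_apply del: split_paired_All)

lemma lr_comp: "lr E \<Longrightarrow> la g \<Longrightarrow> lr (\<lambda>x. E (g x))"
  using lk_comp[of "\<lambda>a. E a c" g for c] by (simp add: lr_def del: split_paired_All)

lemma lr_expand: "lr E \<Longrightarrow> E z = (\<Sum>k\<in>Eb. fscale (cd k z) (E k))"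
  using lk_expand[of "\<lambda>a. E a c" z for c]
  by (intro ext) (simp add: lr_def sum_fun_apply fscale_def del: split_paired_All)

lemma lr_expand': "lr E \<Longrightarrow> (\<And>a. reg (E a)) \<Longrightarrow> E z = (\<Sum>k\<in>Eb. br (cd k z) \<odot> E k)"
  using lr_expand[of E z] by (simp add: br_cv)

text \<open>The points: grouplike elements of \<open>R \<otimes> A\<close>. At a point, \<open>B\<close> turns Sweedler sums into
  products.\<close>

definition gl :: "('a \<Rightarrow> 'a four \<Rightarrow> 'k) \<Rightarrow> bool" where
  "gl u \<longleftrightarrow> (\<forall>i\<in>Eb. \<forall>j\<in>Eb. u i \<odot> u j = (\<Sum>k\<in>Eb. fscale (DA k i j) (u k))) \<and>
    (\<Sum>k\<in>Eb. fscale (\<epsilon> k) (u k)) = e4 \<and> (\<forall>k. u k = B u (\<lambda>a. br (cd k a)))"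

lemma glD:
  assumes "gl u"
  shows "i \<in> Eb \<Longrightarrow> j \<in> Eb \<Longrightarrow> u i \<odot> u j = (\<Sum>k\<in>Eb. fscale (DA k i j) (u k))"
    "(\<Sum>k\<in>Eb. fscale (\<epsilon> k) (u k)) = e4"
  using assms unfolding gl_def by blast+

text \<open>Expanding \<open>F\<close> in the basis leaves the coefficients \<open>DA k i j\<close>
  against \<open>u k\<close>; the first clause of \<open>gl\<close> contracts them to
  \<open>u i \<odot> u j\<close>, which is a double evaluation.\<close>

lemma B_gl:
  assumes u: "gl u" and F: "lr2 (\<lambda>x y. F x y)"
  shows "B u (\<lambda>a. sw H a (\<lambda>x y. F x y)) = B u (\<lambda>x. B u (\<lambda>y. F x y))"
proof -
  have sw: "sw H a (\<lambda>x y. F x y) = (\<Sum>i\<in>Eb. \<Sum>j\<in>Eb. fscale (DA a i j) (F i j))" for a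
    using sw_expand[of "\<lambda>x y. F x y c" a for c] F
    by (intro ext) (simp add: sw_apply lr_def DA_def sum_fun_apply fscale_def del: split_paired_All)
  have "B u (\<lambda>a. sw H a (\<lambda>x y. F x y)) = (\<Sum>k\<in>Eb. \<Sum>i\<in>Eb. \<Sum>j\<in>Eb. fscale (DA k i j) (u k) \<odot> F i j)"
    unfolding B_def sw R.cv_sum R.cv_scale ..
  also have "\<dots> = (\<Sum>i\<in>Eb. \<Sum>k\<in>Eb. \<Sum>j\<in>Eb. fscale (DA k i j) (u k) \<odot> F i j)" by (rule sum.swap)
  also have "\<dots> = (\<Sum>i\<in>Eb. \<Sum>j\<in>Eb. \<Sum>k\<in>Eb. fscale (DA k i j) (u k) \<odot> F i j)"
    by (intro sum.cong refl sum.swap)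
  also have "\<dots> = (\<Sum>i\<in>Eb. \<Sum>j\<in>Eb. (u i \<odot> u j) \<odot> F i j)"
    by (intro sum.cong refl) (simp add: glD(1)[OF u] R.cv_sum)
  also have "\<dots> = B u (\<lambda>x. B u (\<lambda>y. F x y))"
    by (simp add: B_def R.cv_sum R.cv_assoc)
  finally show ?thesis .
qed

lemma B_eps: "gl u \<Longrightarrow> reg Q \<Longrightarrow> B u (\<lambda>a. fscale (\<epsilon> a) Q) = Q"
proof -
  assume u: "gl u" and Q: "reg Q"
  have "B u (\<lambda>a. fscale (\<epsilon> a) Q) = (\<Sum>k\<in>Eb. fscale (\<epsilon> k) (u k)) \<odot> Q"
    unfolding B_def R.cv_sum R.cv_scale ..
  then show ?thesis using Q by (simp add: glD(2)[OF u] reg_def)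
qed

lemma B_eps_br [simp]: "gl u \<Longrightarrow> B u (\<lambda>a. br (\<epsilon> a)) = e4"
  using B_eps[of u e4] by (simp add: br_def reg_def R.e_cv_e)

text \<open>The last clause of \<open>gl\<close> says that the coordinates of a point are regular
  and vanish off the basis \<open>Eb\<close>; points with the same values on linear forms are thus
  equal as functions.\<close>

lemma gl_br: "gl u \<Longrightarrow> B u (\<lambda>a. br (cd k a)) = u k"
  unfolding gl_def by metis

text \<open>The second premise says that evaluation at \<open>v\<close> is multiplicative on the
  dual of A. In this form products and inverses of points are checked without coordinates.\<close>

lemma glI:
  assumes ext: "\<And>k. v k = B v (\<lambda>a. br (cd k a))"
    and mult: "\<And>f g. lk f \<Longrightarrow> lk g \<Longrightarrow>
      B v (\<lambda>a. br (f a)) \<odot> B v (\<lambda>a. br (g a)) = B v (\<lambda>a. br (sw H a (\<lambda>x y. f x * g y)))"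
    and eps: "B v (\<lambda>a. br (\<epsilon> a)) = e4"
  shows "gl v"
proof -
  have r: "reg (v k)" for k by (subst ext) simp
  have br: "B v (\<lambda>a. br (f a)) = (\<Sum>k\<in>Eb. fscale (f k) (v k))" for f
    unfolding B_def by (intro sum.cong refl) (subst R.cv_comm, rule br_cv[OF r])
  show ?thesis unfolding gl_def
  proof (intro conjI ballI allI)
    show "v i \<odot> v j = (\<Sum>k\<in>Eb. fscale (DA k i j) (v k))" for i j
    proof -
      have "v i \<odot> v j = B v (\<lambda>a. br (cd i a)) \<odot> B v (\<lambda>a. br (cd j a))"
        by (rule arg_cong2[OF ext ext])
      also have "\<dots> = B v (\<lambda>a. br (sw H a (\<lambda>x y. cd i x * cd j y)))"
        by (rule mult[OF lk_cd' lk_cd'])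
      finally show ?thesis by (simp only: br DA_def)
    qed
    show "(\<Sum>k\<in>Eb. fscale (\<epsilon> k) (v k)) = e4" using eps by (simp add: br)
  qed (rule ext)
qed

section \<open>Product, inverse and unit of points\<close>

definition pm where "pm u v = (\<lambda>k. B u (\<lambda>x. B v (\<lambda>y. br (cd k (x * y)))))"
definition pinv where "pinv u = (\<lambda>k. B u (\<lambda>x. br (cd k (S x))))"
definition pone where "pone = (\<lambda>k. br (cd k 1))"

lemma B_pm:
  assumes "lr E" "\<And>a. reg (E a)"
  shows "B (pm u v) E = B u (\<lambda>x. B v (\<lambda>y. E (x * y)))"
proof -
  have "B (pm u v) E = (\<Sum>k\<in>Eb. B u (\<lambda>x. B v (\<lambda>y. br (cd k (x * y)) \<odot> E k)))"
    unfolding B_def[of "pm u v" E] by (simp add: pm_def B_cv_right)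
  also have "\<dots> = B u (\<lambda>x. B v (\<lambda>y. \<Sum>k\<in>Eb. br (cd k (x * y)) \<odot> E k))"
    unfolding B_def R.cv_sum
    by (subst sum.swap, rule sum.cong[OF refl], subst sum.swap, rule refl)
  finally show ?thesis by (simp only: lr_expand'[OF assms, symmetric])
qed

lemma B_pinv:
  assumes "lr E" "\<And>a. reg (E a)"
  shows "B (pinv u) E = B u (\<lambda>x. E (S x))"
proof -
  have "B (pinv u) E = (\<Sum>k\<in>Eb. B u (\<lambda>x. br (cd k (S x)) \<odot> E k))"
    unfolding B_def[of "pinv u" E] by (simp add: pinv_def B_cv_right)
  also have "\<dots> = B u (\<lambda>x. \<Sum>k\<in>Eb. br (cd k (S x)) \<odot> E k)"
    unfolding B_def R.cv_sum by (rule sum.swap)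
  finally show ?thesis by (simp only: lr_expand'[OF assms, symmetric])
qed

lemma B_pone:
  assumes "lr E" "\<And>a. reg (E a)"
  shows "B pone E = E 1"
  unfolding B_def pone_def by (rule lr_expand'[OF assms, symmetric])

text \<open>Grouplikeness lets \<open>x\<close> and \<open>y\<close> be read as the two components
  of one coproduct, to which the antipode axiom applies.\<close>

lemma B_antipode:
  assumes u: "gl u" and G: "lr G" "\<And>a. reg (G a)"
  shows "B u (\<lambda>x. B u (\<lambda>y. G (x * S y))) = G 1" "B u (\<lambda>x. B u (\<lambda>y. G (S x * y))) = G 1"
proof -
  note lg = lr_comp[OF G(1)]
  have *: "sw H a (\<lambda>x y. G (x * S y)) = fscale (\<epsilon> a) (G 1)"
    "sw H a (\<lambda>x y. G (S x * y)) = fscale (\<epsilon> a) (G 1)" for a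
    using sw_antipode[of "\<lambda>x. G x c" a for c] G(1)
    by (auto simp: sw_apply lr_def fscale_def)
  show "B u (\<lambda>x. B u (\<lambda>y. G (x * S y))) = G 1"
    using B_gl[OF u, of "\<lambda>x y. G (x * S y)"] lg B_eps[OF u G(2)[of 1]] by (simp add: *)
  show "B u (\<lambda>x. B u (\<lambda>y. G (S x * y))) = G 1"
    using B_gl[OF u, of "\<lambda>x y. G (S x * y)"] lg B_eps[OF u G(2)[of 1]] by (simp add: *)
qed

text \<open>The universal points: the four coordinates.\<close>

definition U1 where "U1 k = pure (cd k) \<epsilon> \<epsilon> \<epsilon>"
definition U2 where "U2 k = pure \<epsilon> (cd k) \<epsilon> \<epsilon>"
definition U3 where "U3 k = pure \<epsilon> \<epsilon> (cd k) \<epsilon>"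
definition U4 where "U4 k = pure \<epsilon> \<epsilon> \<epsilon> (cd k)"

lemma lk_eps' : "lk \<epsilon>" using lk_eps[OF la_id] .

lemma FA_cv_simps: "FA.cv \<epsilon> \<epsilon> = \<epsilon>" "FA.cv \<epsilon> (cd i) = cd i" "FA.cv (cd i) \<epsilon> = cd i"
    "FA.cv (cd i) (cd j) = (\<lambda>a. DA a i j)"
  using lk_eps' lk_cd' by (auto simp: FA_cv sw_counit FA.e_cv_e DA_def)

lemma e4_pure: "e4 = pure \<epsilon> \<epsilon> \<epsilon> \<epsilon>" by (simp add: e4_def pure_def)

text \<open>Convolving coordinate functions of different factors gives their ordinary product, so
  expanding \<open>E\<close> in all four slots shows that its value at the universal points is
  \<open>E\<close> itself, read as an element of R.\<close>

lemma univ: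
  assumes E: "lk4 E"
  shows "B U1 (\<lambda>a. B U2 (\<lambda>b. B U3 (\<lambda>c. B U4 (\<lambda>d. br (E a b c d))))) =
    (\<lambda>x. E (fst (fst x)) (snd (fst x)) (fst (snd x)) (snd (snd x)))"
proof
  fix x :: "'a four"
  obtain a b c d where x: "x = ((a, b), (c, d))" by (metis surj_pair)
  have e1: "E a b c d = (\<Sum>i\<in>Eb. cd i a * E i b c d)" for a b c d
    by (rule lk_expand) (use E in simp)
  have e2: "E a b c d = (\<Sum>i\<in>Eb. cd i b * E a i c d)" for a b c d
    by (rule lk_expand) (use E in simp)
  have e3: "E a b c d = (\<Sum>i\<in>Eb. cd i c * E a b i d)" for a b c d
    by (rule lk_expand) (use E in simp)
  have e4: "E a b c d = (\<Sum>i\<in>Eb. cd i d * E a b c i)" for a b c d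
    by (rule lk_expand) (use E in simp)
  have "E a b c d = (\<Sum>i\<in>Eb. cd i a * (\<Sum>j\<in>Eb. cd j b * (\<Sum>k\<in>Eb. cd k c * (\<Sum>l\<in>Eb. cd l d * E i j k l))))"
    by (subst e1[of a], subst e2[of _ b], subst e3[of _ _ c], subst e4[of _ _ _ d], rule refl)
  also have "\<dots> = (\<Sum>i\<in>Eb. \<Sum>j\<in>Eb. \<Sum>k\<in>Eb. \<Sum>l\<in>Eb. cd i a * (cd j b * (cd k c * (cd l d * E i j k l))))"
    by (simp only: sum_distrib_left)
  finally show "B U1 (\<lambda>a. B U2 (\<lambda>b. B U3 (\<lambda>c. B U4 (\<lambda>d. br (E a b c d))))) x =
     E (fst (fst x)) (snd (fst x)) (fst (snd x)) (snd (snd x))"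
    unfolding B_def R.cv_sum br_def R.cv_scale U1_def U2_def U3_def U4_def e4_pure pure_cv FA_cv_simps
    by (simp add: sum_fun_apply fscale_def pure_def x mult_ac)
qed

text \<open>Evaluation at the universal points is injective on four-linear forms, being
  \<open>E\<close> itself by \<open>univ\<close>. Identities proved at points return to A through
  this lemma or its variants with fewer variables.\<close>

lemma univ_eq:
  assumes "lk4 E" "lk4 E'"
    "B U1 (\<lambda>a. B U2 (\<lambda>b. B U3 (\<lambda>c. B U4 (\<lambda>d. br (E a b c d))))) =
     B U1 (\<lambda>a. B U2 (\<lambda>b. B U3 (\<lambda>c. B U4 (\<lambda>d. br (E' a b c d)))))"
  shows "E a b c d = E' a b c d"
  using fun_cong[OF assms(3), of "((a, b), (c, d))"]
  unfolding univ[OF assms(1)] univ[OF assms(2)] by simp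

lemma lk_expand_DA: "(\<Sum>k\<in>Eb. DA k i j * cd k a) = DA a i j"
  using lk_expand[of "\<lambda>a. DA a i j" a] by (simp add: mult.commute)

lemma lk_expand_eps: "(\<Sum>k\<in>Eb. \<epsilon> k * cd k a) = \<epsilon> a"
  using lk_expand[OF lk_eps', of a] by (simp add: mult.commute)

lemma cd_expand: "(\<Sum>i\<in>Eb. cd i a * cd k i) = cd k a"
  using lk_expand[OF lk_cd', of k a] by simp

lemma sum_pure:
  "(\<Sum>k\<in>Eb. fscale (c k) (pure (cd k) f g h)) = pure (\<lambda>a. \<Sum>k\<in>Eb. c k * cd k a) f g h"
  "(\<Sum>k\<in>Eb. fscale (c k) (pure f (cd k) g h)) = pure f (\<lambda>a. \<Sum>k\<in>Eb. c k * cd k a) g h"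
  "(\<Sum>k\<in>Eb. fscale (c k) (pure f g (cd k) h)) = pure f g (\<lambda>a. \<Sum>k\<in>Eb. c k * cd k a) h"
  "(\<Sum>k\<in>Eb. fscale (c k) (pure f g h (cd k))) = pure f g h (\<lambda>a. \<Sum>k\<in>Eb. c k * cd k a)"
  by (intro ext; simp add: sum_fun_apply fscale_def pure_def sum_distrib_left sum_distrib_right mult_ac)+

lemma gl_U [simp]: "gl U1" "gl U2" "gl U3" "gl U4"
proof -
  have *: "(\<Sum>i\<in>Eb. cd k i * cd i a) = cd k a" for k a
    using cd_expand[where k = k and a = a] by (simp add: mult.commute)
  note defs = gl_def B_def br_def R.cv_scale e4_pure pure_cv FA_cv_simps sum_pure
    lk_expand_DA lk_expand_eps *
  show "gl U1" "gl U2" "gl U3" "gl U4"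
    unfolding defs U1_def U2_def U3_def U4_def by simp_all
qed

lemma e4_cv [simp]: "reg r \<Longrightarrow> e4 \<odot> r = r" "reg r \<Longrightarrow> r \<odot> e4 = r"
  using R.cv_comm by (metis reg_def)+

lemma reg_e4 [simp]: "reg e4" using reg_br[of 1] by simp

lemma reg_sw [simp]: "(\<And>x y. reg (F x y)) \<Longrightarrow> reg (sw H a F)"
  by (simp add: reg_def cv_sw)

lemma sw_S_eps: "\<epsilon> (S a) = \<epsilon> a"
  using sw_antipode(1)[OF lk_eps', of a] sw_counit(2)[of "\<lambda>x. \<epsilon> (S x)" a] by simp

lemma sw_mult_r: "lr2 (\<lambda>x y. F x y) \<Longrightarrow>
    sw H (a * b) (\<lambda>x y. F x y) = sw H a (\<lambda>a1 a2. sw H b (\<lambda>b1 b2. F (a1 * b1) (a2 * b2)))"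
  by (rule ext, simp add: sw_apply lr_def del: split_paired_All, rule sw_mult)
    (simp del: split_paired_All)

lemma sw_one_r: "lr2 (\<lambda>x y. F x y) \<Longrightarrow> sw H 1 (\<lambda>x y. F x y) = F 1 1"
  by (rule ext, simp add: sw_apply lr_def del: split_paired_All, rule sw_one)
    (simp del: split_paired_All)

text \<open>That \<open>S\<close> is a morphism of coalgebras: both sides are inverse to the coproduct, which is
  expressed by collapsing the fivefold sum \<open>?Q\<close> in two ways.\<close>

lemma sw_S:
  assumes F: "lk2 F"
  shows "sw H (S a) F = sw H a (\<lambda>x y. F (S x) (S y))"
proof -
  have lF: "la g \<Longrightarrow> lk (\<lambda>x. F (g x) y)" "la g \<Longrightarrow> lk (\<lambda>x. F y (g x))" for g y
    using F lk_comp[of "\<lambda>x. F x y" g] lk_comp[of "F y" g] by auto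
  have main: "B u (\<lambda>a. br (sw H (S a) F)) = B u (\<lambda>x. B u (\<lambda>y. br (F (S x) (S y))))" if u: "gl u" for u
  proof -
    let ?Q = "B u (\<lambda>z. B u (\<lambda>t. B u (\<lambda>a. B u (\<lambda>x. B u (\<lambda>y.
      br (sw H (S a) (\<lambda>p q. F (p * (x * S z)) (q * (y * S t)))))))))"
    \<comment> \<open>\<open>x\<close> and \<open>y\<close> form one coproduct; together with the
      coproduct of \<open>S a\<close> it is the coproduct of \<open>S a * x\<close>, which collapses
      to that of 1.\<close>
    have "?Q = B u (\<lambda>z. B u (\<lambda>t. br (F (S z) (S t))))"
    proof -
      have "B u (\<lambda>a. B u (\<lambda>x. B u (\<lambda>y. br (sw H (S a) (\<lambda>p q. F (p * (x * S z)) (q * (y * S t))))))) =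
         br (F (S z) (S t))" for z t
      proof -
        let ?F = "\<lambda>p q. F (p * S z) (q * S t)"
        have "B u (\<lambda>a. B u (\<lambda>x. B u (\<lambda>y. br (sw H (S a) (\<lambda>p q. F (p * (x * S z)) (q * (y * S t))))))) =
           B u (\<lambda>a. B u (\<lambda>x. sw H x (\<lambda>x y. br (sw H (S a) (\<lambda>p q. F (p * (x * S z)) (q * (y * S t)))))))"
          by (simp add: B_gl[OF u] lF)
        also have "\<dots> = B u (\<lambda>a. B u (\<lambda>x. br (sw H (S a * x) ?F)))"
          by (simp add: sw_mult lF br_sw mult.assoc sw_swap[of "S _"])
        also have "\<dots> = br (sw H 1 ?F)"
          by (rule B_antipode(2)[OF u, of "\<lambda>w. br (sw H w ?F)"]) (simp_all add: lF)
        also have "\<dots> = br (F (S z) (S t))" by (simp add: sw_one lF)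
        finally show ?thesis .
      qed
      then show ?thesis by simp
    qed
    \<comment> \<open>Now \<open>y * S t\<close> and then \<open>x * S z\<close> collapse to 1, once
      the evaluations have been reordered so that each pair is adjacent.\<close>
    moreover have "?Q = B u (\<lambda>a. br (sw H (S a) F))"
    proof -
      have "?Q = B u (\<lambda>a. B u (\<lambda>x. B u (\<lambda>z. B u (\<lambda>y. B u (\<lambda>t.
        br (sw H (S a) (\<lambda>p q. F (p * (x * S z)) (q * (y * S t)))))))))"
        (is "_ = ?Q'")
      proof -
        have "?Q = B u (\<lambda>z. B u (\<lambda>a. B u (\<lambda>t. B u (\<lambda>x. B u (\<lambda>y.
           br (sw H (S a) (\<lambda>p q. F (p * (x * S z)) (q * (y * S t)))))))))"
          by (rule arg_cong[where f = "B u"], rule ext, rule B_comm)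
        also have "\<dots> = B u (\<lambda>a. B u (\<lambda>z. B u (\<lambda>t. B u (\<lambda>x. B u (\<lambda>y.
           br (sw H (S a) (\<lambda>p q. F (p * (x * S z)) (q * (y * S t)))))))))"
          by (rule B_comm)
        also have "\<dots> = B u (\<lambda>a. B u (\<lambda>z. B u (\<lambda>x. B u (\<lambda>y. B u (\<lambda>t.
           br (sw H (S a) (\<lambda>p q. F (p * (x * S z)) (q * (y * S t)))))))))"
          by (rule arg_cong[where f = "B u"], rule ext, rule arg_cong[where f = "B u"], rule ext, rule B_comm3)
        also have "\<dots> = ?Q'"
          by (rule arg_cong[where f = "B u"], rule ext, rule B_comm)
        finally show ?thesis .
      qed
      also have "\<dots> = B u (\<lambda>a. B u (\<lambda>x. B u (\<lambda>z. br (sw H (S a) (\<lambda>p q. F (p * (x * S z)) q)))))"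
      proof -
        have "B u (\<lambda>y. B u (\<lambda>t. br (sw H (S a) (\<lambda>p q. F (p * (x * S z)) (q * (y * S t)))))) =
          br (sw H (S a) (\<lambda>p q. F (p * (x * S z)) (q * 1)))" for a x z
          by (rule B_antipode(1)[OF u, of "\<lambda>w. br (sw H (S a) (\<lambda>p q. F (p * (x * S z)) (q * w)))"])
            (simp_all add: lF)
        then show ?thesis by simp
      qed
      also have "\<dots> = B u (\<lambda>a. br (sw H (S a) F))"
      proof -
        have "B u (\<lambda>x. B u (\<lambda>z. br (sw H (S a) (\<lambda>p q. F (p * (x * S z)) q)))) =
          br (sw H (S a) (\<lambda>p q. F (p * 1) q))" for a
          by (rule B_antipode(1)[OF u, of "\<lambda>w. br (sw H (S a) (\<lambda>p q. F (p * w) q))"])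
            (simp_all add: lF)
        then show ?thesis by simp
      qed
      finally show ?thesis .
    qed
    ultimately show ?thesis by simp
  qed
  \<comment> \<open>The three idle slots are filled with counits, which become 1 when their
    variables are set to 1.\<close>
  let ?E = "\<lambda>a b c d. sw H (S a) F * (\<epsilon> b * (\<epsilon> c * \<epsilon> d))"
  let ?E' = "\<lambda>a b c d. sw H a (\<lambda>x y. F (S x) (S y)) * (\<epsilon> b * (\<epsilon> c * \<epsilon> d))"
  have l: "lk4 ?E" "lk4 ?E'" using F by (simp_all add: lF)
  have "B U1 (\<lambda>a. B U2 (\<lambda>b. B U3 (\<lambda>c. B U4 (\<lambda>d. br (?E a b c d))))) =
      B U1 (\<lambda>a. B U2 (\<lambda>b. B U3 (\<lambda>c. B U4 (\<lambda>d. br (?E' a b c d)))))"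
    by (simp add: br_mult B_cv_left B_cv_right main[OF gl_U(1)])
      (simp add: br_sw B_gl lF)
  from univ_eq[OF l this, of a 1 1 1] show ?thesis by simp
qed

lemma sw_S_r: "lr2 (\<lambda>x y. F x y) \<Longrightarrow> sw H (S a) (\<lambda>x y. F x y) = sw H a (\<lambda>x y. F (S x) (S y))"
  by (rule ext, simp add: sw_apply lr_def del: split_paired_All, rule sw_S)
    (simp del: split_paired_All)

lemmas B_simps = B_pm B_pinv B_pone br_sw B_sw cv_sw B_gl br_mult B_cv_left B_cv_right R.cv_assoc sw_cmult

section \<open>The points form a group\<close>

lemma gl_pm [simp]:
  assumes u: "gl u" and v: "gl v"
  shows "gl (pm u v)"
proof (rule glI)
  show "pm u v k = B (pm u v) (\<lambda>a. br (cd k a))" for k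
    by (simp add: B_pm) (simp add: pm_def)
  fix f g assume fg: "lk f" "lk g"
  note l = lk_comp[OF fg(1)] lk_comp[OF fg(2)]
  show "B (pm u v) (\<lambda>a. br (f a)) \<odot> B (pm u v) (\<lambda>a. br (g a)) =
    B (pm u v) (\<lambda>a. br (sw H a (\<lambda>x y. f x * g y)))"
    by (simp add: B_simps sw_mult_r u v l fg)
next
  show "B (pm u v) (\<lambda>a. br (\<epsilon> a)) = e4"
    by (simp add: B_simps u v)
qed

text \<open>Cocommutativity enters through \<open>sw_S\<close>: \<open>S\<close> preserves the order
  of the coproduct, so evaluation at the inverse is still multiplicative.\<close>

lemma gl_pinv [simp]:
  assumes u: "gl u"
  shows "gl (pinv u)"
proof (rule glI)
  show "pinv u k = B (pinv u) (\<lambda>a. br (cd k a))" for k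
    by (simp add: B_pinv) (simp add: pinv_def)
  fix f g assume fg: "lk f" "lk g"
  note l = lk_comp[OF fg(1)] lk_comp[OF fg(2)]
  show "B (pinv u) (\<lambda>a. br (f a)) \<odot> B (pinv u) (\<lambda>a. br (g a)) =
    B (pinv u) (\<lambda>a. br (sw H a (\<lambda>x y. f x * g y)))"
    by (simp add: B_simps sw_S_r u l fg)
next
  show "B (pinv u) (\<lambda>a. br (\<epsilon> a)) = e4"
    by (simp add: B_simps u sw_S_eps)
qed

lemma gl_pone [simp]: "gl pone"
proof (rule glI)
  show "pone k = B pone (\<lambda>a. br (cd k a))" for k
    by (simp add: B_pone) (simp add: pone_def)
  fix f g assume fg: "lk f" "lk g"
  note l = lk_comp[OF fg(1)] lk_comp[OF fg(2)]
  show "B pone (\<lambda>a. br (f a)) \<odot> B pone (\<lambda>a. br (g a)) =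
    B pone (\<lambda>a. br (sw H a (\<lambda>x y. f x * g y)))"
    by (simp add: B_pone sw_one l fg br_mult)
next
  show "B pone (\<lambda>a. br (\<epsilon> a)) = e4"
    by (simp add: B_simps)
qed

lemma pm_assoc: "pm (pm u v) w = pm u (pm v w)"
  unfolding pm_def[of "pm u v" w] pm_def[of u "pm v w"] by (simp add: B_pm mult.assoc)

lemma pm_pone [simp]: "gl u \<Longrightarrow> pm u pone = u" "gl u \<Longrightarrow> pm pone u = u"
  by (rule ext, simp add: pm_def B_pone gl_br)+

lemma pm_pinv [simp]: "gl u \<Longrightarrow> pm u (pinv u) = pone" "gl u \<Longrightarrow> pm (pinv u) u = pone"
  using B_antipode[of u "\<lambda>z. br (cd k z)" for k]
  by (auto simp: pm_def pone_def B_pinv)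

lemma pm_pinv' [simp]: "gl u \<Longrightarrow> gl v \<Longrightarrow> pm u (pm (pinv u) v) = v" "gl u \<Longrightarrow> gl v \<Longrightarrow> pm (pinv u) (pm u v) = v"
  by (simp_all flip: pm_assoc)

lemma pinv_pm [simp]: "gl u \<Longrightarrow> gl v \<Longrightarrow> pinv (pm u v) = pm (pinv v) (pinv u)"
proof -
  assume u: "gl u" and v: "gl v"
  have "pinv (pm u v) = pm (pinv (pm u v)) (pm (pm u v) (pm (pinv v) (pinv u)))"
    using u v by (simp add: pm_assoc)
  also have "\<dots> = pm (pinv v) (pinv u)" using u v by (simp del: pm_assoc add: pm_pinv'(2))
  finally show ?thesis .
qed

lemma pinv_pinv [simp]: "gl u \<Longrightarrow> pinv (pinv u) = u"
  using pm_pinv'(2)[of "pinv u" u] by (metis gl_pinv pm_pinv(2) pm_pone(1))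

lemma pinv_pone [simp]: "pinv pone = pone"
  using pm_pinv(1)[OF gl_pone] pm_pone(2)[OF gl_pinv[OF gl_pone]] by simp

end

section \<open>Cochains at points and the cocycle conditions\<close>

context cocomm_hopf
begin

section \<open>Trilinear and four-linear forms at points\<close>

definition T :: "('a \<Rightarrow> 'a \<Rightarrow> 'a \<Rightarrow> 'k) \<Rightarrow> _" where
  "T F u v s = B u (\<lambda>x. B v (\<lambda>y. B s (\<lambda>z. br (F x y z))))"

definition T4 :: "('a \<Rightarrow> 'a \<Rightarrow> 'a \<Rightarrow> 'a \<Rightarrow> 'k) \<Rightarrow> _" where
  "T4 F u v s t = B u (\<lambda>x. B v (\<lambda>y. B s (\<lambda>z. B t (\<lambda>q. br (F x y z q)))))"

definition cv3 :: "('a \<Rightarrow> 'a \<Rightarrow> 'a \<Rightarrow> 'k) \<Rightarrow> ('a \<Rightarrow> 'a \<Rightarrow> 'a \<Rightarrow> 'k) \<Rightarrow> 'a \<Rightarrow> 'a \<Rightarrow> 'a \<Rightarrow> 'k" where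
  "cv3 F G = (\<lambda>a b c. sw H a (\<lambda>a1 a2. sw H b (\<lambda>b1 b2. sw H c (\<lambda>c1 c2. F a1 b1 c1 * G a2 b2 c2))))"

definition cv4 :: "('a \<Rightarrow> 'a \<Rightarrow> 'a \<Rightarrow> 'a \<Rightarrow> 'k) \<Rightarrow> ('a \<Rightarrow> 'a \<Rightarrow> 'a \<Rightarrow> 'a \<Rightarrow> 'k) \<Rightarrow> 'a \<Rightarrow> 'a \<Rightarrow> 'a \<Rightarrow> 'a \<Rightarrow> 'k" where
  "cv4 F G = (\<lambda>a b c d. sw H a (\<lambda>a1 a2. sw H b (\<lambda>b1 b2. sw H c (\<lambda>c1 c2. sw H d (\<lambda>d1 d2.
    F a1 b1 c1 d1 * G a2 b2 c2 d2)))))"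

definition eps3 :: "'a \<Rightarrow> 'a \<Rightarrow> 'a \<Rightarrow> 'k" where "eps3 a b c = \<epsilon> a * (\<epsilon> b * \<epsilon> c)"
definition eps4 :: "'a \<Rightarrow> 'a \<Rightarrow> 'a \<Rightarrow> 'a \<Rightarrow> 'k" where "eps4 a b c d = \<epsilon> a * (\<epsilon> b * (\<epsilon> c * \<epsilon> d))"

lemma reg_T [simp]: "reg (T F u v s)" "reg (T4 G u v s t)" by (simp_all add: T_def T4_def)

lemma lk3_comp:
  assumes "lk3 F" "la h"
  shows "lk (\<lambda>x. F (h x) b c)" "lk (\<lambda>x. F b (h x) c)" "lk (\<lambda>x. F b c (h x))"
  using assms lk_comp[of "\<lambda>x. F x b c" h] lk_comp[of "\<lambda>x. F b x c" h] lk_comp[of "\<lambda>x. F b c x" h]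
  by auto

lemma lk4_comp:
  assumes "lk4 F" "la h"
  shows "lk (\<lambda>x. F (h x) b c d)" "lk (\<lambda>x. F b (h x) c d)" "lk (\<lambda>x. F b c (h x) d)" "lk (\<lambda>x. F b c d (h x))"
  using assms lk_comp[of "\<lambda>x. F x b c d" h] lk_comp[of "\<lambda>x. F b x c d" h] lk_comp[of "\<lambda>x. F b c x d" h]
    lk_comp[of "\<lambda>x. F b c d x" h]
  by auto

lemma lk3_eps3 [simp]: "lk3 eps3" and lk4_eps4 [simp]: "lk4 eps4"
  by (simp_all add: eps3_def eps4_def)

lemma T_eps3 [simp]: "gl u \<Longrightarrow> gl v \<Longrightarrow> gl s \<Longrightarrow> T eps3 u v s = e4"
  by (simp add: T_def eps3_def B_simps)

lemma T4_eps4 [simp]: "gl u \<Longrightarrow> gl v \<Longrightarrow> gl s \<Longrightarrow> gl t \<Longrightarrow> T4 eps4 u v s t = e4"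
  by (simp add: T4_def eps4_def B_simps)

lemma lk3_cv3: "lk3 F \<Longrightarrow> lk3 G \<Longrightarrow> lk3 (cv3 F G)"
  unfolding cv3_def lk3_def
  by (intro conjI allI lk_sw lk_sw_fun la_id) (auto simp: lk3_comp)

lemma lk4_cv4: "lk4 F \<Longrightarrow> lk4 G \<Longrightarrow> lk4 (cv4 F G)"
  unfolding cv4_def lk4_def lk3_def
  by (intro conjI allI lk_sw lk_sw_fun la_id) (auto simp: lk4_comp)

lemma T_cv3:
  assumes "gl u" "gl v" "gl s" "lk3 F" "lk3 G"
  shows "T (cv3 F G) u v s = T F u v s \<odot> T G u v s"
  unfolding T_def cv3_def using lk3_comp[OF assms(4) la_id] lk3_comp[OF assms(5) la_id]
  by (simp add: B_simps assms(1-3))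

lemma T4_cv4:
  assumes "gl u" "gl v" "gl s" "gl t" "lk4 F" "lk4 G"
  shows "T4 (cv4 F G) u v s t = T4 F u v s t \<odot> T4 G u v s t"
  unfolding T4_def cv4_def using lk4_comp[OF assms(5) la_id] lk4_comp[OF assms(6) la_id]
  by (simp add: B_simps assms(1-4))

lemma T4_univ:
  assumes "lk4 F" "lk4 G" "T4 F U1 U2 U3 U4 = T4 G U1 U2 U3 U4"
  shows "F a b c d = G a b c d"
  using univ_eq[OF assms(1,2)] assms(3) unfolding T4_def by blast

lemma T_univ:
  assumes "lk3 F" "lk3 G" "T F U1 U2 U3 = T G U1 U2 U3"
  shows "F a b c = G a b c"
proof -
  note l = lk3_comp[OF assms(1) la_id] lk3_comp[OF assms(2) la_id]
  \<comment> \<open>A counit fills the fourth slot and disappears when that variable is set to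
    1.\<close>
  have "(\<lambda>a b c d. F a b c * \<epsilon> d) a b c 1 = (\<lambda>a b c d. G a b c * \<epsilon> d) a b c 1"
    by (rule T4_univ) (use assms(3) in \<open>simp_all add: l T4_def T_def B_simps\<close>)
  then show ?thesis by simp
qed

lemma T_pone:
  assumes "gl u" "gl v" "lk3 F"
  shows "T F pone u v = B u (\<lambda>x. B v (\<lambda>y. br (F 1 x y)))" "T F u pone v = B u (\<lambda>x. B v (\<lambda>y. br (F x 1 y)))"
    "T F u v pone = B u (\<lambda>x. B v (\<lambda>y. br (F x y 1)))"
  unfolding T_def using lk3_comp[OF assms(3) la_id] by (simp_all add: B_pone)

text \<open>Concatenating the two argument lists turns a cochain of any bidegree with
  \<open>p + q = 3\<close> into one trilinear form. Convolution, counit and inverse no longer depend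
  on where the list was cut, so the four bidegrees are treated at once.\<close>

definition enc :: "nat \<Rightarrow> ('k, 'a) cochain \<Rightarrow> 'a \<Rightarrow> 'a \<Rightarrow> 'a \<Rightarrow> 'k" where
  "enc p f = (\<lambda>a b c. f (take p [a, b, c]) (drop p [a, b, c]))"
definition enc4 :: "nat \<Rightarrow> ('k, 'a) cochain \<Rightarrow> 'a \<Rightarrow> 'a \<Rightarrow> 'a \<Rightarrow> 'a \<Rightarrow> 'k" where
  "enc4 p f = (\<lambda>a b c d. f (take p [a, b, c, d]) (drop p [a, b, c, d]))"

lemma le_3_cases: "(p::nat) \<le> 3 \<Longrightarrow> p = 0 \<or> p = 1 \<or> p = 2 \<or> p = 3" by auto
lemma le_4_cases: "(p::nat) \<le> 4 \<Longrightarrow> p = 0 \<or> p = 1 \<or> p = 2 \<or> p = 3 \<or> p = 4" by auto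

lemma enc_conv: "p \<le> 3 \<Longrightarrow> enc p (conv H f g) = cv3 (enc p f) (enc p g)"
  by (drule le_3_cases) (auto simp: enc_def cv3_def conv_def)

lemma enc4_conv: "p \<le> 4 \<Longrightarrow> enc4 p (conv H f g) = cv4 (enc4 p f) (enc4 p g)"
  by (drule le_4_cases) (auto simp: enc4_def cv4_def conv_def)

lemma enc_triv: "p \<le> 3 \<Longrightarrow> p + q = 3 \<Longrightarrow> enc p (triv H p q) = eps3"
  by (drule le_3_cases) (auto simp: enc_def triv_def eps3_def fun_eq_iff mult_ac)

lemma enc4_triv: "p \<le> 4 \<Longrightarrow> p + q = 4 \<Longrightarrow> enc4 p (triv H p q) = eps4"
  by (drule le_4_cases) (auto simp: enc4_def triv_def eps4_def fun_eq_iff mult_ac)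

lemma length_3E: assumes "length xs = 3" obtains a b c where "xs = [a, b, c]"
  using assms by (auto simp: numeral_3_eq_3 length_Suc_conv)

lemma length_4E: assumes "length xs = 4" obtains a b c d where "xs = [a, b, c, d]"
  using assms by (auto simp: numeral_eq_Suc length_Suc_conv)

lemma enc_eqD:
  assumes "enc p f = enc p g" "length as = p" "length xs = q" "p + q = 3"
  shows "f as xs = g as xs"
proof -
  have "length (as @ xs) = 3" using assms by simp
  then obtain a b c where abc: "as @ xs = [a, b, c]" by (rule length_3E)
  then have "as = take p [a, b, c]" "xs = drop p [a, b, c]"
    using assms(2) by (metis append_eq_conv_conj)+
  then show ?thesis using assms(1) by (metis enc_def)
qed

lemma enc4_eqD:
  assumes "enc4 p f = enc4 p g" "length as = p" "length xs = q" "p + q = 4"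
  shows "f as xs = g as xs"
proof -
  have "length (as @ xs) = 4" using assms by simp
  then obtain a b c d where abc: "as @ xs = [a, b, c, d]" by (rule length_4E)
  then have "as = take p [a, b, c, d]" "xs = drop p [a, b, c, d]"
    using assms(2) by (metis append_eq_conv_conj)+
  then show ?thesis using assms(1) by (metis enc4_def)
qed

section \<open>Multilinearity and convolution inverses of cochains\<close>

lemma multilin_lin:
  assumes "f \<in> multilin H p q" "length as = p" "length xs = q"
  shows "i < p \<Longrightarrow> lk (\<lambda>a. f (as[i := a]) xs)" "j < q \<Longrightarrow> lk (\<lambda>x. f as (xs[j := x]))"
  using assms unfolding multilin_def lk_def by blast+

lemma multilin_zero: "f \<in> multilin H p q \<Longrightarrow> \<not> (length as = p \<and> length xs = q) \<Longrightarrow> f as xs = 0"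
  unfolding multilin_def by blast

lemma lk3_enc:
  assumes "f \<in> multilin H p q" "p + q = 3"
  shows "lk3 (enc p f)"
proof -
  have "p \<le> 3" using assms(2) by simp
  then have "p = 0 \<and> q = 3 \<or> p = 1 \<and> q = 2 \<or> p = 2 \<and> q = 1 \<or> p = 3 \<and> q = 0"
    using le_3_cases assms(2) by auto
  then show ?thesis
  proof (elim disjE conjE)
    assume [simp]: "p = 0" "q = 3"
    show ?thesis using multilin_lin(2)[OF assms(1), of "[]" "[a, b, c]" 0 for a b c]
        multilin_lin(2)[OF assms(1), of "[]" "[a, b, c]" 1 for a b c]
        multilin_lin(2)[OF assms(1), of "[]" "[a, b, c]" 2 for a b c]
      by (simp add: enc_def)
  next
    assume [simp]: "p = 1" "q = 2"
    show ?thesis using multilin_lin(1)[OF assms(1), of "[a]" "[b, c]" 0 for a b c]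
        multilin_lin(2)[OF assms(1), of "[a]" "[b, c]" 0 for a b c]
        multilin_lin(2)[OF assms(1), of "[a]" "[b, c]" 1 for a b c]
      by (simp add: enc_def)
  next
    assume [simp]: "p = 2" "q = 1"
    show ?thesis using multilin_lin(1)[OF assms(1), of "[a, b]" "[c]" 0 for a b c]
        multilin_lin(1)[OF assms(1), of "[a, b]" "[c]" 1 for a b c]
        multilin_lin(2)[OF assms(1), of "[a, b]" "[c]" 0 for a b c]
      by (simp add: enc_def numeral_2_eq_2)
  next
    assume [simp]: "p = 3" "q = 0"
    show ?thesis using multilin_lin(1)[OF assms(1), of "[a, b, c]" "[]" 0 for a b c]
        multilin_lin(1)[OF assms(1), of "[a, b, c]" "[]" 1 for a b c]
        multilin_lin(1)[OF assms(1), of "[a, b, c]" "[]" 2 for a b c]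
      by (simp add: enc_def)
  qed
qed

lemma cv_inverse_unique:
  assumes "r \<odot> s = e4" "r \<odot> s' = e4" "reg s" "reg s'"
  shows "s = s'"
proof -
  have "s = s \<odot> (r \<odot> s')" using assms(2,3) by simp
  also have "\<dots> = (r \<odot> s) \<odot> s'" by (simp add: R.cv_assoc R.cv_left_comm)
  finally show ?thesis using assms(1,4) by simp
qed

text \<open>At the universal points both are inverses of one element of the commutative ring R.
  Uniqueness is what makes the definite description in \<open>cinv\<close> denote the
  inverse.\<close>

lemma conv_inverse_unique:
  assumes f: "f \<in> multilin H p q" and pq: "p + q = 3"
    and g: "is_conv_inverse H p q f g" and g': "is_conv_inverse H p q f g'"
  shows "g = g'"
proof -
  have p: "p \<le> 3" using pq by simp
  have gm: "g \<in> multilin H p q" "g' \<in> multilin H p q"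
    using g g' by (auto simp: is_conv_inverse_def)
  note l = lk3_enc[OF f pq] lk3_enc[OF gm(1) pq] lk3_enc[OF gm(2) pq]
  have "cv3 (enc p f) (enc p g) = eps3" "cv3 (enc p f) (enc p g') = eps3"
    using g g' p by (auto simp: is_conv_inverse_def enc_triv[OF p pq] simp flip: enc_conv)
  then have "T (enc p f) U1 U2 U3 \<odot> T (enc p g) U1 U2 U3 = e4"
    "T (enc p f) U1 U2 U3 \<odot> T (enc p g') U1 U2 U3 = e4"
    using l by (simp_all flip: T_cv3 del: lk3_def)
  then have "T (enc p g) U1 U2 U3 = T (enc p g') U1 U2 U3"
    by (rule cv_inverse_unique) simp_all
  then have "enc p g = enc p g'" using T_univ[OF l(2,3)] by blast
  show "g = g'"
  proof (intro ext)
    fix as xs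
    show "g as xs = g' as xs"
    proof (cases "length as = p \<and> length xs = q")
      case True
      then show ?thesis using enc_eqD \<open>enc p g = enc p g'\<close> pq by blast
    next
      case False
      \<comment> \<open>Off the prescribed lengths both are 0 by the convention in
        \<open>multilin\<close>.\<close>
      then show ?thesis using multilin_zero[OF gm(1)] multilin_zero[OF gm(2)] by simp
    qed
  qed
qed

lemma cinv_inverse:
  assumes "f \<in> cochains H p q" "p + q = 3"
  shows "is_conv_inverse H p q f (cinv H p q f)"
proof -
  obtain g where g: "is_conv_inverse H p q f g" and f: "f \<in> multilin H p q"
    using assms(1) by (auto simp: cochains_def)
  show ?thesis unfolding cinv_def
    by (rule theI[of _ g]) (use g conv_inverse_unique[OF f assms(2)] in auto)
qed

section \<open>The trivial cochain\<close>

lemma multilin_triv: "triv H 3 0 \<in> multilin H 3 0"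
proof -
  have "lin_on A base (\<lambda>a. triv H 3 0 (as[i := a]) [])" if len: "length as = 3" and i: "i < 3" for as i
  proof -
    obtain a b c where as: "as = [a, b, c]" by (rule length_3E[OF len])
    have "lk (\<lambda>x. triv H 3 0 (as[i := x]) [])"
      using i by (auto simp: as triv_def less_Suc_eq numeral_3_eq_3)
    then show ?thesis by (simp add: lk_def)
  qed
  then show ?thesis unfolding multilin_def by (auto simp: triv_def)
qed

lemma conv_triv: "conv H (triv H 3 0) (triv H 3 0) = triv H 3 0"
proof (intro ext)
  \<comment> \<open>Both lists produced by \<open>sw_pow\<close> have the length of
    \<open>as\<close>, so a summand supported on length \<open>n\<close> contributes nothing for
    lists of another length. This gives the value 0 that the convolution must have there.\<close>
  have len: "sw_pow H as F = (if length as = n then sw_pow H as F else 0)"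
    if "\<And>us vs. length us \<noteq> n \<Longrightarrow> F us vs = 0" for as n and F :: "'a list \<Rightarrow> 'a list \<Rightarrow> 'k"
    using that
  proof (induction as arbitrary: n F)
    case (Cons a as)
    show ?case
    proof (cases n)
      case 0
      then have "sw_pow H as (\<lambda>us vs. F (x # us) (y # vs)) = 0" for x y
        using Cons.IH[of "Suc (length as)" "\<lambda>us vs. F (x # us) (y # vs)"] Cons.prems by simp
      then show ?thesis using 0 by (simp add: sw_trep split_def sum_list_0)
    next
      case (Suc m)
      then have "sw_pow H as (\<lambda>us vs. F (x # us) (y # vs)) = 0" if "length as \<noteq> m" for x y
        using that Cons.IH[of m "\<lambda>us vs. F (x # us) (y # vs)"] Cons.prems by simp
      then show ?thesis using Suc by (auto simp: sw_trep split_def sum_list_0)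
    qed
  qed auto
  fix as xs
  show "conv H (triv H 3 0) (triv H 3 0) as xs = triv H 3 0 as xs"
  proof (cases "length as = 3 \<and> length xs = 0")
    case True
    have "T (cv3 eps3 eps3) U1 U2 U3 = T eps3 U1 U2 U3"
      by (simp add: T_cv3 del: lk3_def)
    then have "cv3 eps3 eps3 a b c = eps3 a b c" for a b c
      by (intro T_univ lk3_cv3 lk3_eps3)
    then have "enc 3 (conv H (triv H 3 0) (triv H 3 0)) = enc 3 (triv H 3 0)"
      by (simp add: enc_conv enc_triv fun_eq_iff)
    then show ?thesis by (rule enc_eqD[where q = 0]) (use True in auto)
  next
    case False
    have "sw_pow H xs (\<lambda>xs1 xs2. triv H 3 0 as1 xs1 * triv H 3 0 as2 xs2) = 0" if "xs \<noteq> []" for as1 as2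
      using that by (subst len[of 0]) (auto simp: triv_def)
    moreover have "sw_pow H as (\<lambda>as1 as2. sw_pow H [] (\<lambda>xs1 xs2. triv H 3 0 as1 xs1 * triv H 3 0 as2 xs2)) = 0"
      if "length as \<noteq> 3"
      using that by (subst len[of 3]) (auto simp: triv_def)
    moreover have "sw_pow H as (\<lambda>as1 as2. 0) = 0" using len[of 0 "\<lambda>_ _. 0" as] len[of 1 "\<lambda>_ _. 0" as] by (cases as) auto
    ultimately show ?thesis using False unfolding conv_def by (cases "xs = []") (auto simp: triv_def)
  qed
qed

lemma triv_inverse: "is_conv_inverse H 3 0 (triv H 3 0) (triv H 3 0)"
  by (simp add: is_conv_inverse_def conv_triv multilin_triv)

lemma triv_cochain: "triv H 3 0 \<in> cochains H 3 0"
  using triv_inverse multilin_triv by (auto simp: cochains_def)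

lemma cinv_triv [simp]: "cinv H 3 0 (triv H 3 0) = triv H 3 0"
  using conv_inverse_unique[OF multilin_triv _ cinv_inverse[OF triv_cochain] triv_inverse] by simp

lemma sign_pow_triv: "sign_pow H 3 0 (triv H 3 0) n = triv H 3 0"
  by (simp add: sign_pow_def)

lemma triv_C_N: "triv H 3 0 \<in> C_N H 3 0"
  unfolding C_N_def using triv_cochain by (auto simp: triv_def)

text \<open>By multilinearity the universal points decide triviality; a trivial form in turn has the
  value \<open>e4\<close> at every point. All points are allowed on the right so that conditions can
  be specialized to group words.\<close>

lemma is_triv_iff:
  assumes "lk4 (enc4 p X)" "p + q = 4"
  shows "is_triv H p q X \<longleftrightarrow> (\<forall>u v s t. gl u \<longrightarrow> gl v \<longrightarrow> gl s \<longrightarrow> gl t \<longrightarrow> T4 (enc4 p X) u v s t = e4)"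
proof -
  have p: "p \<le> 4" using assms(2) by simp
  have "is_triv H p q X \<longleftrightarrow> enc4 p X = eps4"
  proof
    assume *: "is_triv H p q X"
    have "enc4 p X = enc4 p (triv H p q)"
      unfolding enc4_def using * p assms(2) by (intro ext) (auto simp: is_triv_def)
    then show "enc4 p X = eps4" using enc4_triv[OF p assms(2)] by simp
  next
    assume "enc4 p X = eps4"
    then show "is_triv H p q X"
      unfolding is_triv_def using enc4_eqD[of p X "triv H p q"] enc4_triv[OF p assms(2)] assms(2) by simp
  qed
  moreover have "enc4 p X = eps4" if "\<forall>u v s t. gl u \<longrightarrow> gl v \<longrightarrow> gl s \<longrightarrow> gl t \<longrightarrow> T4 (enc4 p X) u v s t = e4"
    using that T4_univ[OF assms(1) lk4_eps4] by (intro ext) (simp del: lk4_def)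
  ultimately show ?thesis by auto
qed

text \<open>As \<open>ad\<^sub>x(a) = S(x\<^sub>1) a x\<^sub>2\<close>, the adjoint action at points is \<open>a \<mapsto> x\<^sup>-\<^sup>1 a x\<close>.\<close>

definition pc where "pc x a = pm (pinv x) (pm a x)"

lemma gl_pc [simp]: "gl x \<Longrightarrow> gl a \<Longrightarrow> gl (pc x a)" by (simp add: pc_def)

lemma pc_simps [simp]:
  "gl x \<Longrightarrow> gl a \<Longrightarrow> gl b \<Longrightarrow> pc x (pm a b) = pm (pc x a) (pc x b)"
  "gl x \<Longrightarrow> gl a \<Longrightarrow> pc x (pinv a) = pinv (pc x a)"
  "gl x \<Longrightarrow> pc x pone = pone" "gl a \<Longrightarrow> pc pone a = a"
  "gl x \<Longrightarrow> gl y \<Longrightarrow> gl a \<Longrightarrow> pc (pm x y) a = pc y (pc x a)"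
  "gl x \<Longrightarrow> gl a \<Longrightarrow> pc (pinv x) (pc x a) = a"
  "gl x \<Longrightarrow> gl a \<Longrightarrow> pc x (pc (pinv x) a) = a"
  by (simp_all add: pc_def pm_assoc)

lemma lr_ad: "lr E \<Longrightarrow> E (ad H x a) = sw H x (\<lambda>x1 x2. E (S x1 * a * x2))"
  using ad_lk[of "\<lambda>z. E z c" x a for c]
  by (intro ext) (simp add: lr_def sw_apply del: split_paired_All)

text \<open>The two Sweedler components of \<open>x\<close> in \<open>ad\<close> become two
  evaluations at the point \<open>x\<close>, one of them under \<open>S\<close>, so the argument is
  the product of \<open>pinv x\<close>, \<open>a\<close> and \<open>x\<close>.\<close>

lemma B_pc:
  assumes "lr E" "\<And>a. reg (E a)" "gl x"
  shows "B (pc x a) E = B x (\<lambda>y. B a (\<lambda>b. E (ad H y b)))"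
proof -
  have "B x (\<lambda>y. B a (\<lambda>b. E (ad H y b))) = B x (\<lambda>y. B a (\<lambda>b. sw H y (\<lambda>x1 x2. E (S x1 * b * x2))))"
    by (simp only: lr_ad[OF assms(1)])
  also have "\<dots> = B x (\<lambda>x1. B x (\<lambda>x2. B a (\<lambda>b. E (S x1 * b * x2))))"
    by (simp add: B_simps assms lr_comp[OF assms(1)])
  also have "\<dots> = B x (\<lambda>x1. B a (\<lambda>b. B x (\<lambda>x2. E (S x1 * b * x2))))"
    by (rule arg_cong[where f = "B x"], rule ext, rule B_comm)
  also have "\<dots> = B (pc x a) E"
    unfolding pc_def by (simp add: B_simps assms lr_comp[OF assms(1)] mult.assoc)
  finally show ?thesis ..
qed

definition norm3 :: "('a \<Rightarrow> 'a \<Rightarrow> 'a \<Rightarrow> 'k) \<Rightarrow> bool" where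
  "norm3 F \<longleftrightarrow> (\<forall>b c. F 1 b c = \<epsilon> b * \<epsilon> c \<and> F b 1 c = \<epsilon> b * \<epsilon> c \<and> F b c 1 = \<epsilon> b * \<epsilon> c)"

text \<open>With 1 in one slot the normalized \<open>F\<close> is a product of counits, and
  convolving with it leaves \<open>G\<close>; so inverses of normalized cochains are
  normalized.\<close>

lemma cv3_norm:
  assumes "lk3 F" "lk3 G" "cv3 F G = eps3" "norm3 F"
  shows "norm3 G"
proof -
  note l = lk3_comp[OF assms(1)] lk3_comp[OF assms(2)]
  have "cv3 F G 1 b c = G 1 b c" "cv3 F G b 1 c = G b 1 c" "cv3 F G b c 1 = G b c 1" for b c
    unfolding cv3_def using assms(4)
    by (simp_all add: sw_one l norm3_def mult.assoc sw_cmult(1)[symmetric] sw_counit)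
  then show ?thesis using assms(3) by (simp add: norm3_def eps3_def)
qed

lemma conv_list_faces:
  assumes "p \<le> 4" "p + q = 4"
  shows "enc4 p (conv_list H p q []) = eps4"
    "enc4 p (conv_list H p q (f # fs)) = cv4 (enc4 p f) (enc4 p (conv_list H p q fs))"
  using assms by (simp_all add: conv_list_def enc4_triv enc4_conv)

lemma sw_list_num:
  "sw_list H 1 a F = sw H a (\<lambda>x y. \<epsilon> y * F [x])"
  "sw_list H 2 a F = sw H a (\<lambda>x y. sw H y (\<lambda>y z. \<epsilon> z * F [x, y]))"
  "sw_list H 3 a F = sw H a (\<lambda>x y. sw H y (\<lambda>y z. sw H z (\<lambda>z u. \<epsilon> u * F [x, y, z])))"
  by (simp_all add: numeral_2_eq_2 numeral_3_eq_3)

lemma eps4_lam: "eps4 = (\<lambda>a b c d. \<epsilon> a * (\<epsilon> b * (\<epsilon> c * \<epsilon> d)))"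
  by (intro ext) (simp add: eps4_def)

lemma upt_faces: "[1..<1] = []" "[1..<2] = [1]" "[1..<3] = [1, 2]" "[1..<4] = [1, 2, 3::nat]"
  by (simp_all add: upt_rec numeral_eq_Suc)

end

section \<open>The three normalized cochains\<close>

locale cochain_data = cocomm_hopf H for H :: "('k::field, 'a::ring_1) hopf" +
  fixes wc gc tc :: "('k, 'a) cochain"
  assumes wc: "wc \<in> C_N H 0 3" and gc: "gc \<in> C_N H 1 2" and tc: "tc \<in> C_N H 2 1"
begin

text \<open>Trilinear forms of the three cochains, with the group variables before the functional
  arguments, and of their convolution inverses, marked by a prime.\<close>

definition w where "w a b c = wc [] [a, b, c]"
definition w' where "w' a b c = cinv H 0 3 wc [] [a, b, c]"
definition g where "g x a b = gc [x] [a, b]"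
definition g' where "g' x a b = cinv H 1 2 gc [x] [a, b]"
definition t where "t x y a = tc [x, y] [a]"
definition t' where "t' x y a = cinv H 2 1 tc [x, y] [a]"

lemma enc_eqs: "enc 0 wc = w" "enc 0 (cinv H 0 3 wc) = w'" "enc 1 gc = g" "enc 1 (cinv H 1 2 gc) = g'"
  "enc 2 tc = t" "enc 2 (cinv H 2 1 tc) = t'"
  by (auto simp: enc_def w_def w'_def g_def g'_def t_def t'_def fun_eq_iff)

lemma C_N_props:
  assumes "f \<in> C_N H p q" "p + q = 3"
  shows "lk3 (enc p f)" "lk3 (enc p (cinv H p q f))" "cv3 (enc p f) (enc p (cinv H p q f)) = eps3"
    "norm3 (enc p f)" "norm3 (enc p (cinv H p q f))"
proof -
  have f: "f \<in> cochains H p q" "f \<in> multilin H p q" using assms(1) by (auto simp: C_N_def cochains_def)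
  have p: "p \<le> 3" using assms(2) by simp
  note inv = cinv_inverse[OF f(1) assms(2)]
  show l: "lk3 (enc p f)" by (rule lk3_enc[OF f(2) assms(2)])
  have gm: "cinv H p q f \<in> multilin H p q" using inv by (simp add: is_conv_inverse_def)
  show l': "lk3 (enc p (cinv H p q f))" by (rule lk3_enc[OF gm assms(2)])
  show c: "cv3 (enc p f) (enc p (cinv H p q f)) = eps3"
    using inv by (simp add: is_conv_inverse_def enc_triv[OF p assms(2)] flip: enc_conv[OF p])
  have "f (take p [a, b, c]) (drop p [a, b, c]) = \<epsilon> a * (\<epsilon> b * \<epsilon> c)" if "a = 1 \<or> b = 1 \<or> c = 1" for a b c
  proof -
    have "1 \<in> set (take p [a, b, c] @ drop p [a, b, c])" using that by auto
    then have m: "1 \<in> set (take p [a, b, c]) \<union> set (drop p [a, b, c])" by (simp only: set_append)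
    have len: "length (take p [a, b, c]) = p" "length (drop p [a, b, c]) = q" using assms(2) by auto
    have "f (take p [a, b, c]) (drop p [a, b, c]) =
        prod_list (map \<epsilon> (take p [a, b, c])) * prod_list (map \<epsilon> (drop p [a, b, c]))"
      using assms(1) m len unfolding C_N_def by blast
    also have "\<dots> = prod_list (map \<epsilon> (take p [a, b, c] @ drop p [a, b, c]))"
      by (simp only: map_append prod_list.append)
    also have "\<dots> = \<epsilon> a * (\<epsilon> b * \<epsilon> c)" by (simp only: append_take_drop_id) simp
    finally show ?thesis .
  qed
  then show n: "norm3 (enc p f)" by (simp add: norm3_def enc_def)
  show "norm3 (enc p (cinv H p q f))" by (rule cv3_norm[OF l l' c n])
qed

lemma degrees: "0 + 3 = (3::nat)" "1 + 2 = (3::nat)" "2 + 1 = (3::nat)" by simp_all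

lemmas C_N_data = C_N_props[OF wc degrees(1), unfolded enc_eqs] C_N_props[OF gc degrees(2), unfolded enc_eqs]
  C_N_props[OF tc degrees(3), unfolded enc_eqs]

lemma lk3_data: "lk3 w" "lk3 w'" "lk3 g" "lk3 g'" "lk3 t" "lk3 t'"
  by (rule C_N_data)+

lemmas lk_data [simp] = lk3_data[THEN lk3_comp(1)] lk3_data[THEN lk3_comp(2)] lk3_data[THEN lk3_comp(3)]
lemma norm3_data: "norm3 w" "norm3 w'" "norm3 g" "norm3 g'" "norm3 t" "norm3 t'"
  by (rule C_N_data)+

lemma norm_data [simp]:
  "w 1 b c = \<epsilon> b * \<epsilon> c" "w b 1 c = \<epsilon> b * \<epsilon> c" "w b c 1 = \<epsilon> b * \<epsilon> c"
  "w' 1 b c = \<epsilon> b * \<epsilon> c" "w' b 1 c = \<epsilon> b * \<epsilon> c" "w' b c 1 = \<epsilon> b * \<epsilon> c"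
  "g 1 b c = \<epsilon> b * \<epsilon> c" "g b 1 c = \<epsilon> b * \<epsilon> c" "g b c 1 = \<epsilon> b * \<epsilon> c"
  "g' 1 b c = \<epsilon> b * \<epsilon> c" "g' b 1 c = \<epsilon> b * \<epsilon> c" "g' b c 1 = \<epsilon> b * \<epsilon> c"
  "t 1 b c = \<epsilon> b * \<epsilon> c" "t b 1 c = \<epsilon> b * \<epsilon> c" "t b c 1 = \<epsilon> b * \<epsilon> c"
  "t' 1 b c = \<epsilon> b * \<epsilon> c" "t' b 1 c = \<epsilon> b * \<epsilon> c" "t' b c 1 = \<epsilon> b * \<epsilon> c"
  using norm3_data by (auto simp: norm3_def)

lemma cv3_data: "cv3 w w' = eps3" "cv3 g g' = eps3" "cv3 t t' = eps3"
  by (rule C_N_data)+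

lemma T_inv:
  assumes "gl u" "gl v" "gl s"
  shows "T w u v s \<odot> T w' u v s = e4" "T g u v s \<odot> T g' u v s = e4" "T t u v s \<odot> T t' u v s = e4"
  using T_cv3[OF assms lk3_data(1,2)] T_cv3[OF assms lk3_data(3,4)] T_cv3[OF assms lk3_data(5,6)]
  by (simp_all add: cv3_data assms)

lemma T_inv_comm:
  assumes "gl u" "gl v" "gl s"
  shows "T w' u v s \<odot> T w u v s = e4" "T g' u v s \<odot> T g u v s = e4" "T t' u v s \<odot> T t u v s = e4"
  using T_inv[OF assms] by (simp_all add: R.cv_comm)

lemma T_inv':
  assumes "gl u" "gl v" "gl s" "reg X"
  shows "T w u v s \<odot> (T w' u v s \<odot> X) = X" "T g u v s \<odot> (T g' u v s \<odot> X) = X" "T t u v s \<odot> (T t' u v s \<odot> X) = X"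
  using T_inv[OF assms(1-3)] assms(4) by (simp_all flip: R.cv_assoc)

lemma T_norm [simp]:
  assumes "gl u" "gl v"
  shows "T w pone u v = e4" "T w u pone v = e4" "T w u v pone = e4"
  "T w' pone u v = e4" "T w' u pone v = e4" "T w' u v pone = e4"
  "T g pone u v = e4" "T g u pone v = e4" "T g u v pone = e4"
  "T g' pone u v = e4" "T g' u pone v = e4" "T g' u v pone = e4"
  "T t pone u v = e4" "T t u pone v = e4" "T t u v pone = e4"
  "T t' pone u v = e4" "T t' u pone v = e4" "T t' u v pone = e4"
  by (simp_all add: T_pone assms lk3_data B_simps del: lk3_def)

text \<open>The components of the cocycle equation at points, with the inverses moved to the other
  side.\<close>

definition cond0 where "cond0 \<longleftrightarrow> (\<forall>u v s q. gl u \<longrightarrow> gl v \<longrightarrow> gl s \<longrightarrow> gl q \<longrightarrow>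
  T w v s q \<odot> T w u (pm v s) q \<odot> T w u v s = T w (pm u v) s q \<odot> T w u v (pm s q))"
definition cond1 where "cond1 \<longleftrightarrow> (\<forall>x a b c. gl x \<longrightarrow> gl a \<longrightarrow> gl b \<longrightarrow> gl c \<longrightarrow>
  T g x b c \<odot> T g x a (pm b c) \<odot> T w a b c = T g x (pm a b) c \<odot> T g x a b \<odot> T w (pc x a) (pc x b) (pc x c))"
definition cond2 where "cond2 \<longleftrightarrow> (\<forall>x y a b. gl x \<longrightarrow> gl y \<longrightarrow> gl a \<longrightarrow> gl b \<longrightarrow>
  T g y (pc x a) (pc x b) \<odot> T g x a b \<odot> T t x y a \<odot> T t x y b = T g (pm x y) a b \<odot> T t x y (pm a b))"
definition cond3 where "cond3 \<longleftrightarrow> (\<forall>x y z a. gl x \<longrightarrow> gl y \<longrightarrow> gl z \<longrightarrow> gl a \<longrightarrow>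
  T t (pm x y) z a \<odot> T t x y a = T t y z (pc x a) \<odot> T t x (pm y z) a)"

lemma cancel_inverse:
  assumes "P \<odot> P' = e4" "reg X" "reg P"
  shows "P' \<odot> X = e4 \<longleftrightarrow> X = P"
proof
  assume "P' \<odot> X = e4"
  then have "P \<odot> (P' \<odot> X) = P" using assms(3) by simp
  then show "X = P" using assms(1,2) by (simp flip: R.cv_assoc)
next
  assume "X = P" then show "P' \<odot> X = e4" using assms(1) R.cv_comm by metis
qed

lemmas cv_ac = R.cv_assoc R.cv_comm R.cv_left_comm

text \<open>Each face of the differential becomes one factor at points. Commutativity of R gathers
  the faces with exponent -1 into one inverse, which \<open>cancel_inverse\<close> moves to the
  other side. The other three conditions are treated in the same way.\<close>

lemma cond0_iff: "is_triv H 0 4 (d_diff H 0 3 wc) \<longleftrightarrow> cond0"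
proof -
  let ?f1 = "\<lambda>a b c d. \<epsilon> a * w b c d" and ?f2 = "\<lambda>a b c d. w' (a * b) c d"
    and ?f3 = "\<lambda>a b c d. w a (b * c) d" and ?f4 = "\<lambda>a b c d. w' a b (c * d)"
    and ?f5 = "\<lambda>a b c d. w a b c * \<epsilon> d"
  have enc: "enc4 0 (d_diff H 0 3 wc) = cv4 ?f1 (cv4 ?f2 (cv4 ?f3 (cv4 ?f4 (cv4 ?f5 eps4))))"
    unfolding d_diff_def
    by (simp add: conv_list_faces upt_faces del: One_nat_def)
      (simp add: enc4_def merge_def sign_pow_def w_def w'_def)
  have l: "lk4 ?f1" "lk4 ?f2" "lk4 ?f3" "lk4 ?f4" "lk4 ?f5" by simp_all
  have lk: "lk4 (enc4 0 (d_diff H 0 3 wc))"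
    unfolding enc by (intro lk4_cv4 lk4_eps4 l)
  have T4: "T4 (enc4 0 (d_diff H 0 3 wc)) u v s q = (T w' (pm u v) s q \<odot> T w' u v (pm s q)) \<odot>
     (T w v s q \<odot> T w u (pm v s) q \<odot> T w u v s)" if "gl u" "gl v" "gl s" "gl q" for u v s q
    unfolding enc
    by (simp only: T4_cv4[OF that] l lk4_cv4 lk4_eps4 T4_eps4[OF that])
      (use that in \<open>simp add: T_def T4_def B_simps\<close>, simp add: cv_ac)
  have "T4 (enc4 0 (d_diff H 0 3 wc)) u v s q = e4 \<longleftrightarrow>
    T w v s q \<odot> T w u (pm v s) q \<odot> T w u v s = T w (pm u v) s q \<odot> T w u v (pm s q)"
    if "gl u" "gl v" "gl s" "gl q" for u v s q
    unfolding T4[OF that] using that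
    by (intro cancel_inverse) (simp_all add: T_inv T_inv_comm T_inv' cv_ac)
  then show ?thesis unfolding cond0_def
    by (subst is_triv_iff[OF lk]) (simp, intro all_cong1 imp_cong refl)
qed

lemma cond3_iff: "is_triv H 3 1 (conv H (D_diff H 2 1 tc) (d_diff H 3 0 (triv H 3 0))) \<longleftrightarrow> cond3"
proof -
  \<comment> \<open>\<open>q = 1\<close> is odd, so the leading face of \<open>D_diff\<close> is the
    inverse cochain and the signs alternate from there. The extra counit is the tail of
    \<open>sw_list\<close>.\<close>
  let ?f1 = "\<lambda>x y z a. sw H x (\<lambda>x1 x2. \<epsilon> x2 * t' y z (ad H x1 a))" and ?f2 = "\<lambda>x y z a. t (x * y) z a"
    and ?f3 = "\<lambda>x y z a. t' x (y * z) a" and ?f4 = "\<lambda>x y z a. t x y a * \<epsilon> z"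
  let ?X = "conv H (D_diff H 2 1 tc) (d_diff H 3 0 (triv H 3 0))"
  have enc: "enc4 3 ?X = cv4 (cv4 ?f1 (cv4 ?f2 (cv4 ?f3 (cv4 ?f4 eps4)))) (cv4 eps4 (cv4 eps4 eps4))"
    unfolding d_diff_def D_diff_def
    by (simp add: enc4_conv conv_list_faces upt_faces sign_pow_triv del: One_nat_def)
      (simp add: enc4_def merge_def sign_pow_def t_def t'_def triv_def eps4_lam mult_ac sw_list_num del: One_nat_def)
  have l: "lk4 ?f1" "lk4 ?f2" "lk4 ?f3" "lk4 ?f4" by simp_all
  have lk: "lk4 (enc4 3 ?X)"
    unfolding enc by (intro lk4_cv4 lk4_eps4 l)
  have T4: "T4 (enc4 3 ?X) x y z a = (T t' y z (pc x a) \<odot> T t' x (pm y z) a) \<odot>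
     (T t (pm x y) z a \<odot> T t x y a)" if "gl x" "gl y" "gl z" "gl a" for x y z a
  proof -
    have "T4 ?f1 x y z a = T t' y z (pc x a)"
      using that unfolding T4_def T_def
      by (simp add: br_sw B_sw B_gl B_pc, simp add: br_mult B_cv_left B_cv_right)
        (simp only: B_comm[of x y] B_comm[of x z])
    moreover have "T4 ?f2 x y z a = T t (pm x y) z a" "T4 ?f3 x y z a = T t' x (pm y z) a"
      "T4 ?f4 x y z a = T t x y a"
      using that by (simp_all add: T4_def T_def B_simps)
    ultimately show ?thesis unfolding enc
      by (simp only: T4_cv4[OF that] l lk4_cv4 lk4_eps4 T4_eps4[OF that])
        (simp add: cv_ac)
  qed
  have "T4 (enc4 3 ?X) x y z a = e4 \<longleftrightarrow>
    T t (pm x y) z a \<odot> T t x y a = T t y z (pc x a) \<odot> T t x (pm y z) a"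
    if "gl x" "gl y" "gl z" "gl a" for x y z a
    unfolding T4[OF that] using that
    by (intro cancel_inverse) (simp_all add: T_inv T_inv_comm T_inv' cv_ac)
  then show ?thesis unfolding cond3_def
    by (subst is_triv_iff[OF lk]) (simp, intro all_cong1 imp_cong refl)
qed

lemma cond2_iff: "is_triv H 2 2 (conv H (D_diff H 1 2 gc) (d_diff H 2 1 tc)) \<longleftrightarrow> cond2"
proof -
  let ?f1 = "\<lambda>x y a b. sw H x (\<lambda>x1 x2. sw H x2 (\<lambda>x2 x3. \<epsilon> x3 * g y (ad H x1 a) (ad H x2 b)))"
    and ?f2 = "\<lambda>x y a b. g' (x * y) a b" and ?f3 = "\<lambda>x y a b. g x a b * \<epsilon> y"
    and ?f4 = "\<lambda>x y a b. \<epsilon> a * t x y b" and ?f5 = "\<lambda>x y a b. t' x y (a * b)"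
    and ?f6 = "\<lambda>x y a b. t x y a * \<epsilon> b"
  let ?X = "conv H (D_diff H 1 2 gc) (d_diff H 2 1 tc)"
  have enc: "enc4 2 ?X = cv4 (cv4 ?f1 (cv4 ?f2 (cv4 ?f3 eps4))) (cv4 ?f4 (cv4 ?f5 (cv4 ?f6 eps4)))"
    unfolding d_diff_def D_diff_def
    by (simp add: enc4_conv conv_list_faces upt_faces del: One_nat_def)
      (simp add: enc4_def merge_def sign_pow_def t_def t'_def g_def g'_def mult_ac sw_list_num del: One_nat_def)
  have l: "lk4 ?f1" "lk4 ?f2" "lk4 ?f3" "lk4 ?f4" "lk4 ?f5" "lk4 ?f6" by simp_all
  have lk: "lk4 (enc4 2 ?X)"
    unfolding enc by (intro lk4_cv4 lk4_eps4 l)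
  have T4: "T4 (enc4 2 ?X) x y a b = (T g' (pm x y) a b \<odot> T t' x y (pm a b)) \<odot>
     (T g y (pc x a) (pc x b) \<odot> T g x a b \<odot> T t x y a \<odot> T t x y b)"
    if "gl x" "gl y" "gl a" "gl b" for x y a b
  proof -
    have "T4 ?f1 x y a b = T g y (pc x a) (pc x b)"
      using that unfolding T4_def T_def
      by (simp add: br_sw B_sw B_gl B_pc, simp add: br_mult B_cv_left B_cv_right)
        (simp only: B_comm[of x y] B_comm[of x a])
    moreover have "T4 ?f2 x y a b = T g' (pm x y) a b" "T4 ?f3 x y a b = T g x a b"
      "T4 ?f4 x y a b = T t x y b" "T4 ?f5 x y a b = T t' x y (pm a b)" "T4 ?f6 x y a b = T t x y a"
      using that by (simp_all add: T4_def T_def B_simps)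
    ultimately show ?thesis unfolding enc
      by (simp only: T4_cv4[OF that] l lk4_cv4 lk4_eps4 T4_eps4[OF that])
        (simp add: cv_ac)
  qed
  have "T4 (enc4 2 ?X) x y a b = e4 \<longleftrightarrow>
    T g y (pc x a) (pc x b) \<odot> T g x a b \<odot> T t x y a \<odot> T t x y b = T g (pm x y) a b \<odot> T t x y (pm a b)"
    if "gl x" "gl y" "gl a" "gl b" for x y a b
    unfolding T4[OF that] using that
    by (intro cancel_inverse) (simp_all add: T_inv T_inv_comm T_inv' cv_ac)
  then show ?thesis unfolding cond2_def
    by (subst is_triv_iff[OF lk]) (simp, intro all_cong1 imp_cong refl)
qed

lemma cond1_iff: "is_triv H 1 3 (conv H (D_diff H 0 3 wc) (d_diff H 1 2 gc)) \<longleftrightarrow> cond1"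
proof -
  \<comment> \<open>For \<open>p = 0\<close> and \<open>q = 3\<close> there is no merging face and
    the two exponents are 3 and 4, hence \<open>w'\<close> before \<open>w\<close>. Each argument
    takes one Sweedler component of \<open>x\<close>; the last component meets a counit.\<close>
  let ?f1 = "\<lambda>x a b c. sw H x (\<lambda>x1 x2. sw H x2 (\<lambda>x2 x3. sw H x3 (\<lambda>x3 x4.
      \<epsilon> x4 * w' (ad H x1 a) (ad H x2 b) (ad H x3 c))))"
    and ?f2 = "\<lambda>x a b c. w a b c * \<epsilon> x"
    and ?f3 = "\<lambda>x a b c. \<epsilon> a * g x b c" and ?f4 = "\<lambda>x a b c. g' x (a * b) c"
    and ?f5 = "\<lambda>x a b c. g x a (b * c)" and ?f6 = "\<lambda>x a b c. g' x a b * \<epsilon> c"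
  let ?X = "conv H (D_diff H 0 3 wc) (d_diff H 1 2 gc)"
  have enc: "enc4 1 ?X = cv4 (cv4 ?f1 (cv4 ?f2 eps4)) (cv4 ?f3 (cv4 ?f4 (cv4 ?f5 (cv4 ?f6 eps4))))"
    unfolding d_diff_def D_diff_def
    by (simp add: enc4_conv conv_list_faces upt_faces del: One_nat_def)
      (simp add: enc4_def merge_def sign_pow_def w_def w'_def g_def g'_def mult_ac sw_list_num(3))
  have l: "lk4 ?f1" "lk4 ?f2" "lk4 ?f3" "lk4 ?f4" "lk4 ?f5" "lk4 ?f6" by simp_all
  have lk: "lk4 (enc4 1 ?X)"
    unfolding enc by (intro lk4_cv4 lk4_eps4 l)
  have T4: "T4 (enc4 1 ?X) x a b c = (T g' x (pm a b) c \<odot> T g' x a b \<odot> T w' (pc x a) (pc x b) (pc x c)) \<odot>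
     (T g x b c \<odot> T g x a (pm b c) \<odot> T w a b c)"
    if "gl x" "gl a" "gl b" "gl c" for x a b c
  proof -
    have "T4 ?f1 x a b c = T w' (pc x a) (pc x b) (pc x c)"
      using that unfolding T4_def T_def
      by (simp add: br_sw B_sw B_gl B_pc, simp add: br_mult B_cv_left B_cv_right)
        (simp only: B_comm[of x a] B_comm[of x b])
    moreover have "T4 ?f2 x a b c = T w a b c" "T4 ?f3 x a b c = T g x b c"
      "T4 ?f4 x a b c = T g' x (pm a b) c" "T4 ?f5 x a b c = T g x a (pm b c)" "T4 ?f6 x a b c = T g' x a b"
      using that by (simp_all add: T4_def T_def B_simps)
    ultimately show ?thesis unfolding enc
      by (simp only: T4_cv4[OF that] l lk4_cv4 lk4_eps4 T4_eps4[OF that])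
        (simp add: cv_ac)
  qed
  have "T4 (enc4 1 ?X) x a b c = e4 \<longleftrightarrow>
    T g x b c \<odot> T g x a (pm b c) \<odot> T w a b c = T g x (pm a b) c \<odot> T g x a b \<odot> T w (pc x a) (pc x b) (pc x c)"
    if "gl x" "gl a" "gl b" "gl c" for x a b c
    unfolding T4[OF that] using that
    by (intro cancel_inverse) (simp_all add: T_inv T_inv_comm T_inv' cv_ac)
  then show ?thesis unfolding cond1_def
    by (subst is_triv_iff[OF lk]) (simp, intro all_cong1 imp_cong refl)
qed

lemma trivial_iff: "is_triv H 4 0 (D_diff H 3 0 (triv H 3 0))"
proof -
  have enc: "enc4 4 (D_diff H 3 0 (triv H 3 0)) = cv4 eps4 (cv4 eps4 (cv4 eps4 (cv4 eps4 (cv4 eps4 eps4))))"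
    unfolding D_diff_def
    by (simp add: conv_list_faces upt_faces sign_pow_triv del: One_nat_def)
      (simp add: enc4_def merge_def triv_def eps4_lam mult_ac)
  have lk: "lk4 (enc4 4 (D_diff H 3 0 (triv H 3 0)))"
    unfolding enc by (intro lk4_cv4 lk4_eps4)
  have "T4 (enc4 4 (D_diff H 3 0 (triv H 3 0))) x y z a = e4" if "gl x" "gl y" "gl z" "gl a" for x y z a
    unfolding enc by (simp only: T4_cv4[OF that] lk4_cv4 lk4_eps4 T4_eps4[OF that] R.e_cv_e)
  then show ?thesis by (subst is_triv_iff[OF lk]) simp_all
qed

theorem cocycle_iff:
  "normalized_3_cocycle H wc gc tc (triv H 3 0) \<longleftrightarrow> cond0 \<and> cond1 \<and> cond2 \<and> cond3"
  unfolding normalized_3_cocycle_def cond0_iff cond1_iff cond2_iff cond3_iff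
  using wc gc tc triv_C_N trivial_iff by blast

end

section \<open>The algebra \<open>D(A)\<close>\<close>

context cocomm_hopf
begin

section \<open>Hopf algebra identities read off from the points\<close>

definition F1 :: "('a \<Rightarrow> 'k) \<Rightarrow> _" where "F1 f u = B u (\<lambda>a. br (f a))"

lemma reg_F1 [simp]: "reg (F1 f u)" by (simp add: F1_def)
lemma F1_eps [simp]: "gl u \<Longrightarrow> F1 \<epsilon> u = e4" by (simp add: F1_def)
lemma F1_pone: "lk f \<Longrightarrow> F1 f pone = br (f 1)" by (simp add: F1_def B_pone)

lemma univ_eq3:
  assumes "lk3 E" "lk3 E'"
    and "\<And>u v s. gl u \<Longrightarrow> gl v \<Longrightarrow> gl s \<Longrightarrow>
      B u (\<lambda>a. B v (\<lambda>b. B s (\<lambda>c. br (E a b c)))) = B u (\<lambda>a. B v (\<lambda>b. B s (\<lambda>c. br (E' a b c))))"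
  shows "E a b c = E' a b c"
  by (rule T_univ[OF assms(1,2)]) (simp add: T_def assms(3))

lemma univ_eq2:
  assumes "lk2 E" "lk2 E'"
    and "\<And>u v. gl u \<Longrightarrow> gl v \<Longrightarrow>
      B u (\<lambda>a. B v (\<lambda>b. br (E a b))) = B u (\<lambda>a. B v (\<lambda>b. br (E' a b)))"
  shows "E a b = E' a b"
proof -
  have "(\<lambda>a b c. E a b * \<epsilon> c) a b 1 = (\<lambda>a b c. E' a b * \<epsilon> c) a b 1"
    by (rule univ_eq3) (use assms in \<open>simp_all add: br_mult B_cv_left B_cv_right\<close>)
  then show ?thesis by simp
qed

text \<open>Antimultiplicativity is the group law for inverses of points, transferred back through a
  linear form \<open>p\<close>; the composition rule for \<open>ad\<close> below comes from
  \<open>pc\<close> in the same way.\<close>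

lemma S_mult: "S (x * y) = S y * S x"
proof (rule lk_separate)
  fix p assume p: "lk p"
  note l = lk_comp[OF p]
  show "p (S (x * y)) = p (S y * S x)"
  proof (rule univ_eq2[where E = "\<lambda>x y. p (S (x * y))" and E' = "\<lambda>x y. p (S y * S x)"])
    fix u v assume uv: "gl u" "gl v"
    have "B (pinv (pm u v)) (\<lambda>z. br (p z)) = B (pm (pinv v) (pinv u)) (\<lambda>z. br (p z))"
      using uv by simp
    then show "B u (\<lambda>a. B v (\<lambda>b. br (p (S (a * b))))) = B u (\<lambda>a. B v (\<lambda>b. br (p (S b * S a))))"
      by (simp del: pinv_pm add: B_pinv B_pm p l) (rule B_comm)
  qed (simp_all add: l)
qed

lemma S_one [simp]: "S 1 = 1"
proof (rule lk_separate)
  fix p assume p: "lk p"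
  then show "p (S 1) = p 1"
    using sw_antipode(1)[OF p, of 1] lk_comp[OF p] by (simp add: sw_one)
qed

lemma ad_mult: "ad H (x * y) a = ad H y (ad H x a)"
proof (rule lk_separate)
  fix p assume p: "lk p"
  note l = lk_comp[OF p]
  show "p (ad H (x * y) a) = p (ad H y (ad H x a))"
  proof (rule univ_eq3[where E = "\<lambda>x y a. p (ad H (x * y) a)" and E' = "\<lambda>x y a. p (ad H y (ad H x a))"])
    fix u v s assume g: "gl u" "gl v" "gl s"
    have "B (pc (pm u v) s) (\<lambda>z. br (p z)) = B (pc v (pc u s)) (\<lambda>z. br (p z))"
      using g by simp
    then have "B u (\<lambda>a. B v (\<lambda>b. B s (\<lambda>c. br (p (ad H (a * b) c))))) =
        B v (\<lambda>b. B u (\<lambda>a. B s (\<lambda>c. br (p (ad H b (ad H a c))))))"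
      by (simp del: pc_simps add: B_pc B_pm p l g)
    then show "B u (\<lambda>a. B v (\<lambda>b. B s (\<lambda>c. br (p (ad H (a * b) c))))) =
        B u (\<lambda>a. B v (\<lambda>b. B s (\<lambda>c. br (p (ad H b (ad H a c))))))"
      by (simp only: B_comm[of v u])
  qed (simp_all add: l)
qed

lemma ad_one_left [simp]: "ad H 1 a = a"
proof (rule lk_separate)
  fix p assume p: "lk p"
  then show "p (ad H 1 a) = p a"
    using lk_comp[OF p] by (simp add: ad_lk sw_one)
qed

lemma ad_one_right [simp]: "ad H x 1 = scal H (\<epsilon> x) 1"
  by (rule lk_separate) (simp add: ad_lk sw_antipode lkD(2))

text \<open>The conjugate \<open>pc u v\<close> of a point is a point, so evaluation there splits
  the coproduct; reading \<open>pc\<close> as \<open>ad\<close> again gives the right hand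
  side.\<close>

lemma sw_ad:
  assumes "lk2 F"
  shows "sw H (ad H x a) F = sw H x (\<lambda>x1 x2. sw H a (\<lambda>a1 a2. F (ad H x1 a1) (ad H x2 a2)))"
proof (rule univ_eq2[where E = "\<lambda>x a. sw H (ad H x a) F" and
      E' = "\<lambda>x a. sw H x (\<lambda>x1 x2. sw H a (\<lambda>a1 a2. F (ad H x1 a1) (ad H x2 a2)))"])
  note l = lk_comp[of "F y" for y] lk_comp[of "\<lambda>x. F x y" for y]
  have lF: "la h \<Longrightarrow> lk (\<lambda>x. F y (h x))" "la h \<Longrightarrow> lk (\<lambda>x. F (h x) y)" for h y
    using assms l by auto
  show "lk2 (\<lambda>x a. sw H (ad H x a) F)"
    "lk2 (\<lambda>x a. sw H x (\<lambda>x1 x2. sw H a (\<lambda>a1 a2. F (ad H x1 a1) (ad H x2 a2))))"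
    by (simp_all add: lF)
  fix u v assume g: "gl u" "gl v"
  have "B u (\<lambda>x. B v (\<lambda>a. br (sw H (ad H x a) F))) = B (pc u v) (\<lambda>z. br (sw H z F))"
    by (rule B_pc[symmetric]) (simp_all add: lF g)
  also have "\<dots> = B u (\<lambda>x. B v (\<lambda>a. B u (\<lambda>x'. B v (\<lambda>a'. br (F (ad H x a) (ad H x' a'))))))"
    by (simp add: br_sw B_gl B_pc lF g)
  also have "\<dots> = B u (\<lambda>x. B u (\<lambda>x'. B v (\<lambda>a. B v (\<lambda>a'. br (F (ad H x a) (ad H x' a'))))))"
    by (simp only: B_comm[of v u])
  also have "\<dots> = B u (\<lambda>a. B v (\<lambda>b. br (sw H a (\<lambda>x1 x2. sw H b (\<lambda>a1 a2. F (ad H x1 a1) (ad H x2 a2))))))"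
    by (simp add: br_sw B_sw B_gl lF g)
  finally show "B u (\<lambda>x. B v (\<lambda>a. br (sw H (ad H x a) F))) =
    B u (\<lambda>a. B v (\<lambda>b. br (sw H a (\<lambda>x1 x2. sw H b (\<lambda>a1 a2. F (ad H x1 a1) (ad H x2 a2))))))" .
qed

lemma sw_ad_r: "lr2 (\<lambda>x y. F x y) \<Longrightarrow> sw H (ad H x a) (\<lambda>x y. F x y) =
    sw H x (\<lambda>x1 x2. sw H a (\<lambda>a1 a2. F (ad H x1 a1) (ad H x2 a2)))"
  by (rule ext, simp add: sw_apply lr_def del: split_paired_All, rule sw_ad)
    (simp del: split_paired_All)

text \<open>The two stages of a computation at points. \<open>expand_B\<close> turns Sweedler sums,
  products, \<open>S\<close> and \<open>ad\<close> into nested evaluations; \<open>split_B\<close>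
  then factors the evaluated product, so that each cochain or form keeps its own
  evaluations.\<close>

lemmas expand_B = br_sw B_sw B_gl B_pc B_pm B_pinv B_pone sw_mult_r sw_S_r sw_ad_r sw_cmult cv_sw
lemmas split_B = br_mult B_cv_left B_cv_right R.cv_assoc

section \<open>The space of D(A) and its matrix coefficients\<close>

definition lf :: "(('a \<Rightarrow> 'k) \<Rightarrow> 'k) \<Rightarrow> bool" where "lf F \<longleftrightarrow> lin_on (dual H) base F"

lemma dual_simps [simp]: "carr (dual H) = {f. lk f}" "smult (dual H) = fscale" "unit (dual H) = \<epsilon>"
  "mult (dual H) = (\<lambda>f g a. sw H a (\<lambda>a1 a2. f a1 * g a2))"
  by (simp_all add: dual_def lk_def)

lemma vec_space_dual: "vec_space (dual H)"
proof -
  interpret vector_space "fscale :: 'k \<Rightarrow> ('a \<Rightarrow> 'k) \<Rightarrow> 'a \<Rightarrow> 'k" by (rule vector_space_fscale)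
  have "subspace {f. lk f}"
    by (rule subspaceI) (auto simp: lk_iff fscale_def algebra_simps)
  then show ?thesis unfolding vec_space_def dual_simps by (simp add: vector_space_axioms)
qed

lemma lf_simps [simp]: "lf (\<lambda>f. f a)" "lf F \<Longrightarrow> lf (\<lambda>f. c * F f)" "lf F \<Longrightarrow> lf (\<lambda>f. F f * c)"
  by (auto simp: lf_def lin_on_def fscale_def algebra_simps)

lemma lf_sw [simp]: "(\<And>x y. lf (\<lambda>f. F f x y)) \<Longrightarrow> lf (\<lambda>f. sw H a (\<lambda>x y. F f x y))"
  unfolding sw_trep lf_def split_def
  by (rule lin_on_sum_list_fun[OF vec_space_base]) auto

abbreviation Dsp where "Dsp \<equiv> tensor_space (dual H) A"

lemma D_space_eq: "D_space H = Dsp" by (simp add: D_space_def)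

lemma vec_space_D: "vec_space Dsp" by (rule vec_space_tensor[OF vec_space_dual])

lemma dten_carr [simp]: "lk f \<Longrightarrow> dten H f x \<in> carr Dsp"
  unfolding dten_def by (rule tens_carr) simp_all

text \<open>Matrix coefficients: an element of D(A) is tested with an argument \<open>a\<close> of
  its first factor and a linear form \<open>p\<close> on its second. By \<open>D_zero\<close> they
  separate the elements.\<close>

definition e1 :: "'a \<Rightarrow> ('a \<Rightarrow> 'k) \<Rightarrow> _ \<Rightarrow> 'k" where
  "e1 a p s = tsum (dual H) A s (\<lambda>f x. f a * p x)"

lemma e1_bilin: "lk p \<Longrightarrow> bilin_on (dual H) A base (\<lambda>f x. f a * p x)"
  unfolding bilin_on_def using lk_comp[of p] by (auto simp flip: lf_def lk_def)

lemma e1_lin: "lk p \<Longrightarrow> lin_on Dsp base (e1 a p)"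
  unfolding e1_def by (rule tsum_lin[OF vec_space_dual vec_space_base e1_bilin])

lemma e1_dten [simp]: "lk p \<Longrightarrow> lk f \<Longrightarrow> e1 a p (dten H f x) = f a * p x"
  unfolding e1_def dten_def by (rule tsum_tens[OF vec_space_base e1_bilin]) simp_all

lemma D_zero:
  assumes "s \<in> carr Dsp" "\<And>a p. lk p \<Longrightarrow> e1 a p s = 0"
  shows "s = 0"
proof (rule tensor_separate[OF vec_space_dual vec_space_A assms(1), where \<Phi> = "range (\<lambda>a f. f a)" and \<Psi> = "{p. lk p}"])
  show "lin_on (dual H) base \<phi>" if "\<phi> \<in> range (\<lambda>a f. f a)" for \<phi>
    using that by (auto simp flip: lf_def)
  show "v = 0" if "\<And>\<phi>. \<phi> \<in> range (\<lambda>a f. f a) \<Longrightarrow> \<phi> v = 0" for v :: "'a \<Rightarrow> 'k"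
    using that by (intro ext) (auto simp: zero_fun_def)
  show "x = 0" if *: "\<And>p. p \<in> {p. lk p} \<Longrightarrow> p x = 0" for x
  proof (rule lk_separate)
    fix p assume "lk p" then show "p x = p 0" using *[of p] lkD(3)[of p] by simp
  qed
qed (use assms(2) in \<open>auto simp: lk_def e1_def\<close>)

lemma D_ext:
  assumes "s \<in> carr Dsp" "s' \<in> carr Dsp" "\<And>a p. lk p \<Longrightarrow> e1 a p s = e1 a p s'"
  shows "s = s'"
  using D_zero[of "s - s'"] assms lin_on_diff[OF vec_space_D e1_lin]
  by (simp add: vec_space_diff[OF vec_space_D])

lemma e1_sw: "lk p \<Longrightarrow> (\<And>x y. F x y \<in> carr Dsp) \<Longrightarrow> e1 a p (sw H b F) = sw H b (\<lambda>x y. e1 a p (F x y))"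
  by (rule lin_on_sw[OF vec_space_D e1_lin])

lemma lin_on_D:
  assumes "vec_space V" "\<And>v. v \<in> carr V \<Longrightarrow> F v \<in> carr Dsp"
    and "\<And>a p. lk p \<Longrightarrow> lin_on V base (\<lambda>v. e1 a p (F v))"
  shows "lin_on V Dsp F"
  unfolding lin_on_def
proof (intro conjI ballI allI)
  fix x assume x: "x \<in> carr V"
  show "F x \<in> carr Dsp" using assms(2)[OF x] .
  show "F (x + y) = F x + F y" if y: "y \<in> carr V" for y
  proof (rule D_ext)
    show "e1 a p (F (x + y)) = e1 a p (F x + F y)" if p: "lk p" for a p
      using lin_onD(2)[OF assms(3)[OF p] x y] lin_onD(2)[OF e1_lin[OF p] assms(2)[OF x] assms(2)[OF y]]
      by simp
  qed (intro assms(2) vec_space_add[OF assms(1)] vec_space_add[OF vec_space_D] x y)+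
  show "F (smult V c x) = smult Dsp c (F x)" for c
  proof (rule D_ext)
    show "e1 a p (F (smult V c x)) = e1 a p (smult Dsp c (F x))" if p: "lk p" for a p
      using lin_onD(3)[OF assms(3)[OF p] x] lin_onD(3)[OF e1_lin[OF p] assms(2)[OF x]]
      by simp
  qed (intro assms(2) vec_space_scale[OF assms(1)] vec_space_scale[OF vec_space_D] x)+
qed

lemma sw_D_carr [simp]: "(\<And>x y. F x y \<in> carr Dsp) \<Longrightarrow> sw H a F \<in> carr Dsp"
  by (rule sw_carr[OF vec_space_D])

end

context cochain_data
begin

section \<open>The product of D(A)\<close>

definition dm where
  "dm f x h y = sw4 H x (\<lambda>x1 x2 x3 x4. sw H y (\<lambda>y1 y2.
       dten H (mult (dual H) (mult (dual H) f (lact x1 (ract h (S x2)))) (\<lambda>a. tc [x3, y1] [a])) (x4 * y2)))"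

lemma D_mult_dm: "D_mult H tc s r = tsum (dual H) A s (\<lambda>f x. tsum (dual H) A r (\<lambda>h y. dm f x h y))"
  by (simp add: D_mult_def dsum_def dm_def)

lemma lk_mult_dual [simp]: "lk f \<Longrightarrow> lk h \<Longrightarrow> lk (\<lambda>a. sw H a (\<lambda>a1 a2. f a1 * h a2))"
  using lk_comp[of f] lk_comp[of h] by simp

lemma dm_carr [simp]: "lk f \<Longrightarrow> lk h \<Longrightarrow> dm f x h y \<in> carr Dsp"
  unfolding dm_def sw4_def sw3_def lact_def ract_def t_def[symmetric]
  by (intro sw_D_carr dten_carr) (use lk_comp[of f] lk_comp[of h] in simp)

text \<open>By cocommutativity the Sweedler components of \<open>x\<close> in the product of \<open>D(A)\<close> can be permuted so
  that two adjacent ones act through \<open>ad\<close>.\<close>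

definition dmF where
  "dmF f h x1 y1 = (\<lambda>a. sw H a (\<lambda>a1 a2. sw H a2 (\<lambda>a2 a3. sw H x1 (\<lambda>x1 x2.
     f a1 * (h (ad H x1 a2) * t x2 y1 a3)))))"

lemma lk_dmF [simp]:
  assumes "lk f" "lk h"
  shows "la k \<Longrightarrow> lk (\<lambda>a. dmF f h x y (k a))" "la k \<Longrightarrow> lk (\<lambda>x. dmF f h (k x) y a)"
    "la k \<Longrightarrow> lk (\<lambda>y. dmF f h x (k y) a)"
  unfolding dmF_def using lk_comp[OF assms(1)] lk_comp[OF assms(2)] by simp_all

lemma lk_dmF' [simp]: "lk f \<Longrightarrow> lk h \<Longrightarrow> lk (dmF f h x y)"
  using lk_dmF(1)[of f h "\<lambda>x. x"] by simp

lemma dm_eval: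
  assumes f: "lk f" and h: "lk h" and p: "lk p"
  shows "e1 a p (dm f x h y) =
    sw H x (\<lambda>x1 x2. sw H y (\<lambda>y1 y2. dmF f h x1 y1 a * p (x2 * y2)))"
proof -
  note l = lk_comp[OF f] lk_comp[OF h] lk_comp[OF p]
  let ?E = "\<lambda>a x y. sw4 H x (\<lambda>x1 x2 x3 x4. sw H y (\<lambda>y1 y2. sw H a (\<lambda>a1 a2.
     sw H a1 (\<lambda>a11 a12. f a11 * h (S x2 * (a12 * x1))) * t x3 y1 a2) * p (x4 * y2)))"
  have "e1 a p (dm f x h y) = ?E a x y"
    unfolding dm_def sw4_def sw3_def lact_def ract_def t_def[symmetric]
    by (simp add: e1_sw p l f h)
  also have "\<dots> = sw H x (\<lambda>x1 x2. sw H y (\<lambda>y1 y2. dmF f h x1 y1 a * p (x2 * y2)))"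
  proof (rule univ_eq3[where E = ?E and E' = "\<lambda>a x y. sw H x (\<lambda>x1 x2. sw H y (\<lambda>y1 y2. dmF f h x1 y1 a * p (x2 * y2)))"])
    show "lk3 ?E" unfolding sw4_def sw3_def by (simp add: l)
    show "lk3 (\<lambda>a x y. sw H x (\<lambda>x1 x2. sw H y (\<lambda>y1 y2. dmF f h x1 y1 a * p (x2 * y2))))"
      by (simp add: l f h)
    fix u v s assume g: "gl u" "gl v" "gl s"
    \<comment> \<open>The product formula for a group: f(u) h(v^-1 u v) \<theta>(v, s)(u) sits over
      the group element v s, on which \<open>p\<close> is evaluated.\<close>
    let ?R = "F1 f u \<odot> F1 h (pc v u) \<odot> T t v s u \<odot> F1 p (pm v s)"
    have "B u (\<lambda>a. B v (\<lambda>x. B s (\<lambda>y. br (?E a x y)))) = ?R"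
      unfolding sw4_def sw3_def F1_def T_def pc_def
      apply (simp add: expand_B l g)
      apply (simp add: split_B)
      apply (simp only: B_comm[of v u] B_comm[of s u] B_comm[of s v])
      \<comment> \<open>In \<open>dm\<close> the component under \<open>S\<close> is the second one,
        in \<open>ad\<close> it is the first; cocommutativity appears as the exchange of two
        evaluations at the same point.\<close>
      apply (subst B_comm[of v v], rule refl)
      done
    moreover have "B u (\<lambda>a. B v (\<lambda>x. B s (\<lambda>y. br (sw H x (\<lambda>x1 x2. sw H y (\<lambda>y1 y2. dmF f h x1 y1 a * p (x2 * y2))))))) = ?R"
      unfolding dmF_def F1_def T_def
      apply (simp add: expand_B l g)
      apply (simp add: split_B)
      apply (simp only: B_comm[of v u] B_comm[of s u] B_comm[of s v])
      done
    ultimately show "B u (\<lambda>a. B v (\<lambda>x. B s (\<lambda>y. br (?E a x y)))) =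
      B u (\<lambda>a. B v (\<lambda>x. B s (\<lambda>y. br (sw H x (\<lambda>x1 x2. sw H y (\<lambda>y1 y2. dmF f h x1 y1 a * p (x2 * y2)))))))"
      by simp
  qed
  finally show ?thesis .
qed

lemma lin_on_cong:
  "vec_space V \<Longrightarrow> lin_on V W F \<Longrightarrow> (\<And>v. v \<in> carr V \<Longrightarrow> G v = F v) \<Longrightarrow> lin_on V W G"
  unfolding lin_on_def by (simp add: vec_space_add vec_space_scale)

lemma dm_bilin_right: "lk f \<Longrightarrow> bilin_on (dual H) A Dsp (dm f x)"
  unfolding bilin_on_def
proof (intro conjI ballI)
  assume f: "lk f"
  show "lin_on A Dsp (dm f x h)" if "h \<in> carr (dual H)" for h
  proof (rule lin_on_D[OF vec_space_A])
    fix a p assume p: "lk p"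
    show "lin_on A base (\<lambda>y. e1 a p (dm f x h y))"
      using that by (simp add: dm_eval f p lk_comp[OF p] flip: lk_def)
  qed (use that f in simp)
  show "lin_on (dual H) Dsp (\<lambda>h. dm f x h y)" for y
  proof (rule lin_on_D[OF vec_space_dual])
    fix a p assume p: "lk p"
    have "lf (\<lambda>h. sw H x (\<lambda>x1 x2. sw H y (\<lambda>y1 y2. dmF f h x1 y1 a * p (x2 * y2))))"
      unfolding dmF_def by simp
    then show "lin_on (dual H) base (\<lambda>h. e1 a p (dm f x h y))"
      unfolding lf_def by (rule lin_on_cong[OF vec_space_dual]) (simp add: dm_eval f p)
  qed (use f in simp)
qed

lemma dm_bilin_left: "lk h \<Longrightarrow> bilin_on (dual H) A Dsp (\<lambda>f x. dm f x h y)"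
  unfolding bilin_on_def
proof (intro conjI ballI)
  assume h: "lk h"
  show "lin_on A Dsp (\<lambda>x. dm f x h y)" if "f \<in> carr (dual H)" for f
  proof (rule lin_on_D[OF vec_space_A])
    fix a p assume p: "lk p"
    show "lin_on A base (\<lambda>x. e1 a p (dm f x h y))"
      using that by (simp add: dm_eval h p lk_comp[OF p] flip: lk_def)
  qed (use that h in simp)
  show "lin_on (dual H) Dsp (\<lambda>f. dm f x h y)" for x
  proof (rule lin_on_D[OF vec_space_dual])
    fix a p assume p: "lk p"
    have "lf (\<lambda>f. sw H x (\<lambda>x1 x2. sw H y (\<lambda>y1 y2. dmF f h x1 y1 a * p (x2 * y2))))"
      unfolding dmF_def by simp
    then show "lin_on (dual H) base (\<lambda>f. e1 a p (dm f x h y))"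
      unfolding lf_def by (rule lin_on_cong[OF vec_space_dual]) (simp add: dm_eval h p)
  qed (use h in simp)
qed

abbreviation D where "D \<equiv> D_alg H tc"

lemma D_simps [simp]: "carr D = carr Dsp" "smult D = fscale" "mult D = D_mult H tc" "unit D = dten H \<epsilon> 1"
  by (simp_all add: D_alg_def D_space_eq D_unit_def smult_tensor_space)

lemma lin_on_D_alg: "lin_on V D f = lin_on V Dsp f" "lin_on D V h = lin_on Dsp V h"
  by (simp_all add: lin_on_def smult_tensor_space)

lemma bilin_on_D_alg: "bilin_on V W D f = bilin_on V W Dsp f" "bilin_on D W U f' = bilin_on Dsp W U f'"
  "bilin_on V D U f'' = bilin_on V Dsp U f''"
  by (simp_all add: bilin_on_def lin_on_D_alg)

lemma vec_space_D_alg: "vec_space D"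
  using vec_space_D by (simp add: vec_space_def smult_tensor_space)

lemma D_mult_bilin: "bilin_on Dsp Dsp Dsp (D_mult H tc)"
  unfolding bilin_on_def D_mult_dm
proof (intro conjI ballI)
  show "lin_on Dsp Dsp (\<lambda>r. tsum (dual H) A s (\<lambda>f x. tsum (dual H) A r (dm f x)))" if "s \<in> carr Dsp" for s
    by (rule lin_on_tsum_fun[OF vec_space_D that], rule tsum_lin[OF vec_space_dual vec_space_D dm_bilin_right]) simp
  show "lin_on Dsp Dsp (\<lambda>s. tsum (dual H) A s (\<lambda>f x. tsum (dual H) A r (dm f x)))" if "r \<in> carr Dsp" for r
    by (rule tsum_lin[OF vec_space_dual vec_space_D], rule bilin_on_tsum_fun[OF vec_space_D that], rule dm_bilin_left) simp
qed

lemma D_mult_dten: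
  assumes f: "lk f" and h: "lk h"
  shows "D_mult H tc (dten H f x) (dten H h y) = dm f x h y"
proof -
  have c: "dten H h y \<in> carr Dsp" using h by simp
  have b: "bilin_on (dual H) A Dsp (\<lambda>f x. tsum (dual H) A (dten H h y) (\<lambda>h y. dm f x h y))"
    by (rule bilin_on_tsum_fun[OF vec_space_D c], rule dm_bilin_left) simp
  have "D_mult H tc (dten H f x) (dten H h y) = tsum (dual H) A (dten H h y) (\<lambda>h y. dm f x h y)"
    unfolding D_mult_dm dten_def[of H f x]
    by (rule tsum_tens[OF vec_space_D b]) (simp_all add: f)
  also have "\<dots> = dm f x h y"
    unfolding dten_def[of H h y] by (rule tsum_tens[OF vec_space_D dm_bilin_right[OF f]]) (simp_all add: h)
  finally show ?thesis .
qed

lemma D_mult_carr [simp]: "s \<in> carr Dsp \<Longrightarrow> r \<in> carr Dsp \<Longrightarrow> D_mult H tc s r \<in> carr Dsp"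
  by (rule bilin_onD(3)[OF D_mult_bilin])

lemma e1_mult:
  assumes "lk f" "lk h" "lk p"
  shows "e1 a p (D_mult H tc (dten H f x) (dten H h y)) =
    sw H x (\<lambda>x1 x2. sw H y (\<lambda>y1 y2. dmF f h x1 y1 a * p (x2 * y2)))"
  by (simp add: D_mult_dten dm_eval assms)

lemma D_mult_dmF:
  assumes "lk f" "lk h"
  shows "D_mult H tc (dten H f x) (dten H h y) = sw H x (\<lambda>x1 x2. sw H y (\<lambda>y1 y2. dten H (dmF f h x1 y1) (x2 * y2)))"
  by (rule D_ext) (simp_all add: assms e1_mult e1_sw)

lemma D_mult_sw:
  assumes "\<And>x y. F x y \<in> carr Dsp" "r \<in> carr Dsp"
  shows "D_mult H tc (sw H b F) r = sw H b (\<lambda>x y. D_mult H tc (F x y) r)"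
    "D_mult H tc r (sw H b F) = sw H b (\<lambda>x y. D_mult H tc r (F x y))"
  by (rule lin_on_sw[OF vec_space_D bilin_onD(2)[OF D_mult_bilin assms(2)] assms(1)])
    (rule lin_on_sw[OF vec_space_D bilin_onD(1)[OF D_mult_bilin assms(2)] assms(1)])

lemma D_lin_ext:
  assumes "lin_on Dsp U F" "lin_on Dsp U G" "\<And>f x. lk f \<Longrightarrow> F (dten H f x) = G (dten H f x)" "s \<in> carr Dsp"
  shows "F s = G s"
  by (rule tensor_lin_ext[OF vec_space_dual assms(1,2) _ assms(4)]) (use assms(3) in \<open>simp add: dten_def\<close>)

lemma lk_eps0 [simp]: "lk \<epsilon>" by (rule lk_eps')

section \<open>Unit and associativity\<close>

lemma D_unit_left: "s \<in> carr Dsp \<Longrightarrow> D_mult H tc (dten H \<epsilon> 1) s = s"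
proof (rule D_lin_ext[OF bilin_onD(1)[OF D_mult_bilin] lin_on_id(2)])
  fix f x assume f: "lk f"
  note l = lk_comp[OF f]
  show "D_mult H tc (dten H \<epsilon> 1) (dten H f x) = dten H f x"
  proof (rule D_ext)
    fix a p assume p: "lk p"
    show "e1 a p (D_mult H tc (dten H \<epsilon> 1) (dten H f x)) = e1 a p (dten H f x)"
    proof (simp add: e1_mult f p, rule univ_eq2[where E = "\<lambda>a x. sw H 1 (\<lambda>x1 x2. sw H x (\<lambda>y1 y2. dmF \<epsilon> f x1 y1 a * p (x2 * y2)))"])
      fix u v assume g: "gl u" "gl v"
      show "B u (\<lambda>a. B v (\<lambda>x. br (sw H 1 (\<lambda>x1 x2. sw H x (\<lambda>y1 y2. dmF \<epsilon> f x1 y1 a * p (x2 * y2)))))) =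
        B u (\<lambda>a. B v (\<lambda>x. br (f a * p x)))"
        unfolding dmF_def
        by (simp add: expand_B sw_one_r l g p lk_comp[OF p] sw_S_eps)
          (simp add: split_B g)
    qed (simp_all add: f p l lk_comp[OF p])
  qed (simp_all add: f)
qed simp

lemma D_unit_right: "s \<in> carr Dsp \<Longrightarrow> D_mult H tc s (dten H \<epsilon> 1) = s"
proof (rule D_lin_ext[OF bilin_onD(2)[OF D_mult_bilin] lin_on_id(2)])
  fix f x assume f: "lk f"
  note l = lk_comp[OF f]
  show "D_mult H tc (dten H f x) (dten H \<epsilon> 1) = dten H f x"
  proof (rule D_ext)
    fix a p assume p: "lk p"
    show "e1 a p (D_mult H tc (dten H f x) (dten H \<epsilon> 1)) = e1 a p (dten H f x)"
    proof (simp add: e1_mult f p, rule univ_eq2[where E = "\<lambda>a x. sw H x (\<lambda>x1 x2. sw H 1 (\<lambda>y1 y2. dmF f \<epsilon> x1 y1 a * p (x2 * y2)))"])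
      fix u v assume g: "gl u" "gl v"
      show "B u (\<lambda>a. B v (\<lambda>x. br (sw H x (\<lambda>x1 x2. sw H 1 (\<lambda>y1 y2. dmF f \<epsilon> x1 y1 a * p (x2 * y2)))))) =
        B u (\<lambda>a. B v (\<lambda>x. br (f a * p x)))"
        unfolding dmF_def
        by (simp add: expand_B sw_one_r l g p lk_comp[OF p] ad_lk sw_S_eps)
          (simp add: split_B g)
    qed (simp_all add: f p l lk_comp[OF p])
  qed (simp_all add: f)
qed simp

text \<open>Both bracketings carry \<open>f\<close>, \<open>h\<close>, \<open>k\<close>,
  \<open>p\<close> at the same points, since conjugation by v s is conjugation by v followed by s.
  They differ in the two \<theta> factors, which are the two sides of \<open>cond3\<close>.\<close>

lemma assoc_left_points:
  assumes f: "lk f" "lk h" "lk k" "lk p" and g: "gl u" "gl v" "gl s" "gl q"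
  shows "B u (\<lambda>a. B v (\<lambda>x. B s (\<lambda>y. B q (\<lambda>z. br (e1 a p
      (D_mult H tc (D_mult H tc (dten H f x) (dten H h y)) (dten H k z))))))) =
    F1 f u \<odot> F1 h (pc v u) \<odot> T t v s u \<odot> F1 k (pc s (pc v u)) \<odot> T t (pm v s) q u \<odot> F1 p (pm v (pm s q))"
proof -
  note l = lk_comp[OF f(1)] lk_comp[OF f(2)] lk_comp[OF f(3)] lk_comp[OF f(4)]
  show ?thesis
    apply (simp add: D_mult_dmF D_mult_sw e1_sw l f)
    unfolding dmF_def F1_def T_def
    apply (simp add: expand_B l g ad_mult del: pc_simps)
    apply (simp add: split_B del: pc_simps)
    apply (simp only: B_comm[of v u] B_comm[of s u] B_comm[of s v] B_comm[of q u] B_comm[of q v] B_comm[of q s])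
    apply (simp add: cv_ac mult.assoc)
    done
qed

lemma assoc_right_points:
  assumes f: "lk f" "lk h" "lk k" "lk p" and g: "gl u" "gl v" "gl s" "gl q"
  shows "B u (\<lambda>a. B v (\<lambda>x. B s (\<lambda>y. B q (\<lambda>z. br (e1 a p
      (D_mult H tc (dten H f x) (D_mult H tc (dten H h y) (dten H k z)))))))) =
    F1 f u \<odot> F1 h (pc v u) \<odot> F1 k (pc s (pc v u)) \<odot> T t s q (pc v u) \<odot> T t v (pm s q) u \<odot> F1 p (pm v (pm s q))"
proof -
  note l = lk_comp[OF f(1)] lk_comp[OF f(2)] lk_comp[OF f(3)] lk_comp[OF f(4)]
  show ?thesis
    apply (simp add: D_mult_dmF D_mult_sw e1_sw l f)
    unfolding dmF_def F1_def T_def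
    apply (simp add: expand_B l g ad_mult del: pc_simps)
    apply (simp add: split_B del: pc_simps)
    apply (simp only: B_comm[of v u] B_comm[of s u] B_comm[of s v] B_comm[of q u] B_comm[of q v] B_comm[of q s])
    done
qed

lemma lk_dmF_slots [simp]:
  "(\<And>a. lk (\<lambda>x. F x a)) \<Longrightarrow> lk (\<lambda>x. dmF (F x) h y z b)"
  "(\<And>a. lk (\<lambda>x. F x a)) \<Longrightarrow> lk (\<lambda>x. dmF f (F x) y z b)"
  unfolding dmF_def by simp_all

lemma D_assoc_iff:
  "(\<forall>s\<in>carr Dsp. \<forall>r\<in>carr Dsp. \<forall>q\<in>carr Dsp.
     D_mult H tc (D_mult H tc s r) q = D_mult H tc s (D_mult H tc r q)) \<longleftrightarrow> cond3" (is "?A \<longleftrightarrow> _")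
proof
  assume as: ?A
  show cond3 unfolding cond3_def
  proof (intro allI impI)
    fix x y z a assume g: "gl x" "gl y" "gl z" "gl a"
    \<comment> \<open>With all free forms equal to the counit only the \<theta> factors
      remain.\<close>
    have "B a (\<lambda>a. B x (\<lambda>x. B y (\<lambda>y. B z (\<lambda>z. br (e1 a \<epsilon>
        (D_mult H tc (D_mult H tc (dten H \<epsilon> x) (dten H \<epsilon> y)) (dten H \<epsilon> z))))))) =
      B a (\<lambda>a. B x (\<lambda>x. B y (\<lambda>y. B z (\<lambda>z. br (e1 a \<epsilon>
        (D_mult H tc (dten H \<epsilon> x) (D_mult H tc (dten H \<epsilon> y) (dten H \<epsilon> z))))))))"
      using as by simp
    then show "T t (pm x y) z a \<odot> T t x y a = T t y z (pc x a) \<odot> T t x (pm y z) a"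
      using g by (simp add: assoc_left_points assoc_right_points) (simp add: R.cv_comm)
  qed
next
  assume c: cond3
  note cc = c[unfolded cond3_def, rule_format]
  note l1 = bilin_onD(1)[OF D_mult_bilin] and l2 = bilin_onD(2)[OF D_mult_bilin]
  have el: "D_mult H tc (D_mult H tc (dten H f x) (dten H h y)) (dten H k z) =
      D_mult H tc (dten H f x) (D_mult H tc (dten H h y) (dten H k z))"
    if f: "lk f" "lk h" "lk k" for f h k x y z
  proof (rule D_ext)
    fix a p assume p: "lk p"
    let ?E = "\<lambda>a x y z. e1 a p (D_mult H tc (D_mult H tc (dten H f x) (dten H h y)) (dten H k z))"
    let ?E' = "\<lambda>a x y z. e1 a p (D_mult H tc (dten H f x) (D_mult H tc (dten H h y) (dten H k z)))"
    \<comment> \<open>One functional argument and three group variables exhaust the four universal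
      points.\<close>
    show "?E a x y z = ?E' a x y z"
    proof (rule univ_eq)
      note l = lk_comp[OF p]
      show "lk4 ?E" "lk4 ?E'"
        by (simp_all add: D_mult_dmF D_mult_sw e1_sw l f p)
      have "T t s q (pc v u) \<odot> T t v (pm s q) u \<odot> X = T t v s u \<odot> T t (pm v s) q u \<odot> X"
        if "gl v" "gl s" "gl q" "gl u" for v s q u X
      proof -
        have "(T t s q (pc v u) \<odot> T t v (pm s q) u) \<odot> X = (T t (pm v s) q u \<odot> T t v s u) \<odot> X"
          by (simp only: cc[OF that])
        then show ?thesis by (simp add: R.cv_assoc R.cv_left_comm)
      qed
      then show "B U1 (\<lambda>a. B U2 (\<lambda>b. B U3 (\<lambda>c. B U4 (\<lambda>d. br (?E a b c d))))) =
         B U1 (\<lambda>a. B U2 (\<lambda>b. B U3 (\<lambda>c. B U4 (\<lambda>d. br (?E' a b c d)))))"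
        unfolding assoc_left_points[OF f p gl_U] assoc_right_points[OF f p gl_U]
        by (simp add: R.cv_left_comm[of "F1 k _"] del: pc_simps)
    qed
  qed (simp_all add: f)
  show ?A
  proof (intro ballI)
    fix s r q assume s: "s \<in> carr Dsp" and r: "r \<in> carr Dsp" and q: "q \<in> carr Dsp"
    show "D_mult H tc (D_mult H tc s r) q = D_mult H tc s (D_mult H tc r q)"
    proof (rule D_lin_ext[OF lin_on_comp[OF l2 l2] l2 _ s])
      fix f x assume f: "lk f"
      show "D_mult H tc (D_mult H tc (dten H f x) r) q = D_mult H tc (dten H f x) (D_mult H tc r q)"
      proof (rule D_lin_ext[OF lin_on_comp[OF l1 l2] lin_on_comp[OF l2 l1] _ r])
        fix h y assume h: "lk h"
        show "D_mult H tc (D_mult H tc (dten H f x) (dten H h y)) q = D_mult H tc (dten H f x) (D_mult H tc (dten H h y) q)"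
          by (rule D_lin_ext[OF l1 lin_on_comp[OF l1 l1] _ q]) (simp_all add: f h el)
      qed (simp_all add: f q)
    qed (simp_all add: r q)
  qed
qed

lemma kalgebra_D_iff: "kalgebra D \<longleftrightarrow> cond3"
  unfolding kalgebra_def using D_assoc_iff D_mult_bilin
  by (simp add: vec_space_D_alg bilin_on_D_alg D_unit_left D_unit_right)

end

section \<open>Evaluation of tensors\<close>

text \<open>Packages the hypotheses of \<open>tensor_separate\<close>, so that separating families
  can be multiplied repeatedly, up to the fourth tensor power of D(A).\<close>

definition separates ::
  "('k::field, 'v::ab_group_add, 'm) vspace_scheme \<Rightarrow> ('v \<Rightarrow> 'k) set \<Rightarrow> bool" where
  "separates V \<Phi> \<longleftrightarrow> (\<forall>\<phi>\<in>\<Phi>. lin_on V base \<phi>) \<and> (\<forall>v\<in>carr V. (\<forall>\<phi>\<in>\<Phi>. \<phi> v = 0) \<longrightarrow> v = 0)"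

lemma separates_eq:
  assumes "vec_space V" "separates V \<Phi>" "v \<in> carr V" "v' \<in> carr V" "\<And>\<phi>. \<phi> \<in> \<Phi> \<Longrightarrow> \<phi> v = \<phi> v'"
  shows "v = v'"
proof -
  have "v - v' = 0"
    using assms(2) vec_space_diff[OF assms(1,3,4)] assms(5) lin_on_diff[OF assms(1) _ assms(3,4), of base]
    unfolding separates_def by (metis right_minus_eq)
  then show ?thesis by simp
qed

lemma separates_lin_on:
  assumes "vec_space X" "vec_space V" "separates V \<Phi>" "\<And>x. x \<in> carr X \<Longrightarrow> F x \<in> carr V"
    and "\<And>\<phi>. \<phi> \<in> \<Phi> \<Longrightarrow> lin_on X base (\<lambda>x. \<phi> (F x))"
  shows "lin_on X V F"
  unfolding lin_on_def
proof (intro conjI ballI allI)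
  have lin: "lin_on V base \<phi>" if "\<phi> \<in> \<Phi>" for \<phi> using that assms(3) by (simp add: separates_def)
  fix x assume x: "x \<in> carr X"
  show "F x \<in> carr V" using assms(4)[OF x] .
  show "F (x + y) = F x + F y" if y: "y \<in> carr X" for y
  proof (rule separates_eq[OF assms(2,3)])
    show "\<phi> (F (x + y)) = \<phi> (F x + F y)" if "\<phi> \<in> \<Phi>" for \<phi>
      using lin_onD(2)[OF assms(5)[OF that] x y] lin_onD(2)[OF lin[OF that] assms(4)[OF x] assms(4)[OF y]]
      by simp
  qed (intro assms(4) vec_space_add[OF assms(1)] vec_space_add[OF assms(2)] x y)+
  show "F (smult X c x) = smult V c (F x)" for c
  proof (rule separates_eq[OF assms(2,3)])
    show "\<phi> (F (smult X c x)) = \<phi> (smult V c (F x))" if "\<phi> \<in> \<Phi>" for \<phi>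
      using lin_onD(3)[OF assms(5)[OF that] x] lin_onD(3)[OF lin[OF that] assms(4)[OF x]]
      by simp
  qed (intro assms(4) vec_space_scale[OF assms(1)] vec_space_scale[OF assms(2)] x)+
qed

lemma separates_tensor:
  assumes "vec_space V" "vec_space W" "separates V \<Phi>" "separates W \<Psi>"
  shows "separates (tensor_space V W) {\<lambda>t. tsum V W t (\<lambda>v w. \<phi> v * \<psi> w) | \<phi> \<psi>. \<phi> \<in> \<Phi> \<and> \<psi> \<in> \<Psi>}"
  unfolding separates_def
proof (intro conjI ballI impI)
  show "lin_on (tensor_space V W) base \<chi>"
    if "\<chi> \<in> {\<lambda>t. tsum V W t (\<lambda>v w. \<phi> v * \<psi> w) | \<phi> \<psi>. \<phi> \<in> \<Phi> \<and> \<psi> \<in> \<Psi>}" for \<chi>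
    using that assms(3,4) unfolding separates_def
    by (auto intro!: tsum_lin[OF assms(1) vec_space_base bilin_on_base_mult])
next
  fix t assume t: "t \<in> carr (tensor_space V W)"
    and z: "\<forall>\<chi>\<in>{\<lambda>t. tsum V W t (\<lambda>v w. \<phi> v * \<psi> w) | \<phi> \<psi>. \<phi> \<in> \<Phi> \<and> \<psi> \<in> \<Psi>}. \<chi> t = 0"
  show "t = 0"
    by (rule tensor_separate[OF assms(1,2) t, where \<Phi> = \<Phi> and \<Psi> = \<Psi>])
      (use z assms(3,4) in \<open>auto simp: separates_def\<close>)
qed

lemma tsum_cmult:
  fixes c :: "'k::field"
  shows "tsum V W t (\<lambda>v w. c * F v w) = c * tsum V W t F"
    "tsum V W t (\<lambda>v w. F v w * c) = tsum V W t F * c"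
    "tsum V W t (\<lambda>v w. G v w * (c * F v w)) = c * tsum V W t (\<lambda>v w. G v w * F v w)"
    "tsum V W t (\<lambda>v w. G v w * (F v w * c)) = tsum V W t (\<lambda>v w. G v w * F v w) * c"
proof -
  have 1: "tsum V W t (\<lambda>v w. c * F v w) = c * tsum V W t F" for F
    by (simp add: tsum_trep split_def sum_list_const_mult)
  have "(\<lambda>v w. F v w * c) = (\<lambda>v w. c * F v w)" "(\<lambda>v w. G v w * (c * F v w)) = (\<lambda>v w. c * (G v w * F v w))"
    "(\<lambda>v w. G v w * (F v w * c)) = (\<lambda>v w. c * (G v w * F v w))"
    by (simp_all add: fun_eq_iff mult_ac)
  then show "tsum V W t (\<lambda>v w. c * F v w) = c * tsum V W t F"
    "tsum V W t (\<lambda>v w. F v w * c) = tsum V W t F * c"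
    "tsum V W t (\<lambda>v w. G v w * (c * F v w)) = c * tsum V W t (\<lambda>v w. G v w * F v w)"
    "tsum V W t (\<lambda>v w. G v w * (F v w * c)) = tsum V W t (\<lambda>v w. G v w * F v w) * c"
    by (simp_all only: 1 mult.commute)
qed

context cocomm_hopf
begin

section \<open>Forms in several variables as tensors of functionals\<close>

abbreviation du where "du \<equiv> tensor_space (dual H) (dual H)"

lemma separates_dual: "separates (dual H) (range (\<lambda>a f. f a))"
  unfolding separates_def by (simp add: lf_def[symmetric] fun_eq_iff)

lemma separates_D: "separates Dsp {e1 a p | a p. lk p}"
  unfolding separates_def
proof (intro conjI ballI impI)
  show "lin_on Dsp base \<phi>" if "\<phi> \<in> {e1 a p | a p. lk p}" for \<phi> using that e1_lin by auto
  show "v = 0" if "v \<in> carr Dsp" "\<forall>\<phi>\<in>{e1 a p | a p. lk p}. \<phi> v = 0" for v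
    by (rule D_zero[OF that(1)]) (use that(2) in auto)
qed

text \<open>The coordinate forms are the basis dual to \<open>Eb\<close>, which makes this an
  explicit element with the prescribed values.\<close>

definition d2 where "d2 h = (\<Sum>i\<in>Eb. \<Sum>j\<in>Eb. fscale (h i j) (tens (dual H) (dual H) (cd i) (cd j)))"

lemma lk_cd0 [simp]: "lk (cd i)" by (rule lk_cd')

lemma vec_space_du: "vec_space du" by (rule vec_space_tensor[OF vec_space_dual])

lemma fscale_carr: "vec_space (tensor_space V W) \<Longrightarrow> t \<in> carr (tensor_space V W) \<Longrightarrow> fscale c t \<in> carr (tensor_space V W)"
  using vec_space_scale[of "tensor_space V W" t c] by (simp add: smult_tensor_space)

lemma ev2_bilin: "bilin_on (dual H) (dual H) base (\<lambda>f k. f a * k b)"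
  by (rule bilin_on_base_mult) (simp_all flip: lf_def)

lemma d2_props:
  assumes h: "lk2 h"
  shows "d2 h \<in> carr du" "tsum (dual H) (dual H) (d2 h) (\<lambda>f k. f a * k b) = h a b"
proof -
  have c: "fscale (h i j) (tens (dual H) (dual H) (cd i) (cd j)) \<in> carr du" for i j
    by (intro fscale_carr vec_space_du tens_carr) simp_all
  have c2: "(\<Sum>j\<in>Eb. fscale (h i j) (tens (dual H) (dual H) (cd i) (cd j))) \<in> carr du" for i
    by (intro vec_space_sum[OF vec_space_du] c)
  show "d2 h \<in> carr du" unfolding d2_def
    by (intro vec_space_sum[OF vec_space_du] c2)
  let ?L = "\<lambda>t. tsum (dual H) (dual H) t (\<lambda>f k. f a * k b)"
  have L: "lin_on du base ?L" by (rule tsum_lin[OF vec_space_dual vec_space_base ev2_bilin])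
  have "?L (tens (dual H) (dual H) (cd i) (cd j)) = cd i a * cd j b" for i j
    by (rule tsum_tens[OF vec_space_base ev2_bilin]) simp_all
  then have e: "?L (fscale (h i j) (tens (dual H) (dual H) (cd i) (cd j))) = h i j * (cd i a * cd j b)" for i j
    using lin_onD(3)[OF L tens_carr[of "cd i" "dual H" "cd j"]] by (simp add: smult_tensor_space)
  have "?L (d2 h) = (\<Sum>i\<in>Eb. \<Sum>j\<in>Eb. h i j * (cd i a * cd j b))"
    unfolding d2_def by (simp add: lin_on_sum[OF vec_space_du L] c c2 e)
  also have "\<dots> = (\<Sum>i\<in>Eb. cd i a * (\<Sum>j\<in>Eb. cd j b * h i j))"
    by (simp add: sum_distrib_left mult_ac)
  also have "\<dots> = h a b"
    using lk_expand[of "\<lambda>b. h i b" b for i] lk_expand[of "\<lambda>a. h a b" a] h by simp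
  finally show "?L (d2 h) = h a b" .
qed

text \<open>Evaluations separate the tensor square of the dual, so the definite description has the
  explicit element as its only candidate.\<close>

lemma dual_tensor2_eq:
  assumes h: "lk2 h"
  shows "dual_tensor2 H h = d2 h"
  unfolding dual_tensor2_def
proof (rule the_equality)
  have cT: "carr (dual H \<otimes>\<^sub>A dual H) = carr du" by (simp add: tensor_alg_simps)
  show "d2 h \<in> carr (dual H \<otimes>\<^sub>A dual H) \<and> (\<forall>a b. tsum (dual H) (dual H) (d2 h) (\<lambda>f g. f a * g b) = h a b)"
    using d2_props[OF h] unfolding cT by blast
  fix t assume t: "t \<in> carr (dual H \<otimes>\<^sub>A dual H) \<and> (\<forall>a b. tsum (dual H) (dual H) t (\<lambda>f g. f a * g b) = h a b)"
  show "t = d2 h"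
  proof (rule separates_eq[OF vec_space_du separates_tensor[OF vec_space_dual vec_space_dual separates_dual separates_dual]])
    show "t \<in> carr du" using t unfolding cT by blast
    show "d2 h \<in> carr du" by (rule d2_props(1)[OF h])
  qed (use t d2_props(2)[OF h] in auto)
qed

lemma dual_tensor2_carr [simp]: "lk2 h \<Longrightarrow> dual_tensor2 H h \<in> carr du"
  by (simp only: dual_tensor2_eq d2_props(1))

lemma tsum_dual_tensor2:
  assumes "lk2 h"
  shows "tsum (dual H) (dual H) (dual_tensor2 H h) (\<lambda>f k. f a * k b) = h a b"
    "tsum (dual H) (dual H) (dual_tensor2 H h) (\<lambda>f k. k b * f a) = h a b"
  using dual_tensor2_eq[OF assms] d2_props(2)[OF assms] by (simp_all add: mult.commute)

abbreviation du3 where "du3 \<equiv> tensor_space (dual H) du"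

definition d3 where "d3 h = (\<Sum>i\<in>Eb. \<Sum>j\<in>Eb. \<Sum>k\<in>Eb. fscale (h i j k)
  (tens (dual H) du (cd i) (tens (dual H) (dual H) (cd j) (cd k))))"

lemma vec_space_du3: "vec_space du3" by (rule vec_space_tensor[OF vec_space_dual])

lemma ev3_bilin: "bilin_on (dual H) du base (\<lambda>f u. f a * tsum (dual H) (dual H) u (\<lambda>g k. g b * k c))"
  by (rule bilin_on_base_mult)
    (simp flip: lf_def, rule tsum_lin[OF vec_space_dual vec_space_base ev2_bilin])

lemma d3_props:
  assumes h: "lk3 h"
  shows "d3 h \<in> carr du3"
    "tsum (dual H) du (d3 h) (\<lambda>f u. f a * tsum (dual H) (dual H) u (\<lambda>g k. g b * k c)) = h a b c"
proof -
  let ?t = "\<lambda>i j k. tens (dual H) du (cd i) (tens (dual H) (dual H) (cd j) (cd k))"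
  have c0: "?t i j k \<in> carr du3" for i j k
    by (intro tens_carr) simp_all
  have c: "fscale (h i j k) (?t i j k) \<in> carr du3" for i j k
    by (intro fscale_carr vec_space_du3 c0)
  have c1: "(\<Sum>k\<in>Eb. fscale (h i j k) (?t i j k)) \<in> carr du3" for i j
    by (intro vec_space_sum[OF vec_space_du3] c)
  have c2: "(\<Sum>j\<in>Eb. \<Sum>k\<in>Eb. fscale (h i j k) (?t i j k)) \<in> carr du3" for i
    by (intro vec_space_sum[OF vec_space_du3] c1)
  show "d3 h \<in> carr du3" unfolding d3_def
    by (intro vec_space_sum[OF vec_space_du3] c2)
  let ?L = "\<lambda>t. tsum (dual H) du t (\<lambda>f u. f a * tsum (dual H) (dual H) u (\<lambda>g k. g b * k c))"
  have L: "lin_on du3 base ?L" by (rule tsum_lin[OF vec_space_dual vec_space_base ev3_bilin])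
  have "?L (?t i j k) = cd i a * (cd j b * cd k c)" for i j k
    by (subst tsum_tens[OF vec_space_base ev3_bilin]) (simp_all add: tens_carr tsum_tens[OF vec_space_base ev2_bilin])
  then have e: "?L (fscale (h i j k) (?t i j k)) = h i j k * (cd i a * (cd j b * cd k c))" for i j k
    using lin_onD(3)[OF L c0] by (simp add: smult_tensor_space)
  have "?L (d3 h) = (\<Sum>i\<in>Eb. \<Sum>j\<in>Eb. \<Sum>k\<in>Eb. h i j k * (cd i a * (cd j b * cd k c)))"
    unfolding d3_def by (simp add: lin_on_sum[OF vec_space_du3 L] c c1 c2 e)
  also have "\<dots> = (\<Sum>i\<in>Eb. cd i a * (\<Sum>j\<in>Eb. cd j b * (\<Sum>k\<in>Eb. cd k c * h i j k)))"
    by (simp add: sum_distrib_left mult_ac)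
  also have "\<dots> = h a b c"
    using lk_expand[of "\<lambda>c. h i j c" c for i j] lk_expand[of "\<lambda>b. h i b c" b for i]
      lk_expand[of "\<lambda>a. h a b c" a] h by simp
  finally show "?L (d3 h) = h a b c" .
qed

lemma dual_tensor3_eq:
  assumes h: "lk3 h"
  shows "dual_tensor3 H h = d3 h"
proof -
  have t2: "tens (dual H) (dual H \<otimes>\<^sub>A dual H) = tens (dual H) du"
    "tsum (dual H) (dual H \<otimes>\<^sub>A dual H) = tsum (dual H) du"
    "tensor_space (dual H) (dual H \<otimes>\<^sub>A dual H) = du3"
    by (rule tens_cong tsum_cong_space tensor_space_cong; simp add: tensor_alg_simps smult_tensor_space)+
  have cT: "carr (dual H \<otimes>\<^sub>A dual H \<otimes>\<^sub>A dual H) = carr du3" by (simp add: tensor_alg_simps t2)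
  have ev: "(\<lambda>f u. tsum (dual H) (dual H) u (\<lambda>g k. f a * g b * k c)) =
    (\<lambda>f u. f a * tsum (dual H) (dual H) u (\<lambda>g k. g b * k c))" for a b c
    by (simp add: mult.assoc tsum_cmult)
  show ?thesis unfolding dual_tensor3_def t2 cT ev
  proof (rule the_equality)
    show "d3 h \<in> carr du3 \<and> (\<forall>a b c. tsum (dual H) du (d3 h)
      (\<lambda>f u. f a * tsum (dual H) (dual H) u (\<lambda>g k. g b * k c)) = h a b c)"
      using d3_props[OF h] by blast
    fix t assume t: "t \<in> carr du3 \<and> (\<forall>a b c. tsum (dual H) du t
      (\<lambda>f u. f a * tsum (dual H) (dual H) u (\<lambda>g k. g b * k c)) = h a b c)"
    show "t = d3 h"
    proof (rule separates_eq[OF vec_space_du3 separates_tensor[OF vec_space_dual vec_space_du separates_dual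
            separates_tensor[OF vec_space_dual vec_space_dual separates_dual separates_dual]]])
      show "t \<in> carr du3" using t by blast
      show "d3 h \<in> carr du3" by (rule d3_props(1)[OF h])
    qed (use t d3_props(2)[OF h] in auto)
  qed
qed

lemma dual_tensor3_carr [simp]: "lk3 h \<Longrightarrow> dual_tensor3 H h \<in> carr du3"
  by (simp only: dual_tensor3_eq d3_props(1))

lemma tsum_dual_tensor3:
  assumes "lk3 h"
  shows "tsum (dual H) du (dual_tensor3 H h) (\<lambda>f u. f a * tsum (dual H) (dual H) u (\<lambda>g k. g b * k c)) = h a b c"
    "tsum (dual H) du (dual_tensor3 H h) (\<lambda>f u. tsum (dual H) (dual H) u (\<lambda>g k. g b * k c) * f a) = h a b c"
  using dual_tensor3_eq[OF assms] d3_props(2)[OF assms] by (simp_all add: mult.commute)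

end

section \<open>The coproduct of \<open>D(A)\<close>\<close>

lemma alg_space_cong:
  "tens (B \<otimes>\<^sub>A C) W = tens (tensor_space B C) W" "tens W (B \<otimes>\<^sub>A C) = tens W (tensor_space B C)"
  "tsum (B \<otimes>\<^sub>A C) W = tsum (tensor_space B C) W" "tsum W (B \<otimes>\<^sub>A C) = tsum W (tensor_space B C)"
  "tensor_space (B \<otimes>\<^sub>A C) W = tensor_space (tensor_space B C) W"
  "tensor_space W (B \<otimes>\<^sub>A C) = tensor_space W (tensor_space B C)"
  by (rule tens_cong tsum_cong_space tensor_space_cong; simp add: tensor_alg_simps smult_tensor_space)+

text \<open>Lets a product in a tensor power be computed inside a functional, as a double sum over
  decompositions of the two factors.\<close>

lemma tensor_mult_eval:
  assumes B: "vec_space B" "bilin_on B B B (mult B)" and C: "bilin_on C C C (mult C)"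
    and \<phi>: "lin_on B base \<phi>" and \<psi>: "lin_on C base \<psi>"
    and s: "s \<in> carr (tensor_space B C)" and r: "r \<in> carr (tensor_space B C)"
  shows "tsum B C (mult (B \<otimes>\<^sub>A C) s r) (\<lambda>v w. \<phi> v * \<psi> w) =
    tsum B C s (\<lambda>b c. tsum B C r (\<lambda>b' c'. \<phi> (mult B b b') * \<psi> (mult C c c')))"
proof -
  let ?L = "\<lambda>x. tsum B C x (\<lambda>v w. \<phi> v * \<psi> w)"
  have b: "bilin_on B C base (\<lambda>v w. \<phi> v * \<psi> w)" by (rule bilin_on_base_mult[OF \<phi> \<psi>])
  have L: "lin_on (tensor_space B C) base ?L" by (rule tsum_lin[OF B(1) vec_space_base b])
  note v = vec_space_tensor[OF B(1), of C]
  have "?L (mult (B \<otimes>\<^sub>A C) s r) =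
    ?L (tsum B C s (\<lambda>b c. tsum B C r (\<lambda>b' c'. tens B C (mult B b b') (mult C c c'))))"
    by (simp add: tensor_alg_def)
  also have "\<dots> = tsum B C s (\<lambda>b c. ?L (tsum B C r (\<lambda>b' c'. tens B C (mult B b b') (mult C c c'))))"
    by (rule lin_on_tsum[OF v L s tensor_mult_aux(2)[OF B C r]])
  also have "\<dots> = tsum B C s (\<lambda>b c. tsum B C r (\<lambda>b' c'. ?L (tens B C (mult B b b') (mult C c c'))))"
    by (rule tsum_cong[OF s], rule lin_on_tsum[OF v L r tensor_mult_aux(1)[OF B C]])
  also have "\<dots> = tsum B C s (\<lambda>b c. tsum B C r (\<lambda>b' c'. \<phi> (mult B b b') * \<psi> (mult C c c')))"
    by (rule tsum_cong[OF s], rule tsum_cong[OF r], rule tsum_tens[OF vec_space_base b])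
      (auto intro: bilin_onD(3)[OF B(2)] bilin_onD(3)[OF C])
  finally show ?thesis .
qed

context cochain_data
begin

lemma D_space_cong:
  "tens D W = tens Dsp W" "tens W D = tens W Dsp" "tsum D W = tsum Dsp W" "tsum W D = tsum W Dsp"
  "tensor_space D W = tensor_space Dsp W" "tensor_space W D = tensor_space W Dsp"
  by (rule tens_cong tsum_cong_space tensor_space_cong; simp add: smult_tensor_space)+

lemmas space_cong = alg_space_cong D_space_cong D_space_eq

section \<open>Matrix coefficients of the coproduct\<close>

abbreviation Dsp2 where "Dsp2 \<equiv> tensor_space Dsp Dsp"

lemma vec_space_D2: "vec_space Dsp2" by (rule vec_space_tensor[OF vec_space_D])

definition E2 where "E2 a p b q X = tsum Dsp Dsp X (\<lambda>s r. e1 a p s * e1 b q r)"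

lemma E2_bilin: "lk p \<Longrightarrow> lk q \<Longrightarrow> bilin_on Dsp Dsp base (\<lambda>s r. e1 a p s * e1 b q r)"
  by (intro bilin_on_base_mult e1_lin)

lemma E2_lin: "lk p \<Longrightarrow> lk q \<Longrightarrow> lin_on Dsp2 base (E2 a p b q)"
  unfolding E2_def by (rule tsum_lin[OF vec_space_D vec_space_base E2_bilin])

lemma E2_tens: "lk p \<Longrightarrow> lk q \<Longrightarrow> s \<in> carr Dsp \<Longrightarrow> r \<in> carr Dsp \<Longrightarrow>
    E2 a p b q (tens Dsp Dsp s r) = e1 a p s * e1 b q r"
  unfolding E2_def by (rule tsum_tens[OF vec_space_base E2_bilin])

lemma separates_D2: "separates Dsp2 {E2 a p b q | a p b q. lk p \<and> lk q}"
proof -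
  have "{\<lambda>t. tsum Dsp Dsp t (\<lambda>v w. \<phi> v * \<psi> w) | \<phi> \<psi>. \<phi> \<in> {e1 a p | a p. lk p} \<and> \<psi> \<in> {e1 a p | a p. lk p}} =
    {E2 a p b q | a p b q. lk p \<and> lk q}"
    unfolding E2_def by (auto simp: fun_eq_iff) blast+
  then show ?thesis using separates_tensor[OF vec_space_D vec_space_D separates_D separates_D] by simp
qed

lemma D2_ext:
  assumes "s \<in> carr Dsp2" "s' \<in> carr Dsp2"
    "\<And>a p b q. lk p \<Longrightarrow> lk q \<Longrightarrow> E2 a p b q s = E2 a p b q s'"
  shows "s = s'"
  by (rule separates_eq[OF vec_space_D2 separates_D2 assms(1,2)]) (use assms(3) in auto)

lemma lin_on_D2:
  assumes "vec_space X" "\<And>x. x \<in> carr X \<Longrightarrow> F x \<in> carr Dsp2"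
    and "\<And>a p b q. lk p \<Longrightarrow> lk q \<Longrightarrow> lin_on X base (\<lambda>x. E2 a p b q (F x))"
  shows "lin_on X Dsp2 F"
  by (rule separates_lin_on[OF assms(1) vec_space_D2 separates_D2 assms(2)]) (use assms(3) in auto)

lemma lk2_g [simp]: "lk2 (\<lambda>a b. g x a b)" by simp

lemma lk2_comult [simp]: "lk f \<Longrightarrow> lk2 (\<lambda>a b. f (a * b))"
  using lk_comp[of f] by simp

definition com where
  "com f x = sw3 H x (\<lambda>x1 x2 x3. tsum (dual H) (dual H) (dual_comult H f) (\<lambda>f1 f2.
     tsum (dual H) (dual H) (dual_tensor2 H (\<lambda>a b. g x1 a b)) (\<lambda>g1 g2.
       tens Dsp Dsp (dten H (\<lambda>a. sw H a (\<lambda>a1 a2. f1 a1 * g1 a2)) x2) (dten H (\<lambda>a. sw H a (\<lambda>a1 a2. f2 a1 * g2 a2)) x3))))"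

lemma dual_comult_carr [simp]: "lk f \<Longrightarrow> dual_comult H f \<in> carr du"
  unfolding dual_comult_def by (rule dual_tensor2_carr) (rule lk2_comult)

lemma dten_mult_lin:
  assumes "lk f"
  shows "lin_on (dual H) Dsp (\<lambda>h. dten H (\<lambda>a. sw H a (\<lambda>a1 a2. f a1 * h a2)) x)"
    "lin_on (dual H) Dsp (\<lambda>h. dten H (\<lambda>a. sw H a (\<lambda>a1 a2. h a1 * f a2)) x)"
proof -
  have l1: "lin_on (dual H) Dsp (\<lambda>h. dten H h x)"
    unfolding dten_def by (rule bilin_onD(2)[OF tens_bilin]) simp
  have m: "lin_on (dual H) (dual H) (\<lambda>h a. sw H a (\<lambda>a1 a2. f a1 * h a2))"
    "lin_on (dual H) (dual H) (\<lambda>h a. sw H a (\<lambda>a1 a2. h a1 * f a2))"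
    unfolding lin_on_def using assms lk_mult_dual
    by (auto simp: fscale_def fun_eq_iff algebra_simps sw_add sw_cmult)
  show "lin_on (dual H) Dsp (\<lambda>h. dten H (\<lambda>a. sw H a (\<lambda>a1 a2. f a1 * h a2)) x)"
    "lin_on (dual H) Dsp (\<lambda>h. dten H (\<lambda>a. sw H a (\<lambda>a1 a2. h a1 * f a2)) x)"
    by (rule lin_on_comp[OF m(1) l1], rule lin_on_comp[OF m(2) l1])
qed

text \<open>\<open>tsum\<close> is independent of the decomposition for bilinear summands, so each
  of the two nested levels is shown bilinear before linear maps are moved through it.\<close>

lemma com_bilin_inner:
  assumes "vec_space U" "bilin_on Dsp Dsp U F"
  shows "lk f1 \<Longrightarrow> lk f2 \<Longrightarrow> bilin_on (dual H) (dual H) U (\<lambda>g1 g2.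
       F (dten H (\<lambda>a. sw H a (\<lambda>a1 a2. f1 a1 * g1 a2)) x2) (dten H (\<lambda>a. sw H a (\<lambda>a1 a2. f2 a1 * g2 a2)) x3))"
    and "lk2 h \<Longrightarrow> bilin_on (dual H) (dual H) U (\<lambda>f1 f2. tsum (dual H) (dual H) (dual_tensor2 H h) (\<lambda>g1 g2.
       F (dten H (\<lambda>a. sw H a (\<lambda>a1 a2. f1 a1 * g1 a2)) x2) (dten H (\<lambda>a. sw H a (\<lambda>a1 a2. f2 a1 * g2 a2)) x3)))"
  subgoal by (rule bilin_on_comp[OF assms(2) dten_mult_lin(1) dten_mult_lin(1)])
  subgoal by (rule bilin_on_tsum_fun[OF assms(1) dual_tensor2_carr], assumption)
      (rule bilin_on_comp[OF assms(2) dten_mult_lin(2) dten_mult_lin(2)]; simp)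
  done

lemma com_carr [simp]: "lk f \<Longrightarrow> com f x \<in> carr Dsp2"
  unfolding com_def sw3_def
  by (intro sw_carr[OF vec_space_D2] tsum_carr[OF vec_space_dual vec_space_D2 com_bilin_inner(2)[OF vec_space_D2 tens_bilin]])
    simp_all

lemma tsum_com:
  assumes F: "bilin_on Dsp Dsp base F" and f: "lk f"
  shows "tsum Dsp Dsp (com f x) F = sw3 H x (\<lambda>x1 x2 x3. tsum (dual H) (dual H) (dual_comult H f) (\<lambda>f1 f2.
     tsum (dual H) (dual H) (dual_tensor2 H (\<lambda>a b. g x1 a b)) (\<lambda>g1 g2.
       F (dten H (\<lambda>a. sw H a (\<lambda>a1 a2. f1 a1 * g1 a2)) x2) (dten H (\<lambda>a. sw H a (\<lambda>a1 a2. f2 a1 * g2 a2)) x3))))"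
proof -
  have L: "lin_on Dsp2 base (\<lambda>t. tsum Dsp Dsp t F)" by (rule tsum_lin[OF vec_space_D vec_space_base F])
  note ci = com_bilin_inner[OF vec_space_D2 tens_bilin]
  have c: "tsum (dual H) (dual H) (dual_comult H f) (\<lambda>f1 f2.
     tsum (dual H) (dual H) (dual_tensor2 H (\<lambda>a b. g x1 a b)) (\<lambda>g1 g2.
       tens Dsp Dsp (dten H (\<lambda>a. sw H a (\<lambda>a1 a2. f1 a1 * g1 a2)) x2) (dten H (\<lambda>a. sw H a (\<lambda>a1 a2. f2 a1 * g2 a2)) x3))) \<in> carr Dsp2"
    for x1 x2 x3
    by (intro tsum_carr[OF vec_space_dual vec_space_D2 ci(2)] dual_comult_carr f) simp
  show ?thesis unfolding com_def sw3_def
    apply (subst lin_on_sw[OF vec_space_D2 L])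
     apply (intro sw_carr[OF vec_space_D2] c)
    apply (subst lin_on_sw[OF vec_space_D2 L])
     apply (intro c)
    apply (subst lin_on_tsum[OF vec_space_D2 L dual_comult_carr[OF f] ci(2)])
     apply simp
    apply (intro arg_cong[where f = "sw H _"] ext)
    apply (rule tsum_cong[OF dual_comult_carr[OF f]])
    apply (subst lin_on_tsum[OF vec_space_D2 L dual_tensor2_carr ci(1)])
       apply simp_all[3]
    apply (rule tsum_cong[OF dual_tensor2_carr])
     apply simp
    apply (rule tsum_tens[OF vec_space_base F])
     apply simp_all
    done
qed

text \<open>As a congruence rule it lets the simplifier use linearity of the components of a
  decomposition, a premise of the rules that evaluate elementary tensors.\<close>

lemma tsum_cong_dual [cong]:
  "X \<in> carr du \<Longrightarrow> (\<And>u v. lk u \<Longrightarrow> lk v \<Longrightarrow> F u v = G u v) \<Longrightarrow>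
    tsum (dual H) (dual H) X F = tsum (dual H) (dual H) X G"
  by (rule tsum_cong) simp_all

lemma tsum_dual_comult:
  assumes "lk f"
  shows "tsum (dual H) (dual H) (dual_comult H f) (\<lambda>u v. u a * v b) = f (a * b)"
    "tsum (dual H) (dual H) (dual_comult H f) (\<lambda>u v. v b * u a) = f (a * b)"
  unfolding dual_comult_def using tsum_dual_tensor2[OF lk2_comult[OF assms]] by simp_all

text \<open>Moves the sums over decompositions inward until they meet a pure product, where
  \<open>dual_tensor2\<close> and \<open>dual_comult\<close> give back a value such as
  \<open>g x a b\<close> or \<open>f (a * b)\<close>.\<close>

lemmas collapse = tsum_sw_swap sw_cmult tsum_cmult tsum_dual_tensor2 tsum_dual_comult mult.assoc

lemma E2_com:
  assumes "lk f" "lk p" "lk q"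
  shows "E2 a p b q (com f x) = sw3 H x (\<lambda>x1 x2 x3. sw H b (\<lambda>b1 b2. sw H a (\<lambda>a1 a2.
    p x2 * (f (a1 * b1) * (g x1 a2 b2 * q x3)))))"
  unfolding E2_def
  apply (subst tsum_com[OF E2_bilin[OF assms(2,3)] assms(1)])
  apply (simp add: assms)
  apply (simp add: collapse assms)
  done

lemma com_bilin: "bilin_on (dual H) A Dsp2 com"
  unfolding bilin_on_def
proof (intro conjI ballI)
  show "lin_on A Dsp2 (com f)" if "f \<in> carr (dual H)" for f
  proof (rule lin_on_D2[OF vec_space_A])
    fix a p b q assume pq: "lk p" "lk q"
    have f: "lk f" using that by simp
    show "lin_on A base (\<lambda>x. E2 a p b q (com f x))"
      by (simp add: E2_com f pq sw3_def lk_comp[OF pq(1)] lk_comp[OF pq(2)] flip: lk_def)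
  qed (use that in simp)
  show "lin_on (dual H) Dsp2 (\<lambda>f. com f x)" for x
  proof (rule lin_on_D2[OF vec_space_dual])
    fix a p b q assume pq: "lk p" "lk q"
    have "lf (\<lambda>f. sw3 H x (\<lambda>x1 x2 x3. sw H b (\<lambda>b1 b2. sw H a (\<lambda>a1 a2.
        p x2 * (f (a1 * b1) * (g x1 a2 b2 * q x3))))))"
      unfolding sw3_def by simp
    then show "lin_on (dual H) base (\<lambda>f. E2 a p b q (com f x))"
      unfolding lf_def by (rule lin_on_cong[OF vec_space_dual]) (simp add: E2_com pq)
  qed simp
qed

lemma D_comult_eq: "D_comult H gc s = tsum (dual H) A s com"
  unfolding D_comult_def dsum_def com_def[abs_def] D_space_eq g_def dual_simps ..

lemma D_comult_lin: "lin_on Dsp Dsp2 (D_comult H gc)"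
  unfolding D_comult_eq[abs_def] by (rule tsum_lin[OF vec_space_dual vec_space_D2 com_bilin])

lemma D_comult_dten [simp]: "lk f \<Longrightarrow> D_comult H gc (dten H f x) = com f x"
  unfolding D_comult_eq dten_def by (rule tsum_tens[OF vec_space_D2 com_bilin]) simp_all

lemma D_comult_carr [simp]: "s \<in> carr Dsp \<Longrightarrow> D_comult H gc s \<in> carr Dsp2"
  by (rule lin_onD(1)[OF D_comult_lin])

lemma D_comult_unit: "D_comult H gc (dten H \<epsilon> 1) = tens Dsp Dsp (dten H \<epsilon> 1) (dten H \<epsilon> 1)"
proof -
  have "com \<epsilon> 1 = tens Dsp Dsp (dten H \<epsilon> 1) (dten H \<epsilon> 1)"
  proof (rule D2_ext)
    fix a p b q assume pq: "lk p" "lk q"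
    have "sw H b (\<lambda>b1 b2. sw H a (\<lambda>a1 a2. p 1 * (\<epsilon> a1 * \<epsilon> b1 * (\<epsilon> a2 * \<epsilon> b2 * q 1)))) =
      p 1 * q 1 * sw H b (\<lambda>b1 b2. \<epsilon> b1 * \<epsilon> b2) * sw H a (\<lambda>a1 a2. \<epsilon> a1 * \<epsilon> a2)"
      by (simp add: sw_cmult mult_ac)
    then show "E2 a p b q (com \<epsilon> 1) = E2 a p b q (tens Dsp Dsp (dten H \<epsilon> 1) (dten H \<epsilon> 1))"
      by (simp add: E2_com E2_tens pq sw3_def sw_one lk_comp[OF pq(1)] lk_comp[OF pq(2)] sw_counit mult_ac)
  qed (simp_all add: tens_carr)
  then show ?thesis by simp
qed

section \<open>Multiplicativity of the coproduct\<close>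

abbreviation m2 where "m2 \<equiv> mult (D \<otimes>\<^sub>A D)"

lemma D_mult_bilin': "bilin_on D D D (mult D)"
  by (simp add: bilin_on_D_alg D_mult_bilin)

lemma m2_bilin: "bilin_on Dsp2 Dsp2 Dsp2 m2"
  using tensor_alg_mult_bilin[OF vec_space_D_alg D_mult_bilin' D_mult_bilin']
  by (simp add: bilin_on_tensor_alg space_cong)

lemma m2_carr [simp]: "X \<in> carr Dsp2 \<Longrightarrow> Y \<in> carr Dsp2 \<Longrightarrow> m2 X Y \<in> carr Dsp2"
  by (rule bilin_onD(3)[OF m2_bilin])

lemma E2_mult:
  assumes "lk p" "lk q" "X \<in> carr Dsp2" "Y \<in> carr Dsp2"
  shows "E2 a p b q (m2 X Y) = tsum Dsp Dsp X (\<lambda>s r. tsum Dsp Dsp Y (\<lambda>s' r'.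
    e1 a p (D_mult H tc s s') * e1 b q (D_mult H tc r r')))"
  using tensor_mult_eval[OF vec_space_D_alg D_mult_bilin' D_mult_bilin', of "e1 a p" "e1 b q" X Y]
    assms e1_lin
  by (simp add: E2_def space_cong lin_on_D_alg)

lemma E2_mult_bilin:
  assumes "lk p" "lk q"
  shows "s \<in> carr Dsp \<Longrightarrow> r \<in> carr Dsp \<Longrightarrow>
     bilin_on Dsp Dsp base (\<lambda>s' r'. e1 a p (D_mult H tc s s') * e1 b q (D_mult H tc r r'))"
    and "Y \<in> carr Dsp2 \<Longrightarrow>
     bilin_on Dsp Dsp base (\<lambda>s r. tsum Dsp Dsp Y (\<lambda>s' r'. e1 a p (D_mult H tc s s') * e1 b q (D_mult H tc r r')))"
  subgoal
    by (intro bilin_on_base_mult lin_on_comp[OF bilin_onD(1)[OF D_mult_bilin] e1_lin] assms)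
  subgoal
    by (rule bilin_on_tsum_fun[OF vec_space_base], assumption)
      (intro bilin_on_base_mult lin_on_comp[OF bilin_onD(2)[OF D_mult_bilin] e1_lin] assms)
  done

text \<open>\<open>f\<close> and \<open>h\<close> contribute alike to both sides of
  multiplicativity, because conjugation respects \<open>pm u u'\<close>. What differs is \<theta>(v,
  s)(u u') and \<gamma>(v s)(u, u') here against two values each of \<theta> and \<gamma> for the
  product of coproducts; equality is \<open>cond2\<close>.\<close>

lemma comult_mult_left_points:
  assumes f: "lk f" "lk h" "lk p" "lk q" and g: "gl u" "gl u'" "gl v" "gl s"
  shows "B u (\<lambda>a. B u' (\<lambda>b. B v (\<lambda>x. B s (\<lambda>y. br (E2 a p b q
      (D_comult H gc (D_mult H tc (dten H f x) (dten H h y)))))))) =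
    F1 f (pm u u') \<odot> F1 h (pc v (pm u u')) \<odot> T t v s (pm u u') \<odot> T g (pm v s) u u' \<odot> F1 p (pm v s) \<odot> F1 q (pm v s)"
proof -
  note l = lk_comp[OF f(1)] lk_comp[OF f(2)] lk_comp[OF f(3)] lk_comp[OF f(4)]
  have "E2 a p b q (D_comult H gc (D_mult H tc (dten H f x) (dten H h y))) =
    sw H x (\<lambda>x1 x2. sw H y (\<lambda>y1 y2. E2 a p b q (com (dmF f h x1 y1) (x2 * y2))))" for a b x y
    by (simp add: D_mult_dmF f lin_on_sw[OF vec_space_D D_comult_lin] lin_on_sw[OF vec_space_D2 E2_lin]
        sw_carr[OF vec_space_D2])
  then show ?thesis
    apply (simp add: E2_com f sw3_def)
    unfolding dmF_def F1_def T_def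
    apply (simp add: expand_B l g del: pc_simps)
    apply (simp add: split_B del: pc_simps)
    apply (simp only: B_comm[of v u] B_comm[of s u] B_comm[of s v] B_comm[of u' u] B_comm[of v u'] B_comm[of s u'])
    apply (simp add: cv_ac mult.assoc)
    done
qed

lemma comult_mult_right_points:
  assumes f: "lk f" "lk h" "lk p" "lk q" and g: "gl u" "gl u'" "gl v" "gl s"
  shows "B u (\<lambda>a. B u' (\<lambda>b. B v (\<lambda>x. B s (\<lambda>y. br (E2 a p b q
      (m2 (D_comult H gc (dten H f x)) (D_comult H gc (dten H h y)))))))) =
    F1 f (pm u u') \<odot> F1 h (pm (pc v u) (pc v u')) \<odot> T g s (pc v u) (pc v u') \<odot> T g v u u' \<odot>
      T t v s u \<odot> T t v s u' \<odot> F1 p (pm v s) \<odot> F1 q (pm v s)"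
proof -
  note l = lk_comp[OF f(1)] lk_comp[OF f(2)] lk_comp[OF f(3)] lk_comp[OF f(4)]
  note b = E2_mult_bilin[OF f(3,4)]
  show ?thesis
    apply (simp add: f E2_mult)
    apply (simp add: f tsum_com[OF b(2)] tsum_com[OF b(1)] e1_mult)
    apply (simp add: collapse f dmF_def sw3_def)
    unfolding F1_def T_def
    apply (simp add: expand_B l g del: pc_simps)
    apply (simp add: split_B del: pc_simps)
    apply (simp only: B_comm[of v u] B_comm[of s u] B_comm[of s v] B_comm[of u' u] B_comm[of v u'] B_comm[of s u'])
    apply (simp add: cv_ac mult.assoc)
    done
qed

lemma comult_mult_iff:
  "(\<forall>s\<in>carr Dsp. \<forall>r\<in>carr Dsp. D_comult H gc (D_mult H tc s r) = m2 (D_comult H gc s) (D_comult H gc r))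
    \<longleftrightarrow> cond2" (is "?A \<longleftrightarrow> _")
proof
  assume as: ?A
  show cond2 unfolding cond2_def
  proof (intro allI impI)
    fix x y a b assume g: "gl x" "gl y" "gl a" "gl b"
    have "B a (\<lambda>a. B b (\<lambda>b. B x (\<lambda>x. B y (\<lambda>y. br (E2 a \<epsilon> b \<epsilon>
      (D_comult H gc (D_mult H tc (dten H \<epsilon> x) (dten H \<epsilon> y)))))))) =
      B a (\<lambda>a. B b (\<lambda>b. B x (\<lambda>x. B y (\<lambda>y. br (E2 a \<epsilon> b \<epsilon>
      (m2 (D_comult H gc (dten H \<epsilon> x)) (D_comult H gc (dten H \<epsilon> y))))))))"
      using as by (simp del: D_comult_dten)
    then show "T g y (pc x a) (pc x b) \<odot> T g x a b \<odot> T t x y a \<odot> T t x y b = T g (pm x y) a b \<odot> T t x y (pm a b)"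
      unfolding comult_mult_left_points[OF lk_eps0 lk_eps0 lk_eps0 lk_eps0 g(3,4,1,2)]
        comult_mult_right_points[OF lk_eps0 lk_eps0 lk_eps0 lk_eps0 g(3,4,1,2)]
      using g by (simp add: R.cv_comm del: pc_simps)
  qed
next
  assume c: cond2
  note cc = c[unfolded cond2_def, rule_format]
  note l1 = bilin_onD(1)[OF D_mult_bilin] and l2 = bilin_onD(2)[OF D_mult_bilin]
  have el: "D_comult H gc (D_mult H tc (dten H f x) (dten H h y)) = m2 (D_comult H gc (dten H f x)) (D_comult H gc (dten H h y))"
    if f: "lk f" "lk h" for f h x y
  proof (rule D2_ext)
    fix a p b q assume pq: "lk p" "lk q"
    let ?E = "\<lambda>a b x y. E2 a p b q (D_comult H gc (D_mult H tc (dten H f x) (dten H h y)))"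
    let ?E' = "\<lambda>a b x y. E2 a p b q (m2 (D_comult H gc (dten H f x)) (D_comult H gc (dten H h y)))"
    show "?E a b x y = ?E' a b x y"
    proof (rule univ_eq)
      note l = lk_comp[OF pq(1)] lk_comp[OF pq(2)] lk_comp[OF f(1)] lk_comp[OF f(2)]
      have "?E = (\<lambda>a b x y. sw H x (\<lambda>x1 x2. sw H y (\<lambda>y1 y2. E2 a p b q (com (dmF f h x1 y1) (x2 * y2)))))"
        by (intro ext) (simp add: D_mult_dmF f pq lin_on_sw[OF vec_space_D D_comult_lin]
            lin_on_sw[OF vec_space_D2 E2_lin] sw_carr[OF vec_space_D2])
      then show "lk4 ?E" by (simp add: E2_com f pq sw3_def l)
      note b = E2_mult_bilin[OF pq]
      show "lk4 ?E'"
        apply (simp add: f E2_mult pq)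
        apply (simp add: f pq tsum_com[OF b(2)] tsum_com[OF b(1)] e1_mult)
        apply (simp add: collapse f pq dmF_def sw3_def l)
        done
      have "X \<odot> Y \<odot> T t v s (pm u u') \<odot> T g (pm v s) u u' \<odot> Z =
        X \<odot> Y \<odot> T g s (pc v u) (pc v u') \<odot> T g v u u' \<odot> T t v s u \<odot> T t v s u' \<odot> Z"
        if "gl v" "gl s" "gl u" "gl u'" for v s u u' X Y Z
      proof -
        have "T t v s (pm u u') \<odot> T g (pm v s) u u' \<odot> Z = (T g (pm v s) u u' \<odot> T t v s (pm u u')) \<odot> Z"
          by (simp add: R.cv_assoc R.cv_left_comm)
        also have "\<dots> = T g s (pc v u) (pc v u') \<odot> T g v u u' \<odot> T t v s u \<odot> T t v s u' \<odot> Z"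
          by (simp only: cc[OF that, symmetric] R.cv_assoc)
        finally show ?thesis by simp
      qed
      then show "B U1 (\<lambda>a. B U2 (\<lambda>b. B U3 (\<lambda>c. B U4 (\<lambda>d. br (?E a b c d))))) =
         B U1 (\<lambda>a. B U2 (\<lambda>b. B U3 (\<lambda>c. B U4 (\<lambda>d. br (?E' a b c d)))))"
        unfolding comult_mult_left_points[OF f pq gl_U] comult_mult_right_points[OF f pq gl_U]
        by (simp only: pc_simps(1) gl_U)
    qed
  qed (simp_all add: f)
  show ?A
  proof (intro ballI)
    fix s r assume s: "s \<in> carr Dsp" and r: "r \<in> carr Dsp"
    show "D_comult H gc (D_mult H tc s r) = m2 (D_comult H gc s) (D_comult H gc r)"
    proof (rule D_lin_ext[OF lin_on_comp[OF l2 D_comult_lin] lin_on_comp[OF D_comult_lin bilin_onD(2)[OF m2_bilin]] _ s])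
      fix f x assume f: "lk f"
      show "D_comult H gc (D_mult H tc (dten H f x) r) = m2 (D_comult H gc (dten H f x)) (D_comult H gc r)"
        by (rule D_lin_ext[OF lin_on_comp[OF l1 D_comult_lin] lin_on_comp[OF D_comult_lin bilin_onD(1)[OF m2_bilin]] _ r])
          (simp_all add: f el del: D_comult_dten)
    qed (simp_all add: r)
  qed
qed

lemma comult_hom_iff: "alg_hom D (D \<otimes>\<^sub>A D) (D_comult H gc) \<longleftrightarrow> cond2"
  unfolding alg_hom_def using D_comult_lin comult_mult_iff
  by (simp add: lin_on_tensor_alg lin_on_D_alg tensor_alg_simps space_cong D_comult_unit del: D_comult_dten)

section \<open>The counit of D(A)\<close>

lemma D_counit_e1: "D_counit H s = e1 1 \<epsilon> s"
  by (simp add: D_counit_def dsum_def e1_def)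

text \<open>The conjugate of 1 is 1 and the normalized \<open>t\<close> is trivial there, so nothing
  twists the product at this argument; hence the counit is multiplicative.\<close>

lemma dmF_one: "lk f \<Longrightarrow> lk h \<Longrightarrow> dmF f h x y 1 = f 1 * (h 1 * (\<epsilon> x * \<epsilon> y))"
proof -
  assume f: "lk f" "lk h"
  note l = lk_comp[OF f(1)] lk_comp[OF f(2)]
  have "dmF f h x y 1 = sw H x (\<lambda>x1 x2. (f 1 * h 1 * \<epsilon> y) * (\<epsilon> x1 * \<epsilon> x2))"
    unfolding dmF_def by (simp add: sw_one l lkD(2)[OF f(2)] mult_ac)
  also have "\<dots> = f 1 * h 1 * \<epsilon> y * \<epsilon> x" by (simp add: sw_counit flip: sw_cmult)
  finally show ?thesis by (simp add: mult_ac)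
qed

lemma counit_hom: "alg_hom D base (D_counit H)"
proof -
  have c: "D_counit H = e1 1 \<epsilon>" by (rule ext) (rule D_counit_e1)
  have lin: "lin_on Dsp base (e1 1 \<epsilon>)" by (rule e1_lin) simp
  note l1 = bilin_onD(1)[OF D_mult_bilin] and l2 = bilin_onD(2)[OF D_mult_bilin]
  have cm: "lin_on Dsp base (\<lambda>s. e1 1 \<epsilon> s * c)" "lin_on Dsp base (\<lambda>s. c * e1 1 \<epsilon> s)" for c
    using lin by (auto simp: lin_on_def algebra_simps)
  have el: "e1 1 \<epsilon> (D_mult H tc (dten H f x) (dten H h y)) = e1 1 \<epsilon> (dten H f x) * e1 1 \<epsilon> (dten H h y)"
    if f: "lk f" "lk h" for f h x y
  proof -
    have "e1 1 \<epsilon> (D_mult H tc (dten H f x) (dten H h y)) =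
      f 1 * h 1 * sw H x (\<lambda>x1 x2. \<epsilon> x1 * \<epsilon> x2) * sw H y (\<lambda>y1 y2. \<epsilon> y1 * \<epsilon> y2)"
      by (simp add: e1_mult f dmF_one sw_cmult mult_ac)
    then show ?thesis using f by (simp add: sw_counit mult_ac)
  qed
  have "e1 1 \<epsilon> (D_mult H tc s r) = e1 1 \<epsilon> s * e1 1 \<epsilon> r" if s: "s \<in> carr Dsp" and r: "r \<in> carr Dsp" for s r
  proof (rule D_lin_ext[OF lin_on_comp[OF l2 lin] cm(1) _ s])
    fix f x assume f: "lk f"
    show "e1 1 \<epsilon> (D_mult H tc (dten H f x) r) = e1 1 \<epsilon> (dten H f x) * e1 1 \<epsilon> r"
      by (rule D_lin_ext[OF lin_on_comp[OF l1 lin] cm(2) _ r]) (simp_all add: f el del: e1_dten)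
  qed (rule r)
  then show ?thesis unfolding alg_hom_def c by (simp add: lin_on_D_alg lin)
qed

end

section \<open>Functionals on tensor products of maps\<close>

lemma tmap_eval:
  assumes "vec_space V" "vec_space V'" "lin_on V V' f" "lin_on W W' h" "lin_on V' base \<phi>" "lin_on W' base \<psi>"
    and X: "X \<in> carr (tensor_space V W)"
  shows "tsum V' W' (tmap V W V' W' f h X) (\<lambda>v w. \<phi> v * \<psi> w) = tsum V W X (\<lambda>v w. \<phi> (f v) * \<psi> (h w))"
proof -
  have b: "bilin_on V' W' base (\<lambda>v w. \<phi> v * \<psi> w)" by (rule bilin_on_base_mult[OF assms(5,6)])
  have L: "lin_on (tensor_space V' W') base (\<lambda>x. tsum V' W' x (\<lambda>v w. \<phi> v * \<psi> w))"
    by (rule tsum_lin[OF assms(2) vec_space_base b])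
  have "tsum V' W' (tmap V W V' W' f h X) (\<lambda>v w. \<phi> v * \<psi> w) =
    tsum V W X (\<lambda>v w. tsum V' W' (tens V' W' (f v) (h w)) (\<lambda>v w. \<phi> v * \<psi> w))"
    unfolding tmap_def
    by (rule lin_on_tsum[OF vec_space_tensor[OF assms(2)] L X bilin_on_comp[OF tens_bilin assms(3,4)]])
  also have "\<dots> = tsum V W X (\<lambda>v w. \<phi> (f v) * \<psi> (h w))"
    by (rule tsum_cong[OF X], rule tsum_tens[OF vec_space_base b]) (auto intro: lin_onD(1)[OF assms(3)] lin_onD(1)[OF assms(4)])
  finally show ?thesis .
qed

lemma tassoc_eval:
  assumes "vec_space U" "vec_space V" "lin_on U base \<phi>" "lin_on V base \<psi>" "lin_on W base \<chi>"
    and X: "X \<in> carr (tensor_space (tensor_space U V) W)"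
  shows "tsum U (tensor_space V W) (tassoc U V W X) (\<lambda>u y. \<phi> u * tsum V W y (\<lambda>v w. \<psi> v * \<chi> w)) =
    tsum (tensor_space U V) W X (\<lambda>s w. tsum U V s (\<lambda>u v. \<phi> u * \<psi> v) * \<chi> w)"
proof -
  let ?F = "\<lambda>u y. \<phi> u * tsum V W y (\<lambda>v w. \<psi> v * \<chi> w)"
  have b1: "bilin_on V W base (\<lambda>v w. \<psi> v * \<chi> w)" by (rule bilin_on_base_mult[OF assms(4,5)])
  have b2: "bilin_on U V base (\<lambda>v w. \<phi> v * \<psi> w)" by (rule bilin_on_base_mult[OF assms(3,4)])
  have b: "bilin_on U (tensor_space V W) base ?F"
    by (rule bilin_on_base_mult[OF assms(3) tsum_lin[OF assms(2) vec_space_base b1]])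
  have L: "lin_on (tensor_space U (tensor_space V W)) base (\<lambda>x. tsum U (tensor_space V W) x ?F)"
    by (rule tsum_lin[OF assms(1) vec_space_base b])
  have b3: "bilin_on (tensor_space U V) W base (\<lambda>s w. tsum U V s (\<lambda>u v. \<phi> u * \<psi> v) * \<chi> w)"
    by (rule bilin_on_base_mult[OF tsum_lin[OF assms(1) vec_space_base b2] assms(5)])
  have R: "lin_on (tensor_space (tensor_space U V) W) base
      (\<lambda>x. tsum (tensor_space U V) W x (\<lambda>s w. tsum U V s (\<lambda>u v. \<phi> u * \<psi> v) * \<chi> w))"
    by (rule tsum_lin[OF vec_space_tensor[OF assms(1)] vec_space_base b3])
  note tl = lin_on_comp[OF tassoc_lin[OF assms(1,2)] L]
  show ?thesis
  proof (rule tensor_lin_ext[OF vec_space_tensor[OF assms(1)] tl R _ X])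
    fix s w assume s: "s \<in> carr (tensor_space U V)" and w: "w \<in> carr W"
    have "tsum U (tensor_space V W) (tassoc U V W (tens (tensor_space U V) W s w)) ?F =
      tsum U V s (\<lambda>u v. tsum U (tensor_space V W) (tens U (tensor_space V W) u (tens V W v w)) ?F)"
      unfolding tassoc_tens[OF assms(1,2) s w]
      by (rule lin_on_tsum[OF vec_space_tensor[OF assms(1)] L s tassoc_aux(1)[OF assms(1,2) w]])
    also have "\<dots> = tsum U V s (\<lambda>u v. \<phi> u * (\<psi> v * \<chi> w))"
      by (rule tsum_cong[OF s], subst tsum_tens[OF vec_space_base b])
        (auto simp: tens_carr w tsum_tens[OF vec_space_base b1])
    also have "\<dots> = tsum U V s (\<lambda>u v. \<phi> u * \<psi> v) * \<chi> w"
      by (simp add: tsum_cmult)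
    also have "\<dots> = tsum (tensor_space U V) W (tens (tensor_space U V) W s w) (\<lambda>s w. tsum U V s (\<lambda>u v. \<phi> u * \<psi> v) * \<chi> w)"
      by (rule tsum_tens[OF vec_space_base b3 s w, symmetric])
    finally show "tsum U (tensor_space V W) (tassoc U V W (tens (tensor_space U V) W s w)) ?F = \<dots>" .
  qed
qed

lemma separates_mono:
  "separates V \<Phi> \<Longrightarrow> \<Phi> \<subseteq> \<Psi> \<Longrightarrow> (\<And>\<psi>. \<psi> \<in> \<Psi> \<Longrightarrow> lin_on V base \<psi>) \<Longrightarrow> separates V \<Psi>"
  unfolding separates_def by (meson subsetD)

context cochain_data
begin

declare tsum_cong_dual [cong del]

text \<open>Replaces the congruence rule for the dual by one for arbitrary factors. Through
  \<open>=simp=>\<close> the membership facts are simplified before use, so for the dual they become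
  linearity.\<close>

lemma tsum_cong_simp [cong]:
  "X \<in> carr (tensor_space V W) \<Longrightarrow>
    (\<And>u v. u \<in> carr V =simp=> v \<in> carr W =simp=> F u v = G u v) \<Longrightarrow> tsum V W X F = tsum V W X G"
  unfolding simp_implies_def by (rule tsum_cong)

section \<open>The third tensor power and the counit axioms\<close>

abbreviation Dsp3 where "Dsp3 \<equiv> tensor_space Dsp Dsp2"

lemma vec_space_D3: "vec_space Dsp3" by (rule vec_space_tensor[OF vec_space_D])

definition E3 where "E3 a p b q c r X = tsum Dsp Dsp2 X (\<lambda>s u. e1 a p s * E2 b q c r u)"

lemma E3_bilin: "lk p \<Longrightarrow> lk q \<Longrightarrow> lk r \<Longrightarrow> bilin_on Dsp Dsp2 base (\<lambda>s u. e1 a p s * E2 b q c r u)"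
  by (intro bilin_on_base_mult e1_lin E2_lin)

lemma E3_lin: "lk p \<Longrightarrow> lk q \<Longrightarrow> lk r \<Longrightarrow> lin_on Dsp3 base (E3 a p b q c r)"
  unfolding E3_def by (rule tsum_lin[OF vec_space_D vec_space_base E3_bilin])

lemma E3_tens: "lk p \<Longrightarrow> lk q \<Longrightarrow> lk r \<Longrightarrow> s \<in> carr Dsp \<Longrightarrow> u \<in> carr Dsp2 \<Longrightarrow>
    E3 a p b q c r (tens Dsp Dsp2 s u) = e1 a p s * E2 b q c r u"
  unfolding E3_def by (rule tsum_tens[OF vec_space_base E3_bilin])

lemma separates_D3: "separates Dsp3 {E3 a p b q c r | a p b q c r. lk p \<and> lk q \<and> lk r}"
proof -
  have "{\<lambda>t. tsum Dsp Dsp2 t (\<lambda>v w. \<phi> v * \<psi> w) | \<phi> \<psi>. \<phi> \<in> {e1 a p | a p. lk p} \<and> \<psi> \<in> {E2 a p b q | a p b q. lk p \<and> lk q}}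
     \<subseteq> {E3 a p b q c r | a p b q c r. lk p \<and> lk q \<and> lk r}"
    (is "?L \<subseteq> ?R")
  proof
    fix \<chi> assume "\<chi> \<in> ?L"
    then obtain a p b q c r where "\<chi> = E3 a p b q c r" "lk p" "lk q" "lk r"
      unfolding E3_def[abs_def] by blast
    then show "\<chi> \<in> ?R" by blast
  qed
  from separates_mono[OF separates_tensor[OF vec_space_D vec_space_D2 separates_D separates_D2] this]
  show ?thesis using E3_lin by blast
qed

lemma D3_ext:
  assumes "s \<in> carr Dsp3" "s' \<in> carr Dsp3"
    "\<And>a p b q c r. lk p \<Longrightarrow> lk q \<Longrightarrow> lk r \<Longrightarrow> E3 a p b q c r s = E3 a p b q c r s'"
  shows "s = s'"
  by (rule separates_eq[OF vec_space_D3 separates_D3 assms(1,2)]) (use assms(3) in auto)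

lemma fscale_simps:
  "fscale c (x + y) = fscale c x + fscale c y" "fscale (c + d) x = fscale c x + fscale d x"
  "fscale (c * d) x = fscale c (fscale d x)" "fscale c (fscale d x) = fscale d (fscale c x)"
  by (auto simp: fscale_def algebra_simps)

lemma counit_left: "s \<in> carr D \<Longrightarrow> tsum D D (D_comult H gc s) (\<lambda>x y. smult D (D_counit H x) y) = s"
  and counit_right: "s \<in> carr D \<Longrightarrow> tsum D D (D_comult H gc s) (\<lambda>x y. smult D (D_counit H y) x) = s"
proof -
  have ceps: "lin_on Dsp base (e1 1 \<epsilon>)" by (rule e1_lin) simp
  have b: "bilin_on Dsp Dsp Dsp (\<lambda>x y. fscale (e1 1 \<epsilon> x) y)" "bilin_on Dsp Dsp Dsp (\<lambda>x y. fscale (e1 1 \<epsilon> y) x)"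
    using ceps fscale_carr[OF vec_space_D]
    by (auto simp: bilin_on_def lin_on_def smult_tensor_space fscale_simps)
  have lin: "lin_on Dsp Dsp (\<lambda>s. tsum Dsp Dsp (D_comult H gc s) (\<lambda>x y. fscale (e1 1 \<epsilon> x) y))"
    "lin_on Dsp Dsp (\<lambda>s. tsum Dsp Dsp (D_comult H gc s) (\<lambda>x y. fscale (e1 1 \<epsilon> y) x))"
    by (rule lin_on_comp[OF D_comult_lin tsum_lin[OF vec_space_D vec_space_D b(1)]])
      (rule lin_on_comp[OF D_comult_lin tsum_lin[OF vec_space_D vec_space_D b(2)]])
  have sc: "e1 a p (fscale c s) = c * e1 a p s" if "lk p" "s \<in> carr Dsp" for a p c s
    using lin_onD(3)[OF e1_lin[OF that(1)] that(2)] by (simp add: smult_tensor_space)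
  \<comment> \<open>Applying the counit in one tensor factor is evaluation there at 1 and
    \<epsilon>.\<close>
  have ev: "e1 a p (tsum Dsp Dsp X (\<lambda>x y. fscale (e1 1 \<epsilon> x) y)) = E2 1 \<epsilon> a p X"
    "e1 a p (tsum Dsp Dsp X (\<lambda>x y. fscale (e1 1 \<epsilon> y) x)) = E2 a p 1 \<epsilon> X"
    if p: "lk p" and X: "X \<in> carr Dsp2" for a p X
  proof -
    show "e1 a p (tsum Dsp Dsp X (\<lambda>x y. fscale (e1 1 \<epsilon> x) y)) = E2 1 \<epsilon> a p X"
      unfolding lin_on_tsum[OF vec_space_D e1_lin[OF p] X b(1)] E2_def
      by (rule tsum_cong[OF X]) (simp add: sc p)
    show "e1 a p (tsum Dsp Dsp X (\<lambda>x y. fscale (e1 1 \<epsilon> y) x)) = E2 a p 1 \<epsilon> X"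
      unfolding lin_on_tsum[OF vec_space_D e1_lin[OF p] X b(2)] E2_def
      by (rule tsum_cong[OF X]) (simp add: sc p)
  qed
  \<comment> \<open>With one argument equal to 1, \<gamma> is trivial by normalization and the other
    factor returns \<open>f a * p x\<close>.\<close>
  have com: "E2 1 \<epsilon> a p (com f x) = f a * p x" "E2 a p 1 \<epsilon> (com f x) = f a * p x"
    if f: "lk f" and p: "lk p" for a p f x
  proof -
    note l = lk_comp[OF f] lk_comp[OF p]
    show "E2 1 \<epsilon> a p (com f x) = f a * p x"
      by (rule univ_eq2[where E = "\<lambda>a x. E2 1 \<epsilon> a p (com f x)" and E' = "\<lambda>a x. f a * p x"])
        (simp_all add: E2_com f p l sw3_def sw_one, simp add: expand_B l, simp add: split_B cv_ac)
    show "E2 a p 1 \<epsilon> (com f x) = f a * p x"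
      by (rule univ_eq2[where E = "\<lambda>a x. E2 a p 1 \<epsilon> (com f x)" and E' = "\<lambda>a x. f a * p x"])
        (simp_all add: E2_com f p l sw3_def sw_one, simp add: expand_B l, simp add: split_B cv_ac)
  qed
  show "tsum D D (D_comult H gc s) (\<lambda>x y. smult D (D_counit H x) y) = s" if s: "s \<in> carr D"
    unfolding space_cong D_simps D_counit_e1
  proof (rule D_lin_ext[OF lin(1) lin_on_id(2)])
    fix f x assume f: "lk f"
    show "tsum Dsp Dsp (D_comult H gc (dten H f x)) (\<lambda>x y. fscale (e1 1 \<epsilon> x) y) = dten H f x"
      by (rule D_ext) (use lin_onD(1)[OF lin(1), of "dten H f x"] in \<open>simp_all add: f ev com\<close>)
  qed (use s in simp)
  show "tsum D D (D_comult H gc s) (\<lambda>x y. smult D (D_counit H y) x) = s" if s: "s \<in> carr D"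
    unfolding space_cong D_simps D_counit_e1
  proof (rule D_lin_ext[OF lin(2) lin_on_id(2)])
    fix f x assume f: "lk f"
    show "tsum Dsp Dsp (D_comult H gc (dten H f x)) (\<lambda>x y. fscale (e1 1 \<epsilon> y) x) = dten H f x"
      by (rule D_ext) (use lin_onD(1)[OF lin(2), of "dten H f x"] in \<open>simp_all add: f ev com\<close>)
  qed (use s in simp)
qed

section \<open>The associator and quasi-coassociativity\<close>

text \<open>The trilinear form \<open>h\<close> as an element of the third tensor power of D(A),
  supported on functionals tensored with 1. The associator is the case \<open>w'\<close>, its
  inverse the case \<open>w\<close>.\<close>

definition Phi where
  "Phi h = tsum (dual H) du (dual_tensor3 H h) (\<lambda>u1 u. tsum (dual H) (dual H) u (\<lambda>u2 u3.
     tens Dsp Dsp2 (dten H u1 1) (tens Dsp Dsp (dten H u2 1) (dten H u3 1))))"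

lemma dten_lin: "lin_on (dual H) Dsp (\<lambda>f. dten H f x)"
  unfolding dten_def by (rule bilin_onD(2)[OF tens_bilin]) simp

lemma Phi_bilin:
  assumes "vec_space U" "bilin_on Dsp Dsp2 U F"
  shows "u1 \<in> carr (dual H) \<Longrightarrow> bilin_on (dual H) (dual H) U (\<lambda>u2 u3. F (dten H u1 1) (tens Dsp Dsp (dten H u2 1) (dten H u3 1)))"
    and "bilin_on (dual H) du U (\<lambda>u1 u. tsum (dual H) (dual H) u (\<lambda>u2 u3.
      F (dten H u1 1) (tens Dsp Dsp (dten H u2 1) (dten H u3 1))))"
proof -
  have c: "dten H u1 1 \<in> carr Dsp" if "u1 \<in> carr (dual H)" for u1 using that by simp
  show b: "bilin_on (dual H) (dual H) U (\<lambda>u2 u3. F (dten H u1 1) (tens Dsp Dsp (dten H u2 1) (dten H u3 1)))"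
    if "u1 \<in> carr (dual H)" for u1
    by (rule bilin_on_post[OF bilin_on_comp[OF tens_bilin dten_lin dten_lin] bilin_onD(1)[OF assms(2) c[OF that]]])
  show "bilin_on (dual H) du U (\<lambda>u1 u. tsum (dual H) (dual H) u (\<lambda>u2 u3.
      F (dten H u1 1) (tens Dsp Dsp (dten H u2 1) (dten H u3 1))))"
    unfolding bilin_on_def
  proof (intro conjI ballI)
    fix u assume u: "u \<in> carr du"
    show "lin_on (dual H) U (\<lambda>u1. tsum (dual H) (dual H) u (\<lambda>u2 u3.
      F (dten H u1 1) (tens Dsp Dsp (dten H u2 1) (dten H u3 1))))"
      by (rule lin_on_tsum_fun[OF assms(1) u], rule lin_on_comp[OF dten_lin bilin_onD(2)[OF assms(2)]])
        (simp add: tens_carr)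
  qed (rule tsum_lin[OF vec_space_dual assms(1) b])
qed

lemma Phi_carr [simp]: "lk3 h \<Longrightarrow> Phi h \<in> carr Dsp3"
  unfolding Phi_def
  by (rule tsum_carr[OF vec_space_dual vec_space_D3 Phi_bilin(2)[OF vec_space_D3 tens_bilin] dual_tensor3_carr])

lemma tsum_Phi_gen:
  assumes U: "vec_space U" and F: "bilin_on Dsp Dsp2 U F" and h: "lk3 h"
  shows "tsum Dsp Dsp2 (Phi h) F = tsum (dual H) du (dual_tensor3 H h) (\<lambda>u1 u. tsum (dual H) (dual H) u (\<lambda>u2 u3.
     F (dten H u1 1) (tens Dsp Dsp (dten H u2 1) (dten H u3 1))))"
proof -
  have L: "lin_on Dsp3 U (\<lambda>X. tsum Dsp Dsp2 X F)" by (rule tsum_lin[OF vec_space_D U F])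
  note P = Phi_bilin[OF vec_space_D3 tens_bilin]
  note c3 = dual_tensor3_carr[OF h]
  show ?thesis unfolding Phi_def
    apply (subst lin_on_tsum[OF vec_space_D3 L c3 P(2)])
    apply (rule tsum_cong[OF c3])
    apply (subst lin_on_tsum[OF vec_space_D3 L _ P(1)], assumption, assumption)
    apply (rule tsum_cong, assumption)
    apply (rule tsum_tens[OF U F])
     apply (simp_all add: tens_carr)
    done
qed

lemmas tsum_Phi = tsum_Phi_gen[OF vec_space_base]

lemma D_phi_eq: "D_phi H wc = Phi w'"
proof -
  have e: "tsum (dual H) (dual H \<otimes>\<^sub>A dual H) = tsum (dual H) du"
    by (rule tsum_cong_space; simp add: tensor_alg_simps smult_tensor_space)
  show ?thesis unfolding D_phi_def Phi_def D_space_eq w'_def[abs_def] e ..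
qed

lemma E3_Phi:
  assumes h: "lk3 h" and p: "lk p" "lk q" "lk r"
  shows "E3 a p b q c r (Phi h) = h a b c * (p 1 * (q 1 * r 1))"
  unfolding E3_def tsum_Phi[OF E3_bilin[OF p] h]
  apply (simp add: h p E2_tens dual_tensor3_carr del: lk3_def)
  apply (simp add: h collapse tsum_dual_tensor3 del: lk3_def)
  done

text \<open>With group part 1 on the left the conjugation is the identity and \<theta> is trivial by
  normalization, so only the convolution of functionals is left.\<close>

lemma D_mult_dual_left:
  assumes u: "lk u" and p: "lk p" and s: "s \<in> carr Dsp"
  shows "e1 a p (D_mult H tc (dten H u 1) s) = sw H a (\<lambda>a1 a2. u a1 * e1 a2 p s)"
proof (rule D_lin_ext[OF lin_on_comp[OF bilin_onD(1)[OF D_mult_bilin] e1_lin[OF p]] _ _ s])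
  show "dten H u 1 \<in> carr Dsp" using u by simp
  show "lin_on Dsp base (\<lambda>s. sw H a (\<lambda>a1 a2. u a1 * e1 a2 p s))"
    using lin_onD[OF e1_lin[OF p]] by (auto simp: lin_on_def algebra_simps sw_add sw_cmult)
  fix f x assume f: "lk f"
  note l = lk_comp[OF f] lk_comp[OF p] lk_comp[OF u]
  show "e1 a p (D_mult H tc (dten H u 1) (dten H f x)) = sw H a (\<lambda>a1 a2. u a1 * e1 a2 p (dten H f x))"
    apply (rule univ_eq2[where E = "\<lambda>a x. e1 a p (D_mult H tc (dten H u 1) (dten H f x))"
        and E' = "\<lambda>a x. sw H a (\<lambda>a1 a2. u a1 * e1 a2 p (dten H f x))"])
      apply (simp_all add: e1_mult f p u l sw_one)
    unfolding dmF_def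
    apply (simp add: expand_B l sw_one del: pc_simps)
    apply (simp add: split_B)
    done
qed

text \<open>Right multiplication by \<open>u \<otimes> 1\<close> moves \<open>u\<close> past the second tensor factor, so it does not act
  on the first factor alone.\<close>

definition right_twist where "right_twist u a p = (\<lambda>x. sw H x (\<lambda>x1 x2. u (ad H x1 a) * p x2))"

lemma lk_right_twist [simp]:
  assumes "lk u" "lk p"
  shows "la k \<Longrightarrow> lk (\<lambda>x. right_twist u a p (k x))" "la k \<Longrightarrow> lk (\<lambda>a. right_twist u (k a) p x)" "lk (right_twist u a p)"
  unfolding right_twist_def using lk_comp[OF assms(1)] lk_comp[OF assms(2)] by simp_all

lemma D_mult_dual_right:
  assumes u: "lk u" and p: "lk p" and s: "s \<in> carr Dsp"
  shows "e1 a p (D_mult H tc s (dten H u 1)) = sw H a (\<lambda>a1 a2. e1 a1 (right_twist u a2 p) s)"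
proof (rule D_lin_ext[OF lin_on_comp[OF bilin_onD(2)[OF D_mult_bilin] e1_lin[OF p]] _ _ s])
  show "dten H u 1 \<in> carr Dsp" using u by simp
  show "lin_on Dsp base (\<lambda>s. sw H a (\<lambda>a1 a2. e1 a1 (right_twist u a2 p) s))"
    using lin_onD[OF e1_lin[OF lk_right_twist(3)[OF u p]]] by (auto simp: lin_on_def algebra_simps sw_add sw_cmult)
  fix f x assume f: "lk f"
  note l = lk_comp[OF f] lk_comp[OF p] lk_comp[OF u]
  show "e1 a p (D_mult H tc (dten H f x) (dten H u 1)) = sw H a (\<lambda>a1 a2. e1 a1 (right_twist u a2 p) (dten H f x))"
    apply (rule univ_eq2[where E = "\<lambda>a x. e1 a p (D_mult H tc (dten H f x) (dten H u 1))"
        and E' = "\<lambda>a x. sw H a (\<lambda>a1 a2. e1 a1 (right_twist u a2 p) (dten H f x))"])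
      apply (simp_all add: e1_mult f p u l sw_one)
    unfolding dmF_def right_twist_def
    apply (simp add: expand_B l sw_one del: pc_simps)
    apply (simp add: split_B cv_ac del: pc_simps)
    done
qed

lemma D2_mult_dual_left:
  assumes u: "lk u" "lk v" and p: "lk p" "lk q" and s: "s \<in> carr Dsp2"
  shows "E2 a p b q (m2 (tens Dsp Dsp (dten H u 1) (dten H v 1)) s) =
    sw H a (\<lambda>a1 a2. sw H b (\<lambda>b1 b2. u a1 * (v b1 * E2 a2 p b2 q s)))"
proof -
  note b = E2_mult_bilin[OF p]
  show ?thesis
    apply (simp add: E2_mult p s u tens_carr)
    apply (subst tsum_tens[OF vec_space_base b(2)])
       apply (simp_all add: u s)
    apply (simp add: D_mult_dual_left u p s)
    apply (simp add: collapse s E2_def)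
    apply (subst sw_swap)
    apply (simp add: tsum_sw_swap sw_cmult tsum_cmult mult_ac)
    done
qed

lemma D2_mult_dual_right:
  assumes u: "lk u" "lk v" and p: "lk p" "lk q" and s: "s \<in> carr Dsp2"
  shows "E2 a p b q (m2 s (tens Dsp Dsp (dten H u 1) (dten H v 1))) =
    sw H a (\<lambda>a1 a2. sw H b (\<lambda>b1 b2. E2 a1 (right_twist u a2 p) b1 (right_twist v b2 q) s))"
proof -
  note b = E2_mult_bilin[OF p]
  show ?thesis
    apply (simp add: E2_mult p s u tens_carr tsum_tens[OF vec_space_base b(1)])
    apply (simp add: D_mult_dual_right u p s)
    apply (simp add: tsum_sw_swap sw_cmult s E2_def)
    apply (subst sw_swap)
    apply simp
    done
qed

section \<open>Multiplication by elements of the form \<open>Phi h\<close>\<close>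

abbreviation m3 where "m3 \<equiv> mult (D \<otimes>\<^sub>A D \<otimes>\<^sub>A D)"

lemma m2_bilin': "bilin_on (D \<otimes>\<^sub>A D) (D \<otimes>\<^sub>A D) (D \<otimes>\<^sub>A D) m2"
  by (rule tensor_alg_mult_bilin[OF vec_space_D_alg D_mult_bilin' D_mult_bilin'])

lemma m3_bilin': "bilin_on (D \<otimes>\<^sub>A D \<otimes>\<^sub>A D) (D \<otimes>\<^sub>A D \<otimes>\<^sub>A D) (D \<otimes>\<^sub>A D \<otimes>\<^sub>A D) m3"
  by (rule tensor_alg_mult_bilin[OF vec_space_D_alg D_mult_bilin' m2_bilin'])

lemma m3_bilin: "bilin_on Dsp3 Dsp3 Dsp3 m3"
  using m3_bilin' unfolding bilin_on_tensor_alg space_cong .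

lemma m3_carr [simp]: "X \<in> carr Dsp3 \<Longrightarrow> Y \<in> carr Dsp3 \<Longrightarrow> m3 X Y \<in> carr Dsp3"
  by (rule bilin_onD(3)[OF m3_bilin])

lemma E3_mult:
  assumes "lk p" "lk q" "lk r" "X \<in> carr Dsp3" "Y \<in> carr Dsp3"
  shows "E3 a p b q c r (m3 X Y) = tsum Dsp Dsp2 X (\<lambda>s u. tsum Dsp Dsp2 Y (\<lambda>s' u'.
    e1 a p (D_mult H tc s s') * E2 b q c r (m2 u u')))"
proof -
  have "lin_on (D \<otimes>\<^sub>A D) base (E2 b q c r)" using E2_lin[OF assms(2,3)] by (simp add: lin_on_tensor_alg space_cong)
  from tensor_mult_eval[OF vec_space_D_alg D_mult_bilin' m2_bilin' _ this, of "e1 a p" X Y]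
  show ?thesis unfolding E3_def space_cong using assms e1_lin by (simp add: lin_on_D_alg)
qed

lemma E3_mult_bilin:
  assumes "lk p" "lk q" "lk r"
  shows "s \<in> carr Dsp \<Longrightarrow> u \<in> carr Dsp2 \<Longrightarrow>
     bilin_on Dsp Dsp2 base (\<lambda>s' u'. e1 a p (D_mult H tc s s') * E2 b q c r (m2 u u'))"
    and "Y \<in> carr Dsp3 \<Longrightarrow>
     bilin_on Dsp Dsp2 base (\<lambda>s u. tsum Dsp Dsp2 Y (\<lambda>s' u'. e1 a p (D_mult H tc s s') * E2 b q c r (m2 u u')))"
  subgoal
    by (intro bilin_on_base_mult lin_on_comp[OF bilin_onD(1)[OF D_mult_bilin] e1_lin]
        lin_on_comp[OF bilin_onD(1)[OF m2_bilin] E2_lin] assms)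
  subgoal
    by (rule bilin_on_tsum_fun[OF vec_space_base], assumption)
      (intro bilin_on_base_mult lin_on_comp[OF bilin_onD(2)[OF D_mult_bilin] e1_lin]
        lin_on_comp[OF bilin_onD(2)[OF m2_bilin] E2_lin] assms)
  done

lemma E3_Phi_left:
  assumes h: "lk3 h" and p: "lk p" "lk q" "lk r" and Y: "Y \<in> carr Dsp3"
  shows "E3 a p b q c r (m3 (Phi h) Y) =
    sw H a (\<lambda>a1 a2. sw H b (\<lambda>b1 b2. sw H c (\<lambda>c1 c2. h a1 b1 c1 * E3 a2 p b2 q c2 r Y)))"
proof -
  note b = E3_mult_bilin[OF p]
  show ?thesis
    apply (simp only: E3_mult[OF p Phi_carr[OF h] Y])
    apply (subst tsum_Phi[OF b(2)[OF Y] h])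
    apply (simp add: h p Y dual_tensor3_carr D_mult_dual_left D2_mult_dual_left del: lk3_def)
    apply (simp add: sw_cmult tsum_sw_swap tsum_cmult tsum_dual_tensor3 mult.assoc h Y dual_tensor3_carr E3_def sw_swap[of c a] sw_swap[of b a] del: lk3_def)
    done
qed

lemma lin_Phi:
  assumes L: "lin_on Dsp3 base L" and h: "lk3 h"
  shows "L (Phi h) = tsum (dual H) du (dual_tensor3 H h) (\<lambda>u1 u. tsum (dual H) (dual H) u (\<lambda>u2 u3.
     L (tens Dsp Dsp2 (dten H u1 1) (tens Dsp Dsp (dten H u2 1) (dten H u3 1)))))"
proof -
  note P = Phi_bilin[OF vec_space_D3 tens_bilin]
  note c3 = dual_tensor3_carr[OF h]
  show ?thesis unfolding Phi_def
    apply (subst lin_on_tsum[OF vec_space_D3 L c3 P(2)])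
    apply (rule tsum_cong[OF c3])
    apply (subst lin_on_tsum[OF vec_space_D3 L _ P(1)], assumption, assumption)
    apply (rule refl)
    done
qed

text \<open>The twist entangles \<open>u1\<close>, \<open>u2\<close>, \<open>u3\<close> with the
  group parts of \<open>Z\<close>, so the sum over the decomposition of \<open>h\<close> stays open
  here. It closes once \<open>Z\<close> is explicit, and \<open>h\<close> then appears at conjugated
  arguments.\<close>

lemma E3_Phi_right:
  assumes h: "lk3 h" and p: "lk p" "lk q" "lk r" and Z: "Z \<in> carr Dsp3"
  shows "E3 a p b q c r (m3 Z (Phi h)) = tsum (dual H) du (dual_tensor3 H h) (\<lambda>u1 u. tsum (dual H) (dual H) u (\<lambda>u2 u3.
    sw H a (\<lambda>a1 a2. sw H b (\<lambda>b1 b2. sw H c (\<lambda>c1 c2. E3 a1 (right_twist u1 a2 p) b1 (right_twist u2 b2 q) c1 (right_twist u3 c2 r) Z)))))"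
proof -
  note b = E3_mult_bilin[OF p]
  have L: "lin_on Dsp3 base (\<lambda>Y. E3 a p b q c r (m3 Z Y))"
    by (rule lin_on_comp[OF bilin_onD(1)[OF m3_bilin Z] E3_lin[OF p]])
  show ?thesis
    apply (subst lin_Phi[OF L h])
    apply (simp add: h p Z dual_tensor3_carr tens_carr E3_mult tsum_tens[OF vec_space_base b(1)]
       D_mult_dual_right D2_mult_dual_right del: lk3_def)
    apply (simp add: sw_cmult tsum_sw_swap mult.assoc h dual_tensor3_carr Z E3_def sw_swap[of c a] sw_swap[of b a] del: lk3_def)
    done
qed

declare lk3_cv3 [simp]

text \<open>Left multiplication by functionals is convolution in each factor, so the product of the
  two elements is again given by a form.\<close>

lemma Phi_mult:
  assumes h: "lk3 h" "lk3 k"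
  shows "m3 (Phi h) (Phi k) = Phi (cv3 h k)"
proof (rule D3_ext)
  fix a p b q c r assume p: "lk p" "lk q" "lk r"
  show "E3 a p b q c r (m3 (Phi h) (Phi k)) = E3 a p b q c r (Phi (cv3 h k))"
    by (simp add: E3_Phi_left E3_Phi h p del: lk3_def) (simp add: cv3_def sw_cmult mult.assoc)
qed (simp_all add: h del: lk3_def)

lemma Phi_eps: "Phi eps3 = tens Dsp Dsp2 (dten H \<epsilon> 1) (tens Dsp Dsp (dten H \<epsilon> 1) (dten H \<epsilon> 1))"
proof (rule D3_ext)
  fix a p b q c r assume p: "lk p" "lk q" "lk r"
  show "E3 a p b q c r (Phi eps3) = E3 a p b q c r (tens Dsp Dsp2 (dten H \<epsilon> 1) (tens Dsp Dsp (dten H \<epsilon> 1) (dten H \<epsilon> 1)))"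
    by (simp add: E3_Phi E3_tens E2_tens p tens_carr eps3_def mult_ac)
qed (simp_all add: tens_carr eps3_def[abs_def])

lemma unit_D3: "unit (D \<otimes>\<^sub>A D \<otimes>\<^sub>A D) = Phi eps3"
  unfolding Phi_eps by (simp add: tensor_alg_simps space_cong)

lemma cv3_data': "cv3 w' w = eps3"
proof (intro ext)
  have l: "lk3 (cv3 w' w)" "lk3 eps3"
    by (simp add: lk3_data del: lk3_def) (simp add: eps3_def)
  fix a b c show "cv3 w' w a b c = eps3 a b c"
  proof (rule T_univ[OF l])
    show "T (cv3 w' w) U1 U2 U3 = T eps3 U1 U2 U3"
      using T_cv3[OF gl_U(1-3) lk3_data(2,1)] T_inv_comm[OF gl_U(1-3)] by simp
  qed
qed

text \<open>Comes from the multiplicativity of \<open>Phi\<close>, and so provides an explicit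
  \<open>\<psi>\<close> for the axioms from which the cocycle conditions are extracted.\<close>

lemma Phi_inverse: "is_inverse (D \<otimes>\<^sub>A D \<otimes>\<^sub>A D) (Phi w') (Phi w)"
  unfolding is_inverse_def unit_D3
  by (simp add: Phi_mult lk3_data cv3_data cv3_data' tensor_alg_simps space_cong del: lk3_def)

lemma phi_invertible: "\<exists>\<psi>. is_inverse (D \<otimes>\<^sub>A D \<otimes>\<^sub>A D) (D_phi H wc) \<psi>"
  using Phi_inverse unfolding D_phi_eq by blast

lemma phi_carr: "D_phi H wc \<in> carr (D \<otimes>\<^sub>A D \<otimes>\<^sub>A D)"
  unfolding D_phi_eq by (simp add: tensor_alg_simps space_cong lk3_data del: lk3_def)

section \<open>Quasi-coassociativity at points\<close>

lemma eval_comult_right: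
  assumes "lk p" "lk q" "lk r" "X \<in> carr Dsp2"
  shows "E3 a p b q c r (tmap Dsp Dsp Dsp Dsp2 id (D_comult H gc) X) =
    tsum Dsp Dsp X (\<lambda>x y. e1 a p x * E2 b q c r (D_comult H gc y))"
  unfolding E3_def tmap_eval[OF vec_space_D vec_space_D lin_on_id(1) D_comult_lin e1_lin[OF assms(1)] E2_lin[OF assms(2,3)] assms(4)]
  by (simp add: assms)

lemma eval_comult_left:
  assumes "lk p" "lk q" "lk r" "X \<in> carr Dsp2"
  shows "E3 a p b q c r (tassoc Dsp Dsp Dsp (tmap Dsp Dsp Dsp2 Dsp (D_comult H gc) id X)) =
    tsum Dsp Dsp X (\<lambda>x y. E2 a p b q (D_comult H gc x) * e1 c r y)"
proof -
  have c: "tmap Dsp Dsp Dsp2 Dsp (D_comult H gc) id X \<in> carr (tensor_space Dsp2 Dsp)"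
    by (rule lin_onD(1)[OF tmap_lin[OF vec_space_D vec_space_D2 D_comult_lin lin_on_id(1)] assms(4)])
  show ?thesis
    unfolding E3_def E2_def[of b q c r]
      tassoc_eval[OF vec_space_D vec_space_D e1_lin[OF assms(1)] e1_lin[OF assms(2)] e1_lin[OF assms(3)] c]
    unfolding E2_def[symmetric]
      tmap_eval[OF vec_space_D vec_space_D2 D_comult_lin lin_on_id(1) E2_lin[OF assms(1,2)] e1_lin[OF assms(3)] assms(4)]
    by (simp add: assms)
qed

lemma coassoc_left_points:
  assumes f: "lk f" "lk p" "lk q" "lk r" and g: "gl u" "gl v" "gl s" "gl x"
  shows "B u (\<lambda>a. B v (\<lambda>b. B s (\<lambda>c. B x (\<lambda>y. br (E3 a p b q c r
      (tmap Dsp Dsp Dsp Dsp2 id (D_comult H gc) (com f y))))))) =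
    F1 f (pm u (pm v s)) \<odot> T g x u (pm v s) \<odot> T g x v s \<odot> F1 p x \<odot> F1 q x \<odot> F1 r x"
proof -
  note l = lk_comp[OF f(1)] lk_comp[OF f(2)] lk_comp[OF f(3)] lk_comp[OF f(4)]
  have b: "bilin_on Dsp Dsp base (\<lambda>x y. e1 a p x * E2 b q c r (D_comult H gc y))" for a b c
    by (intro bilin_on_base_mult lin_on_comp[OF D_comult_lin E2_lin] e1_lin f)
  show ?thesis
    apply (simp add: eval_comult_right f)
    apply (simp add: tsum_com[OF b] f E2_com)
    apply (simp add: collapse f sw3_def)
    unfolding F1_def T_def
    apply (simp add: expand_B l g del: pc_simps)
    apply (simp add: split_B del: pc_simps)
    apply (simp only: B_comm[of v u] B_comm[of s u] B_comm[of s v] B_comm[of x u] B_comm[of x v] B_comm[of x s])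
    apply (simp add: cv_ac mult.assoc)
    done
qed

text \<open>Multiplication by the associator on the left contributes w^-1(u, v, s). Its inverse on
  the right has to pass the group part \<open>x\<close>, so \<open>w\<close> is taken at the
  conjugated points. Comparison with \<open>coassoc_left_points\<close> is \<open>cond1\<close> with
  one value of \<open>w\<close> moved across.\<close>

lemma coassoc_right_points:
  assumes f: "lk f" "lk p" "lk q" "lk r" and g: "gl u" "gl v" "gl s" "gl x"
  shows "B u (\<lambda>a. B v (\<lambda>b. B s (\<lambda>c. B x (\<lambda>y. br (E3 a p b q c r
      (m3 (m3 (Phi w') (tassoc Dsp Dsp Dsp (tmap Dsp Dsp Dsp2 Dsp (D_comult H gc) id (com f y)))) (Phi w))))))) =
    T w' u v s \<odot> F1 f (pm (pm u v) s) \<odot> T g x (pm u v) s \<odot> T g x u v \<odot> T w (pc x u) (pc x v) (pc x s)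
      \<odot> F1 p x \<odot> F1 q x \<odot> F1 r x"
proof -
  note l = lk_comp[OF f(1)] lk_comp[OF f(2)] lk_comp[OF f(3)] lk_comp[OF f(4)]
  have b: "bilin_on Dsp Dsp base (\<lambda>x y. E2 a p b q (D_comult H gc x) * e1 c r y)" if "lk p" "lk q" "lk r" for a b c p q r
    by (intro bilin_on_base_mult lin_on_comp[OF D_comult_lin E2_lin] e1_lin that)
  have c: "tassoc Dsp Dsp Dsp (tmap Dsp Dsp Dsp2 Dsp (D_comult H gc) id (com f y)) \<in> carr Dsp3" for y
    by (rule lin_onD(1)[OF tassoc_lin[OF vec_space_D vec_space_D]]
       lin_onD(1)[OF tmap_lin[OF vec_space_D vec_space_D2 D_comult_lin lin_on_id(1)]] com_carr f)+
  show ?thesis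
    apply (simp add: E3_Phi_right E3_Phi_left f c lk3_data dual_tensor3_carr eval_comult_left tsum_com[OF b] E2_com del: lk3_def)
    apply (simp add: collapse f sw3_def lk3_data dual_tensor3_carr right_twist_def tsum_dual_tensor3 del: lk3_def)
    unfolding F1_def T_def
    apply (simp add: expand_B l g del: pc_simps)
    apply (simp add: split_B del: pc_simps)
    apply (simp only: B_comm[of v u] B_comm[of s u] B_comm[of s v] B_comm[of x u] B_comm[of x v] B_comm[of x s])
    apply (simp add: cv_ac mult.assoc)
    done
qed

lemma phi_counit:
  "tsum D (D \<otimes>\<^sub>A D) (D_phi H wc) (\<lambda>x u. tsum D D u (\<lambda>y z. tens D D x (smult D (D_counit H y) z))) =
       tens D D (unit D) (unit D)"
proof -
  have ceps: "lin_on Dsp base (e1 1 \<epsilon>)" by (rule e1_lin) simp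
  have b0: "bilin_on Dsp Dsp Dsp (\<lambda>y z. fscale (e1 1 \<epsilon> y) z)"
    using ceps fscale_carr[OF vec_space_D]
    by (auto simp: bilin_on_def lin_on_def smult_tensor_space fscale_simps)
  have b1: "bilin_on Dsp Dsp Dsp2 (\<lambda>y z. tens Dsp Dsp x (fscale (e1 1 \<epsilon> y) z))" if "x \<in> carr Dsp" for x
    by (rule bilin_on_post[OF b0 bilin_onD(1)[OF tens_bilin that]])
  have b2: "bilin_on Dsp Dsp2 Dsp2 (\<lambda>x u. tsum Dsp Dsp u (\<lambda>y z. tens Dsp Dsp x (fscale (e1 1 \<epsilon> y) z)))"
    unfolding bilin_on_def
  proof (intro conjI ballI)
    fix u assume u: "u \<in> carr Dsp2"
    show "lin_on Dsp Dsp2 (\<lambda>x. tsum Dsp Dsp u (\<lambda>y z. tens Dsp Dsp x (fscale (e1 1 \<epsilon> y) z)))"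
      by (rule lin_on_tsum_fun[OF vec_space_D2 u], rule bilin_onD(2)[OF tens_bilin])
        (rule fscale_carr[OF vec_space_D])
  qed (rule tsum_lin[OF vec_space_D vec_space_D2 b1])
  have P: "Phi w' \<in> carr Dsp3" by (simp add: lk3_data del: lk3_def)
  have sc: "e1 a p (fscale c s) = c * e1 a p s" if "lk p" "s \<in> carr Dsp" for a p c s
    using lin_onD(3)[OF e1_lin[OF that(1)] that(2)] by (simp add: smult_tensor_space)
  have "tsum Dsp Dsp2 (Phi w') (\<lambda>x u. tsum Dsp Dsp u (\<lambda>y z. tens Dsp Dsp x (fscale (e1 1 \<epsilon> y) z))) =
    tens Dsp Dsp (dten H \<epsilon> 1) (dten H \<epsilon> 1)"
  proof (rule D2_ext)
    show "tsum Dsp Dsp2 (Phi w') (\<lambda>x u. tsum Dsp Dsp u (\<lambda>y z. tens Dsp Dsp x (fscale (e1 1 \<epsilon> y) z))) \<in> carr Dsp2"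
      by (rule tsum_carr[OF vec_space_D vec_space_D2 b2 P])
    fix a p c r assume p: "lk p" "lk r"
    have "E2 a p c r (tsum Dsp Dsp2 (Phi w') (\<lambda>x u. tsum Dsp Dsp u (\<lambda>y z. tens Dsp Dsp x (fscale (e1 1 \<epsilon> y) z)))) =
      tsum Dsp Dsp2 (Phi w') (\<lambda>x u. E2 a p c r (tsum Dsp Dsp u (\<lambda>y z. tens Dsp Dsp x (fscale (e1 1 \<epsilon> y) z))))"
      by (rule lin_on_tsum[OF vec_space_D2 E2_lin[OF p] P b2])
    \<comment> \<open>The counit in the middle factor means the argument 1 and the form \<epsilon>
      there, where \<open>w'\<close> is trivial by normalization.\<close>
    also have "\<dots> = E3 a p 1 \<epsilon> c r (Phi w')"
      unfolding E3_def
    proof (rule tsum_cong[OF P])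
      fix x u assume x: "x \<in> carr Dsp" and u: "u \<in> carr Dsp2"
      have "E2 a p c r (tsum Dsp Dsp u (\<lambda>y z. tens Dsp Dsp x (fscale (e1 1 \<epsilon> y) z))) =
        tsum Dsp Dsp u (\<lambda>y z. E2 a p c r (tens Dsp Dsp x (fscale (e1 1 \<epsilon> y) z)))"
        by (rule lin_on_tsum[OF vec_space_D2 E2_lin[OF p] u b1[OF x]])
      also have "\<dots> = e1 a p x * E2 1 \<epsilon> c r u"
        unfolding E2_def[of 1 \<epsilon> c r]
        using fscale_carr[OF vec_space_D] by (simp add: u x p E2_tens sc tsum_cmult)
      finally show "E2 a p c r (tsum Dsp Dsp u (\<lambda>y z. tens Dsp Dsp x (fscale (e1 1 \<epsilon> y) z))) = e1 a p x * E2 1 \<epsilon> c r u" .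
    qed
    also have "\<dots> = E2 a p c r (tens Dsp Dsp (dten H \<epsilon> 1) (dten H \<epsilon> 1))"
      by (simp add: E3_Phi E2_tens p lk3_data mult_ac del: lk3_def)
    finally show "E2 a p c r (tsum Dsp Dsp2 (Phi w') (\<lambda>x u. tsum Dsp Dsp u (\<lambda>y z. tens Dsp Dsp x (fscale (e1 1 \<epsilon> y) z)))) =
      E2 a p c r (tens Dsp Dsp (dten H \<epsilon> 1) (dten H \<epsilon> 1))" .
  qed (simp add: tens_carr)
  then show ?thesis unfolding D_phi_eq D_counit_e1 space_cong D_simps .
qed

lemma coassoc_lk4:
  assumes f: "lk f" "lk p" "lk q" "lk r"
  shows "lk4 (\<lambda>a b c y. E3 a p b q c r (tmap Dsp Dsp Dsp Dsp2 id (D_comult H gc) (com f y)))"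
    "lk4 (\<lambda>a b c y. E3 a p b q c r
      (m3 (m3 (Phi w') (tassoc Dsp Dsp Dsp (tmap Dsp Dsp Dsp2 Dsp (D_comult H gc) id (com f y)))) (Phi w)))"
proof -
  note l = lk_comp[OF f(1)] lk_comp[OF f(2)] lk_comp[OF f(3)] lk_comp[OF f(4)]
  have b: "bilin_on Dsp Dsp base (\<lambda>x y. e1 a p x * E2 b q c r (D_comult H gc y))" for a b c
    by (intro bilin_on_base_mult lin_on_comp[OF D_comult_lin E2_lin] e1_lin f)
  show "lk4 (\<lambda>a b c y. E3 a p b q c r (tmap Dsp Dsp Dsp Dsp2 id (D_comult H gc) (com f y)))"
    apply (simp add: eval_comult_right f del: lk4_def)
    apply (simp add: tsum_com[OF b] f E2_com del: lk4_def)
    apply (simp add: collapse f sw3_def l)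
    done
  have b: "bilin_on Dsp Dsp base (\<lambda>x y. E2 a p b q (D_comult H gc x) * e1 c r y)" if "lk p" "lk q" "lk r" for a b c p q r
    by (intro bilin_on_base_mult lin_on_comp[OF D_comult_lin E2_lin] e1_lin that)
  have c: "tassoc Dsp Dsp Dsp (tmap Dsp Dsp Dsp2 Dsp (D_comult H gc) id (com f y)) \<in> carr Dsp3" for y
    by (rule lin_onD(1)[OF tassoc_lin[OF vec_space_D vec_space_D]]
       lin_onD(1)[OF tmap_lin[OF vec_space_D vec_space_D2 D_comult_lin lin_on_id(1)]] com_carr f)+
  show "lk4 (\<lambda>a b c y. E3 a p b q c r
      (m3 (m3 (Phi w') (tassoc Dsp Dsp Dsp (tmap Dsp Dsp Dsp2 Dsp (D_comult H gc) id (com f y)))) (Phi w)))"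
    apply (simp add: E3_Phi_right E3_Phi_left f c lk3_data dual_tensor3_carr eval_comult_left tsum_com[OF b] E2_com
       del: lk3_def lk4_def)
    apply (simp add: collapse f sw3_def lk3_data dual_tensor3_carr right_twist_def tsum_dual_tensor3 del: lk3_def lk4_def)
    apply (simp add: l)
    done
qed

lemma coassoc_iff:
  "(\<forall>s\<in>carr Dsp. tmap Dsp Dsp Dsp Dsp2 id (D_comult H gc) (D_comult H gc s) =
     m3 (m3 (Phi w') (tassoc Dsp Dsp Dsp (tmap Dsp Dsp Dsp2 Dsp (D_comult H gc) id (D_comult H gc s)))) (Phi w))
    \<longleftrightarrow> cond1" (is "(\<forall>s\<in>carr Dsp. ?L s = ?R s) \<longleftrightarrow> _")
proof
  assume as: "\<forall>s\<in>carr Dsp. ?L s = ?R s"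
  show cond1 unfolding cond1_def
  proof (intro allI impI)
    fix x u v s assume g: "gl x" "gl u" "gl v" "gl s"
    have "?L (dten H \<epsilon> y) = ?R (dten H \<epsilon> y)" for y using as by (simp del: D_comult_dten)
    then have "B u (\<lambda>a. B v (\<lambda>b. B s (\<lambda>c. B x (\<lambda>y. br (E3 a \<epsilon> b \<epsilon> c \<epsilon> (?L (dten H \<epsilon> y))))))) =
      B u (\<lambda>a. B v (\<lambda>b. B s (\<lambda>c. B x (\<lambda>y. br (E3 a \<epsilon> b \<epsilon> c \<epsilon> (?R (dten H \<epsilon> y)))))))"
      by (simp only:)
    \<comment> \<open>All free forms are counits; the equation still carries \<open>w'\<close>, and
      multiplying by \<open>w\<close> turns it into \<open>cond1\<close>.\<close>
    then have e: "T g x u (pm v s) \<odot> T g x v s =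
      T w' u v s \<odot> T g x (pm u v) s \<odot> T g x u v \<odot> T w (pc x u) (pc x v) (pc x s)"
      unfolding D_comult_dten[OF lk_eps0] coassoc_left_points[OF lk_eps0 lk_eps0 lk_eps0 lk_eps0 g(2-4,1)]
        coassoc_right_points[OF lk_eps0 lk_eps0 lk_eps0 lk_eps0 g(2-4,1)]
      using g by (simp del: pc_simps)
    have "T g x v s \<odot> T g x u (pm v s) \<odot> T w u v s = T w u v s \<odot> (T g x u (pm v s) \<odot> T g x v s)"
      by (simp add: R.cv_comm R.cv_left_comm)
    also have "\<dots> = T g x (pm u v) s \<odot> T g x u v \<odot> T w (pc x u) (pc x v) (pc x s)"
      unfolding e by (rule T_inv'(1)[OF g(2-4)]) simp
    finally show "T g x v s \<odot> T g x u (pm v s) \<odot> T w u v s =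
      T g x (pm u v) s \<odot> T g x u v \<odot> T w (pc x u) (pc x v) (pc x s)" .
  qed
next
  assume c: cond1
  \<comment> \<open>\<open>cond1\<close> multiplied by \<open>w'\<close> and by a factor
    \<open>Z\<close> that stands for the free forms.\<close>
  have cc: "T g x u (pm v s) \<odot> T g x v s \<odot> Z =
      T w' u v s \<odot> T g x (pm u v) s \<odot> T g x u v \<odot> T w (pc x u) (pc x v) (pc x s) \<odot> Z"
    if g: "gl x" "gl u" "gl v" "gl s" and Z: "reg Z" for x u v s Z
  proof -
    have "T w' u v s \<odot> T g x (pm u v) s \<odot> T g x u v \<odot> T w (pc x u) (pc x v) (pc x s) \<odot> Z =
      T w' u v s \<odot> (T g x (pm u v) s \<odot> T g x u v \<odot> T w (pc x u) (pc x v) (pc x s)) \<odot> Z"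
      by (simp only: R.cv_assoc)
    also have "\<dots> = (T w u v s \<odot> T w' u v s) \<odot> T g x u (pm v s) \<odot> T g x v s \<odot> Z"
      unfolding c[unfolded cond1_def, rule_format, OF g, symmetric]
      by (simp add: R.cv_assoc R.cv_left_comm R.cv_comm)
    also have "\<dots> = T g x u (pm v s) \<odot> T g x v s \<odot> Z"
      using T_inv(1)[OF g(2-4)] Z by simp
    finally show ?thesis by simp
  qed
  have el: "?L (dten H f x) = ?R (dten H f x)" if f: "lk f" for f x
  proof (rule D3_ext)
    fix a p b q c r assume p: "lk p" "lk q" "lk r"
    let ?E = "\<lambda>a b c y. E3 a p b q c r (tmap Dsp Dsp Dsp Dsp2 id (D_comult H gc) (com f y))"
    let ?E' = "\<lambda>a b c y. E3 a p b q c r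
      (m3 (m3 (Phi w') (tassoc Dsp Dsp Dsp (tmap Dsp Dsp Dsp2 Dsp (D_comult H gc) id (com f y)))) (Phi w))"
    have "?E a b c x = ?E' a b c x"
    proof (rule univ_eq[OF coassoc_lk4(1)[OF f p] coassoc_lk4(2)[OF f p]])
      show "B U1 (\<lambda>a. B U2 (\<lambda>b. B U3 (\<lambda>c. B U4 (\<lambda>d. br (?E a b c d))))) =
         B U1 (\<lambda>a. B U2 (\<lambda>b. B U3 (\<lambda>c. B U4 (\<lambda>d. br (?E' a b c d)))))"
        unfolding coassoc_left_points[OF f p gl_U] coassoc_right_points[OF f p gl_U]
        using cc[OF gl_U(4,1-3), of "F1 p U4 \<odot> F1 q U4 \<odot> F1 r U4"]
        by (simp add: R.cv_left_comm[of "F1 f _"] del: pc_simps) (simp add: pm_assoc)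
    qed
    then show "E3 a p b q c r (?L (dten H f x)) = E3 a p b q c r (?R (dten H f x))"
      unfolding D_comult_dten[OF f] .
  next
    show "?L (dten H f x) \<in> carr Dsp3"
      by (rule lin_onD(1)[OF tmap_lin[OF vec_space_D vec_space_D lin_on_id(1) D_comult_lin]]) (simp add: f)
    show "?R (dten H f x) \<in> carr Dsp3"
      by (intro m3_carr Phi_carr lin_onD(1)[OF tassoc_lin[OF vec_space_D vec_space_D]] lk3_data
       lin_onD(1)[OF tmap_lin[OF vec_space_D vec_space_D2 D_comult_lin lin_on_id(1)]] D_comult_carr dten_carr f)
  qed
  have P: "Phi w \<in> carr Dsp3" "Phi w' \<in> carr Dsp3" by (intro Phi_carr lk3_data)+
  have "lin_on Dsp Dsp3 ?L"
    by (rule lin_on_comp[OF D_comult_lin tmap_lin[OF vec_space_D vec_space_D lin_on_id(1) D_comult_lin]])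
  moreover have "lin_on Dsp Dsp3 ?R"
    by (rule lin_on_comp[OF lin_on_comp[OF lin_on_comp[OF lin_on_comp[OF D_comult_lin
      tmap_lin[OF vec_space_D vec_space_D2 D_comult_lin lin_on_id(1)]] tassoc_lin[OF vec_space_D vec_space_D]]
      bilin_onD(1)[OF m3_bilin P(2)]] bilin_onD(2)[OF m3_bilin P(1)]])
  ultimately show "\<forall>s\<in>carr Dsp. ?L s = ?R s" using D_lin_ext[of Dsp3 ?L ?R] el by blast
qed

section \<open>The pentagon\<close>

abbreviation Dsp4 where "Dsp4 \<equiv> tensor_space Dsp Dsp3"

lemma vec_space_D4: "vec_space Dsp4" by (rule vec_space_tensor[OF vec_space_D])

definition E4 where "E4 a p b q c r d s X = tsum Dsp Dsp3 X (\<lambda>x u. e1 a p x * E3 b q c r d s u)"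

lemma E4_bilin: "lk p \<Longrightarrow> lk q \<Longrightarrow> lk r \<Longrightarrow> lk s \<Longrightarrow> bilin_on Dsp Dsp3 base (\<lambda>x u. e1 a p x * E3 b q c r d s u)"
  by (intro bilin_on_base_mult e1_lin E3_lin)

lemma E4_lin: "lk p \<Longrightarrow> lk q \<Longrightarrow> lk r \<Longrightarrow> lk s \<Longrightarrow> lin_on Dsp4 base (E4 a p b q c r d s)"
  unfolding E4_def by (rule tsum_lin[OF vec_space_D vec_space_base E4_bilin])

lemma E4_tens: "lk p \<Longrightarrow> lk q \<Longrightarrow> lk r \<Longrightarrow> lk s \<Longrightarrow> x \<in> carr Dsp \<Longrightarrow> u \<in> carr Dsp3 \<Longrightarrow>
    E4 a p b q c r d s (tens Dsp Dsp3 x u) = e1 a p x * E3 b q c r d s u"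
  unfolding E4_def by (rule tsum_tens[OF vec_space_base E4_bilin])

lemma separates_D4: "separates Dsp4 {E4 a p b q c r d s | a p b q c r d s. lk p \<and> lk q \<and> lk r \<and> lk s}"
proof -
  have "{\<lambda>t. tsum Dsp Dsp3 t (\<lambda>v w. \<phi> v * \<psi> w) | \<phi> \<psi>. \<phi> \<in> {e1 a p | a p. lk p} \<and>
      \<psi> \<in> {E3 a p b q c r | a p b q c r. lk p \<and> lk q \<and> lk r}}
     \<subseteq> {E4 a p b q c r d s | a p b q c r d s. lk p \<and> lk q \<and> lk r \<and> lk s}"
    (is "?L \<subseteq> ?R")
  proof
    fix \<chi> assume "\<chi> \<in> ?L"
    then obtain a p b q c r d s where "\<chi> = E4 a p b q c r d s" "lk p" "lk q" "lk r" "lk s"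
      unfolding E4_def[abs_def] by blast
    then show "\<chi> \<in> ?R" by blast
  qed
  from separates_mono[OF separates_tensor[OF vec_space_D vec_space_D3 separates_D separates_D3] this]
  show ?thesis using E4_lin by blast
qed

lemma D4_ext:
  assumes "X \<in> carr Dsp4" "Y \<in> carr Dsp4"
    "\<And>a p b q c r d s. lk p \<Longrightarrow> lk q \<Longrightarrow> lk r \<Longrightarrow> lk s \<Longrightarrow> E4 a p b q c r d s X = E4 a p b q c r d s Y"
  shows "X = Y"
  by (rule separates_eq[OF vec_space_D4 separates_D4 assms(1,2)]) (use assms(3) in auto)

abbreviation m4 where "m4 \<equiv> mult (D \<otimes>\<^sub>A D \<otimes>\<^sub>A D \<otimes>\<^sub>A D)"

lemma m4_bilin: "bilin_on Dsp4 Dsp4 Dsp4 m4"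
  using tensor_alg_mult_bilin[OF vec_space_D_alg D_mult_bilin' m3_bilin'] unfolding bilin_on_tensor_alg space_cong .

lemma m4_carr [simp]: "X \<in> carr Dsp4 \<Longrightarrow> Y \<in> carr Dsp4 \<Longrightarrow> m4 X Y \<in> carr Dsp4"
  by (rule bilin_onD(3)[OF m4_bilin])

lemma D3_mult_dual_left:
  assumes u: "lk u" "lk v" "lk k" and p: "lk p" "lk q" "lk r" and Y: "Y \<in> carr Dsp3"
  shows "E3 a p b q c r (m3 (tens Dsp Dsp2 (dten H u 1) (tens Dsp Dsp (dten H v 1) (dten H k 1))) Y) =
    sw H a (\<lambda>a1 a2. sw H b (\<lambda>b1 b2. sw H c (\<lambda>c1 c2. u a1 * (v b1 * (k c1 * E3 a2 p b2 q c2 r Y)))))"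
proof -
  note b = E3_mult_bilin[OF p]
  show ?thesis
    apply (simp add: E3_mult p Y u tens_carr)
    apply (subst tsum_tens[OF vec_space_base b(2)])
       apply (simp_all add: u Y tens_carr)
    apply (simp add: D_mult_dual_left D2_mult_dual_left u p Y)
    apply (simp add: sw_cmult tsum_sw_swap tsum_cmult mult.assoc Y E3_def sw_swap[of c a] sw_swap[of b a])
    done
qed

lemma E4_mult_tens:
  assumes p: "lk p" "lk q" "lk r" "lk s" and x: "x \<in> carr Dsp" "u \<in> carr Dsp3" and Y: "Y \<in> carr Dsp4"
  shows "E4 a p b q c r d s (m4 (tens Dsp Dsp3 x u) Y) = tsum Dsp Dsp3 Y (\<lambda>x' u'.
    e1 a p (D_mult H tc x x') * E3 b q c r d s (m3 u u'))"
proof -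
  have l: "lin_on (D \<otimes>\<^sub>A D \<otimes>\<^sub>A D) base (E3 b q c r d s)"
    using E3_lin[OF p(2-4)] unfolding lin_on_tensor_alg space_cong .
  have X: "tens Dsp Dsp3 x u \<in> carr Dsp4" by (rule tens_carr[OF x])
  have b: "bilin_on Dsp Dsp3 base (\<lambda>x u. tsum Dsp Dsp3 Y (\<lambda>x' u'.
    e1 a p (D_mult H tc x x') * E3 b q c r d s (m3 u u')))"
    by (rule bilin_on_tsum_fun[OF vec_space_base Y])
      (intro bilin_on_base_mult lin_on_comp[OF bilin_onD(2)[OF D_mult_bilin] e1_lin]
        lin_on_comp[OF bilin_onD(2)[OF m3_bilin] E3_lin] p)
  show ?thesis
    using tensor_mult_eval[OF vec_space_D_alg D_mult_bilin' m3_bilin' _ l, of "e1 a p" "tens Dsp Dsp3 x u" Y]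
    unfolding space_cong E4_def using p e1_lin X Y
    by (simp add: lin_on_D_alg tsum_tens[OF vec_space_base b x])
qed

abbreviation dten4 where
  "dten4 u v k h \<equiv> tens Dsp Dsp3 (dten H u 1) (tens Dsp Dsp2 (dten H v 1) (tens Dsp Dsp (dten H k 1) (dten H h 1)))"

lemma D4_mult_dual_left:
  assumes u: "lk u" "lk v" "lk k" "lk h" and p: "lk p" "lk q" "lk r" "lk s" and Y: "Y \<in> carr Dsp4"
  shows "E4 a p b q c r d s (m4 (dten4 u v k h) Y) =
    sw H a (\<lambda>a1 a2. sw H b (\<lambda>b1 b2. sw H c (\<lambda>c1 c2. sw H d (\<lambda>d1 d2.
      u a1 * (v b1 * (k c1 * (h d1 * E4 a2 p b2 q c2 r d2 s Y)))))))"
  apply (simp add: E4_mult_tens p Y u tens_carr)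
  apply (simp add: D_mult_dual_left D3_mult_dual_left u p Y)
  apply (simp add: sw_cmult tsum_sw_swap tsum_cmult mult.assoc Y E4_def sw_swap[of d a] sw_swap[of c a] sw_swap[of b a])
  done

text \<open>The analogue of \<open>Phi\<close> for four factors, written in the basis of coordinate
  forms so that a linear functional is computed term by term.\<close>

definition Phi4 where
  "Phi4 K = (\<Sum>i\<in>Eb. \<Sum>j\<in>Eb. \<Sum>k\<in>Eb. \<Sum>l\<in>Eb. fscale (K i j k l) (dten4 (cd i) (cd j) (cd k) (cd l)))"

lemma dten4_carr: "lk u \<Longrightarrow> lk v \<Longrightarrow> lk k \<Longrightarrow> lk h \<Longrightarrow> dten4 u v k h \<in> carr Dsp4"
  by (intro tens_carr) simp_all

lemma lk_cd0 [simp]: "lk (cd i)" by (rule lk_cd')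

lemma lin_Phi4:
  assumes L: "lin_on Dsp4 base L"
  shows "L (Phi4 K) = (\<Sum>i\<in>Eb. \<Sum>j\<in>Eb. \<Sum>k\<in>Eb. \<Sum>l\<in>Eb. K i j k l * L (dten4 (cd i) (cd j) (cd k) (cd l)))"
    and "Phi4 K \<in> carr Dsp4"
proof -
  have c: "fscale (K i j k l) (dten4 (cd i) (cd j) (cd k) (cd l)) \<in> carr Dsp4" for i j k l
    by (rule fscale_carr[OF vec_space_D4 dten4_carr]) simp_all
  have e: "L (fscale z (dten4 (cd i) (cd j) (cd k) (cd l))) = z * L (dten4 (cd i) (cd j) (cd k) (cd l))" for z i j k l
    using lin_onD(3)[OF L dten4_carr, of "cd i" "cd j" "cd k" "cd l" z] by (simp add: smult_tensor_space)
  note s = vec_space_sum[OF vec_space_D4]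
  show "Phi4 K \<in> carr Dsp4" unfolding Phi4_def by (intro s c)
  show "L (Phi4 K) = (\<Sum>i\<in>Eb. \<Sum>j\<in>Eb. \<Sum>k\<in>Eb. \<Sum>l\<in>Eb. K i j k l * L (dten4 (cd i) (cd j) (cd k) (cd l)))"
    unfolding Phi4_def
    by (subst lin_on_sum[OF vec_space_D4 L], (intro s c)[], rule sum.cong[OF refl])+ (rule e)
qed

lemma Phi4_carr [simp]: "Phi4 K \<in> carr Dsp4"
  by (rule lin_Phi4(2)[OF E4_lin[of \<epsilon> \<epsilon> \<epsilon> \<epsilon>]]) simp_all

lemma lk4_expand:
  assumes K: "lk4 K"
  shows "K a b c d = (\<Sum>i\<in>Eb. \<Sum>j\<in>Eb. \<Sum>k\<in>Eb. \<Sum>l\<in>Eb. K i j k l * (cd i a * (cd j b * (cd k c * cd l d))))"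
proof -
  note l = lk4_comp[OF K la_id]
  have "K a b c d = (\<Sum>i\<in>Eb. cd i a * K i b c d)"
    by (rule lk_expand[where f = "\<lambda>a. K a b c d"]) (use K in simp)
  also have "\<dots> = (\<Sum>i\<in>Eb. cd i a * (\<Sum>j\<in>Eb. cd j b * K i j c d))"
    by (intro sum.cong refl arg_cong[where f = "(*) _"] lk_expand[where f = "\<lambda>b. K _ b c d"]) (use K in simp)
  also have "\<dots> = (\<Sum>i\<in>Eb. cd i a * (\<Sum>j\<in>Eb. cd j b * (\<Sum>k\<in>Eb. cd k c * K i j k d)))"
    by (intro sum.cong refl arg_cong[where f = "(*) _"] lk_expand[where f = "\<lambda>c. K _ _ c d"]) (use K in simp)
  also have "\<dots> = (\<Sum>i\<in>Eb. cd i a * (\<Sum>j\<in>Eb. cd j b * (\<Sum>k\<in>Eb. cd k c * (\<Sum>l\<in>Eb. cd l d * K i j k l))))"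
    by (intro sum.cong refl arg_cong[where f = "(*) _"] lk_expand[where f = "\<lambda>d. K _ _ _ d"]) (use K in simp)
  also have "\<dots> = (\<Sum>i\<in>Eb. \<Sum>j\<in>Eb. \<Sum>k\<in>Eb. \<Sum>l\<in>Eb. K i j k l * (cd i a * (cd j b * (cd k c * cd l d))))"
    by (simp add: sum_distrib_left mult_ac)
  finally show ?thesis .
qed

lemma E4_Phi4:
  assumes K: "lk4 K" and p: "lk p" "lk q" "lk r" "lk s"
  shows "E4 a p b q c r d s (Phi4 K) = K a b c d * (p 1 * (q 1 * (r 1 * s 1)))"
  unfolding lin_Phi4(1)[OF E4_lin[OF p]] lk4_expand[OF K, of a b c d]
  by (simp add: E4_tens E3_tens E2_tens p tens_carr sum_distrib_left sum_distrib_right mult_ac)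

lemma E4_Phi4_left:
  assumes K: "lk4 K" and p: "lk p" "lk q" "lk r" "lk s" and Y: "Y \<in> carr Dsp4"
  shows "E4 a p b q c r d s (m4 (Phi4 K) Y) =
    sw H a (\<lambda>a1 a2. sw H b (\<lambda>b1 b2. sw H c (\<lambda>c1 c2. sw H d (\<lambda>d1 d2.
      K a1 b1 c1 d1 * E4 a2 p b2 q c2 r d2 s Y))))"
proof -
  have r: "sw H a (\<lambda>a1 a2. sw H b (\<lambda>b1 b2. sw H c (\<lambda>c1 c2. sw H d (\<lambda>d1 d2.
      K a1 b1 c1 d1 * E4 a2 p b2 q c2 r d2 s Y)))) =
    sw H a (\<lambda>a1 a2. sw H b (\<lambda>b1 b2. sw H c (\<lambda>c1 c2. sw H d (\<lambda>d1 d2.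
      (\<Sum>i\<in>Eb. \<Sum>j\<in>Eb. \<Sum>k\<in>Eb. \<Sum>l\<in>Eb. K i j k l * (cd i a1 * (cd j b1 * (cd k c1 * cd l d1)))) *
      E4 a2 p b2 q c2 r d2 s Y))))"
    by (intro arg_cong[where f = "sw H _"] ext arg_cong2[where f = "(*)"] lk4_expand[OF K] refl)
  show ?thesis
    unfolding r lin_Phi4(1)[OF lin_on_comp[OF bilin_onD(2)[OF m4_bilin Y] E4_lin[OF p]]]
    by (simp add: D4_mult_dual_left p Y sum_distrib_right sw_sum sw_cmult mult.assoc)
qed

lemma Phi4_mult:
  assumes h: "lk4 h" "lk4 k"
  shows "m4 (Phi4 h) (Phi4 k) = Phi4 (cv4 h k)"
proof (rule D4_ext)
  fix a p b q c r d s assume p: "lk p" "lk q" "lk r" "lk s"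
  show "E4 a p b q c r d s (m4 (Phi4 h) (Phi4 k)) = E4 a p b q c r d s (Phi4 (cv4 h k))"
    by (simp add: E4_Phi4_left E4_Phi4 h p lk4_cv4 del: lk4_def) (simp add: cv4_def sw_cmult mult.assoc)
qed simp_all

lemma Phi4_eqI:
  assumes "X \<in> carr Dsp4" "lk4 K"
    "\<And>a p b q c r d s. lk p \<Longrightarrow> lk q \<Longrightarrow> lk r \<Longrightarrow> lk s \<Longrightarrow>
      E4 a p b q c r d s X = K a b c d * (p 1 * (q 1 * (r 1 * s 1)))"
  shows "X = Phi4 K"
  by (rule D4_ext) (simp_all add: assms E4_Phi4 del: lk4_def)

text \<open>Counits as test forms recover the four-linear form; the pentagon thus becomes an
  equation between convolution products of forms.\<close>

lemma Phi4_inj: "lk4 h \<Longrightarrow> lk4 k \<Longrightarrow> Phi4 h = Phi4 k \<longleftrightarrow> h = k"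
proof
  assume l: "lk4 h" "lk4 k" and e: "Phi4 h = Phi4 k"
  show "h = k"
  proof (intro ext)
    fix a b c d
    have "E4 a \<epsilon> b \<epsilon> c \<epsilon> d \<epsilon> (Phi4 h) = E4 a \<epsilon> b \<epsilon> c \<epsilon> d \<epsilon> (Phi4 k)" by (simp only: e)
    then show "h a b c d = k a b c d" by (simp add: E4_Phi4 l del: lk4_def)
  qed
qed simp

text \<open>The five tensors of the pentagon in its written order, two on the left and three on the
  right, as four-linear forms. Each coproduct applied to the associator becomes a product of two
  arguments.\<close>

definition "pent1 = (\<lambda>a b c d. w' a b (c * d))"
definition "pent2 = (\<lambda>a b c d. w' (a * b) c d)"
definition "pent3 = (\<lambda>a b c d. \<epsilon> a * w' b c d)"
definition "pent4 = (\<lambda>a b c d. w' a (b * c) d)"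
definition "pent5 = (\<lambda>a b c d. w' a b c * \<epsilon> d)"

lemmas pent_defs = pent1_def pent2_def pent3_def pent4_def pent5_def

lemma lk4_pent: "lk4 pent1" "lk4 pent2" "lk4 pent3" "lk4 pent4" "lk4 pent5"
  unfolding pent_defs by simp_all

lemma Phi_w'_carr: "Phi w' \<in> carr Dsp3" by (intro Phi_carr lk3_data)

text \<open>\<gamma>(1) is trivial by normalization, so on functionals tensored with 1 the coproduct
  is dual to the product of A; this is why \<gamma> is absent from the pentagon.\<close>

lemma com_one:
  assumes "lk f" "lk p" "lk q"
  shows "E2 a p b q (com f 1) = f (a * b) * (p 1 * q 1)"
proof -
  note l = lk_comp[OF assms(1)] lk_comp[OF assms(2)] lk_comp[OF assms(3)]
  show ?thesis
    by (rule univ_eq2[where E = "\<lambda>a b. E2 a p b q (com f 1)" and E' = "\<lambda>a b. f (a * b) * (p 1 * q 1)"])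
      (simp_all add: E2_com assms l sw3_def sw_one, simp add: expand_B l, simp add: split_B cv_ac)
qed

lemma comult_right_lin: "lin_on Dsp2 Dsp3 (tmap Dsp Dsp Dsp Dsp2 id (D_comult H gc))"
  by (rule tmap_lin[OF vec_space_D vec_space_D lin_on_id(1) D_comult_lin])

lemma comult_left_lin: "lin_on Dsp2 Dsp3 (\<lambda>x. tassoc Dsp Dsp Dsp (tmap Dsp Dsp Dsp2 Dsp (D_comult H gc) id x))"
  by (rule lin_on_comp[OF tmap_lin[OF vec_space_D vec_space_D2 D_comult_lin lin_on_id(1)] tassoc_lin[OF vec_space_D vec_space_D]])

lemma E4_tmap_id:
  assumes F: "lin_on Dsp2 Dsp3 F" and p: "lk p" "lk q" "lk r" "lk s"
  shows "E4 a p b q c r d s (tmap Dsp Dsp2 Dsp Dsp3 id F (Phi w')) =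
    tsum Dsp Dsp2 (Phi w') (\<lambda>x u. e1 a p x * E3 b q c r d s (F u))"
  unfolding E4_def tmap_eval[OF vec_space_D vec_space_D lin_on_id(1) F e1_lin[OF p(1)] E3_lin[OF p(2-4)] Phi_w'_carr]
  by (simp add: Phi_w'_carr)

lemma tmap_id_carr: "lin_on Dsp2 Dsp3 F \<Longrightarrow> tmap Dsp Dsp2 Dsp Dsp3 id F (Phi w') \<in> carr Dsp4"
  by (rule lin_onD(1)[OF tmap_lin[OF vec_space_D vec_space_D lin_on_id(1)]]) (simp_all add: Phi_w'_carr)

section \<open>Identification of the five pentagon tensors\<close>

lemma pent1_eq: "tmap Dsp Dsp2 Dsp Dsp3 id (tmap Dsp Dsp Dsp Dsp2 id (D_comult H gc)) (Phi w') = Phi4 pent1"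
proof (rule Phi4_eqI[OF tmap_id_carr[OF comult_right_lin] lk4_pent(1)])
  fix a p b q c r d s assume p: "lk p" "lk q" "lk r" "lk s"
  note b = bilin_on_base_mult[OF e1_lin[OF p(1)] lin_on_comp[OF comult_right_lin E3_lin[OF p(2-4)]]]
  have b2: "bilin_on Dsp Dsp base (\<lambda>x y. e1 a p x * E2 b q c r (D_comult H gc y))" if "lk p" "lk q" "lk r" for a b c p q r
    by (intro bilin_on_base_mult lin_on_comp[OF D_comult_lin E2_lin] e1_lin that)
  show "E4 a p b q c r d s (tmap Dsp Dsp2 Dsp Dsp3 id (tmap Dsp Dsp Dsp Dsp2 id (D_comult H gc)) (Phi w')) =
    pent1 a b c d * (p 1 * (q 1 * (r 1 * s 1)))"
    unfolding E4_tmap_id[OF comult_right_lin p]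
    apply (subst tsum_Phi[OF b lk3_data(2)])
    apply (simp add: p lk3_data tens_carr eval_comult_right tsum_tens[OF vec_space_base b2] com_one del: lk3_def)
    apply (simp add: lk3_data tsum_cmult tsum_dual_tensor3 mult.assoc pent1_def del: lk3_def)
    done
qed

lemma pent4_eq: "tmap Dsp Dsp2 Dsp Dsp3 id
    (\<lambda>x. tassoc Dsp Dsp Dsp (tmap Dsp Dsp Dsp2 Dsp (D_comult H gc) id x)) (Phi w') = Phi4 pent4"
proof (rule Phi4_eqI[OF tmap_id_carr[OF comult_left_lin] lk4_pent(4)])
  fix a p b q c r d s assume p: "lk p" "lk q" "lk r" "lk s"
  note b = bilin_on_base_mult[OF e1_lin[OF p(1)] lin_on_comp[OF comult_left_lin E3_lin[OF p(2-4)]]]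
  have b2: "bilin_on Dsp Dsp base (\<lambda>x y. E2 a p b q (D_comult H gc x) * e1 c r y)" if "lk p" "lk q" "lk r" for a b c p q r
    by (intro bilin_on_base_mult lin_on_comp[OF D_comult_lin E2_lin] e1_lin that)
  show "E4 a p b q c r d s (tmap Dsp Dsp2 Dsp Dsp3 id
      (\<lambda>x. tassoc Dsp Dsp Dsp (tmap Dsp Dsp Dsp2 Dsp (D_comult H gc) id x)) (Phi w')) =
    pent4 a b c d * (p 1 * (q 1 * (r 1 * s 1)))"
    unfolding E4_tmap_id[OF comult_left_lin p]
    apply (subst tsum_Phi[OF b lk3_data(2)])
    apply (simp add: p lk3_data tens_carr eval_comult_left tsum_tens[OF vec_space_base b2] com_one del: lk3_def)
    apply (simp add: lk3_data tsum_cmult tsum_dual_tensor3 mult.assoc pent4_def del: lk3_def)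
    done
qed

lemma pent3_eq: "tens Dsp Dsp3 (dten H \<epsilon> 1) (Phi w') = Phi4 pent3"
  by (rule Phi4_eqI[OF _ lk4_pent(3)])
    (simp_all add: tens_carr E4_tens E3_Phi lk3_data pent3_def mult_ac del: lk3_def)

lemma pent2_eq: "tassoc Dsp Dsp Dsp2 (tmap Dsp Dsp2 Dsp2 Dsp2 (D_comult H gc) id (Phi w')) = Phi4 pent2"
proof (rule Phi4_eqI[OF _ lk4_pent(2)])
  have c: "tmap Dsp Dsp2 Dsp2 Dsp2 (D_comult H gc) id (Phi w') \<in> carr (tensor_space Dsp2 Dsp2)"
    by (rule lin_onD(1)[OF tmap_lin[OF vec_space_D vec_space_D2 D_comult_lin lin_on_id(1)] Phi_w'_carr])
  show "tassoc Dsp Dsp Dsp2 (tmap Dsp Dsp2 Dsp2 Dsp2 (D_comult H gc) id (Phi w')) \<in> carr Dsp4"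
    by (rule lin_onD(1)[OF tassoc_lin[OF vec_space_D vec_space_D] c])
  fix a p b q c r d s assume p: "lk p" "lk q" "lk r" "lk s"
  note b = bilin_on_base_mult[OF lin_on_comp[OF D_comult_lin E2_lin[OF p(1,2)]] E2_lin[OF p(3,4)]]
  show "E4 a p b q c r d s (tassoc Dsp Dsp Dsp2 (tmap Dsp Dsp2 Dsp2 Dsp2 (D_comult H gc) id (Phi w'))) =
    pent2 a b c d * (p 1 * (q 1 * (r 1 * s 1)))"
    unfolding E4_def E3_def
      tassoc_eval[OF vec_space_D vec_space_D e1_lin[OF p(1)] e1_lin[OF p(2)] E2_lin[OF p(3,4)] c]
    unfolding E2_def[symmetric]
      tmap_eval[OF vec_space_D vec_space_D2 D_comult_lin lin_on_id(1) E2_lin[OF p(1,2)] E2_lin[OF p(3,4)] Phi_w'_carr]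
    unfolding id_def
    apply (subst tsum_Phi[OF b lk3_data(2)])
    apply (simp add: p lk3_data tens_carr E2_tens com_one del: lk3_def)
    apply (simp add: lk3_data tsum_cmult tsum_dual_tensor3 mult.assoc pent2_def del: lk3_def)
    done
qed

text \<open>Only brackets change: two uses of \<open>tassoc\<close> move the unit from the outside
  into the last place, and each is undone by a product functional with the matching
  bracketing.\<close>

lemma pent5_eq: "tmap Dsp (tensor_space Dsp2 Dsp) Dsp Dsp3 id (tassoc Dsp Dsp Dsp)
           (tassoc Dsp Dsp2 Dsp (tens Dsp3 Dsp (Phi w') (dten H \<epsilon> 1))) = Phi4 pent5"
proof (rule Phi4_eqI[OF _ lk4_pent(5)])
  have u: "dten H \<epsilon> 1 \<in> carr Dsp" by simp
  have c: "tens Dsp3 Dsp (Phi w') (dten H \<epsilon> 1) \<in> carr (tensor_space Dsp3 Dsp)"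
    by (rule tens_carr[OF Phi_w'_carr u])
  note al = tassoc_lin[OF vec_space_D vec_space_D, of Dsp]
  note c2 = lin_onD(1)[OF tassoc_lin[OF vec_space_D vec_space_D2] c]
  show "tmap Dsp (tensor_space Dsp2 Dsp) Dsp Dsp3 id (tassoc Dsp Dsp Dsp)
           (tassoc Dsp Dsp2 Dsp (tens Dsp3 Dsp (Phi w') (dten H \<epsilon> 1))) \<in> carr Dsp4"
    by (rule lin_onD(1)[OF tmap_lin[OF vec_space_D vec_space_D lin_on_id(1) al] c2])
  fix a p b q c r d s assume p: "lk p" "lk q" "lk r" "lk s"
  have t: "E3 b q c r d s (tassoc Dsp Dsp Dsp y) = tsum Dsp2 Dsp y (\<lambda>v x. E2 b q c r v * e1 d s x)"
    if "y \<in> carr (tensor_space Dsp2 Dsp)" for y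
    unfolding E3_def E2_def tassoc_eval[OF vec_space_D vec_space_D e1_lin[OF p(2)] e1_lin[OF p(3)] e1_lin[OF p(4)] that] ..
  have "E4 a p b q c r d s (tmap Dsp (tensor_space Dsp2 Dsp) Dsp Dsp3 id (tassoc Dsp Dsp Dsp)
           (tassoc Dsp Dsp2 Dsp (tens Dsp3 Dsp (Phi w') (dten H \<epsilon> 1)))) =
    tsum Dsp (tensor_space Dsp2 Dsp) (tassoc Dsp Dsp2 Dsp (tens Dsp3 Dsp (Phi w') (dten H \<epsilon> 1)))
      (\<lambda>x y. e1 a p x * tsum Dsp2 Dsp y (\<lambda>v x. E2 b q c r v * e1 d s x))"
    unfolding E4_def tmap_eval[OF vec_space_D vec_space_D lin_on_id(1) al e1_lin[OF p(1)] E3_lin[OF p(2-4)] c2]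
    by (rule tsum_cong[OF c2]) (simp add: t)
  also have "\<dots> = tsum Dsp3 Dsp (tens Dsp3 Dsp (Phi w') (dten H \<epsilon> 1)) (\<lambda>x y. E3 a p b q c r x * e1 d s y)"
    unfolding E3_def by (rule tassoc_eval[OF vec_space_D vec_space_D2 e1_lin[OF p(1)] E2_lin[OF p(2,3)] e1_lin[OF p(4)] c])
  also have "\<dots> = E3 a p b q c r (Phi w') * e1 d s (dten H \<epsilon> 1)"
    by (rule tsum_tens[OF vec_space_base bilin_on_base_mult[OF E3_lin[OF p(1-3)] e1_lin[OF p(4)]] Phi_w'_carr u])
  finally show "E4 a p b q c r d s (tmap Dsp (tensor_space Dsp2 Dsp) Dsp Dsp3 id (tassoc Dsp Dsp Dsp)
           (tassoc Dsp Dsp2 Dsp (tens Dsp3 Dsp (Phi w') (dten H \<epsilon> 1)))) = pent5 a b c d * (p 1 * (q 1 * (r 1 * s 1)))"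
    by (simp add: E3_Phi p lk3_data pent5_def mult_ac del: lk3_def)
qed

lemma inverse_eq_iff:
  assumes "P \<odot> P' = e4" "Q \<odot> Q' = e4" "reg P" "reg P'" "reg Q" "reg Q'"
  shows "P' = Q' \<longleftrightarrow> P = Q"
proof
  assume e: "P' = Q'"
  have "P = P \<odot> (Q \<odot> Q')" using assms by simp
  also have "\<dots> = Q \<odot> (P \<odot> Q')" by (rule R.cv_left_comm)
  also have "\<dots> = Q" using assms by (simp flip: e)
  finally show "P = Q" .
next
  assume e: "P = Q"
  have "P' = P' \<odot> (P \<odot> Q')" using assms by (simp add: e)
  also have "\<dots> = P \<odot> (P' \<odot> Q')" by (rule R.cv_left_comm)
  also have "\<dots> = Q'" using assms by (simp flip: R.cv_assoc)
  finally show "P' = Q'" .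
qed

lemma triple_inverse:
  assumes "P \<odot> P' = e4" "Q \<odot> Q' = e4" "R \<odot> R' = e4"
  shows "(P \<odot> Q \<odot> R) \<odot> ((P' \<odot> Q') \<odot> R') = e4"
proof -
  have "(P \<odot> Q \<odot> R) \<odot> ((P' \<odot> Q') \<odot> R') = (P \<odot> P') \<odot> (Q \<odot> Q') \<odot> (R \<odot> R')"
    by (simp only: cv_ac)
  then show ?thesis by (simp add: assms)
qed

text \<open>At points all factors are values of \<open>w'\<close>. Inverting both sides in the
  commutative ring R replaces \<open>w'\<close> by \<open>w\<close> and gives
  \<open>cond0\<close>.\<close>

lemma pentagon_cv_iff: "cv4 pent1 pent2 = cv4 (cv4 pent3 pent4) pent5 \<longleftrightarrow> cond0"
proof -
  note l = lk4_pent
  have L: "T4 (cv4 pent1 pent2) u v s q = T w' u v (pm s q) \<odot> T w' (pm u v) s q"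
    and R: "T4 (cv4 (cv4 pent3 pent4) pent5) u v s q = (T w' v s q \<odot> T w' u (pm v s) q) \<odot> T w' u v s"
    if "gl u" "gl v" "gl s" "gl q" for u v s q
    unfolding T4_cv4[OF that l(1,2)] T4_cv4[OF that lk4_cv4[OF l(3,4)] l(5)] T4_cv4[OF that l(3,4)]
    using that by (simp_all add: pent_defs T_def T4_def B_simps)
  have "T4 (cv4 pent1 pent2) u v s q = T4 (cv4 (cv4 pent3 pent4) pent5) u v s q \<longleftrightarrow>
    T w v s q \<odot> T w u (pm v s) q \<odot> T w u v s = T w (pm u v) s q \<odot> T w u v (pm s q)"
    if g: "gl u" "gl v" "gl s" "gl q" for u v s q
  proof -
    have 1: "(T w (pm u v) s q \<odot> T w u v (pm s q)) \<odot> (T w' u v (pm s q) \<odot> T w' (pm u v) s q) = e4"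
      using g by (simp add: T_inv T_inv' R.cv_assoc)
    have 2: "(T w v s q \<odot> T w u (pm v s) q \<odot> T w u v s) \<odot> ((T w' v s q \<odot> T w' u (pm v s) q) \<odot> T w' u v s) = e4"
      using g by (intro triple_inverse T_inv) simp_all
    show ?thesis unfolding L[OF g] R[OF g] using inverse_eq_iff[OF 1 2] by auto
  qed
  note e = this
  show ?thesis
  proof
    assume "cv4 pent1 pent2 = cv4 (cv4 pent3 pent4) pent5"
    then show cond0 unfolding cond0_def using e by auto
  next
    assume c: cond0
    show "cv4 pent1 pent2 = cv4 (cv4 pent3 pent4) pent5"
    proof (intro ext)
      fix a b c d
      have l: "lk4 (cv4 pent1 pent2)" "lk4 (cv4 (cv4 pent3 pent4) pent5)" by (intro lk4_cv4 l)+
      show "cv4 pent1 pent2 a b c d = cv4 (cv4 pent3 pent4) pent5 a b c d"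
        by (rule T4_univ[OF l]) (simp only: e[OF gl_U] c[unfolded cond0_def, rule_format, OF gl_U])
    qed
  qed
qed

lemma pentagon_iff:
  "m4 (tmap Dsp Dsp2 Dsp Dsp3 id (tmap Dsp Dsp Dsp Dsp2 id (D_comult H gc)) (Phi w'))
     (tassoc Dsp Dsp Dsp2 (tmap Dsp Dsp2 Dsp2 Dsp2 (D_comult H gc) id (Phi w'))) =
   m4 (m4 (tens Dsp Dsp3 (dten H \<epsilon> 1) (Phi w'))
       (tmap Dsp Dsp2 Dsp Dsp3 id (\<lambda>x. tassoc Dsp Dsp Dsp (tmap Dsp Dsp Dsp2 Dsp (D_comult H gc) id x)) (Phi w')))
     (tmap Dsp (tensor_space Dsp2 Dsp) Dsp Dsp3 id (tassoc Dsp Dsp Dsp)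
           (tassoc Dsp Dsp2 Dsp (tens Dsp3 Dsp (Phi w') (dten H \<epsilon> 1)))) \<longleftrightarrow> cond0"
  unfolding pent1_eq pent2_eq pent3_eq pent4_eq pent5_eq
    Phi4_mult[OF lk4_pent(1,2)] Phi4_mult[OF lk4_pent(3,4)] Phi4_mult[OF lk4_cv4[OF lk4_pent(3,4)] lk4_pent(5)]
    Phi4_inj[OF lk4_cv4[OF lk4_pent(1,2)] lk4_cv4[OF lk4_cv4[OF lk4_pent(3,4)] lk4_pent(5)]]
  by (rule pentagon_cv_iff)

section \<open>The antipode of \<open>D(A)\<close>\<close>

text \<open>For a cocommutative Hopf algebra this is the group law \<open>pinv_pinv\<close>,
  transferred from the points.\<close>

lemma S_S [simp]: "S (S a) = a"
proof (rule lk_separate)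
  fix p assume p: "lk p"
  note l = lk_comp[OF p]
  have "p (S (S a)) * \<epsilon> 1 = p a * \<epsilon> 1"
  proof (rule univ_eq2[where E = "\<lambda>a b. p (S (S a)) * \<epsilon> b" and E' = "\<lambda>a b. p a * \<epsilon> b"])
    fix u v assume g: "gl u" "gl v"
    have "B u (\<lambda>x. br (p (S (S x)))) = B (pinv (pinv u)) (\<lambda>x. br (p x))"
      by (simp add: expand_B l g del: pinv_pinv)
    then have "B u (\<lambda>x. br (p (S (S x)))) = B u (\<lambda>x. br (p x))" using g by simp
    then show "B u (\<lambda>a. B v (\<lambda>b. br (p (S (S a)) * \<epsilon> b))) = B u (\<lambda>a. B v (\<lambda>b. br (p a * \<epsilon> b)))"
      by (simp add: split_B)
  qed (simp_all add: l)
  then show "p (S (S a)) = p a" by simp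
qed

definition F2 :: "('a \<Rightarrow> 'a \<Rightarrow> 'k) \<Rightarrow> _" where "F2 K u v = B u (\<lambda>x. B v (\<lambda>c. br (K x c)))"

lemma reg_F2 [simp]: "reg (F2 K u v)" by (simp add: F2_def)

text \<open>The operators \<open>S\<^sub>K(f \<otimes> x)(a) = K(x, c) f(c\<^sup>-\<^sup>1) \<otimes> x\<^sup>-\<^sup>1\<close> with \<open>c = x a x\<^sup>-\<^sup>1\<close>. The antipode is the one for
  the kernel \<open>ker_S\<close>; its inverse is again of this form, with kernel \<open>ker_back\<close>.\<close>

definition antip_pt where "antip_pt K f x c = sw H c (\<lambda>c1 c2. K x c1 * f (S c2))"
definition antip_fun where "antip_fun K f x = (\<lambda>a. sw H x (\<lambda>x1 x2. antip_pt K f x1 (ad H (S x2) a)))"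
definition antip_el where "antip_el K f x = sw H x (\<lambda>x1 x2. dten H (antip_fun K f x1) (S x2))"

lemma lk2_comp: "lk2 K \<Longrightarrow> la k \<Longrightarrow> lk (\<lambda>x. K (k x) c)" "lk2 K \<Longrightarrow> la k \<Longrightarrow> lk (\<lambda>c. K x (k c))"
  using lk_comp[of "\<lambda>x. K x c"] lk_comp[of "K x"] by simp_all

lemma lk_antip_fun [simp]:
  assumes "lk2 K" "lk f"
  shows "la k \<Longrightarrow> lk (\<lambda>x. antip_fun K f (k x) a)" "la k \<Longrightarrow> lk (\<lambda>a. antip_fun K f x (k a))" "lk (antip_fun K f x)"
  unfolding antip_fun_def antip_pt_def using lk2_comp[OF assms(1)] lk_comp[OF assms(2)] by simp_all

lemma lf_antip_fun [simp]: "lf (\<lambda>f. antip_fun K f x a)"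
  unfolding antip_fun_def antip_pt_def by simp

lemma antip_el_carr [simp]: "lk2 K \<Longrightarrow> lk f \<Longrightarrow> antip_el K f x \<in> carr Dsp"
  unfolding antip_el_def by (intro sw_carr[OF vec_space_D] dten_carr lk_antip_fun)

lemma e1_antip_el: "lk2 K \<Longrightarrow> lk f \<Longrightarrow> lk p \<Longrightarrow> e1 a p (antip_el K f x) = sw H x (\<lambda>x1 x2. antip_fun K f x1 a * p (S x2))"
  unfolding antip_el_def by (simp add: e1_sw)

lemma antip_el_bilin: "lk2 K \<Longrightarrow> bilin_on (dual H) A Dsp (antip_el K)"
  unfolding bilin_on_def
proof (intro conjI ballI)
  assume K: "lk2 K"
  show "lin_on A Dsp (antip_el K f)" if "f \<in> carr (dual H)" for f
  proof (rule lin_on_D[OF vec_space_A])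
    fix a p assume p: "lk p"
    have f: "lk f" using that by simp
    show "lin_on A base (\<lambda>x. e1 a p (antip_el K f x))"
      by (simp add: e1_antip_el K f p lk_comp[OF p] del: lk2_def flip: lk_def)
  qed (use that K in simp)
  show "lin_on (dual H) Dsp (\<lambda>f. antip_el K f x)" for x
  proof (rule lin_on_D[OF vec_space_dual])
    fix a p assume p: "lk p"
    have "lf (\<lambda>f. sw H x (\<lambda>x1 x2. antip_fun K f x1 a * p (S x2)))" by simp
    then show "lin_on (dual H) base (\<lambda>f. e1 a p (antip_el K f x))"
      unfolding lf_def by (rule lin_on_cong[OF vec_space_dual]) (simp add: e1_antip_el K p del: lk2_def)
  qed (use K in simp)
qed

definition antip_op where "antip_op K s = tsum (dual H) A s (antip_el K)"

lemma antip_op_lin: "lk2 K \<Longrightarrow> lin_on Dsp Dsp (antip_op K)"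
  unfolding antip_op_def[abs_def] by (rule tsum_lin[OF vec_space_dual vec_space_D antip_el_bilin])

lemma antip_op_dten: "lk2 K \<Longrightarrow> lk f \<Longrightarrow> antip_op K (dten H f x) = antip_el K f x"
  unfolding antip_op_def dten_def by (rule tsum_tens[OF vec_space_D antip_el_bilin]) simp_all

lemma antip_op_el: "lk2 K \<Longrightarrow> lk2 L \<Longrightarrow> lk f \<Longrightarrow> antip_op K (antip_el L f x) = sw H x (\<lambda>x1 x2. antip_el K (antip_fun L f x1) (S x2))"
  unfolding antip_el_def[of L] by (subst lin_on_sw[OF vec_space_D antip_op_lin]) (simp_all add: antip_op_dten del: lk2_def)

text \<open>At points the composite sends \<open>f\<close> over \<open>v\<close> to a multiple of
  \<open>f\<close> over \<open>v\<close>: the two inversions of the functional argument cancel, and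
  the multiplier is \<open>K\<close> at the inverted group element times \<open>L\<close> at the
  original one.\<close>

lemma antip_op_inverse:
  assumes K: "lk2 K" and L: "lk2 L"
    and e: "\<And>u v. gl u \<Longrightarrow> gl v \<Longrightarrow> F2 K (pinv v) (pc v u) \<odot> F2 L v (pinv u) = e4"
    and s: "s \<in> carr Dsp"
  shows "antip_op K (antip_op L s) = s"
proof (rule D_lin_ext[OF lin_on_comp[OF antip_op_lin[OF L] antip_op_lin[OF K]] lin_on_id(2) _ s])
  fix f x assume f: "lk f"
  show "antip_op K (antip_op L (dten H f x)) = dten H f x"
  proof (rule D_ext)
    show "antip_op K (antip_op L (dten H f x)) \<in> carr Dsp"
      by (rule lin_onD(1)[OF antip_op_lin[OF K] lin_onD(1)[OF antip_op_lin[OF L]]]) (simp add: f)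
    fix a p assume p: "lk p"
    note l = lk2_comp[OF K] lk2_comp[OF L] lk_comp[OF f] lk_comp[OF p]
    have ev: "e1 a p (antip_op K (antip_op L (dten H f x))) =
      sw H x (\<lambda>x1 x2. sw H (S x2) (\<lambda>y1 y2. antip_fun K (antip_fun L f x1) y1 a * p (S y2)))" for a x
      by (simp add: antip_op_dten antip_op_el K L f p e1_sw e1_antip_el del: lk2_def)
    show "e1 a p (antip_op K (antip_op L (dten H f x))) = e1 a p (dten H f x)"
    proof (rule univ_eq2[where E = "\<lambda>a x. e1 a p (antip_op K (antip_op L (dten H f x)))" and E' = "\<lambda>a x. e1 a p (dten H f x)"])
      show "lk2 (\<lambda>a x. e1 a p (antip_op K (antip_op L (dten H f x))))"
        unfolding ev antip_fun_def antip_pt_def by (simp add: l)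
      show "lk2 (\<lambda>a x. e1 a p (dten H f x))" by (simp add: f p l)
      fix u v assume g: "gl u" "gl v"
      have "B u (\<lambda>a. B v (\<lambda>x. br (e1 a p (antip_op K (antip_op L (dten H f x)))))) =
        F2 K (pinv v) (pc v u) \<odot> F2 L v (pc (pinv v) (pinv (pc v u))) \<odot> F1 f (pinv (pc (pinv v) (pinv (pc v u)))) \<odot> F1 p v"
        unfolding ev antip_fun_def antip_pt_def F1_def F2_def
        apply (simp add: expand_B l g del: pc_simps)
        apply (simp add: split_B del: pc_simps)
        apply (simp only: B_comm[of v u] cv_ac)
        done
      also have "\<dots> = B u (\<lambda>a. B v (\<lambda>x. br (e1 a p (dten H f x))))"
        using g by (simp add: f p F1_def split_B) (simp add: e[OF g] flip: R.cv_assoc)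
      finally show "B u (\<lambda>a. B v (\<lambda>x. br (e1 a p (antip_op K (antip_op L (dten H f x)))))) = B u (\<lambda>a. B v (\<lambda>x. br (e1 a p (dten H f x))))" .
    qed
  qed (use f in simp)
qed

section \<open>The kernels of the antipode and of its inverse\<close>

definition ker_S where "ker_S x c = sw H x (\<lambda>x1 x2. sw H x2 (\<lambda>x2 x3. sw H c (\<lambda>c1 c2. sw H c2 (\<lambda>c2 c3.
  t' x1 (S x2) c1 * g' x3 (S c2) c3))))"
definition ker_inv where "ker_inv x c = sw H x (\<lambda>x1 x2. sw H x2 (\<lambda>x2 x3. sw H c (\<lambda>c1 c2. sw H c2 (\<lambda>c2 c3.
  t x1 (S x2) c1 * g x3 (S c2) c3))))"
text \<open>Solves the hypothesis of \<open>antip_op_inverse\<close> for \<open>K\<close> when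
  \<open>L\<close> is \<open>ker_S\<close>. With y = v^-1 and c = v^-1 u v one has v = y^-1 and u^-1
  = y^-1 c^-1 y, and \<open>K\<close> must be the inverse of \<open>ker_S\<close> there.\<close>

definition ker_back where "ker_back y c = sw H y (\<lambda>y1 y2. ker_inv (S y1) (ad H y2 (S c)))"

lemma lk2_ker: "lk2 ker_S" "lk2 ker_inv" "lk2 ker_back"
proof -
  show k: "lk2 ker_S" "lk2 ker_inv" unfolding ker_S_def ker_inv_def by simp_all
  show "lk2 ker_back" unfolding ker_back_def using lk2_comp[OF k(2)] by simp
qed

lemma F2_ker_S: "gl v \<Longrightarrow> gl c \<Longrightarrow> F2 ker_S v c = T t' v (pinv v) c \<odot> T g' v (pinv c) c"
  unfolding F2_def ker_S_def T_def
  apply (simp add: expand_B del: pc_simps)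
  apply (simp add: split_B del: pc_simps)
  done

lemma F2_ker_inv: "gl v \<Longrightarrow> gl c \<Longrightarrow> F2 ker_inv v c = T t v (pinv v) c \<odot> T g v (pinv c) c"
  unfolding F2_def ker_inv_def T_def
  apply (simp add: expand_B del: pc_simps)
  apply (simp add: split_B del: pc_simps)
  done

lemma F2_ker_back: "gl v \<Longrightarrow> gl c \<Longrightarrow> F2 ker_back v c = F2 ker_inv (pinv v) (pc v (pinv c))"
  unfolding F2_def ker_back_def using lk2_comp[OF lk2_ker(2)]
  apply (simp add: expand_B del: pc_simps)
  done

lemma F2_inverse: "gl v \<Longrightarrow> gl c \<Longrightarrow> F2 ker_S v c \<odot> F2 ker_inv v c = e4"
proof -
  assume g: "gl v" "gl c"
  have "F2 ker_S v c \<odot> F2 ker_inv v c = (T t' v (pinv v) c \<odot> T t v (pinv v) c) \<odot> (T g' v (pinv c) c \<odot> T g v (pinv c) c)"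
    unfolding F2_ker_S[OF g] F2_ker_inv[OF g] by (simp only: cv_ac)
  then show ?thesis using g by (simp add: T_inv_comm)
qed

lemma antip_op_left_inverse: "s \<in> carr Dsp \<Longrightarrow> antip_op ker_back (antip_op ker_S s) = s"
  and antip_op_right_inverse: "s \<in> carr Dsp \<Longrightarrow> antip_op ker_S (antip_op ker_back s) = s"
  by (rule antip_op_inverse[OF lk2_ker(3,1)]; simp add: F2_ker_back R.cv_comm[of "F2 ker_inv _ _"] F2_inverse)
    (rule antip_op_inverse[OF lk2_ker(1,3)]; simp add: F2_ker_back F2_inverse)

section \<open>Identification of the antipode\<close>

definition antip_body where
  "antip_body f x = sw4 H x (\<lambda>x1 x2 x3 x4. tsum (dual H) (dual H) (dual_tensor2 H (\<lambda>a b. g' x4 a b)) (\<lambda>g1 g2.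
     D_mult H tc (dten H \<epsilon> (S x1)) (dten H (\<lambda>a. sw H a (\<lambda>a1 a2. sw H a1 (\<lambda>b1 b2. t' x2 (S x3) b1 *
       sw H (S b2) (\<lambda>z1 z2. f z1 * g1 z2)) * g2 a2)) 1)))"

lemma D_antipode_eq: "D_antipode H gc tc s = tsum (dual H) A s antip_body"
  unfolding D_antipode_def dsum_def antip_body_def[abs_def] g'_def t'_def dual_simps dual_antipode_def comp_def ..

lemma antip_body_lin: "lin_on (dual H) Dsp (\<lambda>h. D_mult H tc (dten H \<epsilon> y) (dten H h 1))"
  by (rule lin_on_comp[OF dten_lin bilin_onD(1)[OF D_mult_bilin]]) simp

lemma antip_body_bilin:
  assumes "lk f"
  shows "bilin_on (dual H) (dual H) Dsp (\<lambda>g1 g2. D_mult H tc (dten H \<epsilon> (S x1))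
    (dten H (\<lambda>a. sw H a (\<lambda>a1 a2. sw H a1 (\<lambda>b1 b2. t' x2 (S x3) b1 * sw H (S b2) (\<lambda>z1 z2. f z1 * g1 z2)) * g2 a2)) 1))"
proof (rule bilin_on_post[OF _ antip_body_lin])
  note l = lk_comp[OF assms]
  have L: "lk (\<lambda>a. sw H a (\<lambda>a1 a2. sw H a1 (\<lambda>b1 b2. t' x2 (S x3) b1 * sw H (S b2) (\<lambda>z1 z2. f z1 * g1 z2)) * g2 a2))"
    if "lk g1" "lk g2" for g1 g2
    using lk_comp[OF that(1)] lk_comp[OF that(2)] l by simp
  show "bilin_on (dual H) (dual H) (dual H) (\<lambda>g1 g2 a. sw H a (\<lambda>a1 a2. sw H a1 (\<lambda>b1 b2. t' x2 (S x3) b1 *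
      sw H (S b2) (\<lambda>z1 z2. f z1 * g1 z2)) * g2 a2))"
    unfolding bilin_on_def lin_on_def dual_simps mem_Collect_eq
    by (intro conjI ballI allI; (rule L; simp)?)
      (simp_all add: fscale_def fun_eq_iff algebra_simps sw_add sw_cmult)
qed

text \<open>Left multiplication by \<epsilon> \<otimes> x^-1 replaces the argument a by c = x a x^-1
  and contributes \<theta>(x^-1, 1), trivial by normalization; what is left is the kernel at c times
  f(c^-1).\<close>

lemma antip_body_eq:
  assumes f: "lk f"
  shows "antip_body f x = antip_el ker_S f x"
proof (rule D_ext)
  note c = tsum_carr[OF vec_space_dual vec_space_D antip_body_bilin[OF f] dual_tensor2_carr]
  show "antip_body f x \<in> carr Dsp" unfolding antip_body_def sw4_def sw3_def
    by (intro sw_carr[OF vec_space_D] c) simp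
  show "antip_el ker_S f x \<in> carr Dsp" by (rule antip_el_carr[OF lk2_ker(1) f])
  fix a p assume p: "lk p"
  note l = lk_comp[OF f] lk_comp[OF p] lk2_comp[OF lk2_ker(1)]
  have ev: "e1 a p (antip_body f x) = sw4 H x (\<lambda>x1 x2 x3 x4. tsum (dual H) (dual H) (dual_tensor2 H (\<lambda>a b. g' x4 a b)) (\<lambda>g1 g2.
     e1 a p (D_mult H tc (dten H \<epsilon> (S x1)) (dten H (\<lambda>a. sw H a (\<lambda>a1 a2. sw H a1 (\<lambda>b1 b2. t' x2 (S x3) b1 *
       sw H (S b2) (\<lambda>z1 z2. f z1 * g1 z2)) * g2 a2)) 1))))" for a x
    unfolding antip_body_def sw4_def sw3_def
    by (simp add: e1_sw p sw_carr[OF vec_space_D] c lin_on_tsum[OF vec_space_D e1_lin[OF p] dual_tensor2_carr antip_body_bilin[OF f]])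
  have la: "lk (\<lambda>a. sw H a (\<lambda>a1 a2. sw H a1 (\<lambda>b1 b2. t' x2 (S x3) b1 * sw H (S b2) (\<lambda>z1 z2. f z1 * g1 z2)) * g2 a2))"
    if "lk g1" "lk g2" for g1 g2 x2 x3
    using lk_comp[OF that(1)] lk_comp[OF that(2)] l by simp
  \<comment> \<open>Contracting the decomposition of \<gamma>^-1(x4) against \<open>g1\<close> and
    \<open>g2\<close> returns the value \<open>g' x4 w2 a2\<close>.\<close>
  have ev2: "e1 a p (antip_body f x) = sw4 H x (\<lambda>x1 x2 x3 x4. sw H (S x1) (\<lambda>y1 y2. sw H 1 (\<lambda>z1 z2. sw H a (\<lambda>a1 a2. sw H a2 (\<lambda>a2 a3.
     sw H y1 (\<lambda>y1 y3. \<epsilon> a1 * sw H (ad H y1 a2) (\<lambda>a1 a2. sw H a1 (\<lambda>b1 b2. t' x2 (S x3) b1 *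
       sw H (S b2) (\<lambda>w1 w2. f w1 * g' x4 w2 a2))) * t y3 z1 a3 * p (y2 * z2)))))))" for a x
    unfolding ev
    apply (simp add: e1_mult la p dmF_def)
    apply (simp add: collapse)
    done
  show "e1 a p (antip_body f x) = e1 a p (antip_el ker_S f x)"
  proof (rule univ_eq2[where E = "\<lambda>a x. e1 a p (antip_body f x)" and E' = "\<lambda>a x. e1 a p (antip_el ker_S f x)"])
    show "lk2 (\<lambda>a x. e1 a p (antip_body f x))" unfolding ev2 sw4_def sw3_def by (simp add: l)
    show "lk2 (\<lambda>a x. e1 a p (antip_el ker_S f x))" by (simp add: e1_antip_el lk2_ker f p l del: lk2_def) (simp add: lk2_ker f p l)
    fix u v assume g: "gl u" "gl v"
    \<comment> \<open>Evaluations at the one point \<open>v\<close> occur here in an order different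
      from that in the target formula; \<open>rot1\<close> and \<open>rot2\<close> permute
      them.\<close>
    have rot1: "B v (\<lambda>a. B v (\<lambda>b. B v (\<lambda>c. br (t' b (S c) (ad H (S a) x))))) =
        B v (\<lambda>b. B v (\<lambda>c. B v (\<lambda>a. br (t' b (S c) (ad H (S a) x)))))" for x
      by (subst B_comm, subst (2) B_comm) (rule refl)
    have rot2: "B v (\<lambda>a. B v (\<lambda>b. B v (\<lambda>c. br (g' c (S (ad H (S a) x)) (ad H (S b) y))))) =
        B v (\<lambda>c. B v (\<lambda>a. B v (\<lambda>b. br (g' c (S (ad H (S a) x)) (ad H (S b) y)))))" for x y
      by (subst (2) B_comm, subst B_comm) (rule refl)
    have "B u (\<lambda>a. B v (\<lambda>x. br (e1 a p (antip_body f x)))) =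
      T t' v (pinv v) (pc (pinv v) u) \<odot> F1 f (pinv (pc (pinv v) u)) \<odot> T g' v (pinv (pc (pinv v) u)) (pc (pinv v) u) \<odot> F1 p (pinv v)"
      unfolding ev2 F1_def T_def sw4_def sw3_def
      apply (simp add: sw_one l)
      apply (simp add: expand_B l g del: pc_simps)
      apply (simp add: split_B del: pc_simps)
      apply (simp only: B_comm[of v u])
      apply (simp add: cv_ac rot1 rot2 g sw_S_eps)
      done
    moreover have "B u (\<lambda>a. B v (\<lambda>x. br (e1 a p (antip_el ker_S f x)))) =
      F2 ker_S v (pc (pinv v) u) \<odot> F1 f (pinv (pc (pinv v) u)) \<odot> F1 p (pinv v)"
      apply (simp add: e1_antip_el lk2_ker f p del: lk2_def)
      unfolding F1_def F2_def antip_fun_def antip_pt_def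
      apply (simp add: expand_B l g del: pc_simps)
      apply (simp add: split_B del: pc_simps)
      apply (simp only: B_comm[of v u] cv_ac)
      done
    ultimately show "B u (\<lambda>a. B v (\<lambda>x. br (e1 a p (antip_body f x)))) = B u (\<lambda>a. B v (\<lambda>x. br (e1 a p (antip_el ker_S f x))))"
      using g by (simp add: F2_ker_S R.cv_assoc) (simp add: cv_ac)
  qed
qed

lemma D_antipode_op: "s \<in> carr Dsp \<Longrightarrow> D_antipode H gc tc s = antip_op ker_S s"
  unfolding D_antipode_eq antip_op_def by (rule tsum_cong) (simp_all add: antip_body_eq)

lemma antipode_bij: "bij_betw (antip_op ker_S) (carr Dsp) (carr Dsp)"
  by (rule bij_betw_byWitness[where f' = "antip_op ker_back"])
    (auto simp: antip_op_left_inverse antip_op_right_inverse intro: lin_onD(1)[OF antip_op_lin[OF lk2_ker(1)]] lin_onD(1)[OF antip_op_lin[OF lk2_ker(3)]])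

section \<open>Antimultiplicativity of the antipode\<close>

lemma antihom_left_points:
  assumes f: "lk f" "lk h" "lk p" and g: "gl u" "gl v" "gl s"
  shows "B u (\<lambda>a. B v (\<lambda>x. B s (\<lambda>y. br (e1 a p (antip_op ker_S (D_mult H tc (dten H f x) (dten H h y))))))) =
    F2 ker_S (pm v s) (pc (pinv v) (pc (pinv s) u)) \<odot> F1 f (pinv (pc (pinv v) (pc (pinv s) u))) \<odot>
    F1 h (pc v (pinv (pc (pinv v) (pc (pinv s) u)))) \<odot> T t v s (pinv (pc (pinv v) (pc (pinv s) u))) \<odot>
    F1 p (pm (pinv s) (pinv v))"
proof -
  note l = lk_comp[OF f(1)] lk_comp[OF f(2)] lk_comp[OF f(3)] lk2_comp[OF lk2_ker(1)]
  note c = lin_onD(1)[OF antip_op_lin[OF lk2_ker(1)]]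
  show ?thesis
    apply (simp add: D_mult_dmF f lin_on_sw[OF vec_space_D antip_op_lin[OF lk2_ker(1)]] sw_D_carr antip_op_dten lk2_ker e1_sw e1_antip_el
       del: lk2_def)
    unfolding dmF_def F1_def T_def F2_def antip_fun_def antip_pt_def
    apply (simp add: expand_B l g ad_mult S_mult del: pc_simps)
    apply (simp add: split_B del: pc_simps)
    apply (simp only: B_comm[of v u] B_comm[of s u] B_comm[of s v] cv_ac)
    done
qed

lemma antihom_right_points:
  assumes f: "lk f" "lk h" "lk p" and g: "gl u" "gl v" "gl s"
  shows "B u (\<lambda>a. B v (\<lambda>x. B s (\<lambda>y. br (e1 a p (D_mult H tc (antip_op ker_S (dten H h y)) (antip_op ker_S (dten H f x))))))) =
    F2 ker_S s (pc (pinv s) u) \<odot> F1 h (pinv (pc (pinv s) u)) \<odot> F2 ker_S v (pc (pinv v) (pc (pinv s) u)) \<odot>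
    F1 f (pinv (pc (pinv v) (pc (pinv s) u))) \<odot> T t (pinv s) (pinv v) u \<odot> F1 p (pm (pinv s) (pinv v))"
proof -
  note l = lk_comp[OF f(1)] lk_comp[OF f(2)] lk_comp[OF f(3)] lk2_comp[OF lk2_ker(1)]
  show ?thesis
    apply (simp add: f antip_op_dten lk2_ker del: lk2_def)
    apply (simp add: antip_el_def D_mult_sw f lk2_ker sw_D_carr e1_sw e1_mult del: lk2_def)
    unfolding dmF_def F1_def T_def F2_def antip_fun_def antip_pt_def
    apply (simp add: expand_B l g ad_mult S_mult del: pc_simps)
    apply (simp add: split_B del: pc_simps)
    apply (simp only: B_comm[of v u] B_comm[of s u] B_comm[of s v] cv_ac)
    done
qed

text \<open>The cancellation behind \<open>antihom_identity\<close>. Primed letters are inverses;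
  multiplying by \<open>C\<close>, \<open>E\<close>, \<open>Q\<close> and \<open>F\<close> reduces
  the claim to a product of the given relations, in which \<open>m\<close> and \<open>k\<close>
  combine to \<open>C\<close>.\<close>

lemma cv_identity:
  assumes "P \<odot> P' = e4" "G \<odot> G' = e4" "C \<odot> C' = e4" "E \<odot> E' = e4" "Q \<odot> Q' = e4" "F \<odot> F' = e4"
    and e: "E \<odot> F \<odot> b \<odot> k = G" "Q \<odot> m = h \<odot> P" "m \<odot> k = C"
    and r: "reg P'" "reg G'" "reg b" "reg h" "reg C'" "reg E'" "reg Q'" "reg F'"
  shows "(P' \<odot> G') \<odot> b = (C' \<odot> E') \<odot> (Q' \<odot> F') \<odot> h"
proof -
  have "b \<odot> C \<odot> E \<odot> Q \<odot> F = (E \<odot> F \<odot> b \<odot> k) \<odot> (Q \<odot> m)" unfolding e(3)[symmetric] by (simp only: cv_ac)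
  then have *: "b \<odot> C \<odot> E \<odot> Q \<odot> F = G \<odot> (h \<odot> P)" by (simp only: e)
  have "(P' \<odot> G') \<odot> b = ((P' \<odot> G') \<odot> b) \<odot> ((C \<odot> C') \<odot> (E \<odot> E') \<odot> (Q \<odot> Q') \<odot> (F \<odot> F'))"
    using r by (simp add: assms(1-6))
  also have "\<dots> = (P' \<odot> G') \<odot> (C' \<odot> E' \<odot> Q' \<odot> F') \<odot> (b \<odot> C \<odot> E \<odot> Q \<odot> F)" by (simp only: cv_ac)
  also have "\<dots> = (P \<odot> P') \<odot> (G \<odot> G') \<odot> ((C' \<odot> E') \<odot> (Q' \<odot> F') \<odot> h)" unfolding * by (simp only: cv_ac)
  also have "\<dots> = (C' \<odot> E') \<odot> (Q' \<odot> F') \<odot> h" using r by (simp add: assms(1-6))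
  finally show ?thesis .
qed

text \<open>The relations are \<open>cond2\<close> at the arguments c^-1 and c, whose product is 1,
  and \<open>cond3\<close> at the triples (v s, s^-1, v^-1) and (v, s, s^-1). Normalization removes
  the factors at 1, and the auxiliary values \<theta>(v, s)(c) and \<theta>(v s, s^-1)(c) are
  eliminated.\<close>

lemma antihom_identity:
  assumes c2: cond2 and c3: cond3 and g: "gl v" "gl s" "gl c"
  shows "F2 ker_S (pm v s) c \<odot> T t v s (pinv c) = F2 ker_S s (pc v c) \<odot> F2 ker_S v c \<odot> T t (pinv s) (pinv v) (pc s (pc v c))"
proof -
  note cc3 = c3[unfolded cond3_def, rule_format]
  have 1: "T g s (pinv (pc v c)) (pc v c) \<odot> T g v (pinv c) c \<odot> T t v s (pinv c) \<odot> T t v s c = T g (pm v s) (pinv c) c"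
    using c2[unfolded cond2_def, rule_format, OF g(1,2), of "pinv c" c] g by simp
  have 2: "T t v (pinv v) c \<odot> T t (pm v s) (pinv s) c =
    T t (pinv s) (pinv v) (pc s (pc v c)) \<odot> T t (pm v s) (pm (pinv s) (pinv v)) c"
    using cc3[of "pm v s" "pinv s" "pinv v" c] g by (simp add: pm_assoc)
  have 3: "T t (pm v s) (pinv s) c \<odot> T t v s c = T t s (pinv s) (pc v c)"
    using cc3[of v s "pinv s" c] g by simp
  have "(T t' (pm v s) (pinv (pm v s)) c \<odot> T g' (pm v s) (pinv c) c) \<odot> T t v s (pinv c) =
    (T t' s (pinv s) (pc v c) \<odot> T g' s (pinv (pc v c)) (pc v c)) \<odot>
    (T t' v (pinv v) c \<odot> T g' v (pinv c) c) \<odot> T t (pinv s) (pinv v) (pc s (pc v c))"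
    by (rule cv_identity[OF T_inv(3) T_inv(2) T_inv(3) T_inv(2) T_inv(3) T_inv(2) 1 _ 3]) (use g 2 in simp_all)
  then show ?thesis using g by (simp only: F2_ker_S gl_pm gl_pc)
qed

lemma antihom:
  assumes c: cond2 cond3 and s: "s \<in> carr Dsp" and r: "r \<in> carr Dsp"
  shows "antip_op ker_S (D_mult H tc s r) = D_mult H tc (antip_op ker_S r) (antip_op ker_S s)"
proof -
  note Sl = antip_op_lin[OF lk2_ker(1)]
  note l1 = bilin_onD(1)[OF D_mult_bilin] and l2 = bilin_onD(2)[OF D_mult_bilin] and Sc = lin_onD(1)[OF Sl]
  have el: "antip_op ker_S (D_mult H tc (dten H f x) (dten H h y)) = D_mult H tc (antip_op ker_S (dten H h y)) (antip_op ker_S (dten H f x))"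
    if f: "lk f" "lk h" for f h x y
  proof (rule D_ext)
    fix a p assume p: "lk p"
    note l = lk_comp[OF f(1)] lk_comp[OF f(2)] lk_comp[OF p] lk2_comp[OF lk2_ker(1)]
    let ?E = "\<lambda>a x y. e1 a p (antip_op ker_S (D_mult H tc (dten H f x) (dten H h y)))"
    let ?E' = "\<lambda>a x y. e1 a p (D_mult H tc (antip_op ker_S (dten H h y)) (antip_op ker_S (dten H f x)))"
    show "?E a x y = ?E' a x y"
    proof (rule univ_eq3[where E = ?E and E' = ?E'])
      show "lk3 ?E"
        apply (simp add: D_mult_dmF f p lin_on_sw[OF vec_space_D Sl] sw_D_carr antip_op_dten lk2_ker e1_sw e1_antip_el
          del: lk2_def lk3_def)
        unfolding antip_fun_def antip_pt_def dmF_def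
        apply (simp add: l)
        done
      show "lk3 ?E'"
        apply (simp add: f antip_op_dten lk2_ker del: lk2_def lk3_def)
        apply (simp add: antip_el_def D_mult_sw f p lk2_ker sw_D_carr e1_sw e1_mult del: lk2_def lk3_def)
        unfolding antip_fun_def antip_pt_def dmF_def
        apply (simp add: l)
        done
      fix u v s assume g: "gl u" "gl v" "gl s"
      have e: "F2 ker_S (pm v s) (pc (pinv v) (pc (pinv s) u)) \<odot> T t v s (pinv (pc (pinv v) (pc (pinv s) u))) =
        F2 ker_S s (pc (pinv s) u) \<odot> F2 ker_S v (pc (pinv v) (pc (pinv s) u)) \<odot> T t (pinv s) (pinv v) u"
        using antihom_identity[OF c g(2,3), of "pc (pinv v) (pc (pinv s) u)"] g by simp
      have "B u (\<lambda>a. B v (\<lambda>b. B s (\<lambda>c. br (?E a b c)))) =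
        (F2 ker_S (pm v s) (pc (pinv v) (pc (pinv s) u)) \<odot> T t v s (pinv (pc (pinv v) (pc (pinv s) u)))) \<odot>
        F1 f (pinv (pc (pinv v) (pc (pinv s) u))) \<odot> F1 h (pinv (pc (pinv s) u)) \<odot> F1 p (pm (pinv s) (pinv v))"
        unfolding antihom_left_points[OF f p g] using g by (simp add: R.cv_assoc R.cv_left_comm)
      also have "\<dots> = B u (\<lambda>a. B v (\<lambda>b. B s (\<lambda>c. br (?E' a b c))))"
        unfolding e antihom_right_points[OF f p g] by (simp only: cv_ac)
      finally show "B u (\<lambda>a. B v (\<lambda>b. B s (\<lambda>c. br (?E a b c)))) = B u (\<lambda>a. B v (\<lambda>b. B s (\<lambda>c. br (?E' a b c))))" .
    qed
  qed (simp_all add: f Sc)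
  show ?thesis
  proof (rule D_lin_ext[OF lin_on_comp[OF l2 Sl] lin_on_comp[OF Sl l1] _ s])
    fix f x assume f: "lk f"
    show "antip_op ker_S (D_mult H tc (dten H f x) r) = D_mult H tc (antip_op ker_S r) (antip_op ker_S (dten H f x))"
      by (rule D_lin_ext[OF lin_on_comp[OF l1 Sl] lin_on_comp[OF Sl l2] _ r]) (simp_all add: f el Sc)
  qed (simp_all add: r Sc)
qed

lemma ker_S_one: "ker_S 1 c = \<epsilon> c"
proof -
  have "ker_S 1 c * \<epsilon> 1 = \<epsilon> c * \<epsilon> 1"
    by (rule univ_eq2[where E = "\<lambda>c x. ker_S 1 c * \<epsilon> x" and E' = "\<lambda>c x. \<epsilon> c * \<epsilon> x"])
     (simp_all add: ker_S_def sw_one, simp add: expand_B, simp add: split_B sw_S_eps)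
  then show ?thesis by simp
qed

lemma lk_S: "lk u \<Longrightarrow> lk (\<lambda>a. u (S a))"
  using lk_comp[of u] by simp

text \<open>For group part 1 the kernel is trivial and conjugation is the identity, so the antipode
  of D(A) restricts to the dual antipode; hence the axioms for the associator can be computed among
  functionals.\<close>

lemma antipode_dual: "lk u \<Longrightarrow> antip_op ker_S (dten H u 1) = dten H (\<lambda>a. u (S a)) 1"
proof (rule D_ext)
  assume u: "lk u"
  show "antip_op ker_S (dten H u 1) \<in> carr Dsp" by (rule lin_onD(1)[OF antip_op_lin[OF lk2_ker(1)]]) (simp add: u)
  show "dten H (\<lambda>a. u (S a)) 1 \<in> carr Dsp" by (simp add: lk_S u)
  fix a p assume p: "lk p"
  note l = lk_comp[OF u] lk_comp[OF p]
  show "e1 a p (antip_op ker_S (dten H u 1)) = e1 a p (dten H (\<lambda>a. u (S a)) 1)"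
    apply (simp add: antip_op_dten lk2_ker u p lk_S e1_antip_el del: lk2_def)
    apply (simp add: antip_fun_def antip_pt_def sw_one l lk2_comp[OF lk2_ker(1)] ker_S_one)
    apply (simp add: sw_counit lk_S u)
    done
qed

lemma antipode_unit: "antip_op ker_S (dten H \<epsilon> 1) = dten H \<epsilon> 1"
  by (simp add: antipode_dual sw_S_eps)

lemma dual_mult_dual: "lk f \<Longrightarrow> lk h \<Longrightarrow> D_mult H tc (dten H f 1) (dten H h 1) = dten H (\<lambda>a. sw H a (\<lambda>a1 a2. f a1 * h a2)) 1"
  by (rule D_ext) (simp_all add: D_mult_dual_left sw_cmult mult.assoc)

lemma antipode_antiaut: "cond2 \<Longrightarrow> cond3 \<Longrightarrow> alg_antiaut D (D_antipode H gc tc)"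
proof -
  assume c: cond2 cond3
  have "bij_betw (D_antipode H gc tc) (carr Dsp) (carr Dsp) \<longleftrightarrow> bij_betw (antip_op ker_S) (carr Dsp) (carr Dsp)"
    by (rule bij_betw_cong) (rule D_antipode_op)
  moreover have "lin_on Dsp Dsp (D_antipode H gc tc)"
    by (rule lin_on_cong[OF vec_space_D antip_op_lin[OF lk2_ker(1)]]) (simp add: D_antipode_op)
  ultimately show ?thesis
    unfolding alg_antiaut_def
    by (simp add: lin_on_D_alg antipode_bij D_antipode_op antipode_unit antihom[OF c] lin_onD(1)[OF antip_op_lin[OF lk2_ker(1)]] del: lk2_def)
qed

section \<open>The axiom for \<alpha>\<close>

lemma alpha_points:
  assumes f: "lk f" "lk p" and g: "gl u" "gl v"
  shows "B u (\<lambda>a. B v (\<lambda>x. br (tsum Dsp Dsp (com f x) (\<lambda>s r. e1 a p (D_mult H tc (antip_op ker_S s) r))))) =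
    T g v (pinv (pc (pinv v) u)) (pc (pinv v) u) \<odot> F1 f (pm (pinv (pc (pinv v) u)) (pc (pinv v) u)) \<odot>
    F2 ker_S v (pc (pinv v) u) \<odot> T t (pinv v) v u \<odot> F1 p (pm (pinv v) v)"
proof -
  note l = lk_comp[OF f(1)] lk_comp[OF f(2)] lk2_comp[OF lk2_ker(1)]
  have b: "bilin_on Dsp Dsp base (\<lambda>s r. e1 a p (D_mult H tc (antip_op ker_S s) r))" for a
    by (rule bilin_on_post[OF bilin_on_comp[OF D_mult_bilin antip_op_lin[OF lk2_ker(1)] lin_on_id(2)] e1_lin[OF f(2)]])
  show ?thesis
    apply (simp add: tsum_com[OF b f(1)] f antip_op_dten lk2_ker del: lk2_def)
    apply (simp add: antip_el_def D_mult_sw f lk2_ker sw_D_carr e1_sw e1_mult del: lk2_def)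
    unfolding dmF_def antip_fun_def antip_pt_def
    apply (simp add: collapse f sw3_def)
    unfolding F1_def T_def F2_def
    apply (simp add: expand_B l g ad_mult S_mult del: pc_simps pm_pinv)
    apply (simp add: split_B del: pc_simps)
    apply (simp only: B_comm[of v u] cv_ac)
    done
qed

lemma alpha_carr: "D_alpha H \<in> carr D"
  by (simp add: D_alpha_def)

lemma antipode_alpha:
  assumes c3: cond3 and s: "s \<in> carr D"
  shows "tsum D D (D_comult H gc s) (\<lambda>x y. mult D (mult D (D_antipode H gc tc x) (D_alpha H)) y) =
    smult D (D_counit H s) (D_alpha H)"
proof -
  have s: "s \<in> carr Dsp" using s by simp
  note Sl = antip_op_lin[OF lk2_ker(1)]
  have b: "bilin_on Dsp Dsp Dsp (\<lambda>s r. D_mult H tc (antip_op ker_S s) r)"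
    by (rule bilin_on_comp[OF D_mult_bilin Sl lin_on_id(2)])
  have "tsum Dsp Dsp (D_comult H gc s) (\<lambda>s r. D_mult H tc (antip_op ker_S s) r) = fscale (e1 1 \<epsilon> s) (dten H \<epsilon> 1)"
  proof (rule D_lin_ext[OF lin_on_comp[OF D_comult_lin tsum_lin[OF vec_space_D vec_space_D b]] _ _ s])
    have u: "dten H \<epsilon> 1 \<in> carr Dsp" by simp
    show "lin_on Dsp Dsp (\<lambda>s. fscale (e1 1 \<epsilon> s) (dten H \<epsilon> 1))"
      using lin_onD[OF e1_lin[OF lk_eps0]] fscale_carr[OF vec_space_D u]
      by (auto simp: lin_on_def fscale_simps smult_tensor_space)
    fix f x assume f: "lk f"
    show "tsum Dsp Dsp (D_comult H gc (dten H f x)) (\<lambda>s r. D_mult H tc (antip_op ker_S s) r) = fscale (e1 1 \<epsilon> (dten H f x)) (dten H \<epsilon> 1)"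
    proof (rule D_ext)
      show "tsum Dsp Dsp (D_comult H gc (dten H f x)) (\<lambda>s r. D_mult H tc (antip_op ker_S s) r) \<in> carr Dsp"
        by (rule tsum_carr[OF vec_space_D vec_space_D b]) (simp add: f)
      show "fscale (e1 1 \<epsilon> (dten H f x)) (dten H \<epsilon> 1) \<in> carr Dsp" by (rule fscale_carr[OF vec_space_D u])
      fix a p assume p: "lk p"
      note l = lk_comp[OF f] lk_comp[OF p] lk2_comp[OF lk2_ker(1)]
      have b': "bilin_on Dsp Dsp base (\<lambda>s r. e1 a p (D_mult H tc (antip_op ker_S s) r))" for a
        by (rule bilin_on_post[OF b e1_lin[OF p]])
      have R: "e1 a p (fscale (e1 1 \<epsilon> (dten H f x)) (dten H \<epsilon> 1)) = f 1 * \<epsilon> x * (\<epsilon> a * p 1)"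
        using lin_onD(3)[OF e1_lin[OF p] u, of a "f 1 * \<epsilon> x"] f p by (simp add: smult_tensor_space)
      let ?E = "\<lambda>a x. tsum Dsp Dsp (com f x) (\<lambda>s r. e1 a p (D_mult H tc (antip_op ker_S s) r))"
      have "?E a x = f 1 * \<epsilon> x * (\<epsilon> a * p 1)"
      proof (rule univ_eq2[where E = ?E and E' = "\<lambda>a x. f 1 * \<epsilon> x * (\<epsilon> a * p 1)"])
        show "lk2 ?E"
          apply (simp add: tsum_com[OF b' f] f p antip_op_dten lk2_ker del: lk2_def)
          apply (simp add: antip_el_def D_mult_sw f p lk2_ker sw_D_carr e1_sw e1_mult del: lk2_def)
          unfolding dmF_def antip_fun_def antip_pt_def
          apply (simp add: collapse f sw3_def l)
          done
        show "lk2 (\<lambda>a x. f 1 * \<epsilon> x * (\<epsilon> a * p 1))" by simp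
        fix u v assume g: "gl u" "gl v"
        let ?c = "pc (pinv v) u"
        \<comment> \<open>\<open>cond3\<close> at (v, v^-1, v): two factors are trivial by
          normalization, which identifies \<theta>(v, v^-1) at v u v^-1 with \<theta>(v^-1, v) at
          u.\<close>
        have t: "T t v (pinv v) ?c = T t (pinv v) v u"
          using c3[unfolded cond3_def, rule_format, of v "pinv v" v ?c] g by simp
        have "T g v (pinv ?c) ?c \<odot> F2 ker_S v ?c \<odot> T t (pinv v) v u =
          (T g' v (pinv ?c) ?c \<odot> T g v (pinv ?c) ?c) \<odot> (T t' v (pinv v) ?c \<odot> T t v (pinv v) ?c)"
          unfolding t using g by (simp only: F2_ker_S gl_pc gl_pinv cv_ac)
        then have e: "T g v (pinv ?c) ?c \<odot> F2 ker_S v ?c \<odot> T t (pinv v) v u = e4"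
          using g by (simp add: T_inv_comm)
        have "B u (\<lambda>a. B v (\<lambda>x. br (?E a x))) =
          (T g v (pinv ?c) ?c \<odot> F2 ker_S v ?c \<odot> T t (pinv v) v u) \<odot> F1 f (pm (pinv ?c) ?c) \<odot> F1 p (pm (pinv v) v)"
          unfolding alpha_points[OF f p g] by (simp only: cv_ac)
        also have "\<dots> = B u (\<lambda>a. B v (\<lambda>x. br (f 1 * \<epsilon> x * (\<epsilon> a * p 1))))"
          unfolding e using g by (simp add: F1_pone f p split_B)
        finally show "B u (\<lambda>a. B v (\<lambda>x. br (?E a x))) = B u (\<lambda>a. B v (\<lambda>x. br (f 1 * \<epsilon> x * (\<epsilon> a * p 1))))" .
      qed
      then show "e1 a p (tsum Dsp Dsp (D_comult H gc (dten H f x)) (\<lambda>s r. D_mult H tc (antip_op ker_S s) r)) =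
        e1 a p (fscale (e1 1 \<epsilon> (dten H f x)) (dten H \<epsilon> 1))"
        unfolding R D_comult_dten[OF f] lin_on_tsum[OF vec_space_D e1_lin[OF p] com_carr[OF f] b] .
    qed
  qed
  moreover have "tsum Dsp Dsp (D_comult H gc s) (\<lambda>x y. D_mult H tc (D_mult H tc (D_antipode H gc tc x) (dten H \<epsilon> 1)) y) =
    tsum Dsp Dsp (D_comult H gc s) (\<lambda>s r. D_mult H tc (antip_op ker_S s) r)"
    by (rule tsum_cong[OF D_comult_carr[OF s]]) (simp add: D_antipode_op D_unit_right lin_onD(1)[OF Sl])
  ultimately show ?thesis
    unfolding space_cong D_simps D_counit_e1 D_alpha_def by simp
qed

text \<open>The functional part of \<beta>, at points w(a, a^-1, a).\<close>

definition beta_fun where "beta_fun a = sw H a (\<lambda>a1 a2. sw H a2 (\<lambda>a2 a3. w a1 (S a2) a3))"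

lemma lk_beta_fun [simp]: "la k \<Longrightarrow> lk (\<lambda>x. beta_fun (k x))" "lk beta_fun"
proof -
  show "lk beta_fun" unfolding beta_fun_def[abs_def] by simp
  then show "la k \<Longrightarrow> lk (\<lambda>x. beta_fun (k x))" by (rule lk_comp)
qed

lemma F1_beta_fun: "gl u \<Longrightarrow> F1 beta_fun u = T w u (pinv u) u"
  unfolding F1_def beta_fun_def T_def by (simp add: expand_B)

text \<open>The axioms for the associator and the description of \<beta> sum an expression trilinear
  in the three factors over \<open>Phi h\<close>. The sum is reduced to functionals, where
  \<open>tsum_dual_tensor3\<close> can contract it to values of \<open>h\<close>.\<close>

lemma tsum_Phi_tri:
  assumes G': "\<forall>s\<in>carr Dsp. bilin_on Dsp Dsp Dsp (G s)"
    and L': "\<forall>r\<in>carr Dsp. \<forall>q\<in>carr Dsp. lin_on Dsp Dsp (\<lambda>s. G s r q)" and h: "lk3 h"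
  shows "tsum Dsp Dsp2 (Phi h) (\<lambda>s X. tsum Dsp Dsp X (G s)) =
    tsum (dual H) du (dual_tensor3 H h) (\<lambda>u1 u. tsum (dual H) (dual H) u (\<lambda>u2 u3.
      G (dten H u1 1) (dten H u2 1) (dten H u3 1)))" (is "?L = ?R")
    and "tsum Dsp Dsp2 (Phi h) (\<lambda>s X. tsum Dsp Dsp X (G s)) \<in> carr Dsp" (is ?C)
    and "lk p \<Longrightarrow> e1 a p (tsum Dsp Dsp2 (Phi h) (\<lambda>s X. tsum Dsp Dsp X (G s))) =
      tsum (dual H) du (dual_tensor3 H h) (\<lambda>u1 u. tsum (dual H) (dual H) u (\<lambda>u2 u3.
      e1 a p (G (dten H u1 1) (dten H u2 1) (dten H u3 1))))"
proof -
  note G = bspec[OF G'] and L = bspec[OF bspec[OF L']]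
  have b: "bilin_on Dsp Dsp2 Dsp (\<lambda>s X. tsum Dsp Dsp X (G s))"
    unfolding bilin_on_def
  proof (intro conjI ballI)
    show "lin_on Dsp2 Dsp (\<lambda>X. tsum Dsp Dsp X (G s))" if "s \<in> carr Dsp" for s
      by (rule tsum_lin[OF vec_space_D vec_space_D G[OF that]])
    show "lin_on Dsp Dsp (\<lambda>s. tsum Dsp Dsp X (G s))" if "X \<in> carr Dsp2" for X
      by (rule lin_on_tsum_fun[OF vec_space_D that L])
  qed
  have e: "tsum Dsp Dsp (tens Dsp Dsp (dten H u2 1) (dten H u3 1)) (G (dten H u1 1)) = G (dten H u1 1) (dten H u2 1) (dten H u3 1)"
    if "lk u1" "lk u2" "lk u3" for u1 u2 u3
    by (rule tsum_tens[OF vec_space_D G]) (simp_all add: that)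
  show "?L = ?R"
    unfolding tsum_Phi_gen[OF vec_space_D b h]
    by (rule tsum_cong[OF dual_tensor3_carr[OF h]], rule tsum_cong, assumption) (simp add: e)
  show ?C by (rule tsum_carr[OF vec_space_D vec_space_D b Phi_carr[OF h]])
  assume p: "lk p"
  have E: "e1 a p ?L = tsum Dsp Dsp2 (Phi h) (\<lambda>s X. e1 a p (tsum Dsp Dsp X (G s)))"
    by (rule lin_on_tsum[OF vec_space_D e1_lin[OF p] Phi_carr[OF h] b])
  show "e1 a p ?L = tsum (dual H) du (dual_tensor3 H h) (\<lambda>u1 u. tsum (dual H) (dual H) u (\<lambda>u2 u3.
      e1 a p (G (dten H u1 1) (dten H u2 1) (dten H u3 1))))"
    unfolding E tsum_Phi[OF bilin_on_post[OF b e1_lin[OF p]] h]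
    by (rule tsum_cong[OF dual_tensor3_carr[OF h]], rule tsum_cong, assumption) (simp add: e)
qed

lemma antip_op_carr [simp]: "s \<in> carr Dsp \<Longrightarrow> antip_op ker_S s \<in> carr Dsp"
  by (rule lin_onD(1)[OF antip_op_lin[OF lk2_ker(1)]])

text \<open>\<beta> is the sum of s S(r) q over \<open>Phi w\<close>, since on functionals the
  antipode and the product of D(A) are those of the dual. The matrix coefficients of such a sum can
  be computed, and they identify it.\<close>

lemma D_beta_eq: "D_beta H wc = dten H beta_fun 1"
proof -
  note l1 = bilin_onD(1)[OF D_mult_bilin] and l2 = bilin_onD(2)[OF D_mult_bilin] and Sl = antip_op_lin[OF lk2_ker(1)]
  have e: "tsum (dual H) (dual H \<otimes>\<^sub>A dual H) = tsum (dual H) du"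
    by (rule tsum_cong_space; simp add: tensor_alg_simps smult_tensor_space)
  let ?G = "\<lambda>s r q. D_mult H tc (D_mult H tc s (antip_op ker_S r)) q"
  have G: "\<forall>s\<in>carr Dsp. bilin_on Dsp Dsp Dsp (?G s)"
    by (intro ballI bilin_on_comp[OF D_mult_bilin lin_on_comp[OF Sl l1] lin_on_id(2)])
  have L: "\<forall>r\<in>carr Dsp. \<forall>q\<in>carr Dsp. lin_on Dsp Dsp (\<lambda>s. ?G s r q)"
    by (intro ballI lin_on_comp[OF l2 l2] antip_op_carr)
  note tri = tsum_Phi_tri[of ?G, OF G L lk3_data(1)]
  have "D_beta H wc = tsum Dsp Dsp2 (Phi w) (\<lambda>s X. tsum Dsp Dsp X (?G s))"
    apply (rule trans[OF _ tri(1)[symmetric]])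
    unfolding D_beta_def w_def[abs_def] e dual_antipode_def comp_def dual_simps
    apply (rule tsum_cong[OF dual_tensor3_carr[OF lk3_data(1)[unfolded w_def[abs_def]]]])
    apply (rule tsum_cong, assumption)
    apply (simp add: antipode_dual dual_mult_dual lk_S)
    done
  moreover have "tsum Dsp Dsp2 (Phi w) (\<lambda>s X. tsum Dsp Dsp X (?G s)) = dten H beta_fun 1"
  proof (rule D_ext[OF tri(2)])
    fix a p assume p: "lk p"
    show "e1 a p (tsum Dsp Dsp2 (Phi w) (\<lambda>s X. tsum Dsp Dsp X (?G s))) = e1 a p (dten H beta_fun 1)"
      apply (rule trans[OF tri(3)[OF p]])
      apply (simp add: p lk3_data dual_tensor3_carr antipode_dual dual_mult_dual lk_S del: lk3_def)
      apply (simp add: collapse tsum_dual_tensor3 lk3_data dual_tensor3_carr del: lk3_def)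
      \<comment> \<open>The product of functionals brackets the coproduct to the left,
        \<open>beta_fun\<close> to the right.\<close>
      apply (simp add: beta_fun_def sw_cmult sw_coassoc[of "\<lambda>x1 x2 y. w x1 (S x2) y * p 1"])
      done
  qed simp_all
  ultimately show ?thesis by simp
qed

section \<open>The axiom for \<beta>\<close>

lemma beta_points:
  assumes f: "lk f" "lk p" and g: "gl u" "gl v"
  shows "B u (\<lambda>a. B v (\<lambda>x. br (tsum Dsp Dsp (com f x) (\<lambda>s r. e1 a p (D_mult H tc (D_mult H tc s (dten H beta_fun 1)) (antip_op ker_S r)))))) =
    T g v u (pinv (pc (pinv v) (pc v u))) \<odot> F1 f (pm u (pinv (pc (pinv v) (pc v u)))) \<odot> F1 beta_fun (pc v u) \<odot>
    F2 ker_S v (pc (pinv v) (pc v u)) \<odot> T t v (pinv v) u \<odot> F1 p (pm v (pinv v))"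
proof -
  note l = lk_comp[OF f(1)] lk_comp[OF f(2)] lk2_comp[OF lk2_ker(1)]
  note l1 = bilin_onD(1)[OF D_mult_bilin] and l2 = bilin_onD(2)[OF D_mult_bilin] and Sl = antip_op_lin[OF lk2_ker(1)]
  have c: "dten H beta_fun 1 \<in> carr Dsp" by simp
  \<comment> \<open>Evaluations at the one point \<open>v\<close> occur in different orders on the
    two sides; these instances exchange them.\<close>
  have rot: "B v (\<lambda>b. B v (\<lambda>c. br (f (x * S (ad H (S c) (ad H b y)))))) =
      B v (\<lambda>c. B v (\<lambda>b. br (f (x * S (ad H (S c) (ad H b y))))))"
    "B v (\<lambda>b. B v (\<lambda>c. br (g z x (S (ad H (S c) (ad H b y)))))) =
      B v (\<lambda>c. B v (\<lambda>b. br (g z x (S (ad H (S c) (ad H b y))))))"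
    "B v (\<lambda>a. B v (\<lambda>b. B v (\<lambda>c. br (ker_S b (ad H (S c) (ad H a x)))))) =
      B v (\<lambda>b. B v (\<lambda>c. B v (\<lambda>a. br (ker_S b (ad H (S c) (ad H a x))))))" for x y z
      apply (rule B_comm, rule B_comm)
    by (subst B_comm, subst (2) B_comm) (rule refl)
  have b: "bilin_on Dsp Dsp base (\<lambda>s r. e1 a p (D_mult H tc (D_mult H tc s (dten H beta_fun 1)) (antip_op ker_S r)))" for a
    by (rule bilin_on_post[OF bilin_on_comp[OF D_mult_bilin l2[OF c] Sl] e1_lin[OF f(2)]])
  show ?thesis
    apply (simp add: tsum_com[OF b f(1)] f antip_op_dten lk2_ker D_mult_dmF del: lk2_def)
    apply (simp add: antip_el_def D_mult_sw f lk2_ker sw_D_carr e1_sw e1_mult del: lk2_def)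
    unfolding dmF_def antip_fun_def antip_pt_def
    apply (simp add: collapse f sw3_def sw_one l)
    unfolding F1_def T_def F2_def
    apply (simp add: expand_B l g ad_mult S_mult del: pc_simps pm_pinv)
    apply (simp add: split_B del: pc_simps)
    apply (simp only: B_comm[of v u])
    apply (simp add: cv_ac rot g)
    done
qed

lemma beta_carr: "D_beta H wc \<in> carr D"
  by (simp add: D_beta_eq)

text \<open>\<open>cond1\<close> at the group element v and the triple (u, u^-1, u) relates \<beta>
  at u to \<beta> at its conjugate; the remaining values of \<gamma> and \<theta> cancel against the
  kernel of the antipode.\<close>

lemma beta_identity:
  assumes c1: cond1 and g: "gl u" "gl v"
  shows "T g v u (pinv u) \<odot> F1 beta_fun (pc v u) \<odot> F2 ker_S v u \<odot> T t v (pinv v) u = F1 beta_fun u"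
proof -
  have 1: "T g v (pinv u) u \<odot> T w u (pinv u) u = T g v u (pinv u) \<odot> T w (pc v u) (pinv (pc v u)) (pc v u)"
    using c1[unfolded cond1_def, rule_format, of v u "pinv u" u] g by simp
  have "T g v u (pinv u) \<odot> F1 beta_fun (pc v u) \<odot> F2 ker_S v u \<odot> T t v (pinv v) u =
    (T g v u (pinv u) \<odot> T w (pc v u) (pinv (pc v u)) (pc v u)) \<odot> T g' v (pinv u) u \<odot> (T t' v (pinv v) u \<odot> T t v (pinv v) u)"
    using g by (simp only: F1_beta_fun F2_ker_S gl_pc cv_ac)
  also have "\<dots> = (T g' v (pinv u) u \<odot> T g v (pinv u) u) \<odot> (T t' v (pinv v) u \<odot> T t v (pinv v) u) \<odot> T w u (pinv u) u"
    unfolding 1[symmetric] by (simp only: cv_ac)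
  also have "\<dots> = F1 beta_fun u" using g by (simp add: T_inv_comm F1_beta_fun)
  finally show ?thesis .
qed

lemma antipode_beta:
  assumes c1: cond1 and s: "s \<in> carr D"
  shows "tsum D D (D_comult H gc s) (\<lambda>x y. mult D (mult D x (D_beta H wc)) (D_antipode H gc tc y)) =
    smult D (D_counit H s) (D_beta H wc)"
proof -
  have s: "s \<in> carr Dsp" using s by simp
  note l2 = bilin_onD(2)[OF D_mult_bilin] and Sl = antip_op_lin[OF lk2_ker(1)]
  have u: "dten H beta_fun 1 \<in> carr Dsp" by simp
  let ?F = "\<lambda>s r. D_mult H tc (D_mult H tc s (dten H beta_fun 1)) (antip_op ker_S r)"
  have b: "bilin_on Dsp Dsp Dsp ?F" by (rule bilin_on_comp[OF D_mult_bilin l2[OF u] Sl])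
  have "tsum Dsp Dsp (D_comult H gc s) ?F = fscale (e1 1 \<epsilon> s) (dten H beta_fun 1)"
  proof (rule D_lin_ext[OF lin_on_comp[OF D_comult_lin tsum_lin[OF vec_space_D vec_space_D b]] _ _ s])
    show "lin_on Dsp Dsp (\<lambda>s. fscale (e1 1 \<epsilon> s) (dten H beta_fun 1))"
      using lin_onD[OF e1_lin[OF lk_eps0]] fscale_carr[OF vec_space_D u]
      by (auto simp: lin_on_def fscale_simps smult_tensor_space)
    fix f x assume f: "lk f"
    show "tsum Dsp Dsp (D_comult H gc (dten H f x)) ?F = fscale (e1 1 \<epsilon> (dten H f x)) (dten H beta_fun 1)"
    proof (rule D_ext)
      show "tsum Dsp Dsp (D_comult H gc (dten H f x)) ?F \<in> carr Dsp"
        by (rule tsum_carr[OF vec_space_D vec_space_D b]) (simp add: f)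
      show "fscale (e1 1 \<epsilon> (dten H f x)) (dten H beta_fun 1) \<in> carr Dsp" by (rule fscale_carr[OF vec_space_D u])
      fix a p assume p: "lk p"
      note l = lk_comp[OF f] lk_comp[OF p] lk2_comp[OF lk2_ker(1)]
      have b': "bilin_on Dsp Dsp base (\<lambda>s r. e1 a p (?F s r))" for a
        by (rule bilin_on_post[OF b e1_lin[OF p]])
      have R: "e1 a p (fscale (e1 1 \<epsilon> (dten H f x)) (dten H beta_fun 1)) = f 1 * \<epsilon> x * (beta_fun a * p 1)"
        using lin_onD(3)[OF e1_lin[OF p] u, of a "f 1 * \<epsilon> x"] f p by (simp add: smult_tensor_space)
      let ?E = "\<lambda>a x. tsum Dsp Dsp (com f x) (\<lambda>s r. e1 a p (?F s r))"
      have "?E a x = f 1 * \<epsilon> x * (beta_fun a * p 1)"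
      proof (rule univ_eq2[where E = ?E and E' = "\<lambda>a x. f 1 * \<epsilon> x * (beta_fun a * p 1)"])
        show "lk2 ?E"
          apply (simp add: tsum_com[OF b' f] f p antip_op_dten lk2_ker D_mult_dmF del: lk2_def)
          apply (simp add: antip_el_def D_mult_sw f p lk2_ker sw_D_carr e1_sw e1_mult del: lk2_def)
          unfolding dmF_def antip_fun_def antip_pt_def
          apply (simp add: collapse f sw3_def sw_one l)
          done
        show "lk2 (\<lambda>a x. f 1 * \<epsilon> x * (beta_fun a * p 1))" by simp
        fix u v assume g: "gl u" "gl v"
        have "B u (\<lambda>a. B v (\<lambda>x. br (?E a x))) =
          (T g v u (pinv u) \<odot> F1 beta_fun (pc v u) \<odot> F2 ker_S v u \<odot> T t v (pinv v) u) \<odot> F1 f (pm u (pinv u)) \<odot> F1 p (pm v (pinv v))"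
          unfolding beta_points[OF f p g] using g by (simp only: pc_simps cv_ac)
        also have "\<dots> = B u (\<lambda>a. B v (\<lambda>x. br (f 1 * \<epsilon> x * (beta_fun a * p 1))))"
          unfolding beta_identity[OF c1 g] using g by (simp add: F1_pone f p split_B) (simp add: F1_def cv_ac)
        finally show "B u (\<lambda>a. B v (\<lambda>x. br (?E a x))) = B u (\<lambda>a. B v (\<lambda>x. br (f 1 * \<epsilon> x * (beta_fun a * p 1))))" .
      qed
      then show "e1 a p (tsum Dsp Dsp (D_comult H gc (dten H f x)) ?F) =
        e1 a p (fscale (e1 1 \<epsilon> (dten H f x)) (dten H beta_fun 1))"
        unfolding R D_comult_dten[OF f] lin_on_tsum[OF vec_space_D e1_lin[OF p] com_carr[OF f] b] .
    qed
  qed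
  moreover have "tsum Dsp Dsp (D_comult H gc s) (\<lambda>x y. D_mult H tc (D_mult H tc x (dten H beta_fun 1)) (D_antipode H gc tc y)) =
    tsum Dsp Dsp (D_comult H gc s) ?F"
    by (rule tsum_cong[OF D_comult_carr[OF s]]) (simp add: D_antipode_op)
  ultimately show ?thesis
    unfolding space_cong D_simps D_counit_e1 D_beta_eq by simp
qed

text \<open>\<beta> has the value of \<open>w\<close> at the triple where contracting the associator
  produces the value of \<open>w'\<close>; this is the origin of its form.\<close>

lemma phi_identity: "gl u \<Longrightarrow> T w' u (pinv u) u \<odot> F1 beta_fun u = e4"
  by (simp add: F1_beta_fun T_inv_comm)

text \<open>Reduces both axioms linking the associator, \<alpha> and \<beta> to one check: the
  contracted form \<open>K\<close> is trivial at every point.\<close>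

lemma tsum_Phi_tri_unit:
  assumes G: "\<forall>s\<in>carr Dsp. bilin_on Dsp Dsp Dsp (G s)"
    and L: "\<forall>r\<in>carr Dsp. \<forall>q\<in>carr Dsp. lin_on Dsp Dsp (\<lambda>s. G s r q)" and h: "lk3 h"
    and K: "lk K" "\<And>a p. lk p \<Longrightarrow> tsum (dual H) du (dual_tensor3 H h) (\<lambda>u1 u. tsum (dual H) (dual H) u (\<lambda>u2 u3.
      e1 a p (G (dten H u1 1) (dten H u2 1) (dten H u3 1)))) = K a * p 1"
    and e: "\<And>u. gl u \<Longrightarrow> F1 K u = e4"
  shows "tsum Dsp Dsp2 (Phi h) (\<lambda>s X. tsum Dsp Dsp X (G s)) = dten H \<epsilon> 1"
proof (rule D_ext[OF tsum_Phi_tri(2)[OF G L h]])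
  fix a p assume p: "lk p"
  note l = lk_comp[OF K(1)]
  have "K a * \<epsilon> 1 = \<epsilon> a * \<epsilon> 1"
  proof (rule univ_eq2[where E = "\<lambda>a b. K a * \<epsilon> b" and E' = "\<lambda>a b. \<epsilon> a * \<epsilon> b"])
    fix u v assume g: "gl u" "gl v"
    show "B u (\<lambda>a. B v (\<lambda>b. br (K a * \<epsilon> b))) = B u (\<lambda>a. B v (\<lambda>b. br (\<epsilon> a * \<epsilon> b)))"
      using e[OF g(1)] g by (simp add: split_B F1_def)
  qed (simp_all add: l)
  then have "K a = \<epsilon> a" by simp
  then show "e1 a p (tsum Dsp Dsp2 (Phi h) (\<lambda>s X. tsum Dsp Dsp X (G s))) = e1 a p (dten H \<epsilon> 1)"
    unfolding tsum_Phi_tri(3)[OF G L h p] K(2)[OF p] by (simp add: p)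
qed simp

lemma antipode_phi:
  "tsum D (D \<otimes>\<^sub>A D) (D_phi H wc) (\<lambda>x u. tsum D D u (\<lambda>y z.
     mult D (mult D (mult D (mult D x (D_beta H wc)) (D_antipode H gc tc y)) (D_alpha H)) z)) = unit D"
proof -
  note l1 = bilin_onD(1)[OF D_mult_bilin] and l2 = bilin_onD(2)[OF D_mult_bilin] and Sl = antip_op_lin[OF lk2_ker(1)]
  have u: "dten H beta_fun 1 \<in> carr Dsp" by simp
  let ?G = "\<lambda>s r q. D_mult H tc (D_mult H tc (D_mult H tc s (dten H beta_fun 1)) (antip_op ker_S r)) q"
  \<comment> \<open>The four components of \<open>a\<close> go in order to X, \<beta>, S(Y) and Z;
    \<alpha> is the unit.\<close>
  let ?K = "\<lambda>a. sw H a (\<lambda>a1 a4. sw H a1 (\<lambda>a1 a3. sw H a1 (\<lambda>a1 a2. beta_fun a2 * w' a1 (S a3) a4)))"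
  have G: "\<forall>s\<in>carr Dsp. bilin_on Dsp Dsp Dsp (?G s)"
    by (intro ballI bilin_on_comp[OF D_mult_bilin lin_on_comp[OF Sl l1] lin_on_id(2)] D_mult_carr u)
  have L: "\<forall>r\<in>carr Dsp. \<forall>q\<in>carr Dsp. lin_on Dsp Dsp (\<lambda>s. ?G s r q)"
    by (intro ballI lin_on_comp[OF lin_on_comp[OF l2 l2] l2] antip_op_carr u)
  have "tsum Dsp Dsp2 (Phi w') (\<lambda>s X. tsum Dsp Dsp X (?G s)) = dten H \<epsilon> 1"
  proof (rule tsum_Phi_tri_unit[OF G L lk3_data(2), of ?K])
    show "lk ?K" by simp
    show "tsum (dual H) du (dual_tensor3 H w') (\<lambda>u1 u. tsum (dual H) (dual H) u (\<lambda>u2 u3.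
      e1 a p (?G (dten H u1 1) (dten H u2 1) (dten H u3 1)))) = ?K a * p 1" if p: "lk p" for a p
      apply (simp add: p lk3_data dual_tensor3_carr antipode_dual dual_mult_dual lk_S del: lk3_def)
      apply (simp add: collapse tsum_dual_tensor3 lk3_data dual_tensor3_carr del: lk3_def)
      done
    fix u assume g: "gl u"
    have "F1 ?K u = F1 beta_fun u \<odot> T w' u (pinv u) u"
      unfolding F1_def T_def
      apply (simp add: expand_B g)
      apply (simp add: split_B)
      done
    then show "F1 ?K u = e4" using phi_identity[OF g] by (simp add: R.cv_comm)
  qed
  moreover have "tsum Dsp Dsp2 (Phi w') (\<lambda>x u. tsum Dsp Dsp u (\<lambda>y z.
     D_mult H tc (D_mult H tc (D_mult H tc (D_mult H tc x (dten H beta_fun 1)) (D_antipode H gc tc y)) (dten H \<epsilon> 1)) z)) =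
     tsum Dsp Dsp2 (Phi w') (\<lambda>s X. tsum Dsp Dsp X (?G s))"
    by (rule tsum_cong[OF Phi_w'_carr], rule tsum_cong, assumption)
      (simp add: D_antipode_op D_unit_right)
  ultimately show ?thesis unfolding D_phi_eq D_beta_eq D_alpha_def space_cong D_simps by simp
qed

text \<open>\<open>cond0\<close> at (u, u^-1, u, u^-1): every factor with an argument 1 drops out,
  leaving w(u^-1, u, u^-1) w(u, u^-1, u) = 1.\<close>

lemma phi_inverse_identity:
  assumes c0: cond0 and g: "gl u"
  shows "T w (pinv u) u (pinv u) \<odot> F1 beta_fun u = e4"
  using c0[unfolded cond0_def, rule_format, of u "pinv u" u "pinv u"] g by (simp add: F1_beta_fun)

lemma antipode_phi_inverse:
  assumes c0: cond0
  shows "tsum Dsp Dsp2 (Phi w) (\<lambda>p u. tsum Dsp Dsp u (\<lambda>q r.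
     D_mult H tc (D_mult H tc (D_mult H tc (D_mult H tc (D_antipode H gc tc p) (D_alpha H)) q) (D_beta H wc)) (D_antipode H gc tc r))) =
    dten H \<epsilon> 1"
proof -
  note l1 = bilin_onD(1)[OF D_mult_bilin] and l2 = bilin_onD(2)[OF D_mult_bilin] and Sl = antip_op_lin[OF lk2_ker(1)]
  have u: "dten H beta_fun 1 \<in> carr Dsp" by simp
  let ?G = "\<lambda>s r q. D_mult H tc (D_mult H tc (D_mult H tc (antip_op ker_S s) r) (dten H beta_fun 1)) (antip_op ker_S q)"
  \<comment> \<open>Here the components of \<open>a\<close> go in order to S(P), Q, \<beta> and
    S(R).\<close>
  let ?K = "\<lambda>a. sw H a (\<lambda>a1 a4. sw H a1 (\<lambda>a1 a3. sw H a1 (\<lambda>a1 a2. beta_fun a3 * w (S a1) a2 (S a4))))"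
  have G: "\<forall>s\<in>carr Dsp. bilin_on Dsp Dsp Dsp (?G s)"
    by (intro ballI bilin_on_comp[OF D_mult_bilin lin_on_comp[OF l1 l2] Sl] antip_op_carr u)
  have L: "\<forall>r\<in>carr Dsp. \<forall>q\<in>carr Dsp. lin_on Dsp Dsp (\<lambda>s. ?G s r q)"
    by (intro ballI lin_on_comp[OF lin_on_comp[OF lin_on_comp[OF Sl l2] l2] l2] antip_op_carr u)
  have P: "Phi w \<in> carr Dsp3" by (intro Phi_carr lk3_data)
  have "tsum Dsp Dsp2 (Phi w) (\<lambda>s X. tsum Dsp Dsp X (?G s)) = dten H \<epsilon> 1"
  proof (rule tsum_Phi_tri_unit[OF G L lk3_data(1), of ?K])
    show "lk ?K" by simp
    show "tsum (dual H) du (dual_tensor3 H w) (\<lambda>u1 u. tsum (dual H) (dual H) u (\<lambda>u2 u3.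
      e1 a p (?G (dten H u1 1) (dten H u2 1) (dten H u3 1)))) = ?K a * p 1" if p: "lk p" for a p
      apply (simp add: p lk3_data dual_tensor3_carr antipode_dual dual_mult_dual lk_S del: lk3_def)
      apply (simp add: collapse tsum_dual_tensor3 lk3_data dual_tensor3_carr del: lk3_def)
      done
    fix u assume g: "gl u"
    have "F1 ?K u = F1 beta_fun u \<odot> T w (pinv u) u (pinv u)"
      unfolding F1_def T_def
      apply (simp add: expand_B g)
      apply (simp add: split_B)
      done
    then show "F1 ?K u = e4" using phi_inverse_identity[OF c0 g] by (simp add: R.cv_comm)
  qed
  moreover have "tsum Dsp Dsp2 (Phi w) (\<lambda>p u. tsum Dsp Dsp u (\<lambda>q r.
     D_mult H tc (D_mult H tc (D_mult H tc (D_mult H tc (D_antipode H gc tc p) (dten H \<epsilon> 1)) q) (dten H beta_fun 1)) (D_antipode H gc tc r))) =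
     tsum Dsp Dsp2 (Phi w) (\<lambda>s X. tsum Dsp Dsp X (?G s))"
    by (rule tsum_cong[OF P], rule tsum_cong, assumption)
      (simp add: D_antipode_op D_unit_right)
  ultimately show ?thesis unfolding D_beta_eq D_alpha_def by simp
qed

section \<open>Assembly of the quasi-Hopf axioms\<close>

lemma tmap_space:
  "tmap D D D (D \<otimes>\<^sub>A D) = tmap Dsp Dsp Dsp Dsp2"
  "tmap D D (D \<otimes>\<^sub>A D) D = tmap Dsp Dsp Dsp2 Dsp"
  "tmap D (D \<otimes>\<^sub>A D) D (D \<otimes>\<^sub>A D \<otimes>\<^sub>A D) = tmap Dsp Dsp2 Dsp Dsp3"
  "tmap D (D \<otimes>\<^sub>A D) (D \<otimes>\<^sub>A D) (D \<otimes>\<^sub>A D) = tmap Dsp Dsp2 Dsp2 Dsp2"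
  "tmap D ((D \<otimes>\<^sub>A D) \<otimes>\<^sub>A D) D (D \<otimes>\<^sub>A D \<otimes>\<^sub>A D) = tmap Dsp (tensor_space Dsp2 Dsp) Dsp Dsp3"
  "tassoc D D D = tassoc Dsp Dsp Dsp"
  "tassoc D D (D \<otimes>\<^sub>A D) = tassoc Dsp Dsp Dsp2"
  "tassoc D (D \<otimes>\<^sub>A D) D = tassoc Dsp Dsp2 Dsp"
  "tens D (D \<otimes>\<^sub>A D \<otimes>\<^sub>A D) = tens Dsp Dsp3"
  "tens (D \<otimes>\<^sub>A D \<otimes>\<^sub>A D) D = tens Dsp3 Dsp"
  by (intro ext; unfold tmap_def tassoc_def space_cong; rule refl)+

lemma quasi_hopf_iff:
  "quasi_hopf_algebra D (D_comult H gc) (D_counit H) (D_antipode H gc tc) (D_phi H wc) (D_alpha H) (D_beta H wc)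
    \<longleftrightarrow> cond0 \<and> cond1 \<and> cond2 \<and> cond3"
proof
  assume "quasi_hopf_algebra D (D_comult H gc) (D_counit H) (D_antipode H gc tc) (D_phi H wc) (D_alpha H) (D_beta H wc)"
  then interpret Q: quasi_hopf_algebra D "D_comult H gc" "D_counit H" "D_antipode H gc tc" "D_phi H wc" "D_alpha H" "D_beta H wc" .
  have cond3 using Q.algebra by (simp only: kalgebra_D_iff)
  moreover have cond2 using Q.comult_hom by (simp only: comult_hom_iff)
  \<comment> \<open>The axiom is applied to the explicit inverse \<open>Phi w\<close>.\<close>
  moreover have cond1
    using Q.quasi_coassoc[OF _ Phi_inverse[folded D_phi_eq]] unfolding D_phi_eq tmap_space D_simps coassoc_iff[symmetric]
    by blast
  moreover have cond0
    using Q.pentagon unfolding D_phi_eq tmap_space D_simps by (simp only: pentagon_iff)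
  ultimately show "cond0 \<and> cond1 \<and> cond2 \<and> cond3" by blast
next
  assume "cond0 \<and> cond1 \<and> cond2 \<and> cond3"
  then have c: cond0 cond1 cond2 cond3 by blast+
  have al: "kalgebra D" using c(4) by (simp only: kalgebra_D_iff)
  have al3: "kalgebra (D \<otimes>\<^sub>A D \<otimes>\<^sub>A D)" by (intro kalgebra_tensor al)
  \<comment> \<open>The third tensor power is an algebra because \<open>cond3\<close> makes D(A)
    one, so the inverse of the associator is unique.\<close>
  have inv: "\<psi> = Phi w" if "is_inverse (D \<otimes>\<^sub>A D \<otimes>\<^sub>A D) (D_phi H wc) \<psi>" for \<psi>
    by (rule is_inverse_unique[OF al3 phi_carr that]) (use Phi_inverse in \<open>simp only: D_phi_eq\<close>)
  show "quasi_hopf_algebra D (D_comult H gc) (D_counit H) (D_antipode H gc tc) (D_phi H wc) (D_alpha H) (D_beta H wc)"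
  proof
    show "kalgebra D" by (rule al)
    show "alg_hom D (D \<otimes>\<^sub>A D) (D_comult H gc)" using c(3) by (simp only: comult_hom_iff)
    show "alg_hom D base (D_counit H)" by (rule counit_hom)
    show "alg_antiaut D (D_antipode H gc tc)" by (rule antipode_antiaut[OF c(3,4)])
    show "D_phi H wc \<in> carr (D \<otimes>\<^sub>A D \<otimes>\<^sub>A D)" by (rule phi_carr)
    show "\<exists>\<psi>. is_inverse (D \<otimes>\<^sub>A D \<otimes>\<^sub>A D) (D_phi H wc) \<psi>" by (rule phi_invertible)
    show "D_alpha H \<in> carr D" "D_beta H wc \<in> carr D" by (rule alpha_carr, rule beta_carr)
    show "tmap D D D (D \<otimes>\<^sub>A D) id (D_comult H gc) (D_comult H gc a) =
      m3 (m3 (D_phi H wc) (tassoc D D D (tmap D D (D \<otimes>\<^sub>A D) D (D_comult H gc) id (D_comult H gc a)))) \<psi>"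
      if "a \<in> carr D" "is_inverse (D \<otimes>\<^sub>A D \<otimes>\<^sub>A D) (D_phi H wc) \<psi>" for a \<psi>
      using c(2) that(1) unfolding inv[OF that(2)] D_phi_eq tmap_space D_simps coassoc_iff[symmetric] by blast
    show "m4 (tmap D (D \<otimes>\<^sub>A D) D (D \<otimes>\<^sub>A D \<otimes>\<^sub>A D) id (tmap D D D (D \<otimes>\<^sub>A D) id (D_comult H gc)) (D_phi H wc))
         (tassoc D D (D \<otimes>\<^sub>A D) (tmap D (D \<otimes>\<^sub>A D) (D \<otimes>\<^sub>A D) (D \<otimes>\<^sub>A D) (D_comult H gc) id (D_phi H wc))) =
       m4 (m4 (tens D (D \<otimes>\<^sub>A D \<otimes>\<^sub>A D) (unit D) (D_phi H wc))
           (tmap D (D \<otimes>\<^sub>A D) D (D \<otimes>\<^sub>A D \<otimes>\<^sub>A D) id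
             (\<lambda>t. tassoc D D D (tmap D D (D \<otimes>\<^sub>A D) D (D_comult H gc) id t)) (D_phi H wc)))
         (tmap D ((D \<otimes>\<^sub>A D) \<otimes>\<^sub>A D) D (D \<otimes>\<^sub>A D \<otimes>\<^sub>A D) id (tassoc D D D)
           (tassoc D (D \<otimes>\<^sub>A D) D (tens (D \<otimes>\<^sub>A D \<otimes>\<^sub>A D) D (D_phi H wc) (unit D))))"
      using c(1) unfolding D_phi_eq tmap_space D_simps pentagon_iff .
    show "tsum D (D \<otimes>\<^sub>A D) \<psi> (\<lambda>p u. tsum D D u (\<lambda>q r.
           mult D (mult D (mult D (mult D (D_antipode H gc tc p) (D_alpha H)) q) (D_beta H wc)) (D_antipode H gc tc r))) = unit D"
      if "is_inverse (D \<otimes>\<^sub>A D \<otimes>\<^sub>A D) (D_phi H wc) \<psi>" for \<psi>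
      using antipode_phi_inverse[OF c(1)] unfolding inv[OF that] space_cong D_simps .
  qed (rule counit_left counit_right phi_counit antipode_alpha[OF c(4)] antipode_beta[OF c(2)] antipode_phi; assumption)+
qed

end

theorem theorem4p2:
  fixes H :: "('k::field, 'a::ring_1) hopf"
    and w \<gamma> \<theta> :: "('k, 'a) cochain"
  assumes "hopf_algebra H"
    and "cocommutative H"
    and "finite_dim (alg H)"
    and "w \<in> C_N H 0 3"
    and "\<gamma> \<in> C_N H 1 2"
    and "\<theta> \<in> C_N H 2 1"
  shows "quasi_hopf_algebra (D_alg H \<theta>) (D_comult H \<gamma>) (D_counit H) (D_antipode H \<gamma> \<theta>)
           (D_phi H w) (D_alpha H) (D_beta H w)
         \<longleftrightarrow> normalized_3_cocycle H w \<gamma> \<theta> (triv H 3 0)"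
proof -
  interpret cochain_data H w \<gamma> \<theta>
    using assms by (simp add: cochain_data_def cocomm_hopf_def cocomm_hopf_axioms_def cochain_data_axioms_def)
  show ?thesis using quasi_hopf_iff cocycle_iff by simp
qed

end
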